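(* In intensional Martin-Löf type theory with a cumulative hierarchy of univalent universes $\mathcal{U}_0:\mathcal{U}_1:\mathcal{U}_2:\dots$ (and no higher inductive types), for every natural number $n$ the type $\neg\,\mathsf{is}\text{-}n\text{-}\mathsf{type}(\mathcal{U}_n)$ is inhabited; i.e. the universe $\mathcal{U}_n$ is not an $n$-type.
   Context: Truncation levels: $\mathsf{is}\text{-}(-2)\text{-}\mathsf{type}(B):\equiv\sum_{b:B}\prod_{x:B} b=x$ and $\mathsf{is}\text{-}(k+1)\text{-}\mathsf{type}(B):\equiv\prod_{x,y:B}\mathsf{is}\text{-}k\text{-}\mathsf{type}(x=y)$. Here $n$ is a fixed (external) natural number: the statement is a schema, one derivation for each $n$. *)

theory Defs
  imports Main
begin

text \<open>
  A deep embedding of intensional Martin-Loef type theory in the style of the appendix of the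
  HoTT book: dependent products (with judgmental eta), dependent sums, coproducts, the empty and
  unit types, natural numbers, identity types, and a cumulative hierarchy of Russell-style
  universes, each of which is univalent.  Function extensionality is not postulated, and there
  are no higher inductive types.

  Raw terms use de Bruijn indices.  Eliminators carry their motive, and every argument that binds
  variables binds them in telescope order, so that index 0 is the last variable of the telescope.
\<close>

datatype tm =
    Var nat
  | Univ nat
  | Prd tm tm                   \<comment> \<open>\<open>\<Prod>(x:A). B\<close>; \<open>B\<close> binds 1\<close>
  | Lam tm tm                   \<comment> \<open>\<open>\<lambda>(x:A). b\<close>; \<open>b\<close> binds 1\<close>
  | App tm tm
  | Sig tm tm                   \<comment> \<open>\<open>\<Sum>(x:A). B\<close>; \<open>B\<close> binds 1\<close>
  | Dpair tm tm
  | SigInd tm tm tm             \<comment> \<open>\<open>ind([z]C, [x,y]g, p)\<close>\<close>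
  | Coprod tm tm
  | CInl tm
  | CInr tm
  | CoprodInd tm tm tm tm       \<comment> \<open>\<open>ind([z]C, [x]c, [y]d, e)\<close>\<close>
  | Empty
  | EmptyInd tm tm              \<comment> \<open>\<open>ind([z]C, e)\<close>\<close>
  | Unit
  | Star
  | UnitInd tm tm tm            \<comment> \<open>\<open>ind([z]C, c, e)\<close>\<close>
  | Nat
  | Zero
  | Succ tm
  | NatInd tm tm tm tm          \<comment> \<open>\<open>ind([z]C, c, [x,y]d, e)\<close>\<close>
  | IdT tm tm tm                \<comment> \<open>\<open>a =\<^sub>A b\<close>, written \<open>IdT A a b\<close>\<close>
  | Refl tm
  | IdInd tm tm tm tm tm        \<comment> \<open>\<open>ind([x,y,q]C, [z]c, a, b, p)\<close>\<close>
  | Ua nat                      \<comment> \<open>the univalence axiom for \<open>Univ i\<close>\<close>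

section \<open>Renaming and substitution\<close>

abbreviation scons :: "'a \<Rightarrow> (nat \<Rightarrow> 'a) \<Rightarrow> nat \<Rightarrow> 'a"  (infixr "\<cdot>" 60) where
  "a \<cdot> \<sigma> \<equiv> case_nat a \<sigma>"

definition upr :: "(nat \<Rightarrow> nat) \<Rightarrow> nat \<Rightarrow> nat" where
  "upr \<xi> = 0 \<cdot> (\<lambda>k. Suc (\<xi> k))"

primrec ren :: "(nat \<Rightarrow> nat) \<Rightarrow> tm \<Rightarrow> tm" where
  "ren \<xi> (Var k) = Var (\<xi> k)"
| "ren \<xi> (Univ i) = Univ i"
| "ren \<xi> (Prd A B) = Prd (ren \<xi> A) (ren (upr \<xi>) B)"
| "ren \<xi> (Lam A b) = Lam (ren \<xi> A) (ren (upr \<xi>) b)"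
| "ren \<xi> (App f a) = App (ren \<xi> f) (ren \<xi> a)"
| "ren \<xi> (Sig A B) = Sig (ren \<xi> A) (ren (upr \<xi>) B)"
| "ren \<xi> (Dpair a b) = Dpair (ren \<xi> a) (ren \<xi> b)"
| "ren \<xi> (SigInd C g p) = SigInd (ren (upr \<xi>) C) (ren (upr (upr \<xi>)) g) (ren \<xi> p)"
| "ren \<xi> (Coprod A B) = Coprod (ren \<xi> A) (ren \<xi> B)"
| "ren \<xi> (CInl a) = CInl (ren \<xi> a)"
| "ren \<xi> (CInr b) = CInr (ren \<xi> b)"
| "ren \<xi> (CoprodInd C c d e) =
     CoprodInd (ren (upr \<xi>) C) (ren (upr \<xi>) c) (ren (upr \<xi>) d) (ren \<xi> e)"
| "ren \<xi> Empty = Empty"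
| "ren \<xi> (EmptyInd C e) = EmptyInd (ren (upr \<xi>) C) (ren \<xi> e)"
| "ren \<xi> Unit = Unit"
| "ren \<xi> Star = Star"
| "ren \<xi> (UnitInd C c e) = UnitInd (ren (upr \<xi>) C) (ren \<xi> c) (ren \<xi> e)"
| "ren \<xi> Nat = Nat"
| "ren \<xi> Zero = Zero"
| "ren \<xi> (Succ e) = Succ (ren \<xi> e)"
| "ren \<xi> (NatInd C c d e) =
     NatInd (ren (upr \<xi>) C) (ren \<xi> c) (ren (upr (upr \<xi>)) d) (ren \<xi> e)"
| "ren \<xi> (IdT A a b) = IdT (ren \<xi> A) (ren \<xi> a) (ren \<xi> b)"
| "ren \<xi> (Refl a) = Refl (ren \<xi> a)"
| "ren \<xi> (IdInd C c a b p) =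
     IdInd (ren (upr (upr (upr \<xi>))) C) (ren (upr \<xi>) c) (ren \<xi> a) (ren \<xi> b) (ren \<xi> p)"
| "ren \<xi> (Ua i) = Ua i"

abbreviation wk :: "nat \<Rightarrow> tm \<Rightarrow> tm" where
  "wk m \<equiv> ren (\<lambda>k. k + m)"

definition up :: "(nat \<Rightarrow> tm) \<Rightarrow> nat \<Rightarrow> tm" where
  "up \<sigma> = Var 0 \<cdot> (\<lambda>k. wk 1 (\<sigma> k))"

primrec subst :: "(nat \<Rightarrow> tm) \<Rightarrow> tm \<Rightarrow> tm" where
  "subst \<sigma> (Var k) = \<sigma> k"
| "subst \<sigma> (Univ i) = Univ i"
| "subst \<sigma> (Prd A B) = Prd (subst \<sigma> A) (subst (up \<sigma>) B)"
| "subst \<sigma> (Lam A b) = Lam (subst \<sigma> A) (subst (up \<sigma>) b)"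
| "subst \<sigma> (App f a) = App (subst \<sigma> f) (subst \<sigma> a)"
| "subst \<sigma> (Sig A B) = Sig (subst \<sigma> A) (subst (up \<sigma>) B)"
| "subst \<sigma> (Dpair a b) = Dpair (subst \<sigma> a) (subst \<sigma> b)"
| "subst \<sigma> (SigInd C g p) = SigInd (subst (up \<sigma>) C) (subst (up (up \<sigma>)) g) (subst \<sigma> p)"
| "subst \<sigma> (Coprod A B) = Coprod (subst \<sigma> A) (subst \<sigma> B)"
| "subst \<sigma> (CInl a) = CInl (subst \<sigma> a)"
| "subst \<sigma> (CInr b) = CInr (subst \<sigma> b)"
| "subst \<sigma> (CoprodInd C c d e) =
     CoprodInd (subst (up \<sigma>) C) (subst (up \<sigma>) c) (subst (up \<sigma>) d) (subst \<sigma> e)"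
| "subst \<sigma> Empty = Empty"
| "subst \<sigma> (EmptyInd C e) = EmptyInd (subst (up \<sigma>) C) (subst \<sigma> e)"
| "subst \<sigma> Unit = Unit"
| "subst \<sigma> Star = Star"
| "subst \<sigma> (UnitInd C c e) = UnitInd (subst (up \<sigma>) C) (subst \<sigma> c) (subst \<sigma> e)"
| "subst \<sigma> Nat = Nat"
| "subst \<sigma> Zero = Zero"
| "subst \<sigma> (Succ e) = Succ (subst \<sigma> e)"
| "subst \<sigma> (NatInd C c d e) =
     NatInd (subst (up \<sigma>) C) (subst \<sigma> c) (subst (up (up \<sigma>)) d) (subst \<sigma> e)"
| "subst \<sigma> (IdT A a b) = IdT (subst \<sigma> A) (subst \<sigma> a) (subst \<sigma> b)"
| "subst \<sigma> (Refl a) = Refl (subst \<sigma> a)"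
| "subst \<sigma> (IdInd C c a b p) =
     IdInd (subst (up (up (up \<sigma>))) C) (subst (up \<sigma>) c) (subst \<sigma> a) (subst \<sigma> b) (subst \<sigma> p)"
| "subst \<sigma> (Ua i) = Ua i"

abbreviation inst :: "tm \<Rightarrow> tm \<Rightarrow> tm"  ("_\<lbrakk>_\<rbrakk>" [100, 0] 100) where
  "B\<lbrakk>a\<rbrakk> \<equiv> subst (a \<cdot> Var) B"

section \<open>Types of the object theory\<close>

definition Arr :: "tm \<Rightarrow> tm \<Rightarrow> tm" where
  "Arr A B = Prd A (wk 1 B)"

definition Cross :: "tm \<Rightarrow> tm \<Rightarrow> tm" where
  "Cross A B = Sig A (wk 1 B)"

definition Neg :: "tm \<Rightarrow> tm" where
  "Neg A = Arr A Empty"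

text \<open>
  The type \<open>(\<Sum>(g:B\<rightarrow>A). \<Prod>(y:B). f (g y) = y) \<times> (\<Sum>(h:B\<rightarrow>A). \<Prod>(x:A). h (f x) = x)\<close> expressing that
  \<open>f : A \<rightarrow> B\<close> is an equivalence (bi-invertible map).
\<close>

definition Isequiv :: "tm \<Rightarrow> tm \<Rightarrow> tm \<Rightarrow> tm" where
  "Isequiv A B f =
     Cross
       (Sig (Arr B A)
          (Prd (wk 1 B) (IdT (wk 2 B) (App (wk 2 f) (App (Var 1) (Var 0))) (Var 0))))
       (Sig (Arr B A)
          (Prd (wk 1 A) (IdT (wk 2 A) (App (Var 1) (App (wk 2 f) (Var 0))) (Var 0))))"

definition Equiv :: "tm \<Rightarrow> tm \<Rightarrow> tm" where
  "Equiv A B = Sig (Arr A B) (Isequiv (wk 1 A) (wk 1 B) (Var 0))"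

definition id_equiv :: "tm \<Rightarrow> tm" where
  "id_equiv A =
     (let i = Lam A (Var 0); h = Lam A (Refl (Var 0))
      in Dpair i (Dpair (Dpair i h) (Dpair i h)))"

text \<open>
  The canonical map \<open>(A = B) \<rightarrow> (A \<simeq> B)\<close> for \<open>A B : Univ i\<close>, by path induction sending
  reflexivity to the identity equivalence.
\<close>

definition idtoeqv :: "nat \<Rightarrow> tm \<Rightarrow> tm \<Rightarrow> tm" where
  "idtoeqv i A B =
     Lam (IdT (Univ i) A B)
       (IdInd (Equiv (Var 2) (Var 1)) (id_equiv (Var 0)) (wk 1 A) (wk 1 B) (Var 0))"

text \<open>\<open>\<Prod>(A B : Univ i). isequiv (idtoeqv A B)\<close>\<close>

definition univalence :: "nat \<Rightarrow> tm" where
  "univalence i =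
     Prd (Univ i) (Prd (Univ i)
       (Isequiv (IdT (Univ i) (Var 1) (Var 0)) (Equiv (Var 1) (Var 0))
          (idtoeqv i (Var 1) (Var 0))))"

text \<open>
  Truncation levels start at \<open>-2\<close>: \<open>is_trunc m B\<close> expresses that \<open>B\<close> is an \<open>(m-2)\<close>-type.
\<close>

primrec is_trunc :: "nat \<Rightarrow> tm \<Rightarrow> tm" where
  "is_trunc 0 B = Sig B (Prd (wk 1 B) (IdT (wk 2 B) (Var 1) (Var 0)))"
| "is_trunc (Suc m) B = Prd B (Prd (wk 1 B) (is_trunc m (IdT (wk 2 B) (Var 1) (Var 0))))"

definition is_type :: "int \<Rightarrow> tm \<Rightarrow> tm" where
  "is_type k B = is_trunc (nat (k + 2)) B"

lemma is_type_minus_two: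
  "is_type (-2) B = Sig B (Prd (wk 1 B) (IdT (wk 2 B) (Var 1) (Var 0)))"
  by (simp add: is_type_def)

lemma is_type_step:
  assumes "k \<ge> -2"
  shows "is_type (k + 1) B = Prd B (Prd (wk 1 B) (is_type k (IdT (wk 2 B) (Var 1) (Var 0))))"
proof -
  have "nat (k + 1 + 2) = Suc (nat (k + 2))"
    using assms by simp
  then show ?thesis
    by (simp add: is_type_def)
qed

section \<open>Judgments\<close>

text \<open>
  A context is a list of types whose head is the most recently declared variable.  There is no
  separate judgment for being a type: types are the terms that inhabit some universe.
  Weakening and substitution are not primitive rules.
\<close>

inductive
  ctx :: "tm list \<Rightarrow> bool" and
  typing :: "tm list \<Rightarrow> tm \<Rightarrow> tm \<Rightarrow> bool"  ("_ \<turnstile> _ \<Colon> _" [50, 50, 50] 50) and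
  jeq :: "tm list \<Rightarrow> tm \<Rightarrow> tm \<Rightarrow> tm \<Rightarrow> bool"  ("_ \<turnstile> _ \<doteq> _ \<Colon> _" [50, 50, 50, 50] 50)
where
  ctx_empty: "ctx []"
| ctx_ext: "\<Gamma> \<turnstile> A \<Colon> Univ i \<Longrightarrow> ctx (A # \<Gamma>)"

| var: "ctx \<Gamma> \<Longrightarrow> k < length \<Gamma> \<Longrightarrow> \<Gamma> \<turnstile> Var k \<Colon> wk (Suc k) (\<Gamma> ! k)"

| eq_refl: "\<Gamma> \<turnstile> a \<Colon> A \<Longrightarrow> \<Gamma> \<turnstile> a \<doteq> a \<Colon> A"
| eq_sym: "\<Gamma> \<turnstile> a \<doteq> b \<Colon> A \<Longrightarrow> \<Gamma> \<turnstile> b \<doteq> a \<Colon> A"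
| eq_trans: "\<Gamma> \<turnstile> a \<doteq> b \<Colon> A \<Longrightarrow> \<Gamma> \<turnstile> b \<doteq> c \<Colon> A \<Longrightarrow> \<Gamma> \<turnstile> a \<doteq> c \<Colon> A"
| conv: "\<Gamma> \<turnstile> a \<Colon> A \<Longrightarrow> \<Gamma> \<turnstile> A \<doteq> B \<Colon> Univ i \<Longrightarrow> \<Gamma> \<turnstile> a \<Colon> B"
| eq_conv: "\<Gamma> \<turnstile> a \<doteq> b \<Colon> A \<Longrightarrow> \<Gamma> \<turnstile> A \<doteq> B \<Colon> Univ i \<Longrightarrow> \<Gamma> \<turnstile> a \<doteq> b \<Colon> B"

| univ_intro: "ctx \<Gamma> \<Longrightarrow> \<Gamma> \<turnstile> Univ i \<Colon> Univ (Suc i)"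
| univ_cumul: "\<Gamma> \<turnstile> A \<Colon> Univ i \<Longrightarrow> \<Gamma> \<turnstile> A \<Colon> Univ (Suc i)"
| univ_cumul_eq: "\<Gamma> \<turnstile> A \<doteq> B \<Colon> Univ i \<Longrightarrow> \<Gamma> \<turnstile> A \<doteq> B \<Colon> Univ (Suc i)"
| univ_ua: "ctx \<Gamma> \<Longrightarrow> \<Gamma> \<turnstile> Ua i \<Colon> univalence i"

| prd_form:
    "\<Gamma> \<turnstile> A \<Colon> Univ i \<Longrightarrow> A # \<Gamma> \<turnstile> B \<Colon> Univ i \<Longrightarrow> \<Gamma> \<turnstile> Prd A B \<Colon> Univ i"
| prd_form_eq:
    "\<Gamma> \<turnstile> A \<Colon> Univ i \<Longrightarrow> \<Gamma> \<turnstile> A \<doteq> A' \<Colon> Univ i \<Longrightarrow> A # \<Gamma> \<turnstile> B \<doteq> B' \<Colon> Univ i \<Longrightarrow>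
     \<Gamma> \<turnstile> Prd A B \<doteq> Prd A' B' \<Colon> Univ i"
| prd_intro:
    "\<Gamma> \<turnstile> A \<Colon> Univ i \<Longrightarrow> A # \<Gamma> \<turnstile> b \<Colon> B \<Longrightarrow> \<Gamma> \<turnstile> Lam A b \<Colon> Prd A B"
| prd_intro_eq:
    "\<Gamma> \<turnstile> A \<Colon> Univ i \<Longrightarrow> \<Gamma> \<turnstile> A \<doteq> A' \<Colon> Univ i \<Longrightarrow> A # \<Gamma> \<turnstile> b \<doteq> b' \<Colon> B \<Longrightarrow>
     \<Gamma> \<turnstile> Lam A b \<doteq> Lam A' b' \<Colon> Prd A B"
| prd_elim:
    "\<Gamma> \<turnstile> f \<Colon> Prd A B \<Longrightarrow> \<Gamma> \<turnstile> a \<Colon> A \<Longrightarrow> \<Gamma> \<turnstile> App f a \<Colon> B\<lbrakk>a\<rbrakk>"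
| prd_elim_eq:
    "\<Gamma> \<turnstile> f \<doteq> f' \<Colon> Prd A B \<Longrightarrow> \<Gamma> \<turnstile> a \<doteq> a' \<Colon> A \<Longrightarrow> \<Gamma> \<turnstile> App f a \<doteq> App f' a' \<Colon> B\<lbrakk>a\<rbrakk>"
| prd_comp:
    "\<Gamma> \<turnstile> A \<Colon> Univ i \<Longrightarrow> A # \<Gamma> \<turnstile> b \<Colon> B \<Longrightarrow> \<Gamma> \<turnstile> a \<Colon> A \<Longrightarrow>
     \<Gamma> \<turnstile> App (Lam A b) a \<doteq> b\<lbrakk>a\<rbrakk> \<Colon> B\<lbrakk>a\<rbrakk>"
| prd_uniq:
    "\<Gamma> \<turnstile> f \<Colon> Prd A B \<Longrightarrow> \<Gamma> \<turnstile> f \<doteq> Lam A (App (wk 1 f) (Var 0)) \<Colon> Prd A B"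

| sig_form:
    "\<Gamma> \<turnstile> A \<Colon> Univ i \<Longrightarrow> A # \<Gamma> \<turnstile> B \<Colon> Univ i \<Longrightarrow> \<Gamma> \<turnstile> Sig A B \<Colon> Univ i"
| sig_form_eq:
    "\<Gamma> \<turnstile> A \<Colon> Univ i \<Longrightarrow> \<Gamma> \<turnstile> A \<doteq> A' \<Colon> Univ i \<Longrightarrow> A # \<Gamma> \<turnstile> B \<doteq> B' \<Colon> Univ i \<Longrightarrow>
     \<Gamma> \<turnstile> Sig A B \<doteq> Sig A' B' \<Colon> Univ i"
| sig_intro:
    "A # \<Gamma> \<turnstile> B \<Colon> Univ i \<Longrightarrow> \<Gamma> \<turnstile> a \<Colon> A \<Longrightarrow> \<Gamma> \<turnstile> b \<Colon> B\<lbrakk>a\<rbrakk> \<Longrightarrow> \<Gamma> \<turnstile> Dpair a b \<Colon> Sig A B"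
| sig_intro_eq:
    "A # \<Gamma> \<turnstile> B \<Colon> Univ i \<Longrightarrow> \<Gamma> \<turnstile> a \<doteq> a' \<Colon> A \<Longrightarrow> \<Gamma> \<turnstile> b \<doteq> b' \<Colon> B\<lbrakk>a\<rbrakk> \<Longrightarrow>
     \<Gamma> \<turnstile> Dpair a b \<doteq> Dpair a' b' \<Colon> Sig A B"
| sig_elim:
    "Sig A B # \<Gamma> \<turnstile> C \<Colon> Univ i \<Longrightarrow>
     B # A # \<Gamma> \<turnstile> g \<Colon> subst (Dpair (Var 1) (Var 0) \<cdot> (\<lambda>k. Var (k + 2))) C \<Longrightarrow>
     \<Gamma> \<turnstile> p \<Colon> Sig A B \<Longrightarrow> \<Gamma> \<turnstile> SigInd C g p \<Colon> C\<lbrakk>p\<rbrakk>"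
| sig_elim_eq:
    "Sig A B # \<Gamma> \<turnstile> C \<doteq> C' \<Colon> Univ i \<Longrightarrow>
     B # A # \<Gamma> \<turnstile> g \<doteq> g' \<Colon> subst (Dpair (Var 1) (Var 0) \<cdot> (\<lambda>k. Var (k + 2))) C \<Longrightarrow>
     \<Gamma> \<turnstile> p \<doteq> p' \<Colon> Sig A B \<Longrightarrow> \<Gamma> \<turnstile> SigInd C g p \<doteq> SigInd C' g' p' \<Colon> C\<lbrakk>p\<rbrakk>"
| sig_comp:
    "Sig A B # \<Gamma> \<turnstile> C \<Colon> Univ i \<Longrightarrow>
     B # A # \<Gamma> \<turnstile> g \<Colon> subst (Dpair (Var 1) (Var 0) \<cdot> (\<lambda>k. Var (k + 2))) C \<Longrightarrow>
     \<Gamma> \<turnstile> a \<Colon> A \<Longrightarrow> \<Gamma> \<turnstile> b \<Colon> B\<lbrakk>a\<rbrakk> \<Longrightarrow>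
     \<Gamma> \<turnstile> SigInd C g (Dpair a b) \<doteq> subst (b \<cdot> a \<cdot> Var) g \<Colon> C\<lbrakk>Dpair a b\<rbrakk>"

| coprod_form:
    "\<Gamma> \<turnstile> A \<Colon> Univ i \<Longrightarrow> \<Gamma> \<turnstile> B \<Colon> Univ i \<Longrightarrow> \<Gamma> \<turnstile> Coprod A B \<Colon> Univ i"
| coprod_form_eq:
    "\<Gamma> \<turnstile> A \<doteq> A' \<Colon> Univ i \<Longrightarrow> \<Gamma> \<turnstile> B \<doteq> B' \<Colon> Univ i \<Longrightarrow> \<Gamma> \<turnstile> Coprod A B \<doteq> Coprod A' B' \<Colon> Univ i"
| coprod_intro1:
    "\<Gamma> \<turnstile> A \<Colon> Univ i \<Longrightarrow> \<Gamma> \<turnstile> B \<Colon> Univ i \<Longrightarrow> \<Gamma> \<turnstile> a \<Colon> A \<Longrightarrow> \<Gamma> \<turnstile> CInl a \<Colon> Coprod A B"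
| coprod_intro1_eq:
    "\<Gamma> \<turnstile> A \<Colon> Univ i \<Longrightarrow> \<Gamma> \<turnstile> B \<Colon> Univ i \<Longrightarrow> \<Gamma> \<turnstile> a \<doteq> a' \<Colon> A \<Longrightarrow>
     \<Gamma> \<turnstile> CInl a \<doteq> CInl a' \<Colon> Coprod A B"
| coprod_intro2:
    "\<Gamma> \<turnstile> A \<Colon> Univ i \<Longrightarrow> \<Gamma> \<turnstile> B \<Colon> Univ i \<Longrightarrow> \<Gamma> \<turnstile> b \<Colon> B \<Longrightarrow> \<Gamma> \<turnstile> CInr b \<Colon> Coprod A B"
| coprod_intro2_eq:
    "\<Gamma> \<turnstile> A \<Colon> Univ i \<Longrightarrow> \<Gamma> \<turnstile> B \<Colon> Univ i \<Longrightarrow> \<Gamma> \<turnstile> b \<doteq> b' \<Colon> B \<Longrightarrow>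
     \<Gamma> \<turnstile> CInr b \<doteq> CInr b' \<Colon> Coprod A B"
| coprod_elim:
    "Coprod A B # \<Gamma> \<turnstile> C \<Colon> Univ i \<Longrightarrow>
     A # \<Gamma> \<turnstile> c \<Colon> subst (CInl (Var 0) \<cdot> (\<lambda>k. Var (k + 1))) C \<Longrightarrow>
     B # \<Gamma> \<turnstile> d \<Colon> subst (CInr (Var 0) \<cdot> (\<lambda>k. Var (k + 1))) C \<Longrightarrow>
     \<Gamma> \<turnstile> e \<Colon> Coprod A B \<Longrightarrow> \<Gamma> \<turnstile> CoprodInd C c d e \<Colon> C\<lbrakk>e\<rbrakk>"
| coprod_elim_eq:
    "Coprod A B # \<Gamma> \<turnstile> C \<doteq> C' \<Colon> Univ i \<Longrightarrow>
     A # \<Gamma> \<turnstile> c \<doteq> c' \<Colon> subst (CInl (Var 0) \<cdot> (\<lambda>k. Var (k + 1))) C \<Longrightarrow>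
     B # \<Gamma> \<turnstile> d \<doteq> d' \<Colon> subst (CInr (Var 0) \<cdot> (\<lambda>k. Var (k + 1))) C \<Longrightarrow>
     \<Gamma> \<turnstile> e \<doteq> e' \<Colon> Coprod A B \<Longrightarrow>
     \<Gamma> \<turnstile> CoprodInd C c d e \<doteq> CoprodInd C' c' d' e' \<Colon> C\<lbrakk>e\<rbrakk>"
| coprod_comp1:
    "Coprod A B # \<Gamma> \<turnstile> C \<Colon> Univ i \<Longrightarrow>
     A # \<Gamma> \<turnstile> c \<Colon> subst (CInl (Var 0) \<cdot> (\<lambda>k. Var (k + 1))) C \<Longrightarrow>
     B # \<Gamma> \<turnstile> d \<Colon> subst (CInr (Var 0) \<cdot> (\<lambda>k. Var (k + 1))) C \<Longrightarrow>
     \<Gamma> \<turnstile> a \<Colon> A \<Longrightarrow> \<Gamma> \<turnstile> CoprodInd C c d (CInl a) \<doteq> c\<lbrakk>a\<rbrakk> \<Colon> C\<lbrakk>CInl a\<rbrakk>"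
| coprod_comp2:
    "Coprod A B # \<Gamma> \<turnstile> C \<Colon> Univ i \<Longrightarrow>
     A # \<Gamma> \<turnstile> c \<Colon> subst (CInl (Var 0) \<cdot> (\<lambda>k. Var (k + 1))) C \<Longrightarrow>
     B # \<Gamma> \<turnstile> d \<Colon> subst (CInr (Var 0) \<cdot> (\<lambda>k. Var (k + 1))) C \<Longrightarrow>
     \<Gamma> \<turnstile> b \<Colon> B \<Longrightarrow> \<Gamma> \<turnstile> CoprodInd C c d (CInr b) \<doteq> d\<lbrakk>b\<rbrakk> \<Colon> C\<lbrakk>CInr b\<rbrakk>"

| empty_form: "ctx \<Gamma> \<Longrightarrow> \<Gamma> \<turnstile> Empty \<Colon> Univ i"
| empty_elim:
    "Empty # \<Gamma> \<turnstile> C \<Colon> Univ i \<Longrightarrow> \<Gamma> \<turnstile> e \<Colon> Empty \<Longrightarrow> \<Gamma> \<turnstile> EmptyInd C e \<Colon> C\<lbrakk>e\<rbrakk>"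
| empty_elim_eq:
    "Empty # \<Gamma> \<turnstile> C \<doteq> C' \<Colon> Univ i \<Longrightarrow> \<Gamma> \<turnstile> e \<doteq> e' \<Colon> Empty \<Longrightarrow>
     \<Gamma> \<turnstile> EmptyInd C e \<doteq> EmptyInd C' e' \<Colon> C\<lbrakk>e\<rbrakk>"

| unit_form: "ctx \<Gamma> \<Longrightarrow> \<Gamma> \<turnstile> Unit \<Colon> Univ i"
| unit_intro: "ctx \<Gamma> \<Longrightarrow> \<Gamma> \<turnstile> Star \<Colon> Unit"
| unit_elim:
    "Unit # \<Gamma> \<turnstile> C \<Colon> Univ i \<Longrightarrow> \<Gamma> \<turnstile> c \<Colon> C\<lbrakk>Star\<rbrakk> \<Longrightarrow> \<Gamma> \<turnstile> e \<Colon> Unit \<Longrightarrow>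
     \<Gamma> \<turnstile> UnitInd C c e \<Colon> C\<lbrakk>e\<rbrakk>"
| unit_elim_eq:
    "Unit # \<Gamma> \<turnstile> C \<doteq> C' \<Colon> Univ i \<Longrightarrow> \<Gamma> \<turnstile> c \<doteq> c' \<Colon> C\<lbrakk>Star\<rbrakk> \<Longrightarrow> \<Gamma> \<turnstile> e \<doteq> e' \<Colon> Unit \<Longrightarrow>
     \<Gamma> \<turnstile> UnitInd C c e \<doteq> UnitInd C' c' e' \<Colon> C\<lbrakk>e\<rbrakk>"
| unit_comp:
    "Unit # \<Gamma> \<turnstile> C \<Colon> Univ i \<Longrightarrow> \<Gamma> \<turnstile> c \<Colon> C\<lbrakk>Star\<rbrakk> \<Longrightarrow> \<Gamma> \<turnstile> UnitInd C c Star \<doteq> c \<Colon> C\<lbrakk>Star\<rbrakk>"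

| nat_form: "ctx \<Gamma> \<Longrightarrow> \<Gamma> \<turnstile> Nat \<Colon> Univ i"
| nat_intro1: "ctx \<Gamma> \<Longrightarrow> \<Gamma> \<turnstile> Zero \<Colon> Nat"
| nat_intro2: "\<Gamma> \<turnstile> e \<Colon> Nat \<Longrightarrow> \<Gamma> \<turnstile> Succ e \<Colon> Nat"
| nat_intro2_eq: "\<Gamma> \<turnstile> e \<doteq> e' \<Colon> Nat \<Longrightarrow> \<Gamma> \<turnstile> Succ e \<doteq> Succ e' \<Colon> Nat"
| nat_elim:
    "Nat # \<Gamma> \<turnstile> C \<Colon> Univ i \<Longrightarrow> \<Gamma> \<turnstile> c \<Colon> C\<lbrakk>Zero\<rbrakk> \<Longrightarrow>
     C # Nat # \<Gamma> \<turnstile> d \<Colon> subst (Succ (Var 1) \<cdot> (\<lambda>k. Var (k + 2))) C \<Longrightarrow>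
     \<Gamma> \<turnstile> e \<Colon> Nat \<Longrightarrow> \<Gamma> \<turnstile> NatInd C c d e \<Colon> C\<lbrakk>e\<rbrakk>"
| nat_elim_eq:
    "Nat # \<Gamma> \<turnstile> C \<Colon> Univ i \<Longrightarrow> Nat # \<Gamma> \<turnstile> C \<doteq> C' \<Colon> Univ i \<Longrightarrow> \<Gamma> \<turnstile> c \<doteq> c' \<Colon> C\<lbrakk>Zero\<rbrakk> \<Longrightarrow>
     C # Nat # \<Gamma> \<turnstile> d \<doteq> d' \<Colon> subst (Succ (Var 1) \<cdot> (\<lambda>k. Var (k + 2))) C \<Longrightarrow>
     \<Gamma> \<turnstile> e \<doteq> e' \<Colon> Nat \<Longrightarrow> \<Gamma> \<turnstile> NatInd C c d e \<doteq> NatInd C' c' d' e' \<Colon> C\<lbrakk>e\<rbrakk>"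
| nat_comp1:
    "Nat # \<Gamma> \<turnstile> C \<Colon> Univ i \<Longrightarrow> \<Gamma> \<turnstile> c \<Colon> C\<lbrakk>Zero\<rbrakk> \<Longrightarrow>
     C # Nat # \<Gamma> \<turnstile> d \<Colon> subst (Succ (Var 1) \<cdot> (\<lambda>k. Var (k + 2))) C \<Longrightarrow>
     \<Gamma> \<turnstile> NatInd C c d Zero \<doteq> c \<Colon> C\<lbrakk>Zero\<rbrakk>"
| nat_comp2:
    "Nat # \<Gamma> \<turnstile> C \<Colon> Univ i \<Longrightarrow> \<Gamma> \<turnstile> c \<Colon> C\<lbrakk>Zero\<rbrakk> \<Longrightarrow>
     C # Nat # \<Gamma> \<turnstile> d \<Colon> subst (Succ (Var 1) \<cdot> (\<lambda>k. Var (k + 2))) C \<Longrightarrow>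
     \<Gamma> \<turnstile> e \<Colon> Nat \<Longrightarrow>
     \<Gamma> \<turnstile> NatInd C c d (Succ e) \<doteq> subst (NatInd C c d e \<cdot> e \<cdot> Var) d \<Colon> C\<lbrakk>Succ e\<rbrakk>"

| id_form:
    "\<Gamma> \<turnstile> A \<Colon> Univ i \<Longrightarrow> \<Gamma> \<turnstile> a \<Colon> A \<Longrightarrow> \<Gamma> \<turnstile> b \<Colon> A \<Longrightarrow> \<Gamma> \<turnstile> IdT A a b \<Colon> Univ i"
| id_form_eq:
    "\<Gamma> \<turnstile> A \<doteq> A' \<Colon> Univ i \<Longrightarrow> \<Gamma> \<turnstile> a \<doteq> a' \<Colon> A \<Longrightarrow> \<Gamma> \<turnstile> b \<doteq> b' \<Colon> A \<Longrightarrow>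
     \<Gamma> \<turnstile> IdT A a b \<doteq> IdT A' a' b' \<Colon> Univ i"
| id_intro:
    "\<Gamma> \<turnstile> A \<Colon> Univ i \<Longrightarrow> \<Gamma> \<turnstile> a \<Colon> A \<Longrightarrow> \<Gamma> \<turnstile> Refl a \<Colon> IdT A a a"
| id_intro_eq:
    "\<Gamma> \<turnstile> A \<Colon> Univ i \<Longrightarrow> \<Gamma> \<turnstile> a \<doteq> a' \<Colon> A \<Longrightarrow> \<Gamma> \<turnstile> Refl a \<doteq> Refl a' \<Colon> IdT A a a"
| id_elim:
    "IdT (wk 2 A) (Var 1) (Var 0) # wk 1 A # A # \<Gamma> \<turnstile> C \<Colon> Univ i \<Longrightarrow>
     A # \<Gamma> \<turnstile> c \<Colon> subst (Refl (Var 0) \<cdot> Var 0 \<cdot> Var 0 \<cdot> (\<lambda>k. Var (k + 1))) C \<Longrightarrow>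
     \<Gamma> \<turnstile> a \<Colon> A \<Longrightarrow> \<Gamma> \<turnstile> b \<Colon> A \<Longrightarrow> \<Gamma> \<turnstile> p \<Colon> IdT A a b \<Longrightarrow>
     \<Gamma> \<turnstile> IdInd C c a b p \<Colon> subst (p \<cdot> b \<cdot> a \<cdot> Var) C"
| id_elim_eq:
    "IdT (wk 2 A) (Var 1) (Var 0) # wk 1 A # A # \<Gamma> \<turnstile> C \<doteq> C' \<Colon> Univ i \<Longrightarrow>
     A # \<Gamma> \<turnstile> c \<doteq> c' \<Colon> subst (Refl (Var 0) \<cdot> Var 0 \<cdot> Var 0 \<cdot> (\<lambda>k. Var (k + 1))) C \<Longrightarrow>
     \<Gamma> \<turnstile> a \<doteq> a' \<Colon> A \<Longrightarrow> \<Gamma> \<turnstile> b \<doteq> b' \<Colon> A \<Longrightarrow> \<Gamma> \<turnstile> p \<doteq> p' \<Colon> IdT A a b \<Longrightarrow>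
     \<Gamma> \<turnstile> IdInd C c a b p \<doteq> IdInd C' c' a' b' p' \<Colon> subst (p \<cdot> b \<cdot> a \<cdot> Var) C"
| id_comp:
    "IdT (wk 2 A) (Var 1) (Var 0) # wk 1 A # A # \<Gamma> \<turnstile> C \<Colon> Univ i \<Longrightarrow>
     A # \<Gamma> \<turnstile> c \<Colon> subst (Refl (Var 0) \<cdot> Var 0 \<cdot> Var 0 \<cdot> (\<lambda>k. Var (k + 1))) C \<Longrightarrow>
     \<Gamma> \<turnstile> a \<Colon> A \<Longrightarrow>
     \<Gamma> \<turnstile> IdInd C c a a (Refl a) \<doteq> c\<lbrakk>a\<rbrakk> \<Colon> subst (Refl a \<cdot> a \<cdot> a \<cdot> Var) C"

end

theory Submission
  imports Defs
begin

text \<open>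
  Suppose that \<open>Univ n\<close> is an \<open>n\<close>-type. Then every loop in \<open>\<Omega>\<^sup>n\<^sup>+\<^sup>1(Univ n, X)\<close> is trivial, in particular
  whenever this loop space is a set. The latter property, restricted to those \<open>X\<close>, descends from
  level \<open>n + 1\<close> to level \<open>n\<close>: let \<open>L\<close> be the type of triples of a type \<open>X : Univ n\<close>, a loop
  \<open>p : \<Omega>\<^sup>n\<^sup>+\<^sup>1(Univ n, X)\<close> and a proof that this loop space is a set. By univalence and function
  extensionality, \<open>\<Omega>\<^sup>n\<^sup>+\<^sup>2(Univ (n + 1), L)\<close> is equivalent to \<open>\<Prod>(l : L). \<Omega>\<^sup>n\<^sup>+\<^sup>1(L, l)\<close>, which is again a set.
  It contains the tautological section, which sends \<open>(X, p, t)\<close> to a loop lying over \<open>p\<close>; it is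
  trivial by assumption, hence so is every such \<open>p\<close>. At level \<open>0\<close> this says that the set of
  automorphisms of the two-element type is trivial, which the swap refutes.

  The argument is carried out in the object theory with inhabitation \<open>\<Gamma> \<Turnstile> A\<close> in place of explicit
  terms wherever the term is irrelevant; the universe level \<open>n\<close> and the descent live on the meta level.
\<close>

section \<open>The substitution calculus\<close>

text \<open>The set condition is what makes \<open>L\<close> tractable. Its fibre over X, a loop
  with a proof that the loop space is a set, is then itself a set, so it does not affect \<Omega>^k
  of \<open>L\<close> for k \<ge> 2: for n \<ge> 1 the loop lying over p corresponds to p itself.
  For n = 0 this fails, since a loop in \<open>L\<close> over q also records that transport along q
  carries (p, t) to itself; the choice q = p is possible because p commutes with itself. Dimension
  and universe rise together: \<open>L\<close> quantifies over \<open>Univ n\<close> and hence lives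
  in \<open>Univ (n + 1)\<close>, while at \<open>L\<close> the first loop is spent on turning a
  path into a self-equivalence and the second one becomes a homotopy from the identity to itself. In
  computing loop spaces of sums only the fibre over the base point has to be a set or a proposition;
  in particular, being an equivalence has to be a proposition at the identity map only. Loops in
  products require function extensionality, which the theory does not assume and which is therefore
  extracted from univalence first.\<close>

definition S :: "nat \<Rightarrow> nat \<Rightarrow> tm" where
  "S n = (\<lambda>k. Var (k + n))"

definition scomp :: "(nat \<Rightarrow> tm) \<Rightarrow> (nat \<Rightarrow> tm) \<Rightarrow> nat \<Rightarrow> tm"  (infixr "\<Zsemi>" 65) where
  "\<sigma> \<Zsemi> \<tau> = (\<lambda>k. subst \<tau> (\<sigma> k))"

lemma S_apply [simp]: "S n k = Var (k + n)"
  by (simp add: S_def)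

lemma scomp_apply [simp]: "(\<sigma> \<Zsemi> \<tau>) k = subst \<tau> (\<sigma> k)"
  by (simp add: scomp_def)

lemma up_ren: "up (\<lambda>k. Var (\<xi> k)) = (\<lambda>k. Var (upr \<xi> k))"
  by (rule ext) (simp add: up_def upr_def split: nat.split)

text \<open>Together with \<open>wk_subst\<close> and \<open>up_S\<close> this removes renamings and
  liftings from all terms: every substitution becomes an expression in cons, shift and composition,
  and the simplification rules below compute its normal form.\<close>

lemma ren_subst: "ren \<xi> t = subst (\<lambda>k. Var (\<xi> k)) t"
  by (induction t arbitrary: \<xi>) (simp_all add: up_ren)

lemma subst_Var: "subst Var t = t"
proof -
  have up_Var: "up Var = Var"
    by (rule ext) (simp add: up_def split: nat.split)
  show ?thesis
    by (induction t) (simp_all add: up_Var)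
qed

lemma up_upr: "(\<lambda>k. up \<sigma> (upr \<xi> k)) = up (\<lambda>k. \<sigma> (\<xi> k))"
  by (rule ext) (simp add: up_def upr_def split: nat.split)

lemma subst_ren: "subst \<sigma> (ren \<xi> t) = subst (\<lambda>k. \<sigma> (\<xi> k)) t"
  by (induction t arbitrary: \<sigma> \<xi>) (simp_all add: up_upr)

lemma ren_ren: "ren \<zeta> (ren \<xi> t) = ren (\<lambda>k. \<zeta> (\<xi> k)) t"
  by (simp add: subst_ren ren_subst[of \<zeta>] ren_subst[of "\<lambda>k. \<zeta> (\<xi> k)"])

lemma ren_upr_up: "(\<lambda>k. ren (upr \<xi>) (up \<sigma> k)) = up (\<lambda>k. ren \<xi> (\<sigma> k))"
  by (rule ext) (simp add: up_def upr_def ren_ren split: nat.split)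

lemma ren_of_subst: "ren \<xi> (subst \<sigma> t) = subst (\<lambda>k. ren \<xi> (\<sigma> k)) t"
  by (induction t arbitrary: \<sigma> \<xi>) (simp_all add: ren_upr_up)

lemma up_up: "(\<lambda>k. subst (up \<tau>) (up \<sigma> k)) = up (\<lambda>k. subst \<tau> (\<sigma> k))"
  by (rule ext) (simp add: up_def subst_ren ren_of_subst split: nat.split)

text \<open>\<open>up\<close> is defined by a renaming, so fusing two substitutions under a binder
  presupposes both mixed fusion laws, \<open>subst_ren\<close> and
  \<open>ren_of_subst\<close>.\<close>

lemma subst_subst [simp]: "subst \<tau> (subst \<sigma> t) = subst (\<sigma> \<Zsemi> \<tau>) t"
  unfolding scomp_def
  by (induction t arbitrary: \<sigma> \<tau>) (simp_all add: up_up)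

lemma wk_subst: "wk n t = subst (S n) t"
  by (simp add: ren_subst S_def)

lemma Var_S: "Var = S 0"
  by (simp add: S_def fun_eq_iff)

lemma subst_S0 [simp]: "subst (S 0) t = t"
  by (simp add: subst_Var flip: Var_S)

lemma scons_scomp [simp]: "(a \<cdot> \<sigma>) \<Zsemi> \<tau> = subst \<tau> a \<cdot> (\<sigma> \<Zsemi> \<tau>)"
  by (rule ext) (simp split: nat.split)

text \<open>The shift amount is matched as a successor, which is why numerals are unfolded into
  successors further down.\<close>

lemma S_scomp_scons [simp]: "S (Suc n) \<Zsemi> (a \<cdot> \<sigma>) = S n \<Zsemi> \<sigma>"
  by (rule ext) simp

lemma S0_scomp [simp]: "S 0 \<Zsemi> \<sigma> = \<sigma>"
  by (rule ext) simp

lemma scomp_S0 [simp]: "\<sigma> \<Zsemi> S 0 = \<sigma>"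
  by (rule ext) simp

lemma S_scomp_S [simp]: "S n \<Zsemi> S m = S (n + m)"
  by (rule ext) (simp add: add.assoc)

lemma scomp_assoc [simp]: "(\<sigma> \<Zsemi> \<tau>) \<Zsemi> \<rho> = \<sigma> \<Zsemi> \<tau> \<Zsemi> \<rho>"
  by (rule ext) simp

lemma scons_S [simp]: "Var n \<cdot> S (Suc n) = S n"
  by (rule ext) (simp split: nat.split)

lemma up_S [simp]: "up \<sigma> = Var 0 \<cdot> (\<sigma> \<Zsemi> S (Suc 0))"
  by (rule ext) (simp add: up_def[unfolded wk_subst] split: nat.split)

lemma Var_add_S: "(\<lambda>k. Var (k + n)) = S n"
  by (simp add: S_def)

declare numeral_eq_Suc [simp]

lemma subst_Arr [simp]: "subst \<sigma> (Arr A B) = Arr (subst \<sigma> A) (subst \<sigma> B)"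
  unfolding Arr_def wk_subst by simp

lemma subst_Cross [simp]: "subst \<sigma> (Cross A B) = Cross (subst \<sigma> A) (subst \<sigma> B)"
  unfolding Cross_def wk_subst by simp

lemma subst_Isequiv [simp]:
  "subst \<sigma> (Isequiv A B f) = Isequiv (subst \<sigma> A) (subst \<sigma> B) (subst \<sigma> f)"
  unfolding Isequiv_def wk_subst by simp

lemma subst_Equiv [simp]: "subst \<sigma> (Equiv A B) = Equiv (subst \<sigma> A) (subst \<sigma> B)"
  unfolding Equiv_def wk_subst by simp

lemma subst_id_equiv [simp]: "subst \<sigma> (id_equiv A) = id_equiv (subst \<sigma> A)"
  unfolding id_equiv_def wk_subst by (simp add: Let_def)

lemma subst_idtoeqv [simp]:
  "subst \<sigma> (idtoeqv i A B) = idtoeqv i (subst \<sigma> A) (subst \<sigma> B)"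
  unfolding idtoeqv_def wk_subst by simp

lemma subst_univalence [simp]: "subst \<sigma> (univalence i) = univalence i"
  unfolding univalence_def by simp

lemma subst_is_trunc [simp]: "subst \<sigma> (is_trunc m A) = is_trunc m (subst \<sigma> A)"
  by (induction m arbitrary: \<sigma> A) (simp_all only: is_trunc.simps wk_subst, simp_all)

section \<open>Judgments in terms of the substitution calculus\<close>

lemma scons_Var: "a \<cdot> Var = a \<cdot> S 0"
  by (simp flip: Var_S)

lemmas to_S = wk_subst scons_Var Var_add_S

text \<open>In the primed rules every substituted type is a variable with an equation as premise.
  The conclusion then unifies with any goal, and the equation between normal forms is left to the
  simplifier.\<close>

lemma var': "ctx \<Gamma> \<Longrightarrow> k < length \<Gamma> \<Longrightarrow> T = subst (S (Suc k)) (\<Gamma> ! k) \<Longrightarrow> \<Gamma> \<turnstile> Var k \<Colon> T"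
  using var[unfolded to_S] by simp

lemma univ_ua': "ctx \<Gamma> \<Longrightarrow> T = univalence i \<Longrightarrow> \<Gamma> \<turnstile> Ua i \<Colon> T"
  using univ_ua by simp

lemma prd_elim':
  "\<Gamma> \<turnstile> f \<Colon> Prd A B \<Longrightarrow> \<Gamma> \<turnstile> a \<Colon> A \<Longrightarrow> T = subst (a \<cdot> S 0) B \<Longrightarrow> \<Gamma> \<turnstile> App f a \<Colon> T"
  using prd_elim[unfolded to_S] by simp

lemma prd_elim_eq':
  "\<Gamma> \<turnstile> f \<doteq> f' \<Colon> Prd A B \<Longrightarrow> \<Gamma> \<turnstile> a \<doteq> a' \<Colon> A \<Longrightarrow> T = subst (a \<cdot> S 0) B \<Longrightarrow>
   \<Gamma> \<turnstile> App f a \<doteq> App f' a' \<Colon> T"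
  using prd_elim_eq[unfolded to_S] by simp

lemma prd_comp':
  "\<Gamma> \<turnstile> A \<Colon> Univ i \<Longrightarrow> A # \<Gamma> \<turnstile> b \<Colon> B \<Longrightarrow> \<Gamma> \<turnstile> a \<Colon> A \<Longrightarrow>
   u = subst (a \<cdot> S 0) b \<Longrightarrow> T = subst (a \<cdot> S 0) B \<Longrightarrow> \<Gamma> \<turnstile> App (Lam A b) a \<doteq> u \<Colon> T"
  using prd_comp[unfolded to_S] by simp

lemma prd_uniq':
  "\<Gamma> \<turnstile> f \<Colon> Prd A B \<Longrightarrow> u = Lam A (App (subst (S (Suc 0)) f) (Var 0)) \<Longrightarrow> \<Gamma> \<turnstile> f \<doteq> u \<Colon> Prd A B"
  using prd_uniq[unfolded to_S] by simp

lemma sig_intro':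
  "A # \<Gamma> \<turnstile> B \<Colon> Univ i \<Longrightarrow> \<Gamma> \<turnstile> a \<Colon> A \<Longrightarrow> \<Gamma> \<turnstile> b \<Colon> T \<Longrightarrow> T = subst (a \<cdot> S 0) B \<Longrightarrow>
   \<Gamma> \<turnstile> Dpair a b \<Colon> Sig A B"
  using sig_intro[unfolded to_S] by simp

lemma sig_intro_eq':
  "A # \<Gamma> \<turnstile> B \<Colon> Univ i \<Longrightarrow> \<Gamma> \<turnstile> a \<doteq> a' \<Colon> A \<Longrightarrow> \<Gamma> \<turnstile> b \<doteq> b' \<Colon> T \<Longrightarrow>
   T = subst (a \<cdot> S 0) B \<Longrightarrow> \<Gamma> \<turnstile> Dpair a b \<doteq> Dpair a' b' \<Colon> Sig A B"
  using sig_intro_eq[unfolded to_S] by simp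

lemma sig_elim':
  "Sig A B # \<Gamma> \<turnstile> C \<Colon> Univ i \<Longrightarrow> B # A # \<Gamma> \<turnstile> g \<Colon> G \<Longrightarrow> \<Gamma> \<turnstile> p \<Colon> Sig A B \<Longrightarrow>
   G = subst (Dpair (Var (Suc 0)) (Var 0) \<cdot> S (Suc (Suc 0))) C \<Longrightarrow> T = subst (p \<cdot> S 0) C \<Longrightarrow> \<Gamma> \<turnstile> SigInd C g p \<Colon> T"
  using sig_elim[unfolded to_S] by simp

lemma sig_elim_eq':
  "Sig A B # \<Gamma> \<turnstile> C \<doteq> C' \<Colon> Univ i \<Longrightarrow> B # A # \<Gamma> \<turnstile> g \<doteq> g' \<Colon> G \<Longrightarrow>
   \<Gamma> \<turnstile> p \<doteq> p' \<Colon> Sig A B \<Longrightarrow> G = subst (Dpair (Var (Suc 0)) (Var 0) \<cdot> S (Suc (Suc 0))) C \<Longrightarrow>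
   T = subst (p \<cdot> S 0) C \<Longrightarrow> \<Gamma> \<turnstile> SigInd C g p \<doteq> SigInd C' g' p' \<Colon> T"
  using sig_elim_eq[unfolded to_S] by simp

lemma sig_comp':
  "Sig A B # \<Gamma> \<turnstile> C \<Colon> Univ i \<Longrightarrow> B # A # \<Gamma> \<turnstile> g \<Colon> G \<Longrightarrow>
   \<Gamma> \<turnstile> a \<Colon> A \<Longrightarrow> \<Gamma> \<turnstile> b \<Colon> Bb \<Longrightarrow> Bb = subst (a \<cdot> S 0) B \<Longrightarrow>
   G = subst (Dpair (Var (Suc 0)) (Var 0) \<cdot> S (Suc (Suc 0))) C \<Longrightarrow> u = subst (b \<cdot> a \<cdot> S 0) g \<Longrightarrow>
   T = subst (Dpair a b \<cdot> S 0) C \<Longrightarrow> \<Gamma> \<turnstile> SigInd C g (Dpair a b) \<doteq> u \<Colon> T"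
  using sig_comp[unfolded to_S] by simp

lemma coprod_elim':
  "Coprod A B # \<Gamma> \<turnstile> C \<Colon> Univ i \<Longrightarrow> A # \<Gamma> \<turnstile> c \<Colon> Tc \<Longrightarrow> B # \<Gamma> \<turnstile> d \<Colon> Td \<Longrightarrow> \<Gamma> \<turnstile> e \<Colon> Coprod A B \<Longrightarrow>
   Tc = subst (CInl (Var 0) \<cdot> S (Suc 0)) C \<Longrightarrow> Td = subst (CInr (Var 0) \<cdot> S (Suc 0)) C \<Longrightarrow>
   T = subst (e \<cdot> S 0) C \<Longrightarrow> \<Gamma> \<turnstile> CoprodInd C c d e \<Colon> T"
  using coprod_elim[unfolded to_S] by simp

lemma coprod_elim_eq':
  "Coprod A B # \<Gamma> \<turnstile> C \<doteq> C' \<Colon> Univ i \<Longrightarrow> A # \<Gamma> \<turnstile> c \<doteq> c' \<Colon> Tc \<Longrightarrow> B # \<Gamma> \<turnstile> d \<doteq> d' \<Colon> Td \<Longrightarrow>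
   \<Gamma> \<turnstile> e \<doteq> e' \<Colon> Coprod A B \<Longrightarrow>
   Tc = subst (CInl (Var 0) \<cdot> S (Suc 0)) C \<Longrightarrow> Td = subst (CInr (Var 0) \<cdot> S (Suc 0)) C \<Longrightarrow>
   T = subst (e \<cdot> S 0) C \<Longrightarrow> \<Gamma> \<turnstile> CoprodInd C c d e \<doteq> CoprodInd C' c' d' e' \<Colon> T"
  using coprod_elim_eq[unfolded to_S] by simp

lemma coprod_comp1':
  "Coprod A B # \<Gamma> \<turnstile> C \<Colon> Univ i \<Longrightarrow> A # \<Gamma> \<turnstile> c \<Colon> Tc \<Longrightarrow> B # \<Gamma> \<turnstile> d \<Colon> Td \<Longrightarrow> \<Gamma> \<turnstile> a \<Colon> A \<Longrightarrow>
   Tc = subst (CInl (Var 0) \<cdot> S (Suc 0)) C \<Longrightarrow> Td = subst (CInr (Var 0) \<cdot> S (Suc 0)) C \<Longrightarrow>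
   u = subst (a \<cdot> S 0) c \<Longrightarrow> T = subst (CInl a \<cdot> S 0) C \<Longrightarrow> \<Gamma> \<turnstile> CoprodInd C c d (CInl a) \<doteq> u \<Colon> T"
  using coprod_comp1[unfolded to_S] by simp

lemma coprod_comp2':
  "Coprod A B # \<Gamma> \<turnstile> C \<Colon> Univ i \<Longrightarrow> A # \<Gamma> \<turnstile> c \<Colon> Tc \<Longrightarrow> B # \<Gamma> \<turnstile> d \<Colon> Td \<Longrightarrow> \<Gamma> \<turnstile> b \<Colon> B \<Longrightarrow>
   Tc = subst (CInl (Var 0) \<cdot> S (Suc 0)) C \<Longrightarrow> Td = subst (CInr (Var 0) \<cdot> S (Suc 0)) C \<Longrightarrow>
   u = subst (b \<cdot> S 0) d \<Longrightarrow> T = subst (CInr b \<cdot> S 0) C \<Longrightarrow> \<Gamma> \<turnstile> CoprodInd C c d (CInr b) \<doteq> u \<Colon> T"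
  using coprod_comp2[unfolded to_S] by simp

lemma empty_elim':
  "Empty # \<Gamma> \<turnstile> C \<Colon> Univ i \<Longrightarrow> \<Gamma> \<turnstile> e \<Colon> Empty \<Longrightarrow> T = subst (e \<cdot> S 0) C \<Longrightarrow> \<Gamma> \<turnstile> EmptyInd C e \<Colon> T"
  using empty_elim[unfolded to_S] by simp

lemma empty_elim_eq':
  "Empty # \<Gamma> \<turnstile> C \<doteq> C' \<Colon> Univ i \<Longrightarrow> \<Gamma> \<turnstile> e \<doteq> e' \<Colon> Empty \<Longrightarrow> T = subst (e \<cdot> S 0) C \<Longrightarrow>
   \<Gamma> \<turnstile> EmptyInd C e \<doteq> EmptyInd C' e' \<Colon> T"
  using empty_elim_eq[unfolded to_S] by simp

lemma unit_elim':
  "Unit # \<Gamma> \<turnstile> C \<Colon> Univ i \<Longrightarrow> \<Gamma> \<turnstile> c \<Colon> Tc \<Longrightarrow> \<Gamma> \<turnstile> e \<Colon> Unit \<Longrightarrow> Tc = subst (Star \<cdot> S 0) C \<Longrightarrow>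
   T = subst (e \<cdot> S 0) C \<Longrightarrow> \<Gamma> \<turnstile> UnitInd C c e \<Colon> T"
  using unit_elim[unfolded to_S] by simp

lemma unit_elim_eq':
  "Unit # \<Gamma> \<turnstile> C \<doteq> C' \<Colon> Univ i \<Longrightarrow> \<Gamma> \<turnstile> c \<doteq> c' \<Colon> Tc \<Longrightarrow> \<Gamma> \<turnstile> e \<doteq> e' \<Colon> Unit \<Longrightarrow>
   Tc = subst (Star \<cdot> S 0) C \<Longrightarrow> T = subst (e \<cdot> S 0) C \<Longrightarrow> \<Gamma> \<turnstile> UnitInd C c e \<doteq> UnitInd C' c' e' \<Colon> T"
  using unit_elim_eq[unfolded to_S] by simp

lemma unit_comp':
  "Unit # \<Gamma> \<turnstile> C \<Colon> Univ i \<Longrightarrow> \<Gamma> \<turnstile> c \<Colon> T \<Longrightarrow> T = subst (Star \<cdot> S 0) C \<Longrightarrow> \<Gamma> \<turnstile> UnitInd C c Star \<doteq> c \<Colon> T"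
  using unit_comp[unfolded to_S] by simp

lemma nat_elim':
  "Nat # \<Gamma> \<turnstile> C \<Colon> Univ i \<Longrightarrow> \<Gamma> \<turnstile> c \<Colon> Tc \<Longrightarrow> C # Nat # \<Gamma> \<turnstile> d \<Colon> Td \<Longrightarrow> \<Gamma> \<turnstile> e \<Colon> Nat \<Longrightarrow>
   Tc = subst (Zero \<cdot> S 0) C \<Longrightarrow> Td = subst (Succ (Var (Suc 0)) \<cdot> S (Suc (Suc 0))) C \<Longrightarrow>
   T = subst (e \<cdot> S 0) C \<Longrightarrow> \<Gamma> \<turnstile> NatInd C c d e \<Colon> T"
  using nat_elim[unfolded to_S] by simp

lemma nat_elim_eq':
  "Nat # \<Gamma> \<turnstile> C \<Colon> Univ i \<Longrightarrow> Nat # \<Gamma> \<turnstile> C \<doteq> C' \<Colon> Univ i \<Longrightarrow> \<Gamma> \<turnstile> c \<doteq> c' \<Colon> Tc \<Longrightarrow>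
   C # Nat # \<Gamma> \<turnstile> d \<doteq> d' \<Colon> Td \<Longrightarrow> \<Gamma> \<turnstile> e \<doteq> e' \<Colon> Nat \<Longrightarrow>
   Tc = subst (Zero \<cdot> S 0) C \<Longrightarrow> Td = subst (Succ (Var (Suc 0)) \<cdot> S (Suc (Suc 0))) C \<Longrightarrow>
   T = subst (e \<cdot> S 0) C \<Longrightarrow> \<Gamma> \<turnstile> NatInd C c d e \<doteq> NatInd C' c' d' e' \<Colon> T"
  using nat_elim_eq[unfolded to_S] by simp

lemma nat_comp1':
  "Nat # \<Gamma> \<turnstile> C \<Colon> Univ i \<Longrightarrow> \<Gamma> \<turnstile> c \<Colon> T \<Longrightarrow> C # Nat # \<Gamma> \<turnstile> d \<Colon> Td \<Longrightarrow>
   T = subst (Zero \<cdot> S 0) C \<Longrightarrow> Td = subst (Succ (Var (Suc 0)) \<cdot> S (Suc (Suc 0))) C \<Longrightarrow>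
   \<Gamma> \<turnstile> NatInd C c d Zero \<doteq> c \<Colon> T"
  using nat_comp1[unfolded to_S] by simp

lemma nat_comp2':
  "Nat # \<Gamma> \<turnstile> C \<Colon> Univ i \<Longrightarrow> \<Gamma> \<turnstile> c \<Colon> Tc \<Longrightarrow> C # Nat # \<Gamma> \<turnstile> d \<Colon> Td \<Longrightarrow> \<Gamma> \<turnstile> e \<Colon> Nat \<Longrightarrow>
   Tc = subst (Zero \<cdot> S 0) C \<Longrightarrow> Td = subst (Succ (Var (Suc 0)) \<cdot> S (Suc (Suc 0))) C \<Longrightarrow>
   u = subst (NatInd C c d e \<cdot> e \<cdot> S 0) d \<Longrightarrow> T = subst (Succ e \<cdot> S 0) C \<Longrightarrow>
   \<Gamma> \<turnstile> NatInd C c d (Succ e) \<doteq> u \<Colon> T"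
  using nat_comp2[unfolded to_S] by simp

lemma id_elim':
  "\<Gamma> \<turnstile> p \<Colon> IdT A a b \<Longrightarrow> \<Gamma> \<turnstile> a \<Colon> A \<Longrightarrow> \<Gamma> \<turnstile> b \<Colon> A \<Longrightarrow>
   IdT (subst (S (Suc (Suc 0))) A) (Var (Suc 0)) (Var 0) # subst (S (Suc 0)) A # A # \<Gamma> \<turnstile> C \<Colon> Univ i \<Longrightarrow> A # \<Gamma> \<turnstile> c \<Colon> Tc \<Longrightarrow>
   Tc = subst (Refl (Var 0) \<cdot> Var 0 \<cdot> S 0) C \<Longrightarrow>
   T = subst (p \<cdot> b \<cdot> a \<cdot> S 0) C \<Longrightarrow> \<Gamma> \<turnstile> IdInd C c a b p \<Colon> T"
  using id_elim[unfolded to_S] by simp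

lemma id_elim_eq':
  "\<Gamma> \<turnstile> p \<doteq> p' \<Colon> IdT A a b \<Longrightarrow> \<Gamma> \<turnstile> a \<doteq> a' \<Colon> A \<Longrightarrow> \<Gamma> \<turnstile> b \<doteq> b' \<Colon> A \<Longrightarrow>
   IdT (subst (S (Suc (Suc 0))) A) (Var (Suc 0)) (Var 0) # subst (S (Suc 0)) A # A # \<Gamma> \<turnstile> C \<doteq> C' \<Colon> Univ i \<Longrightarrow>
   A # \<Gamma> \<turnstile> c \<doteq> c' \<Colon> Tc \<Longrightarrow>
   Tc = subst (Refl (Var 0) \<cdot> Var 0 \<cdot> S 0) C \<Longrightarrow>
   T = subst (p \<cdot> b \<cdot> a \<cdot> S 0) C \<Longrightarrow> \<Gamma> \<turnstile> IdInd C c a b p \<doteq> IdInd C' c' a' b' p' \<Colon> T"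
  using id_elim_eq[unfolded to_S] by simp

lemma id_comp':
  "\<Gamma> \<turnstile> a \<Colon> A \<Longrightarrow> IdT (subst (S (Suc (Suc 0))) A) (Var (Suc 0)) (Var 0) # subst (S (Suc 0)) A # A # \<Gamma> \<turnstile> C \<Colon> Univ i \<Longrightarrow>
   A # \<Gamma> \<turnstile> c \<Colon> Tc \<Longrightarrow>
   Tc = subst (Refl (Var 0) \<cdot> Var 0 \<cdot> S 0) C \<Longrightarrow>
   u = subst (a \<cdot> S 0) c \<Longrightarrow> T = subst (Refl a \<cdot> a \<cdot> a \<cdot> S 0) C \<Longrightarrow>
   \<Gamma> \<turnstile> IdInd C c a a (Refl a) \<doteq> u \<Colon> T"
  using id_comp[unfolded to_S] by simp

section \<open>Weakening and substitution\<close>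

text \<open>Rules such as \<open>sig_elim\<close> have premises in a context extended by a type
  whose formation is not itself a premise. To move a substitution under such a binder, the induction
  must also provide that the types in the context remain types; this is that additional
  invariant.\<close>

primrec stable_ctx :: "(tm list \<Rightarrow> (nat \<Rightarrow> tm) \<Rightarrow> tm list \<Rightarrow> bool) \<Rightarrow> tm list \<Rightarrow> bool" where
  "stable_ctx R [] \<longleftrightarrow> True"
| "stable_ctx R (A # \<Gamma>) \<longleftrightarrow>
     stable_ctx R \<Gamma> \<and> (\<exists>i. \<forall>\<Delta> \<sigma>. R \<Delta> \<sigma> \<Gamma> \<longrightarrow> \<Delta> \<turnstile> subst \<sigma> A \<Colon> Univ i)"

declare stable_ctx.simps [simp del]

lemma stable_ctx_tl: "stable_ctx R (A # \<Gamma>) \<Longrightarrow> stable_ctx R \<Gamma>"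
  by (simp add: stable_ctx.simps)

lemmas stable_rules =
  prd_comp' sig_comp' coprod_comp1' coprod_comp2' unit_comp' nat_comp1' nat_comp2' id_comp'
  univ_intro prd_form prd_form_eq prd_intro prd_intro_eq prd_elim' prd_elim_eq' sig_form
  sig_form_eq sig_intro' sig_intro_eq' sig_elim' sig_elim_eq' coprod_form coprod_form_eq
  coprod_intro1 coprod_intro1_eq coprod_intro2 coprod_intro2_eq coprod_elim' coprod_elim_eq'
  empty_form empty_elim' empty_elim_eq' unit_form unit_intro unit_elim' unit_elim_eq' nat_form
  nat_intro1 nat_intro2 nat_intro2_eq nat_elim' nat_elim_eq' id_form id_form_eq id_intro
  id_intro_eq id_elim' id_elim_eq' univ_cumul univ_cumul_eq prd_uniq' eq_refl eq_sym

text \<open>The relation is abstract because the induction is used twice: for renamings, whose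
  closure under binders \<open>R_up\<close> is elementary, and for typed substitutions, whose
  closure under binders needs weakening, that is, the first instance.\<close>

lemma
  assumes R_ctx: "\<And>\<Delta> \<sigma> \<Gamma>. R \<Delta> \<sigma> \<Gamma> \<Longrightarrow> ctx \<Delta>"
    and R_var: "\<And>\<Delta> \<sigma> \<Gamma> k. R \<Delta> \<sigma> \<Gamma> \<Longrightarrow> k < length \<Gamma> \<Longrightarrow> \<Delta> \<turnstile> \<sigma> k \<Colon> subst (S (Suc k) \<Zsemi> \<sigma>) (\<Gamma> ! k)"
    and R_up: "\<And>\<Delta> \<sigma> \<Gamma> A i. R \<Delta> \<sigma> \<Gamma> \<Longrightarrow> \<Delta> \<turnstile> subst \<sigma> A \<Colon> Univ i \<Longrightarrow>
      R (subst \<sigma> A # \<Delta>) (Var 0 \<cdot> (\<sigma> \<Zsemi> S (Suc 0))) (A # \<Gamma>)"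
  shows stable_ctx: "ctx \<Gamma> \<Longrightarrow> stable_ctx R \<Gamma>"
    and stable_typing: "\<Gamma> \<turnstile> a \<Colon> A \<Longrightarrow>
      stable_ctx R \<Gamma> \<and> (\<forall>\<Delta> \<sigma>. R \<Delta> \<sigma> \<Gamma> \<longrightarrow> \<Delta> \<turnstile> subst \<sigma> a \<Colon> subst \<sigma> A)"
    and stable_jeq: "\<Gamma> \<turnstile> a \<doteq> b \<Colon> A \<Longrightarrow>
      stable_ctx R \<Gamma> \<and> (\<forall>\<Delta> \<sigma>. R \<Delta> \<sigma> \<Gamma> \<longrightarrow> \<Delta> \<turnstile> subst \<sigma> a \<doteq> subst \<sigma> b \<Colon> subst \<sigma> A)"
proof -
  have X: "R (subst \<sigma> A # \<Delta>) (Var 0 \<cdot> (\<sigma> \<Zsemi> S (Suc 0))) (A # \<Gamma>)"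
    if "stable_ctx R (A # \<Gamma>)" "R \<Delta> \<sigma> \<Gamma>" for A \<Gamma> \<Delta> \<sigma>
    using that by (auto simp: stable_ctx.simps intro: R_up)
  have X2: "R (subst (Var 0 \<cdot> (\<sigma> \<Zsemi> S (Suc 0))) B # subst \<sigma> A # \<Delta>)
      (Var 0 \<cdot> Var (Suc 0) \<cdot> (\<sigma> \<Zsemi> S (Suc (Suc 0)))) (B # A # \<Gamma>)"
    if "stable_ctx R (B # A # \<Gamma>)" "R \<Delta> \<sigma> \<Gamma>" for A B \<Gamma> \<Delta> \<sigma>
    using X[OF that(1) X[OF stable_ctx_tl[OF that(1)] that(2)]] by simp
  \<comment> \<open>The three binders of the motive of identity elimination, with the lifted
    substitution in normal form.\<close>
  have X3: "R (IdT (subst (\<sigma> \<Zsemi> S (Suc (Suc 0))) A) (Var (Suc 0)) (Var 0) #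
        subst (\<sigma> \<Zsemi> S (Suc 0)) A # subst \<sigma> A # \<Delta>)
      (Var 0 \<cdot> Var (Suc 0) \<cdot> Var (Suc (Suc 0)) \<cdot> (\<sigma> \<Zsemi> S (Suc (Suc (Suc 0)))))
      (IdT (subst (S (Suc (Suc 0))) A) (Var (Suc 0)) (Var 0) # subst (S (Suc 0)) A # A # \<Gamma>)"
    if "stable_ctx R (IdT (subst (S (Suc (Suc 0))) A) (Var (Suc 0)) (Var 0) # subst (S (Suc 0)) A # A # \<Gamma>)"
      "R \<Delta> \<sigma> \<Gamma>" for A \<Gamma> \<Delta> \<sigma>
    using X[OF that(1) X2[OF stable_ctx_tl[OF that(1)] that(2)]] by simp
  note tl = stable_ctx_tl
  note Xs = X X[where A = "Sig A B" for A B, simplified] X[where A = "Coprod A B" for A B, simplified]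
    X[where A = Empty, simplified] X[where A = Unit, simplified] X[where A = Nat, simplified]
    X2 X2[where A = Nat, simplified] X3
  show "ctx \<Gamma> \<Longrightarrow> stable_ctx R \<Gamma>"
    and "\<Gamma> \<turnstile> a \<Colon> A \<Longrightarrow>
      stable_ctx R \<Gamma> \<and> (\<forall>\<Delta> \<sigma>. R \<Delta> \<sigma> \<Gamma> \<longrightarrow> \<Delta> \<turnstile> subst \<sigma> a \<Colon> subst \<sigma> A)"
    and "\<Gamma> \<turnstile> a \<doteq> b \<Colon> A \<Longrightarrow>
      stable_ctx R \<Gamma> \<and> (\<forall>\<Delta> \<sigma>. R \<Delta> \<sigma> \<Gamma> \<longrightarrow> \<Delta> \<turnstile> subst \<sigma> a \<doteq> subst \<sigma> b \<Colon> subst \<sigma> A)"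
  proof (induction rule: ctx_typing_jeq.inducts)
    case (var \<Gamma> k)
    then show ?case unfolding wk_subst using R_var by simp
  next
    case (univ_ua \<Gamma> i)
    then show ?case using R_ctx univ_ua' by auto
  next
    case (eq_trans \<Gamma> a b A c)
    then show ?case by simp (meson ctx_typing_jeq.eq_trans)
  next
    case (conv \<Gamma> a A B i)
    then show ?case by simp (meson ctx_typing_jeq.conv)
  next
    case (eq_conv \<Gamma> a b A B i)
    then show ?case by simp (meson ctx_typing_jeq.eq_conv)
  next
    case ctx_empty
    then show ?case by (simp add: stable_ctx.simps)
  next
    case ctx_ext
    then show ?case by (auto simp: stable_ctx.simps)
  \<comment> \<open>All remaining cases are uniform: apply the rule itself, and prove each premise
    from its induction hypothesis at the given substitution or at one lifted by
    \<open>Xs\<close>.\<close>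
  qed ((rule conjI, blast dest: tl, (intro allI impI)?, (unfold to_S)?, simp?, rule stable_rules,
      (rule R_ctx, assumption | ((elim conjE)?, erule allE, erule allE, erule mp, (assumption | rule Xs, assumption, assumption)) |
        simp; fail | simp, ((elim conjE)?, erule allE, erule allE, erule mp, (assumption | rule Xs, assumption, assumption)))+)[1])+
qed

text \<open>All tails at once, because a premise in an extended context has to yield that the
  context without the extension is well formed.\<close>

lemma
  shows ctx_drop: "ctx \<Gamma> \<Longrightarrow> \<forall>k. ctx (drop k \<Gamma>)"
    and typing_drop: "\<Gamma> \<turnstile> a \<Colon> A \<Longrightarrow> \<forall>k. ctx (drop k \<Gamma>)"
    and jeq_drop: "\<Gamma> \<turnstile> a \<doteq> b \<Colon> A \<Longrightarrow> \<forall>k. ctx (drop k \<Gamma>)"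
proof (induction rule: ctx_typing_jeq.inducts)
  case (ctx_ext \<Gamma> A i)
  show ?case
  proof
    fix k
    show "ctx (drop k (A # \<Gamma>))"
      using ctx_ext by (cases k) (auto intro: ctx_typing_jeq.ctx_ext)
  qed
qed (simp_all add: ctx_empty)

lemma typing_ctx: "\<Gamma> \<turnstile> a \<Colon> A \<Longrightarrow> ctx \<Gamma>"
  using typing_drop[THEN spec, of _ _ _ 0] by simp

text \<open>The types agree as raw terms and not merely up to judgmental equality; hence the
  relation can be lifted under binders before weakening is available.\<close>

definition renames :: "tm list \<Rightarrow> (nat \<Rightarrow> tm) \<Rightarrow> tm list \<Rightarrow> bool" where
  "renames \<Delta> \<sigma> \<Gamma> \<longleftrightarrow> ctx \<Delta> \<and> (\<forall>k < length \<Gamma>. \<exists>l < length \<Delta>.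
     \<sigma> k = Var l \<and> subst (S (Suc l)) (\<Delta> ! l) = subst (S (Suc k) \<Zsemi> \<sigma>) (\<Gamma> ! k))"

definition substs :: "tm list \<Rightarrow> (nat \<Rightarrow> tm) \<Rightarrow> tm list \<Rightarrow> bool" where
  "substs \<Delta> \<sigma> \<Gamma> \<longleftrightarrow>
     ctx \<Delta> \<and> (\<forall>k < length \<Gamma>. \<Delta> \<turnstile> \<sigma> k \<Colon> subst (S (Suc k) \<Zsemi> \<sigma>) (\<Gamma> ! k))"

lemma typing_renames:
  assumes "\<Gamma> \<turnstile> a \<Colon> A" "renames \<Delta> \<sigma> \<Gamma>"
  shows "\<Delta> \<turnstile> subst \<sigma> a \<Colon> subst \<sigma> A"
proof -
  have R_var: "\<Delta> \<turnstile> \<sigma> k \<Colon> subst (S (Suc k) \<Zsemi> \<sigma>) (\<Gamma> ! k)" if "renames \<Delta> \<sigma> \<Gamma>" "k < length \<Gamma>" for \<Delta> \<sigma> \<Gamma> k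
    using that var' by (fastforce simp: renames_def)
  have R_up: "renames (subst \<sigma> A # \<Delta>) (Var 0 \<cdot> (\<sigma> \<Zsemi> S (Suc 0))) (A # \<Gamma>)"
    if R: "renames \<Delta> \<sigma> \<Gamma>" and A: "\<Delta> \<turnstile> subst \<sigma> A \<Colon> Univ i" for \<Delta> \<sigma> \<Gamma> A i
    unfolding renames_def
  proof (intro conjI allI impI)
    show "ctx (subst \<sigma> A # \<Delta>)" using A by (rule ctx_ext)
  next
    fix k assume k: "k < length (A # \<Gamma>)"
    show "\<exists>l < length (subst \<sigma> A # \<Delta>). (Var 0 \<cdot> (\<sigma> \<Zsemi> S (Suc 0))) k = Var l \<and>
      subst (S (Suc l)) ((subst \<sigma> A # \<Delta>) ! l) =
      subst (S (Suc k) \<Zsemi> (Var 0 \<cdot> (\<sigma> \<Zsemi> S (Suc 0)))) ((A # \<Gamma>) ! k)"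
    proof (cases k)
      case 0
      then show ?thesis by (intro exI[of _ 0]) simp
    next
      case (Suc k')
      with R k obtain l where l: "l < length \<Delta>" "\<sigma> k' = Var l"
        "subst (S (Suc l)) (\<Delta> ! l) = subst (S (Suc k') \<Zsemi> \<sigma>) (\<Gamma> ! k')"
        by (auto simp: renames_def)
      have "subst (S (Suc 0)) (subst (S (Suc l)) (\<Delta> ! l)) =
          subst (S (Suc 0)) (subst (S (Suc k') \<Zsemi> \<sigma>) (\<Gamma> ! k'))"
        by (simp only: l(3))
      then show ?thesis using Suc l(1,2) by (intro exI[of _ "Suc l"]) simp
    qed
  qed
  have "renames \<Delta> \<sigma> \<Gamma> \<Longrightarrow> ctx \<Delta>" for \<Delta> \<sigma> \<Gamma>
    by (simp add: renames_def)
  then show ?thesis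
    using stable_typing[where R = renames, OF _ R_var R_up assms(1)] assms(2) by auto
qed

lemma renames_S: "ctx (A # \<Gamma>) \<Longrightarrow> renames (A # \<Gamma>) (S 1) \<Gamma>"
  by (auto simp: renames_def intro!: exI[of _ "Suc _"])

lemma substs_up:
  assumes "substs \<Delta> \<sigma> \<Gamma>" "\<Delta> \<turnstile> subst \<sigma> A \<Colon> Univ i"
  shows "substs (subst \<sigma> A # \<Delta>) (Var 0 \<cdot> (\<sigma> \<Zsemi> S (Suc 0))) (A # \<Gamma>)"
  unfolding substs_def
proof (intro conjI allI impI)
  show c: "ctx (subst \<sigma> A # \<Delta>)" using assms(2) by (rule ctx_ext)
  fix k assume k: "k < length (A # \<Gamma>)"
  show "subst \<sigma> A # \<Delta> \<turnstile> (Var 0 \<cdot> (\<sigma> \<Zsemi> S (Suc 0))) k \<Colon>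
      subst (S (Suc k) \<Zsemi> (Var 0 \<cdot> (\<sigma> \<Zsemi> S (Suc 0)))) ((A # \<Gamma>) ! k)"
  proof (cases k)
    case 0
    then show ?thesis using c by (auto intro: var')
  next
    case (Suc k')
    with assms(1) k have "\<Delta> \<turnstile> \<sigma> k' \<Colon> subst (S (Suc k') \<Zsemi> \<sigma>) (\<Gamma> ! k')"
      by (simp add: substs_def)
    from typing_renames[OF this renames_S[OF c]] show ?thesis using Suc by simp
  qed
qed

lemma
  assumes "substs \<Delta> \<sigma> \<Gamma>"
  shows typing_substs: "\<Gamma> \<turnstile> a \<Colon> A \<Longrightarrow> \<Delta> \<turnstile> subst \<sigma> a \<Colon> subst \<sigma> A"
    and jeq_substs: "\<Gamma> \<turnstile> a \<doteq> b \<Colon> A \<Longrightarrow> \<Delta> \<turnstile> subst \<sigma> a \<doteq> subst \<sigma> b \<Colon> subst \<sigma> A"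
proof -
  have R_ctx: "substs \<Delta> \<sigma> \<Gamma> \<Longrightarrow> ctx \<Delta>" for \<Delta> \<sigma> \<Gamma>
    by (simp add: substs_def)
  have R_var: "substs \<Delta> \<sigma> \<Gamma> \<Longrightarrow> k < length \<Gamma> \<Longrightarrow> \<Delta> \<turnstile> \<sigma> k \<Colon> subst (S (Suc k) \<Zsemi> \<sigma>) (\<Gamma> ! k)" for \<Delta> \<sigma> \<Gamma> k
    by (simp add: substs_def)
  show "\<Delta> \<turnstile> subst \<sigma> a \<Colon> subst \<sigma> A" if "\<Gamma> \<turnstile> a \<Colon> A"
  proof -
    have "stable_ctx substs \<Gamma> \<and> (\<forall>\<Delta> \<sigma>. substs \<Delta> \<sigma> \<Gamma> \<longrightarrow> \<Delta> \<turnstile> subst \<sigma> a \<Colon> subst \<sigma> A)"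
      by (rule stable_typing[where R = substs]) (erule R_ctx | erule (1) R_var substs_up | rule that)+
    with assms show ?thesis by blast
  qed
  show "\<Delta> \<turnstile> subst \<sigma> a \<doteq> subst \<sigma> b \<Colon> subst \<sigma> A" if "\<Gamma> \<turnstile> a \<doteq> b \<Colon> A"
  proof -
    have "stable_ctx substs \<Gamma> \<and> (\<forall>\<Delta> \<sigma>. substs \<Delta> \<sigma> \<Gamma> \<longrightarrow> \<Delta> \<turnstile> subst \<sigma> a \<doteq> subst \<sigma> b \<Colon> subst \<sigma> A)"
      by (rule stable_jeq[where R = substs]) (erule R_ctx | erule (1) R_var substs_up | rule that)+
    with assms show ?thesis by blast
  qed
qed

lemma substs_S: "ctx \<Delta> \<Longrightarrow> n \<le> length \<Delta> \<Longrightarrow> drop n \<Delta> = \<Gamma> \<Longrightarrow> substs \<Delta> (S n) \<Gamma>"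
  by (auto simp: substs_def add.commute intro!: var')

lemma substs_cons:
  "substs \<Delta> \<sigma> \<Gamma> \<Longrightarrow> \<Delta> \<turnstile> a \<Colon> T \<Longrightarrow> T = subst \<sigma> A \<Longrightarrow> substs \<Delta> (a \<cdot> \<sigma>) (A # \<Gamma>)"
  by (auto simp: substs_def nth_Cons split: nat.split)

section \<open>Types and inhabitation\<close>

abbreviation v0 where "v0 \<equiv> Var 0"
abbreviation v1 where "v1 \<equiv> Var (Suc 0)"
abbreviation v2 where "v2 \<equiv> Var (Suc (Suc 0))"
abbreviation v3 where "v3 \<equiv> Var (Suc (Suc (Suc 0)))"
abbreviation v4 where "v4 \<equiv> Var (Suc (Suc (Suc (Suc 0))))"
abbreviation v5 where "v5 \<equiv> Var (Suc (Suc (Suc (Suc (Suc 0)))))"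
abbreviation s0 where "s0 \<equiv> S 0"
abbreviation s1 where "s1 \<equiv> S (Suc 0)"
abbreviation s2 where "s2 \<equiv> S (Suc (Suc 0))"
abbreviation s3 where "s3 \<equiv> S (Suc (Suc (Suc 0)))"
abbreviation s4 where "s4 \<equiv> S (Suc (Suc (Suc (Suc 0))))"
abbreviation s5 where "s5 \<equiv> S (Suc (Suc (Suc (Suc (Suc 0)))))"
abbreviation w1 where "w1 \<equiv> subst s1"
abbreviation w2 where "w2 \<equiv> subst s2"
abbreviation w3 where "w3 \<equiv> subst s3"
abbreviation w4 where "w4 \<equiv> subst s4"
abbreviation w5 where "w5 \<equiv> subst s5"

definition isty :: "tm list \<Rightarrow> tm \<Rightarrow> bool" where
  "isty \<Gamma> A \<longleftrightarrow> (\<exists>i. \<Gamma> \<turnstile> A \<Colon> Univ i)"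

definition inh :: "tm list \<Rightarrow> tm \<Rightarrow> bool"  ("_ \<Turnstile> _" [50, 50] 50) where
  "\<Gamma> \<Turnstile> A \<longleftrightarrow> (\<exists>t. \<Gamma> \<turnstile> t \<Colon> A)"

definition eqty :: "tm list \<Rightarrow> tm \<Rightarrow> tm \<Rightarrow> bool" where
  "eqty \<Gamma> A B \<longleftrightarrow> (\<exists>i. \<Gamma> \<turnstile> A \<doteq> B \<Colon> Univ i)"

lemma istyI: "\<Gamma> \<turnstile> A \<Colon> Univ i \<Longrightarrow> isty \<Gamma> A"
  by (auto simp: isty_def)

lemma inhI: "\<Gamma> \<turnstile> t \<Colon> A \<Longrightarrow> \<Gamma> \<Turnstile> A"
  by (auto simp: inh_def)

lemma eqtyI: "\<Gamma> \<turnstile> A \<doteq> B \<Colon> Univ i \<Longrightarrow> eqty \<Gamma> A B"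
  by (auto simp: eqty_def)

lemma eqty_sym: "eqty \<Gamma> A B \<Longrightarrow> eqty \<Gamma> B A"
  by (auto simp: eqty_def intro: eq_sym)

lemma univ_le: "i \<le> j \<Longrightarrow> \<Gamma> \<turnstile> A \<Colon> Univ i \<Longrightarrow> \<Gamma> \<turnstile> A \<Colon> Univ j"
  by (induction rule: dec_induct) (auto intro: univ_cumul)

text \<open>The formation rules want both constituents in one universe; cumulativity provides
  it.\<close>

lemma isty_max: "isty \<Gamma> A \<Longrightarrow> isty \<Delta> B \<Longrightarrow> \<exists>i. \<Gamma> \<turnstile> A \<Colon> Univ i \<and> \<Delta> \<turnstile> B \<Colon> Univ i"
  unfolding isty_def by (meson max.cobounded1 max.cobounded2 univ_le)

lemma isty_ctx: "isty \<Gamma> A \<Longrightarrow> ctx \<Gamma>"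
  by (auto simp: isty_def dest: typing_ctx)

lemma ctx_cons: "isty \<Gamma> A \<Longrightarrow> ctx (A # \<Gamma>)"
  by (auto simp: isty_def intro: ctx_ext)

lemma isty_Prd: "isty \<Gamma> A \<Longrightarrow> isty (A # \<Gamma>) B \<Longrightarrow> isty \<Gamma> (Prd A B)"
  by (metis isty_max istyI prd_form)

lemma isty_Sig: "isty \<Gamma> A \<Longrightarrow> isty (A # \<Gamma>) B \<Longrightarrow> isty \<Gamma> (Sig A B)"
  by (metis isty_max istyI sig_form)

lemma isty_Coprod: "isty \<Gamma> A \<Longrightarrow> isty \<Gamma> B \<Longrightarrow> isty \<Gamma> (Coprod A B)"
  by (metis isty_max istyI coprod_form)

lemma isty_Id: "isty \<Gamma> A \<Longrightarrow> \<Gamma> \<turnstile> a \<Colon> A \<Longrightarrow> \<Gamma> \<turnstile> b \<Colon> A \<Longrightarrow> isty \<Gamma> (IdT A a b)"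
  by (metis isty_def id_form)

lemma isty_base: "ctx \<Gamma> \<Longrightarrow> isty \<Gamma> (Univ i)" "ctx \<Gamma> \<Longrightarrow> isty \<Gamma> Empty" "ctx \<Gamma> \<Longrightarrow> isty \<Gamma> Unit"
  by (auto intro: istyI univ_intro empty_form unit_form)

lemma isty_var: "ctx \<Gamma> \<Longrightarrow> k < length \<Gamma> \<Longrightarrow> \<exists>i. subst (S (Suc k)) (\<Gamma> ! k) = Univ i \<Longrightarrow> isty \<Gamma> (Var k)"
  by (metis istyI var')

lemma isty_subst: "isty \<Gamma> A \<Longrightarrow> substs \<Delta> \<sigma> \<Gamma> \<Longrightarrow> isty \<Delta> (subst \<sigma> A)"
  using typing_substs by (fastforce simp: isty_def)

lemma typing_subst: "\<Gamma> \<turnstile> a \<Colon> A \<Longrightarrow> substs \<Delta> \<sigma> \<Gamma> \<Longrightarrow> subst \<sigma> A = T \<Longrightarrow> \<Delta> \<turnstile> subst \<sigma> a \<Colon> T"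
  using typing_substs by blast

lemma inh_subst: "\<Gamma> \<Turnstile> A \<Longrightarrow> substs \<Delta> \<sigma> \<Gamma> \<Longrightarrow> subst \<sigma> A = T \<Longrightarrow> \<Delta> \<Turnstile> T"
  unfolding inh_def using typing_substs by blast

lemma substs_cons': "substs \<Delta> \<sigma> \<Gamma> \<Longrightarrow> \<Delta> \<turnstile> a \<Colon> subst \<sigma> A \<Longrightarrow> substs \<Delta> (a \<cdot> \<sigma>) (A # \<Gamma>)"
  by (rule substs_cons) auto

lemma lam_typing: "isty \<Gamma> A \<Longrightarrow> A # \<Gamma> \<turnstile> b \<Colon> B \<Longrightarrow> \<Gamma> \<turnstile> Lam A b \<Colon> Prd A B"
  by (auto simp: isty_def intro: prd_intro)

lemma beta:
  "isty \<Gamma> A \<Longrightarrow> A # \<Gamma> \<turnstile> b \<Colon> B \<Longrightarrow> \<Gamma> \<turnstile> a \<Colon> A \<Longrightarrow> subst (a \<cdot> S 0) b = u \<Longrightarrow> subst (a \<cdot> S 0) B = T \<Longrightarrow>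
   \<Gamma> \<turnstile> App (Lam A b) a \<doteq> u \<Colon> T"
  by (auto simp: isty_def intro: prd_comp')

lemma pair_typing:
  "isty (A # \<Gamma>) B \<Longrightarrow> \<Gamma> \<turnstile> a \<Colon> A \<Longrightarrow> \<Gamma> \<turnstile> b \<Colon> subst (a \<cdot> S 0) B \<Longrightarrow> \<Gamma> \<turnstile> Dpair a b \<Colon> Sig A B"
  by (auto simp: isty_def intro: sig_intro')

lemma refl_typing: "isty \<Gamma> A \<Longrightarrow> \<Gamma> \<turnstile> a \<Colon> A \<Longrightarrow> a = a1 \<Longrightarrow> a = a2 \<Longrightarrow> \<Gamma> \<turnstile> Refl a \<Colon> IdT A a1 a2"
  by (auto simp: isty_def intro: id_intro)

lemma typing_conv: "\<Gamma> \<turnstile> a \<Colon> A \<Longrightarrow> eqty \<Gamma> A B \<Longrightarrow> \<Gamma> \<turnstile> a \<Colon> B"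
  by (auto simp: eqty_def intro: conv)

lemma jeq_conv: "\<Gamma> \<turnstile> a \<doteq> b \<Colon> A \<Longrightarrow> eqty \<Gamma> A B \<Longrightarrow> \<Gamma> \<turnstile> a \<doteq> b \<Colon> B"
  by (auto simp: eqty_def intro: eq_conv)

lemma inh_conv: "\<Gamma> \<Turnstile> A \<Longrightarrow> eqty \<Gamma> A B \<Longrightarrow> \<Gamma> \<Turnstile> B"
  by (auto simp: inh_def intro: typing_conv)

text \<open>
  The loop \<open>(assumption | rule tys, assumption | rule ty | simp)+\<close> is a syntax-directed type checker.
  Since contexts only change by substitutions, \<open>tys\<close> takes the typings of subterms from the
  assumptions and leaves the typing of the substitution to \<open>ty\<close>.
\<close>

named_theorems ty

lemmas tys = isty_subst typing_subst istyI istyI[OF typing_subst]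

lemmas ty_base [ty] = isty_var isty_Prd isty_Sig isty_Coprod isty_Id isty_base substs_S substs_cons' ctx_cons var'
  lam_typing pair_typing refl_typing prd_form sig_form id_form univ_intro

text \<open>Congruence of substitution is obtained by \<open>\<beta>\<close>-expansion, since it is not a primitive rule.\<close>

lemma functionality_tm:
  assumes "A # \<Gamma> \<turnstile> t \<Colon> T" "\<Gamma> \<turnstile> a \<doteq> a' \<Colon> A" "\<Gamma> \<turnstile> a \<Colon> A" "\<Gamma> \<turnstile> a' \<Colon> A" "isty \<Gamma> A" "isty (A # \<Gamma>) T"
  shows "\<Gamma> \<turnstile> subst (a \<cdot> S 0) t \<doteq> subst (a' \<cdot> S 0) t \<Colon> subst (a \<cdot> S 0) T"
proof -
  have 1: "\<Gamma> \<turnstile> App (Lam A t) a \<doteq> App (Lam A t) a' \<Colon> subst (a \<cdot> S 0) T"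
    by (rule prd_elim_eq'[OF _ assms(2) refl]) (rule eq_refl lam_typing assms)+
  have b: "\<Gamma> \<turnstile> App (Lam A t) x \<doteq> subst (x \<cdot> S 0) t \<Colon> subst (x \<cdot> S 0) T" if "\<Gamma> \<turnstile> x \<Colon> A" for x
    by (rule beta) (rule assms that refl)+
  obtain j where j: "A # \<Gamma> \<turnstile> T \<Colon> Univ j" using assms(6) by (auto simp: isty_def)
  have 2: "\<Gamma> \<turnstile> App (Lam A T) a \<doteq> App (Lam A T) a' \<Colon> Univ j"
    by (rule prd_elim_eq'[OF _ assms(2)]) (rule eq_refl lam_typing assms j | simp)+
  have c: "\<Gamma> \<turnstile> App (Lam A T) x \<doteq> subst (x \<cdot> S 0) T \<Colon> Univ j" if "\<Gamma> \<turnstile> x \<Colon> A" for x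
    by (rule beta) (rule assms that refl j | simp)+
  have "eqty \<Gamma> (subst (a' \<cdot> S 0) T) (subst (a \<cdot> S 0) T)"
    using eq_trans[OF eq_sym[OF c[OF assms(4)]] eq_trans[OF eq_sym[OF 2] c[OF assms(3)]]] by (rule eqtyI)
  then show ?thesis
    using eq_trans[OF eq_trans[OF eq_sym[OF b[OF assms(3)]] 1] jeq_conv[OF b[OF assms(4)]]] by blast
qed

lemma functionality:
  assumes "isty (A # \<Gamma>) C" "\<Gamma> \<turnstile> a \<doteq> a' \<Colon> A" "\<Gamma> \<turnstile> a \<Colon> A" "\<Gamma> \<turnstile> a' \<Colon> A" "isty \<Gamma> A"
  shows "eqty \<Gamma> (subst (a \<cdot> S 0) C) (subst (a' \<cdot> S 0) C)"
proof -
  obtain j where j: "A # \<Gamma> \<turnstile> C \<Colon> Univ j" using assms(1) by (auto simp: isty_def)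
  from functionality_tm[OF j assms(2-5) isty_base(1)[OF ctx_cons[OF assms(5)]]]
  show ?thesis by (auto intro: eqtyI)
qed

text \<open>After the first \<beta>-step the term is an abstraction over the instance of
  \<open>B\<close> at \<open>x\<close>, with the substitution lifted once. The curried form is
  needed since \<open>B\<close> depends on the first argument.\<close>

lemma beta2:
  assumes "isty \<Gamma> A" "isty (A # \<Gamma>) B" "B # A # \<Gamma> \<turnstile> C \<Colon> Univ j"
    "\<Gamma> \<turnstile> x \<Colon> A" "\<Gamma> \<turnstile> y \<Colon> subst (x \<cdot> S 0) B"
  shows "\<Gamma> \<turnstile> App (App (Lam A (Lam B C)) x) y \<doteq> subst (y \<cdot> x \<cdot> S 0) C \<Colon> Univ j"
proof -
  have ctx: "ctx \<Gamma>" using assms(4) by (rule typing_ctx)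
  let ?C = "subst (v0 \<cdot> w1 x \<cdot> S 1) C"
  have Bx: "isty \<Gamma> (subst (x \<cdot> S 0) B)"
    by (insert assms ctx, (rule isty_subst ty, assumption | rule ty | simp; fail)+)
  have C': "subst (x \<cdot> S 0) B # \<Gamma> \<turnstile> ?C \<Colon> Univ j"
    by (rule typing_subst[OF assms(3)])
      (insert assms ctx Bx, (assumption | rule typing_subst, assumption | rule ty | simp; fail)+)
  have L: "\<Gamma> \<turnstile> App (Lam A (Lam B C)) x \<doteq> Lam (subst (x \<cdot> S 0) B) ?C \<Colon> Prd (subst (x \<cdot> S 0) B) (Univ j)"
    by (rule beta[where B = "Prd B (Univ j)"]) (insert assms, (assumption | rule lam_typing | simp)+)
  have "\<Gamma> \<turnstile> App (App (Lam A (Lam B C)) x) y \<doteq> App (Lam (subst (x \<cdot> S 0) B) ?C) y \<Colon> Univ j"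
    by (rule prd_elim_eq'[OF L eq_refl[OF assms(5)]]) simp
  moreover have "\<Gamma> \<turnstile> App (Lam (subst (x \<cdot> S 0) B) ?C) y \<doteq> subst (y \<cdot> x \<cdot> S 0) C \<Colon> Univ j"
    by (rule beta[OF Bx C' assms(5)]) simp_all
  ultimately show ?thesis by (rule eq_trans)
qed

lemma functionality2:
  assumes "isty (B # A # \<Gamma>) C" "\<Gamma> \<turnstile> a \<doteq> a' \<Colon> A" "\<Gamma> \<turnstile> a \<Colon> A" "\<Gamma> \<turnstile> a' \<Colon> A"
    "\<Gamma> \<turnstile> b \<doteq> b' \<Colon> subst (a \<cdot> S 0) B" "\<Gamma> \<turnstile> b \<Colon> subst (a \<cdot> S 0) B" "\<Gamma> \<turnstile> b' \<Colon> subst (a' \<cdot> S 0) B"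
    "isty \<Gamma> A" "isty (A # \<Gamma>) B"
  shows "eqty \<Gamma> (subst (b \<cdot> a \<cdot> S 0) C) (subst (b' \<cdot> a' \<cdot> S 0) C)"
proof -
  obtain j where j: "B # A # \<Gamma> \<turnstile> C \<Colon> Univ j" using assms(1) by (auto simp: isty_def)
  let ?F = "Lam A (Lam B C)"
  have F: "\<Gamma> \<turnstile> ?F \<Colon> Prd A (Prd B (Univ j))"
    by (rule lam_typing assms j)+
  have F1: "\<Gamma> \<turnstile> App ?F a \<doteq> App ?F a' \<Colon> Prd (subst (a \<cdot> S 0) B) (Univ j)"
    by (rule prd_elim_eq'[OF eq_refl[OF F] assms(2)]) simp
  have 1: "\<Gamma> \<turnstile> App (App ?F a) b \<doteq> App (App ?F a') b' \<Colon> Univ j"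
    by (rule prd_elim_eq'[OF F1 assms(5)]) simp
  note b = beta2[OF assms(8,9) j]
  show ?thesis
    using eq_trans[OF eq_sym[OF b[OF assms(3,6)]] eq_trans[OF 1 b[OF assms(4,7)]]] by (rule eqtyI)
qed

lemma inh_Prd: "isty \<Gamma> A \<Longrightarrow> A # \<Gamma> \<Turnstile> B \<Longrightarrow> \<Gamma> \<Turnstile> Prd A B"
  by (auto simp: inh_def intro: lam_typing)

lemma inh_App: "\<Gamma> \<Turnstile> Prd A B \<Longrightarrow> \<Gamma> \<turnstile> a \<Colon> A \<Longrightarrow> subst (a \<cdot> S 0) B = T \<Longrightarrow> \<Gamma> \<Turnstile> T"
  by (auto simp: inh_def intro: prd_elim')

lemma inh_wk: "\<Gamma> \<Turnstile> A \<Longrightarrow> isty \<Gamma> B \<Longrightarrow> B # \<Gamma> \<Turnstile> w1 A"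
  by (erule inh_subst) (rule substs_S[where n = "Suc 0"] ctx_cons | simp)+

lemma inh_unPrd: "\<Gamma> \<Turnstile> Prd A B \<Longrightarrow> isty \<Gamma> A \<Longrightarrow> A # \<Gamma> \<Turnstile> B"
  by (drule (1) inh_wk, simp, erule inh_App[where a = v0]) (rule var' ctx_cons | simp)+

lemma Arr_eq: "Arr A B = Prd A (w1 B)"
  unfolding Arr_def wk_subst by simp

lemma Cross_eq: "Cross A B = Sig A (w1 B)"
  unfolding Cross_def wk_subst by simp

text \<open>The argument is an unnamed witness, so the instance of \<open>B\<close> must be the same
  for all of them.\<close>

lemma inh_mp:
  assumes "\<Gamma> \<Turnstile> Prd A B" "\<Gamma> \<Turnstile> A" "\<And>a. subst (a \<cdot> S 0) B = T"
  shows "\<Gamma> \<Turnstile> T"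
proof -
  obtain f a where fa: "\<Gamma> \<turnstile> f \<Colon> Prd A B" "\<Gamma> \<turnstile> a \<Colon> A" using assms(1,2) by (auto simp: inh_def)
  show ?thesis by (rule inhI, rule prd_elim'[OF fa]) (simp add: assms(3))
qed

section \<open>Identity types\<close>

lemma fam_app:
  "\<Gamma> \<turnstile> F \<Colon> Prd A (Prd (IdT (w1 A) (w1 x) v0) (Univ j)) \<Longrightarrow> \<Gamma> \<turnstile> y \<Colon> A \<Longrightarrow> \<Gamma> \<turnstile> q \<Colon> IdT A x y \<Longrightarrow>
   \<Gamma> \<turnstile> App (App F y) q \<Colon> Univ j"
  by (rule prd_elim'[where A = "IdT A x y" and B = "Univ j"], rule prd_elim', assumption+) simp_all

text \<open>The primitive rule leaves both endpoints free. The version with a fixed left endpoint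
  follows by eliminating into a statement about all families F on the paths out of x: an element of
  F at (x, reflexivity) yields one at (y, q). It is then applied to the family
  \<open>C\<close>.\<close>

lemma based_J:
  assumes A: "isty \<Gamma> A" and a: "\<Gamma> \<turnstile> a \<Colon> A" and b: "\<Gamma> \<turnstile> b \<Colon> A" and p: "\<Gamma> \<turnstile> p \<Colon> IdT A a b"
    and C: "isty (IdT (w1 A) (w1 a) v0 # A # \<Gamma>) C"
    and base: "\<Gamma> \<Turnstile> subst (Refl a \<cdot> a \<cdot> S 0) C"
  shows "\<Gamma> \<Turnstile> subst (p \<cdot> b \<cdot> S 0) C"
proof -
  have ctx: "ctx \<Gamma>" using a by (rule typing_ctx)
  obtain j where j: "IdT (w1 A) (w1 a) v0 # A # \<Gamma> \<turnstile> C \<Colon> Univ j" using C by (auto simp: isty_def)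
  let ?F = "\<lambda>A x. Prd A (Prd (IdT (w1 A) (w1 x) v0) (Univ j))"
  \<comment> \<open>In the context \<open>?G\<close> the variables \<open>v2\<close>,
    \<open>v1\<close> and \<open>v0\<close> are x, y and q. Quantifying over F inside the motive is
    what keeps x free.\<close>
  let ?D = "Prd (?F (w3 A) v2) (Prd (App (App v0 v3) (Refl v3)) (App (App v1 v3) v2))"
  let ?G = "IdT (w2 A) v1 v0 # w1 A # A # \<Gamma>"
  let ?f = "Lam A (Lam (IdT (w1 A) (w1 a) v0) C)"
  have F: "isty \<Delta> (?F B x)" if "isty \<Delta> B" "\<Delta> \<turnstile> x \<Colon> B" for \<Delta> B x
    by (insert that isty_ctx[OF that(1)], (assumption | rule isty_subst, assumption | rule typing_subst, assumption | rule ty | rule istyI, assumption | simp)+)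
  have G: "ctx ?G" by (insert A ctx, (assumption | rule isty_subst, assumption | rule typing_subst, assumption | rule ty | rule istyI, assumption | simp)+)
  have 1: "isty (?F (w3 A) v2 # ?G) (App (App v0 v3) (Refl v3))"
    by (rule istyI[of _ _ j], rule fam_app[where x = v3 and A = "w4 A"]) (insert A ctx G, (assumption | rule isty_subst, assumption | rule typing_subst, assumption | rule ty | rule istyI, assumption | simp)+)
  have D: "isty ?G ?D"
    apply (rule isty_Prd)
     apply (rule F; insert A ctx; (assumption | rule isty_subst, assumption | rule typing_subst, assumption | rule ty | rule istyI, assumption | simp)+)
    apply (rule isty_Prd[OF 1])
    apply (rule istyI[of _ _ j], rule fam_app[where x = v4 and A = "w5 A"])
    apply (insert A ctx G ctx_cons[OF 1], (assumption | rule isty_subst, assumption | rule typing_subst, assumption | rule ty | rule istyI, assumption | simp)+)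
    done
  have 2: "isty (?F (w1 A) v0 # A # \<Gamma>) (App (App v0 v1) (Refl v1))"
    by (rule istyI[of _ _ j], rule fam_app[where x = v1 and A = "w2 A"]) (insert A ctx, (assumption | rule isty_subst, assumption | rule typing_subst, assumption | rule ty | rule istyI, assumption | simp)+)
  have c: "A # \<Gamma> \<turnstile> Lam (?F (w1 A) v0) (Lam (App (App v0 v1) (Refl v1)) v0) \<Colon>
      Prd (?F (w1 A) v0) (Prd (App (App v0 v1) (Refl v1)) (App (App v1 v2) (Refl v2)))"
    apply (rule lam_typing)
     apply (insert A ctx 2, (assumption | rule isty_subst, assumption | rule typing_subst, assumption | rule ty | rule istyI, assumption | simp)+)
    done
  obtain k where k: "?G \<turnstile> ?D \<Colon> Univ k" using D by (auto simp: isty_def)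
  have J: "\<Gamma> \<turnstile> IdInd ?D (Lam (?F (w1 A) v0) (Lam (App (App v0 v1) (Refl v1)) v0)) a b p \<Colon>
      Prd (?F A a) (Prd (App (App v0 (w1 a)) (Refl (w1 a))) (App (App v1 (w2 b)) (w2 p)))"
    by (rule id_elim'[OF p a b _ c]) (insert k, simp_all)
  have f: "\<Gamma> \<turnstile> ?f \<Colon> ?F A a" by (insert A ctx a j, (assumption | rule isty_subst, assumption | rule typing_subst, assumption | rule ty | rule istyI, assumption | simp)+)
  note K = prd_elim'[OF J f refl, simplified]
  \<comment> \<open>The abstracted family has to be reduced to \<open>C\<close> at both ends, at (a,
    reflexivity) and at (b, p).\<close>
  have "\<Gamma> \<turnstile> App (App ?f y) q \<doteq> subst (q \<cdot> y \<cdot> S 0) C \<Colon> Univ j" if "\<Gamma> \<turnstile> y \<Colon> A" "\<Gamma> \<turnstile> q \<Colon> IdT A a y" for y q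
    by (rule beta2) (insert that A ctx a j, (assumption | rule isty_subst, assumption | rule typing_subst, assumption | rule ty | rule istyI, assumption | simp)+)
  note E = eqtyI[OF this]
  have "\<Gamma> \<Turnstile> App (App ?f a) (Refl a)"
    using inh_conv[OF base eqty_sym[OF E]] a A refl_typing by blast
  then have "\<Gamma> \<Turnstile> App (App ?f b) p"
    by (rule inh_mp[OF inhI[OF K]]) simp
  then show ?thesis using E[OF b p] by (rule inh_conv)
qed

lemma based_J':
  assumes "\<Gamma> \<turnstile> p \<Colon> IdT A a b" "subst (p \<cdot> b \<cdot> S 0) C = T" "isty \<Gamma> A" "\<Gamma> \<turnstile> a \<Colon> A" "\<Gamma> \<turnstile> b \<Colon> A"
    "isty (IdT (w1 A) (w1 a) v0 # A # \<Gamma>) C" "\<Gamma> \<Turnstile> subst (Refl a \<cdot> a \<cdot> S 0) C"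
  shows "\<Gamma> \<Turnstile> T"
  using based_J[of \<Gamma> A a b p C] assms by blast

lemma transport:
  assumes "\<Gamma> \<Turnstile> IdT A a b" "isty \<Gamma> A" "\<Gamma> \<turnstile> a \<Colon> A" "\<Gamma> \<turnstile> b \<Colon> A" "isty (A # \<Gamma>) C" "\<Gamma> \<Turnstile> subst (a \<cdot> S 0) C"
  shows "\<Gamma> \<Turnstile> subst (b \<cdot> S 0) C"
proof -
  obtain p where p: "\<Gamma> \<turnstile> p \<Colon> IdT A a b" using assms(1) by (auto simp: inh_def)
  show ?thesis
    by (rule based_J'[OF p, where C = "w1 C"])
      (insert assms typing_ctx[OF p], (assumption | rule isty_subst, assumption | rule typing_subst, assumption | rule ty | rule istyI, assumption | simp)+)
qed

lemma transport':
  assumes "\<Gamma> \<Turnstile> IdT A a b" "subst (a \<cdot> S 0) C = T1" "subst (b \<cdot> S 0) C = T2" "\<Gamma> \<Turnstile> T1"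
    "isty \<Gamma> A" "\<Gamma> \<turnstile> a \<Colon> A" "\<Gamma> \<turnstile> b \<Colon> A" "isty (A # \<Gamma>) C"
  shows "\<Gamma> \<Turnstile> T2"
  using transport assms by blast

lemma id_refl: "isty \<Gamma> A \<Longrightarrow> \<Gamma> \<turnstile> a \<Colon> A \<Longrightarrow> \<Gamma> \<Turnstile> IdT A a a"
  by (rule inhI) (rule refl_typing refl | assumption)+

lemma id_sym:
  assumes "\<Gamma> \<Turnstile> IdT A a b" "isty \<Gamma> A" "\<Gamma> \<turnstile> a \<Colon> A" "\<Gamma> \<turnstile> b \<Colon> A"
  shows "\<Gamma> \<Turnstile> IdT A b a"
  by (rule transport'[OF assms(1), where C = "IdT (w1 A) v0 (w1 a)"])
    (insert assms typing_ctx[OF assms(3)] id_refl[OF assms(2,3)], (assumption | rule isty_subst, assumption | rule typing_subst, assumption | rule ty | rule istyI, assumption | simp)+)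

lemma id_trans:
  assumes "\<Gamma> \<Turnstile> IdT A a b" "\<Gamma> \<Turnstile> IdT A b c" "isty \<Gamma> A" "\<Gamma> \<turnstile> a \<Colon> A" "\<Gamma> \<turnstile> b \<Colon> A" "\<Gamma> \<turnstile> c \<Colon> A"
  shows "\<Gamma> \<Turnstile> IdT A a c"
  by (rule transport'[OF assms(2), where C = "IdT (w1 A) (w1 a) v0"])
    (insert assms typing_ctx[OF assms(4)], (assumption | rule isty_subst, assumption | rule typing_subst, assumption | rule ty | rule istyI, assumption | simp)+)

lemma id_ap:
  assumes "\<Gamma> \<Turnstile> IdT A a b" "isty \<Gamma> A" "\<Gamma> \<turnstile> a \<Colon> A" "\<Gamma> \<turnstile> b \<Colon> A" "isty \<Gamma> B" "A # \<Gamma> \<turnstile> f \<Colon> w1 B"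
  shows "\<Gamma> \<Turnstile> IdT B (subst (a \<cdot> S 0) f) (subst (b \<cdot> S 0) f)"
proof -
  have fa: "\<Gamma> \<turnstile> subst (x \<cdot> S 0) f \<Colon> B" if "\<Gamma> \<turnstile> x \<Colon> A" for x
    by (rule typing_subst[OF assms(6)]) (insert assms that typing_ctx[OF that], (assumption | rule isty_subst, assumption | rule typing_subst, assumption | rule ty | rule istyI, assumption | simp)+)
  show ?thesis
    by (rule transport'[OF assms(1), where C = "IdT (w1 B) (subst (w1 a \<cdot> S 1) f) f"])
      (insert assms typing_ctx[OF assms(3)] fa[OF assms(3)] id_refl[OF assms(5) fa[OF assms(3)]], (assumption | rule isty_subst, assumption | rule typing_subst, assumption | rule ty | rule istyI, assumption | simp)+)
qed

lemma eqty_Id: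
  assumes "isty \<Gamma> A" "\<Gamma> \<turnstile> a \<doteq> a' \<Colon> A" "\<Gamma> \<turnstile> b \<doteq> b' \<Colon> A"
  shows "eqty \<Gamma> (IdT A a b) (IdT A a' b')"
  using assms unfolding isty_def eqty_def by (meson eq_refl id_form_eq)

lemma id_jeq: "isty \<Gamma> A \<Longrightarrow> \<Gamma> \<turnstile> a \<Colon> A \<Longrightarrow> \<Gamma> \<turnstile> a \<doteq> b \<Colon> A \<Longrightarrow> \<Gamma> \<Turnstile> IdT A a b"
  by (rule inh_conv[OF id_refl eqty_Id]) (auto intro: eq_refl)

text \<open>Transport as a term, for its computation on reflexivity.\<close>

definition Tr :: "tm \<Rightarrow> tm \<Rightarrow> tm \<Rightarrow> tm \<Rightarrow> tm \<Rightarrow> tm" where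
  "Tr P a b p u =
     App (IdInd (Prd (subst (v2 \<cdot> s3) P) (subst (v2 \<cdot> s4) P)) (Lam P v0) a b p) u"

lemma subst_Tr [simp]:
  "subst \<sigma> (Tr P a b p u) =
   Tr (subst (v0 \<cdot> (\<sigma> \<Zsemi> s1)) P) (subst \<sigma> a) (subst \<sigma> b) (subst \<sigma> p) (subst \<sigma> u)"
  by (simp add: Tr_def)

lemma Tr_fun:
  assumes "isty \<Gamma> A" "isty (A # \<Gamma>) P" "\<Gamma> \<turnstile> a \<Colon> A"
  shows "isty (IdT (w2 A) v1 v0 # w1 A # A # \<Gamma>) (Prd (subst (v2 \<cdot> s3) P) (subst (v2 \<cdot> s4) P))"
    "A # \<Gamma> \<turnstile> Lam P v0 \<Colon> Prd P (w1 P)"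
  by (insert assms typing_ctx[OF assms(3)], (assumption | rule isty_subst, assumption | rule typing_subst, assumption | rule ty | rule istyI, assumption | simp)+)

lemma Tr_typing:
  assumes "isty \<Gamma> A" "isty (A # \<Gamma>) P" "\<Gamma> \<turnstile> a \<Colon> A" "\<Gamma> \<turnstile> b \<Colon> A" "\<Gamma> \<turnstile> p \<Colon> IdT A a b"
    "\<Gamma> \<turnstile> u \<Colon> subst (a \<cdot> S 0) P"
  shows "\<Gamma> \<turnstile> Tr P a b p u \<Colon> subst (b \<cdot> S 0) P"
proof -
  obtain j where j: "IdT (w2 A) v1 v0 # w1 A # A # \<Gamma> \<turnstile> Prd (subst (v2 \<cdot> s3) P) (subst (v2 \<cdot> s4) P) \<Colon> Univ j"
    using Tr_fun(1)[OF assms(1-3)] by (auto simp: isty_def)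
  have "\<Gamma> \<turnstile> IdInd (Prd (subst (v2 \<cdot> s3) P) (subst (v2 \<cdot> s4) P)) (Lam P v0) a b p \<Colon>
      Prd (subst (a \<cdot> S 0) P) (subst (w1 b \<cdot> s1) P)"
    by (rule id_elim'[OF assms(5,3,4) _ Tr_fun(2)[OF assms(1-3)]]) (insert j, simp_all)
  then show ?thesis unfolding Tr_def by (rule prd_elim'[OF _ assms(6)]) simp
qed

lemma Tr_refl:
  assumes "isty \<Gamma> A" "isty (A # \<Gamma>) P" "\<Gamma> \<turnstile> a \<Colon> A" "\<Gamma> \<turnstile> u \<Colon> subst (a \<cdot> S 0) P"
  shows "\<Gamma> \<turnstile> Tr P a a (Refl a) u \<doteq> u \<Colon> subst (a \<cdot> S 0) P"
proof -
  obtain j where j: "IdT (w2 A) v1 v0 # w1 A # A # \<Gamma> \<turnstile> Prd (subst (v2 \<cdot> s3) P) (subst (v2 \<cdot> s4) P) \<Colon> Univ j"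
    using Tr_fun(1)[OF assms(1-3)] by (auto simp: isty_def)
  have 1: "\<Gamma> \<turnstile> IdInd (Prd (subst (v2 \<cdot> s3) P) (subst (v2 \<cdot> s4) P)) (Lam P v0) a a (Refl a) \<doteq>
      Lam (subst (a \<cdot> S 0) P) v0 \<Colon> Prd (subst (a \<cdot> S 0) P) (subst (w1 a \<cdot> s1) P)"
    by (rule id_comp'[OF assms(3) _ Tr_fun(2)[OF assms(1-3)]]) (insert j, simp_all)
  have 2: "\<Gamma> \<turnstile> App (Lam (subst (a \<cdot> S 0) P) v0) u \<doteq> u \<Colon> subst (a \<cdot> S 0) P"
    by (rule beta[where B = "subst (w1 a \<cdot> s1) P"]) (insert assms typing_ctx[OF assms(3)], (assumption | rule isty_subst, assumption | rule typing_subst, assumption | rule ty | rule istyI, assumption | simp)+)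
  have "\<Gamma> \<turnstile> Tr P a a (Refl a) u \<doteq> App (Lam (subst (a \<cdot> S 0) P) v0) u \<Colon> subst (a \<cdot> S 0) P"
    unfolding Tr_def by (rule prd_elim_eq'[OF 1 eq_refl[OF assms(4)]]) simp
  then show ?thesis using 2 by (rule eq_trans)
qed

section \<open>Dependent sums\<close>

definition Fst :: "tm \<Rightarrow> tm \<Rightarrow> tm" where
  "Fst A p = SigInd (w1 A) v1 p"

definition Snd :: "tm \<Rightarrow> tm \<Rightarrow> tm \<Rightarrow> tm" where
  "Snd A B p = SigInd (subst (Fst (w1 A) v0 \<cdot> s1) B) v0 p"

lemma subst_Fst [simp]: "subst \<sigma> (Fst A p) = Fst (subst \<sigma> A) (subst \<sigma> p)"
  by (simp add: Fst_def)

lemma subst_Snd [simp]: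
  "subst \<sigma> (Snd A B p) = Snd (subst \<sigma> A) (subst (v0 \<cdot> (\<sigma> \<Zsemi> s1)) B) (subst \<sigma> p)"
  by (simp add: Snd_def)

lemma Fst_typing:
  assumes "isty \<Gamma> A" "isty (A # \<Gamma>) B" "\<Gamma> \<turnstile> p \<Colon> Sig A B"
  shows "\<Gamma> \<turnstile> Fst A p \<Colon> A"
proof -
  have "isty (Sig A B # \<Gamma>) (w1 A)"
    by (insert assms typing_ctx[OF assms(3)], (assumption | rule tys, assumption | rule ty | simp)+)
  then obtain j where j: "Sig A B # \<Gamma> \<turnstile> w1 A \<Colon> Univ j" by (auto simp: isty_def)
  show ?thesis unfolding Fst_def
    by (rule sig_elim'[OF j _ assms(3), of _ "w2 A"])
      (insert assms typing_ctx[OF assms(3)], (assumption | rule tys, assumption | rule ty | simp)+)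
qed

lemma Fst_pair:
  assumes "isty \<Gamma> A" "isty (A # \<Gamma>) B" "\<Gamma> \<turnstile> a \<Colon> A" "\<Gamma> \<turnstile> b \<Colon> subst (a \<cdot> S 0) B"
  shows "\<Gamma> \<turnstile> Fst A (Dpair a b) \<doteq> a \<Colon> A"
proof -
  have "isty (Sig A B # \<Gamma>) (w1 A)"
    by (insert assms typing_ctx[OF assms(3)], (assumption | rule tys, assumption | rule ty | simp)+)
  then obtain j where j: "Sig A B # \<Gamma> \<turnstile> w1 A \<Colon> Univ j" by (auto simp: isty_def)
  show ?thesis unfolding Fst_def
    by (rule sig_comp'[OF j _ assms(3,4), of _ "w2 A"])
      (insert assms typing_ctx[OF assms(3)], (assumption | rule tys, assumption | rule ty | simp)+)
qed

text \<open>The branch \<open>v0\<close> has type \<open>B\<close> at \<open>v1\<close>, while the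
  motive asks for \<open>B\<close> at the first projection of a pair; \<open>Fst_pair\<close> and
  congruence of substitution bridge the difference.\<close>

lemma Snd_motive:
  assumes "isty \<Gamma> A" "isty (A # \<Gamma>) B"
  shows "isty (Sig A B # \<Gamma>) (subst (Fst (w1 A) v0 \<cdot> s1) B)"
    "B # A # \<Gamma> \<turnstile> v0 \<Colon> subst (Dpair v1 v0 \<cdot> S 2) (subst (Fst (w1 A) v0 \<cdot> s1) B)"
proof -
  have ctx: "ctx \<Gamma>" using assms(1) by (rule isty_ctx)
  have S: "isty \<Gamma> (Sig A B)" by (insert assms, (assumption | rule tys, assumption | rule ty | simp)+)
  have v: "Sig A B # \<Gamma> \<turnstile> Fst (w1 A) v0 \<Colon> w1 A"
    by (rule Fst_typing[where B = "subst (v0 \<cdot> s2) B"]) (insert S assms ctx, (assumption | rule tys, assumption | rule ty | simp)+)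
  show "isty (Sig A B # \<Gamma>) (subst (Fst (w1 A) v0 \<cdot> s1) B)"
    by (insert assms ctx S v, (assumption | rule tys, assumption | rule ty | simp)+)
  have p: "B # A # \<Gamma> \<turnstile> Dpair v1 v0 \<Colon> Sig (w2 A) (subst (v0 \<cdot> s3) B)"
    by (insert assms ctx, (assumption | rule tys, assumption | rule ty | simp)+)
  have f: "B # A # \<Gamma> \<turnstile> Fst (w2 A) (Dpair v1 v0) \<Colon> w2 A"
    by (rule Fst_typing[OF _ _ p]) (insert assms ctx, (assumption | rule tys, assumption | rule ty | simp)+)
  have e: "B # A # \<Gamma> \<turnstile> Fst (w2 A) (Dpair v1 v0) \<doteq> v1 \<Colon> w2 A"
    by (rule Fst_pair[where B = "subst (v0 \<cdot> s3) B"]) (insert assms ctx, (assumption | rule tys, assumption | rule ty | simp)+)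
  have "eqty (B # A # \<Gamma>) (subst (v1 \<cdot> s0) (subst (v0 \<cdot> s3) B))
      (subst (Fst (w2 A) (Dpair v1 v0) \<cdot> s0) (subst (v0 \<cdot> s3) B))"
    by (rule functionality[OF _ eq_sym[OF e] _ f]) (insert assms ctx, (assumption | rule tys, assumption | rule ty | simp)+)
  moreover have "B # A # \<Gamma> \<turnstile> v0 \<Colon> subst (v1 \<cdot> s0) (subst (v0 \<cdot> s3) B)"
    by (insert assms ctx, (assumption | rule tys, assumption | rule ty | simp)+)
  ultimately show "B # A # \<Gamma> \<turnstile> v0 \<Colon> subst (Dpair v1 v0 \<cdot> S 2) (subst (Fst (w1 A) v0 \<cdot> s1) B)"
    using typing_conv by fastforce
qed

lemma Snd_typing:
  assumes "isty \<Gamma> A" "isty (A # \<Gamma>) B" "\<Gamma> \<turnstile> p \<Colon> Sig A B"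
  shows "\<Gamma> \<turnstile> Snd A B p \<Colon> subst (Fst A p \<cdot> S 0) B"
proof -
  obtain j where j: "Sig A B # \<Gamma> \<turnstile> subst (Fst (w1 A) v0 \<cdot> s1) B \<Colon> Univ j"
    using Snd_motive[OF assms(1,2)] by (auto simp: isty_def)
  show ?thesis unfolding Snd_def
    by (rule sig_elim'[OF j Snd_motive(2)[OF assms(1,2)] assms(3)]) simp_all
qed

lemma Snd_pair:
  assumes "isty \<Gamma> A" "isty (A # \<Gamma>) B" "\<Gamma> \<turnstile> a \<Colon> A" "\<Gamma> \<turnstile> b \<Colon> subst (a \<cdot> S 0) B"
  shows "\<Gamma> \<turnstile> Snd A B (Dpair a b) \<doteq> b \<Colon> subst (a \<cdot> S 0) B"
proof -
  obtain j where j: "Sig A B # \<Gamma> \<turnstile> subst (Fst (w1 A) v0 \<cdot> s1) B \<Colon> Univ j"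
    using Snd_motive[OF assms(1,2)] by (auto simp: isty_def)
  have p: "\<Gamma> \<turnstile> Dpair a b \<Colon> Sig A B" by (insert assms, (assumption | rule tys, assumption | rule ty | simp)+)
  have "\<Gamma> \<turnstile> Snd A B (Dpair a b) \<doteq> b \<Colon> subst (Fst A (Dpair a b) \<cdot> s0) B" unfolding Snd_def
    by (rule sig_comp'[OF j Snd_motive(2)[OF assms(1,2)] assms(3,4)]) simp_all
  moreover have "eqty \<Gamma> (subst (Fst A (Dpair a b) \<cdot> s0) B) (subst (a \<cdot> s0) B)"
    by (rule functionality[OF assms(2) Fst_pair[OF assms] Fst_typing[OF assms(1,2) p] assms(3,1)])
  ultimately show ?thesis by (rule jeq_conv)
qed

lemma inh_sigE:
  assumes "\<Gamma> \<Turnstile> Sig A B" "isty \<Gamma> A" "isty (A # \<Gamma>) B"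
  obtains a where "\<Gamma> \<turnstile> a \<Colon> A" "\<Gamma> \<Turnstile> subst (a \<cdot> S 0) B"
  using assms Fst_typing Snd_typing unfolding inh_def by blast

lemma inh_pair: "isty (A # \<Gamma>) B \<Longrightarrow> \<Gamma> \<turnstile> a \<Colon> A \<Longrightarrow> \<Gamma> \<Turnstile> subst (a \<cdot> S 0) B \<Longrightarrow> \<Gamma> \<Turnstile> Sig A B"
  unfolding inh_def using pair_typing by blast

lemma inh_sig_ind:
  assumes "\<Gamma> \<turnstile> p \<Colon> Sig A B" "subst (p \<cdot> S 0) C = T" "isty (Sig A B # \<Gamma>) C"
    "B # A # \<Gamma> \<Turnstile> subst (Dpair v1 v0 \<cdot> s2) C"
  shows "\<Gamma> \<Turnstile> T"
proof -
  obtain j where j: "Sig A B # \<Gamma> \<turnstile> C \<Colon> Univ j" using assms(3) by (auto simp: isty_def)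
  from assms(4) obtain g where "B # A # \<Gamma> \<turnstile> g \<Colon> subst (Dpair v1 v0 \<cdot> s2) C" by (auto simp: inh_def)
  then show ?thesis using assms(2) by (intro inhI[OF sig_elim'[OF j _ assms(1)]]) simp_all
qed

text \<open>Pairs have no judgmental \<eta>-rule, so a statement about a variable of a sum type is
  reduced to pairs of variables by elimination.\<close>

lemma inh_sig_ctx:
  assumes "isty \<Gamma> A" "isty (A # \<Gamma>) B" "isty (Sig A B # \<Gamma>) C"
    "B # A # \<Gamma> \<Turnstile> subst (Dpair v1 v0 \<cdot> s2) C"
  shows "Sig A B # \<Gamma> \<Turnstile> C"
proof -
  have ctx: "ctx \<Gamma>" using assms(1) by (rule isty_ctx)
  have S: "isty \<Gamma> (Sig A B)" by (insert assms, (assumption | rule tys, assumption | rule ty | simp)+)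
  show ?thesis
    apply (rule inh_sig_ind[where p = v0 and A = "w1 A" and B = "subst (v0 \<cdot> s2) B" and C = "subst (v0 \<cdot> s2) C"])
    apply (insert S assms ctx)
    apply ((assumption | rule tys, assumption | rule ty | simp)+)[1]
    apply simp
    apply ((assumption | rule tys, assumption | rule ty | simp)+)[1]
    apply (rule inh_subst[OF assms(4), where \<sigma> = "v0 \<cdot> v1 \<cdot> s3"])
    apply (assumption | rule tys, assumption | rule ty | simp)+
    done
qed

section \<open>Equivalences and univalence\<close>

declare Arr_eq [simp]

abbreviation arr :: "tm \<Rightarrow> tm \<Rightarrow> tm" where "arr A B \<equiv> Prd A (w1 B)"

lemma Isequiv_eq: "Isequiv A B f =
    Sig (Sig (arr B A) (Prd (w1 B) (IdT (w2 B) (App (w2 f) (App v1 v0)) v0)))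
      (w1 (Sig (arr B A) (Prd (w1 A) (IdT (w2 A) (App v1 (App (w2 f) v0)) v0))))"
  unfolding Isequiv_def Cross_eq wk_subst by simp

lemma Equiv_eq: "Equiv A B = Sig (arr A B) (Isequiv (w1 A) (w1 B) v0)"
  unfolding Equiv_def wk_subst by simp

lemma app_typing:
  "\<Gamma> \<turnstile> f \<Colon> Prd A B \<Longrightarrow> \<Gamma> \<turnstile> a \<Colon> A \<Longrightarrow> subst (a \<cdot> S 0) B = T \<Longrightarrow> \<Gamma> \<turnstile> App f a \<Colon> T"
  using prd_elim' by blast

lemma arr_app: "\<Gamma> \<turnstile> f \<Colon> arr A B \<Longrightarrow> \<Gamma> \<turnstile> a \<Colon> A \<Longrightarrow> \<Gamma> \<turnstile> App f a \<Colon> B"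
  by (rule app_typing, assumption+) simp

lemma Isequiv_parts:
  assumes A: "\<Gamma> \<turnstile> A \<Colon> Univ i" and B: "\<Gamma> \<turnstile> B \<Colon> Univ i" and f: "\<Gamma> \<turnstile> f \<Colon> arr A B"
  shows "arr B A # \<Gamma> \<turnstile> Prd (w1 B) (IdT (w2 B) (App (w2 f) (App v1 v0)) v0) \<Colon> Univ i"
    "arr B A # \<Gamma> \<turnstile> Prd (w1 A) (IdT (w2 A) (App v1 (App (w2 f) v0)) v0) \<Colon> Univ i"
proof -
  have ctx: "ctx \<Gamma>" using f by (rule typing_ctx)
  have 1: "w1 B # arr B A # \<Gamma> \<turnstile> App (w2 f) (App v1 v0) \<Colon> w2 B"
    by (rule arr_app[where A = "w2 A"], insert A B f ctx, (assumption | rule tys, assumption | rule ty | simp)+, rule arr_app[where A = "w2 B"], (assumption | rule tys, assumption | rule ty | simp)+)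
  have 2: "w1 A # arr B A # \<Gamma> \<turnstile> App v1 (App (w2 f) v0) \<Colon> w2 A"
    by (rule arr_app[where A = "w2 B"], insert A B f ctx, (assumption | rule tys, assumption | rule ty | simp)+, rule arr_app[where A = "w2 A"], (assumption | rule tys, assumption | rule ty | simp)+)
  show "arr B A # \<Gamma> \<turnstile> Prd (w1 B) (IdT (w2 B) (App (w2 f) (App v1 v0)) v0) \<Colon> Univ i"
    "arr B A # \<Gamma> \<turnstile> Prd (w1 A) (IdT (w2 A) (App v1 (App (w2 f) v0)) v0) \<Colon> Univ i"
    by (insert 1 2 A B f ctx, (assumption | rule tys, assumption | rule ty | simp)+)
qed

lemma Isequiv_form:
  assumes "\<Gamma> \<turnstile> A \<Colon> Univ i" "\<Gamma> \<turnstile> B \<Colon> Univ i" "\<Gamma> \<turnstile> f \<Colon> arr A B"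
  shows "\<Gamma> \<turnstile> Isequiv A B f \<Colon> Univ i"
proof -
  let ?S = "Sig (arr B A) (Prd (w1 B) (IdT (w2 B) (App (w2 f) (App v1 v0)) v0))"
  let ?T = "Sig (arr B A) (Prd (w1 A) (IdT (w2 A) (App v1 (App (w2 f) v0)) v0))"
  note P = Isequiv_parts[OF assms]
  have ctx: "ctx \<Gamma>" using assms(1) by (rule typing_ctx)
  have arr: "\<Gamma> \<turnstile> arr B A \<Colon> Univ i" by (insert assms ctx, (assumption | rule tys, assumption | rule ty | simp)+)
  have S: "\<Gamma> \<turnstile> ?S \<Colon> Univ i" and T: "\<Gamma> \<turnstile> ?T \<Colon> Univ i"
    by (rule sig_form[OF arr P(1)], rule sig_form[OF arr P(2)])
  have "?S # \<Gamma> \<turnstile> w1 ?T \<Colon> Univ i"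
    by (rule typing_subst[OF T]) (rule substs_S ctx_ext[OF S] | simp)+
  with S show ?thesis unfolding Isequiv_eq by (rule sig_form)
qed

lemma Equiv_form:
  assumes "\<Gamma> \<turnstile> A \<Colon> Univ i" "\<Gamma> \<turnstile> B \<Colon> Univ i"
  shows "\<Gamma> \<turnstile> Equiv A B \<Colon> Univ i"
  unfolding Equiv_eq
  by (insert assms typing_ctx[OF assms(1)], rule sig_form, (assumption | rule tys, assumption | rule ty | simp)+, rule Isequiv_form, (assumption | rule tys, assumption | rule ty | simp)+)

text \<open>The right inverse is the only part of an \<open>Isequiv\<close> that is ever extracted:
  applied to univalence it gives a preimage under \<open>idtoeqv\<close> of every
  equivalence.\<close>

lemma Isequiv_section:
  assumes "\<Gamma> \<turnstile> A \<Colon> Univ i" "\<Gamma> \<turnstile> B \<Colon> Univ i" "\<Gamma> \<turnstile> f \<Colon> arr A B" "\<Gamma> \<Turnstile> Isequiv A B f"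
  obtains g where "\<Gamma> \<turnstile> g \<Colon> arr B A" "\<Gamma> \<Turnstile> Prd B (IdT (w1 B) (App (w1 f) (App (w1 g) v0)) v0)"
proof -
  let ?S = "Sig (arr B A) (Prd (w1 B) (IdT (w2 B) (App (w2 f) (App v1 v0)) v0))"
  let ?T = "Sig (arr B A) (Prd (w1 A) (IdT (w2 A) (App v1 (App (w2 f) v0)) v0))"
  note P = Isequiv_parts[OF assms(1-3)]
  have ctx: "ctx \<Gamma>" using assms(1) by (rule typing_ctx)
  have arr: "\<Gamma> \<turnstile> arr B A \<Colon> Univ i" by (insert assms ctx, (assumption | rule tys, assumption | rule ty | simp)+)
  have S: "\<Gamma> \<turnstile> ?S \<Colon> Univ i" and T: "\<Gamma> \<turnstile> ?T \<Colon> Univ i"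
    by (rule sig_form[OF arr P(1)], rule sig_form[OF arr P(2)])
  have T': "?S # \<Gamma> \<turnstile> w1 ?T \<Colon> Univ i"
    by (rule typing_subst[OF T]) (rule substs_S ctx_ext[OF S] | simp)+
  have "\<Gamma> \<Turnstile> ?S"
    using assms(4)[unfolded Isequiv_eq] by (rule inh_sigE) (rule istyI S T' inhI | assumption)+
  then show thesis
    by (rule inh_sigE) (rule istyI arr P(1) | rule that, simp, simp)+
qed

text \<open>With open terms instead of functions the composites are substitutions; \<beta> relates
  them to the nested applications in \<open>Isequiv\<close>.\<close>

lemma Isequiv_Lam:
  assumes A: "\<Gamma> \<turnstile> A \<Colon> Univ i" and B: "\<Gamma> \<turnstile> B \<Colon> Univ i"
    and f: "A # \<Gamma> \<turnstile> f \<Colon> w1 B" and g: "B # \<Gamma> \<turnstile> g \<Colon> w1 A" and h: "B # \<Gamma> \<turnstile> h \<Colon> w1 A"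
    and fg: "B # \<Gamma> \<Turnstile> IdT (w1 B) (subst (g \<cdot> s1) f) v0"
    and hf: "A # \<Gamma> \<Turnstile> IdT (w1 A) (subst (f \<cdot> s1) h) v0"
  shows "\<Gamma> \<Turnstile> Isequiv A B (Lam A f)"
proof -
  have ctx: "ctx \<Gamma>" using A by (rule typing_ctx)
  have lf: "\<Gamma> \<turnstile> Lam A f \<Colon> arr A B" and lg: "\<Gamma> \<turnstile> Lam B g \<Colon> arr B A" and lh: "\<Gamma> \<turnstile> Lam B h \<Colon> arr B A"
    by (insert A B f g h ctx, (assumption | rule tys, assumption | rule ty | simp)+)
  note P = Isequiv_parts[OF A B lf]
  \<comment> \<open>Used for both composites, the second time with \<open>A\<close> and
    \<open>B\<close> exchanged.\<close>
  have comp: "B # \<Gamma> \<Turnstile> IdT (w1 B) (App (w1 (Lam A f)) (App (w1 (Lam B g)) v0)) v0"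
    if A: "\<Gamma> \<turnstile> A \<Colon> Univ i" and B: "\<Gamma> \<turnstile> B \<Colon> Univ i"
    and f: "A # \<Gamma> \<turnstile> f \<Colon> w1 B" and g: "B # \<Gamma> \<turnstile> g \<Colon> w1 A"
    and fg: "B # \<Gamma> \<Turnstile> IdT (w1 B) (subst (g \<cdot> s1) f) v0" for A B f g
  proof (rule inh_conv[OF fg eqty_sym[OF eqty_Id]])
    have b: "B # \<Gamma> \<turnstile> App (w1 (Lam B g)) v0 \<doteq> g \<Colon> w1 A"
      by (simp, rule beta) (insert A B f g ctx, (assumption | rule tys, assumption | rule ty | simp)+)
    have c: "B # \<Gamma> \<turnstile> App (w1 (Lam A f)) g \<doteq> subst (g \<cdot> s1) f \<Colon> w1 B"
      by (simp, rule beta) (insert A B f g ctx, (assumption | rule tys, assumption | rule ty | simp)+)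
    have d: "B # \<Gamma> \<turnstile> w1 (Lam A f) \<Colon> arr (w1 A) (w1 B)"
      by (insert A B f g ctx, (assumption | rule tys, assumption | rule ty | simp)+)
    have "B # \<Gamma> \<turnstile> App (w1 (Lam A f)) (App (w1 (Lam B g)) v0) \<doteq> App (w1 (Lam A f)) g \<Colon> w1 B"
      by (rule prd_elim_eq'[OF eq_refl[OF d] b]) simp
    then show "B # \<Gamma> \<turnstile> App (w1 (Lam A f)) (App (w1 (Lam B g)) v0) \<doteq> subst (g \<cdot> s1) f \<Colon> w1 B"
      using c by (rule eq_trans)
    show "isty (B # \<Gamma>) (w1 B)" "B # \<Gamma> \<turnstile> v0 \<doteq> v0 \<Colon> w1 B"
      by (rule isty_subst[OF istyI[OF B]] eq_refl, insert B ctx, (assumption | rule tys, assumption | rule ty | simp)+)+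
  qed
  have "\<Gamma> \<Turnstile> Prd B (IdT (w1 B) (App (w1 (Lam A f)) (App (w1 (Lam B g)) v0)) v0)"
    by (rule inh_Prd[OF istyI[OF B] comp[OF A B f g fg]])
  then have 1: "\<Gamma> \<Turnstile> Sig (arr B A) (Prd (w1 B) (IdT (w2 B) (App (w2 (Lam A f)) (App v1 v0)) v0))"
    by (intro inh_pair[OF istyI[OF P(1)] lg]) simp
  have "\<Gamma> \<Turnstile> Prd A (IdT (w1 A) (App (w1 (Lam B h)) (App (w1 (Lam A f)) v0)) v0)"
    by (rule inh_Prd[OF istyI[OF A] comp[OF B A h f hf]])
  then have 2: "\<Gamma> \<Turnstile> Sig (arr B A) (Prd (w1 A) (IdT (w2 A) (App v1 (App (w2 (Lam A f)) v0)) v0))"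
    by (intro inh_pair[OF istyI[OF P(2)] lh]) simp
  let ?S = "Sig (arr B A) (Prd (w1 B) (IdT (w2 B) (App (w2 (Lam A f)) (App v1 v0)) v0))"
  let ?T = "Sig (arr B A) (Prd (w1 A) (IdT (w2 A) (App v1 (App (w2 (Lam A f)) v0)) v0))"
  have arr: "\<Gamma> \<turnstile> arr B A \<Colon> Univ i" by (insert A B ctx, (assumption | rule tys, assumption | rule ty | simp)+)
  have S: "\<Gamma> \<turnstile> ?S \<Colon> Univ i" and T: "\<Gamma> \<turnstile> ?T \<Colon> Univ i"
    by (rule sig_form[OF arr P(1)], rule sig_form[OF arr P(2)])
  have "isty (?S # \<Gamma>) (w1 ?T)"
    by (rule isty_subst[OF istyI[OF T]]) (rule substs_S ctx_ext[OF S] | simp)+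
  then have "\<Gamma> \<turnstile> Dpair t u \<Colon> Sig ?S (w1 ?T)" if "\<Gamma> \<turnstile> t \<Colon> ?S" "\<Gamma> \<turnstile> u \<Colon> ?T" for t u
    by (rule pair_typing[OF _ that(1)]) (insert that(2), simp)
  with 1 2 show ?thesis unfolding Isequiv_eq inh_def by blast
qed

lemma id_equiv_eq: "id_equiv A =
    Dpair (Lam A v0) (Dpair (Dpair (Lam A v0) (Lam A (Refl v0))) (Dpair (Lam A v0) (Lam A (Refl v0))))"
  by (simp add: id_equiv_def Let_def)

lemma id_equiv_typing:
  assumes A: "\<Gamma> \<turnstile> A \<Colon> Univ i"
  shows "\<Gamma> \<turnstile> Dpair (Dpair (Lam A v0) (Lam A (Refl v0))) (Dpair (Lam A v0) (Lam A (Refl v0))) \<Colon>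
      Isequiv A A (Lam A v0)"
    "\<Gamma> \<turnstile> id_equiv A \<Colon> Equiv A A"
proof -
  have ctx: "ctx \<Gamma>" using A by (rule typing_ctx)
  have i: "\<Gamma> \<turnstile> Lam A v0 \<Colon> arr A A" by (insert A ctx, (assumption | rule tys, assumption | rule ty | simp)+)
  note P = Isequiv_parts[OF A A i]
  have A1: "isty (A # \<Gamma>) (w1 A)" and v: "A # \<Gamma> \<turnstile> v0 \<Colon> w1 A" by (insert A ctx, (assumption | rule tys, assumption | rule ty | simp)+)
  have i1: "A # \<Gamma> \<turnstile> Lam (w1 A) v0 \<Colon> arr (w1 A) (w1 A)" by (insert A ctx, (assumption | rule tys, assumption | rule ty | simp)+)
  have b: "A # \<Gamma> \<turnstile> App (Lam (w1 A) v0) v0 \<doteq> v0 \<Colon> w1 A"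
    by (rule beta[where B = "w2 A"]) (insert A ctx, (assumption | rule tys, assumption | rule ty | simp)+)
  have "A # \<Gamma> \<turnstile> App (Lam (w1 A) v0) (App (Lam (w1 A) v0) v0) \<doteq> App (Lam (w1 A) v0) v0 \<Colon> w1 A"
    by (rule prd_elim_eq'[OF eq_refl[OF i1] b]) simp
  note bb = eq_trans[OF this b]
  have r: "A # \<Gamma> \<turnstile> Refl v0 \<Colon> IdT (w1 A) (App (Lam (w1 A) v0) (App (Lam (w1 A) v0) v0)) v0"
    by (rule typing_conv[OF refl_typing[OF A1 v refl refl] eqty_Id[OF A1 eq_sym[OF bb] eq_refl[OF v]]])
  have l: "\<Gamma> \<turnstile> Lam A (Refl v0) \<Colon> Prd A (IdT (w1 A) (App (Lam (w1 A) v0) (App (Lam (w1 A) v0) v0)) v0)"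
    by (rule lam_typing[OF istyI[OF A] r])
  let ?S = "Sig (arr A A) (Prd (w1 A) (IdT (w2 A) (App (w2 (Lam A v0)) (App v1 v0)) v0))"
  let ?T = "Sig (arr A A) (Prd (w1 A) (IdT (w2 A) (App v1 (App (w2 (Lam A v0)) v0)) v0))"
  have arr: "\<Gamma> \<turnstile> arr A A \<Colon> Univ i" by (insert A ctx, (assumption | rule tys, assumption | rule ty | simp)+)
  have S: "\<Gamma> \<turnstile> ?S \<Colon> Univ i" and T: "\<Gamma> \<turnstile> ?T \<Colon> Univ i"
    by (rule sig_form[OF arr P(1)], rule sig_form[OF arr P(2)])
  have T': "isty (?S # \<Gamma>) (w1 ?T)"
    by (rule isty_subst[OF istyI[OF T]]) (rule substs_S ctx_ext[OF S] | simp)+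
  have s: "\<Gamma> \<turnstile> Dpair (Lam A v0) (Lam A (Refl v0)) \<Colon> ?S"
    by (rule pair_typing[OF istyI[OF P(1)] i]) (insert l, simp)
  have t: "\<Gamma> \<turnstile> Dpair (Lam A v0) (Lam A (Refl v0)) \<Colon> ?T"
    by (rule pair_typing[OF istyI[OF P(2)] i]) (insert l, simp)
  show e: "\<Gamma> \<turnstile> Dpair (Dpair (Lam A v0) (Lam A (Refl v0))) (Dpair (Lam A v0) (Lam A (Refl v0))) \<Colon>
      Isequiv A A (Lam A v0)"
    unfolding Isequiv_eq by (rule pair_typing[OF T' s]) (insert t, simp)
  have "isty (arr A A # \<Gamma>) (Isequiv (w1 A) (w1 A) v0)"
    by (rule istyI, rule Isequiv_form) (insert A ctx, (assumption | rule tys, assumption | rule ty | simp)+)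
  then show "\<Gamma> \<turnstile> id_equiv A \<Colon> Equiv A A"
    unfolding id_equiv_eq Equiv_eq by (rule pair_typing[OF _ i]) (insert e, simp)
qed

lemma idtoeqv_eq: "idtoeqv i A B =
    Lam (IdT (Univ i) A B) (IdInd (Equiv v2 v1) (id_equiv v0) (w1 A) (w1 B) v0)"
  unfolding idtoeqv_def wk_subst by simp

lemma idtoeqv_motive: "ctx \<Gamma> \<Longrightarrow> IdT (w2 (Univ i)) v1 v0 # w1 (Univ i) # Univ i # \<Gamma> \<turnstile> Equiv v2 v1 \<Colon> Univ i"
  by (rule Equiv_form) (assumption | rule tys, assumption | rule ty | simp)+

lemma idtoeqv_body:
  assumes "\<Gamma> \<turnstile> A \<Colon> Univ i" "\<Gamma> \<turnstile> B \<Colon> Univ i" "\<Gamma> \<turnstile> p \<Colon> IdT (Univ i) A B"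
  shows "\<Gamma> \<turnstile> IdInd (Equiv v2 v1) (id_equiv v0) A B p \<Colon> Equiv A B"
  by (rule id_elim'[OF assms(3,1,2) idtoeqv_motive id_equiv_typing(2)])
    (insert assms typing_ctx[OF assms(1)], (assumption | rule tys, assumption | rule ty | simp)+)

lemma idtoeqv_typing:
  assumes "\<Gamma> \<turnstile> A \<Colon> Univ i" "\<Gamma> \<turnstile> B \<Colon> Univ i"
  shows "\<Gamma> \<turnstile> idtoeqv i A B \<Colon> arr (IdT (Univ i) A B) (Equiv A B)"
  unfolding idtoeqv_eq
  by (rule lam_typing) (insert assms typing_ctx[OF assms(1)], (assumption | rule tys, assumption | rule ty | simp)+, simp?, rule idtoeqv_body, (assumption | rule tys, assumption | rule ty | simp)+)

lemma idtoeqv_Refl: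
  assumes A: "\<Gamma> \<turnstile> A \<Colon> Univ i"
  shows "\<Gamma> \<turnstile> App (idtoeqv i A A) (Refl A) \<doteq> id_equiv A \<Colon> Equiv A A"
proof -
  have ctx: "ctx \<Gamma>" using A by (rule typing_ctx)
  have b: "\<Gamma> \<turnstile> App (idtoeqv i A A) (Refl A) \<doteq> IdInd (Equiv v2 v1) (id_equiv v0) A A (Refl A) \<Colon> Equiv A A"
    unfolding idtoeqv_eq
    by (rule beta[where B = "w1 (Equiv A A)"]) (insert A ctx, (assumption | rule tys, assumption | rule ty | simp)+, simp?, rule idtoeqv_body, (assumption | rule tys, assumption | rule ty | simp)+)
  have "\<Gamma> \<turnstile> IdInd (Equiv v2 v1) (id_equiv v0) A A (Refl A) \<doteq> id_equiv A \<Colon> Equiv A A"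
    by (rule id_comp'[OF A idtoeqv_motive id_equiv_typing(2)]) (insert A ctx, (assumption | rule tys, assumption | rule ty | simp)+)
  with b show ?thesis by (rule eq_trans)
qed

lemma Fst_id_equiv:
  assumes A: "\<Gamma> \<turnstile> A \<Colon> Univ i"
  shows "\<Gamma> \<turnstile> Fst (arr A A) (id_equiv A) \<doteq> Lam A v0 \<Colon> arr A A"
  unfolding id_equiv_eq
  by (rule Fst_pair[where B = "Isequiv (w1 A) (w1 A) v0"])
    (insert A id_equiv_typing(1)[OF A] typing_ctx[OF A], (assumption | rule tys, assumption | rule ty | simp)+, rule istyI, rule Isequiv_form, (assumption | rule tys, assumption | rule ty | simp)+)

lemma Equiv_fib:
  assumes "\<Gamma> \<turnstile> A \<Colon> Univ i" "\<Gamma> \<turnstile> B \<Colon> Univ i"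
  shows "isty (arr A B # \<Gamma>) (Isequiv (w1 A) (w1 B) v0)"
  by (rule istyI, rule Isequiv_form) (insert assms typing_ctx[OF assms(1)], (assumption | rule tys, assumption | rule ty | simp)+)

lemma Fst_Equiv:
  assumes "\<Gamma> \<turnstile> A \<Colon> Univ i" "\<Gamma> \<turnstile> B \<Colon> Univ i" "\<Gamma> \<turnstile> e \<Colon> Equiv A B"
  shows "\<Gamma> \<turnstile> Fst (arr A B) e \<Colon> arr A B"
  by (rule Fst_typing[OF _ Equiv_fib[OF assms(1,2)] assms(3)[unfolded Equiv_eq]])
    (insert assms typing_ctx[OF assms(1)], (assumption | rule tys, assumption | rule ty | simp)+)

text \<open>Equivalence induction: univalence makes the identity equivalence the generic one.\<close>

lemma equiv_induct:
  assumes B: "\<Gamma> \<turnstile> B \<Colon> Univ i" and Q: "\<Gamma> \<turnstile> Q \<Colon> Univ i" and f: "\<Gamma> \<turnstile> f \<Colon> arr B Q"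
    and eqv: "\<Gamma> \<Turnstile> Isequiv B Q f"
    and C: "isty (Prd (w1 B) v1 # Univ i # \<Gamma>) C"
    and base: "\<Gamma> \<Turnstile> subst (Lam B v0 \<cdot> B \<cdot> S 0) C"
  shows "\<Gamma> \<Turnstile> subst (f \<cdot> Q \<cdot> S 0) C"
proof -
  have ctx: "ctx \<Gamma>" using B by (rule typing_ctx)
  obtain s where s: "\<Gamma> \<turnstile> s \<Colon> Isequiv B Q f" using eqv by (auto simp: inh_def)
  have E: "\<Gamma> \<turnstile> Dpair f s \<Colon> Equiv B Q"
    unfolding Equiv_eq by (rule pair_typing[OF Equiv_fib[OF B Q] f]) (insert s, simp)
  have Id: "\<Gamma> \<turnstile> IdT (Univ i) B Q \<Colon> Univ (Suc i)" by (insert B Q ctx, (assumption | rule tys, assumption | rule ty | simp)+)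
  have Eqv: "\<Gamma> \<turnstile> Equiv B Q \<Colon> Univ (Suc i)" by (rule univ_cumul[OF Equiv_form[OF B Q]])
  have "\<Gamma> \<turnstile> App (App (Ua i) B) Q \<Colon> Isequiv (IdT (Univ i) B Q) (Equiv B Q) (idtoeqv i B Q)"
    by (rule app_typing[OF app_typing[OF univ_ua[OF ctx, unfolded univalence_def] B refl, simplified] Q]) simp
  from Isequiv_section[OF Id Eqv idtoeqv_typing[OF B Q] inhI[OF this]]
  obtain g where g: "\<Gamma> \<turnstile> g \<Colon> arr (Equiv B Q) (IdT (Univ i) B Q)"
    and gs: "\<Gamma> \<Turnstile> Prd (Equiv B Q) (IdT (w1 (Equiv B Q)) (App (w1 (idtoeqv i B Q)) (App (w1 g) v0)) v0)"
    by blast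
  define e where "e = App g (Dpair f s)"
  have e: "\<Gamma> \<turnstile> e \<Colon> IdT (Univ i) B Q" unfolding e_def by (rule arr_app[OF g E])
  have path: "\<Gamma> \<Turnstile> IdT (Equiv B Q) (App (idtoeqv i B Q) e) (Dpair f s)"
    by (rule inh_App[OF gs E]) (simp add: e_def)
  have app: "\<Delta> \<turnstile> App (idtoeqv i X Y) q \<Colon> Equiv X Y"
    if "\<Delta> \<turnstile> X \<Colon> Univ i" "\<Delta> \<turnstile> Y \<Colon> Univ i" "\<Delta> \<turnstile> q \<Colon> IdT (Univ i) X Y" for \<Delta> X Y q
    by (rule arr_app[OF idtoeqv_typing[OF that(1,2)] that(3)])
  \<comment> \<open>\<open>C\<close> is pulled back along \<open>idtoeqv\<close>: at a path out of
    \<open>B\<close> it is taken at the function underlying the induced equivalence. Path induction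
    applies to the resulting family.\<close>
  let ?M = "subst (Fst (Prd (w2 B) v2) (App (idtoeqv i (w2 B) v1) v0) \<cdot> v1 \<cdot> s2) C"
  have F1: "IdT (Univ i) (w1 B) v0 # Univ i # \<Gamma> \<turnstile> Fst (Prd (w2 B) v2) (App (idtoeqv i (w2 B) v1) v0) \<Colon> Prd (w2 B) v2"
    by (rule Fst_Equiv[where B = v1 and A = "w2 B", simplified], insert B Q ctx, (assumption | rule tys, assumption | rule ty | simp)+, rule app, (assumption | rule tys, assumption | rule ty | simp)+)
  have M: "isty (IdT (Univ i) (w1 B) v0 # Univ i # \<Gamma>) ?M"
    by (insert B ctx F1 C, (assumption | rule tys, assumption | rule ty | simp)+)
  have idb: "\<Gamma> \<turnstile> Lam B v0 \<Colon> arr B B" by (insert B ctx, (assumption | rule tys, assumption | rule ty | simp)+)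
  have app_id: "\<Gamma> \<turnstile> App (idtoeqv i B B) (Refl B) \<Colon> Equiv B B"
    by (rule app[OF B B]) (insert B ctx, (assumption | rule tys, assumption | rule ty | simp)+)
  have arrB: "isty \<Gamma> (arr B X)" if "\<Gamma> \<turnstile> X \<Colon> Univ i" for X by (insert B that ctx, (assumption | rule tys, assumption | rule ty | simp)+)
  \<comment> \<open>The base case of the path induction: \<open>idtoeqv\<close> computes on
    reflexivity, and the underlying function is the identity.\<close>
  have FB: "\<Gamma> \<turnstile> Fst (arr B B) (App (idtoeqv i B B) (Refl B)) \<doteq> Lam B v0 \<Colon> arr B B"
  proof -
    have "Equiv B B # \<Gamma> \<turnstile> Fst (w1 (arr B B)) v0 \<Colon> w1 (arr B B)"
      by (simp, rule Fst_Equiv[where A = "w1 B" and B = "w1 B", simplified])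
        (insert B ctx istyI[OF Equiv_form[OF B B]], (assumption | rule tys, assumption | rule ty | simp)+)
    then have "\<Gamma> \<turnstile> subst (App (idtoeqv i B B) (Refl B) \<cdot> S 0) (Fst (w1 (arr B B)) v0) \<doteq>
        subst (id_equiv B \<cdot> S 0) (Fst (w1 (arr B B)) v0) \<Colon>
        subst (App (idtoeqv i B B) (Refl B) \<cdot> S 0) (w1 (arr B B))"
      by (rule functionality_tm[OF _ idtoeqv_Refl[OF B] app_id id_equiv_typing(2)[OF B] istyI[OF Equiv_form[OF B B]]])
        (insert B ctx istyI[OF Equiv_form[OF B B]], (assumption | rule tys, assumption | rule ty | simp)+)
    then have "\<Gamma> \<turnstile> Fst (arr B B) (App (idtoeqv i B B) (Refl B)) \<doteq> Fst (arr B B) (id_equiv B) \<Colon> arr B B"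
      by simp
    then show ?thesis using Fst_id_equiv[OF B] by (rule eq_trans)
  qed
  have C1: "isty (arr B X # \<Gamma>) (subst (v0 \<cdot> w1 X \<cdot> s1) C)" if "\<Gamma> \<turnstile> X \<Colon> Univ i" for X
    by (insert B ctx C arrB[OF that] that, (assumption | rule tys, assumption | rule ty | simp)+)
  have 0: "\<Gamma> \<Turnstile> subst (Fst (arr B B) (App (idtoeqv i B B) (Refl B)) \<cdot> B \<cdot> S 0) C"
    using inh_conv[OF _ eqty_sym[OF functionality[OF C1[OF B] FB Fst_Equiv[OF B B app_id] idb arrB[OF B]]]] base
    by simp
  have 1: "\<Gamma> \<Turnstile> subst (Fst (arr B Q) (App (idtoeqv i B Q) e) \<cdot> Q \<cdot> S 0) C"
    by (rule based_J'[OF e, where C = ?M]) (insert B Q M ctx 0, (assumption | rule tys, assumption | rule ty | simp)+)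
  have F2: "Equiv B Q # \<Gamma> \<turnstile> Fst (w1 (arr B Q)) v0 \<Colon> w1 (arr B Q)"
    by (simp, rule Fst_Equiv[where A = "w1 B" and B = "w1 Q", simplified])
      (insert B Q ctx istyI[OF Eqv], (assumption | rule tys, assumption | rule ty | simp)+)
  have M2: "isty (Equiv B Q # \<Gamma>) (subst (Fst (w1 (arr B Q)) v0 \<cdot> w1 Q \<cdot> s1) C)"
    by (insert B Q ctx F2 C istyI[OF Eqv], (assumption | rule tys, assumption | rule ty | simp)+)
  \<comment> \<open>The equivalence induced by the path \<open>e\<close> is only propositionally
    equal to the given one, so this replacement is a transport; the following one, from the
    projection of the pair to \<open>f\<close>, is a conversion.\<close>
  have 2: "\<Gamma> \<Turnstile> subst (Fst (arr B Q) (Dpair f s) \<cdot> Q \<cdot> S 0) C"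
    by (rule transport'[OF path _ _ 1 istyI[OF Eqv] app[OF B Q e] E M2]) simp_all
  have Ff: "\<Gamma> \<turnstile> Fst (arr B Q) (Dpair f s) \<doteq> f \<Colon> arr B Q"
    by (rule Fst_pair[OF arrB[OF Q] Equiv_fib[OF B Q] f]) (insert s, simp)
  show ?thesis
    using inh_conv[OF _ functionality[OF C1[OF Q] Ff Fst_Equiv[OF B Q E] f arrB[OF Q]]] 2 by simp
qed

lemma equiv_induct':
  assumes "\<Gamma> \<Turnstile> Isequiv B Q f" "subst (f \<cdot> Q \<cdot> S 0) C = T" "\<Gamma> \<turnstile> B \<Colon> Univ i" "\<Gamma> \<turnstile> Q \<Colon> Univ i"
    "\<Gamma> \<turnstile> f \<Colon> arr B Q" "isty (Prd (w1 B) v1 # Univ i # \<Gamma>) C" "\<Gamma> \<Turnstile> subst (Lam B v0 \<cdot> B \<cdot> S 0) C"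
  shows "\<Gamma> \<Turnstile> T"
  using equiv_induct assms by blast

lemma ua_path:
  assumes "\<Gamma> \<turnstile> A \<Colon> Univ i" "\<Gamma> \<turnstile> B \<Colon> Univ i" "\<Gamma> \<turnstile> f \<Colon> arr A B" "\<Gamma> \<Turnstile> Isequiv A B f"
  shows "\<Gamma> \<Turnstile> IdT (Univ i) A B"
  by (rule equiv_induct'[OF assms(4), where C = "IdT (Univ i) (w2 A) v1"])
    (insert assms typing_ctx[OF assms(1)] id_refl[OF isty_base(1)[OF typing_ctx[OF assms(1)]] assms(1)], (assumption | rule tys, assumption | rule ty | simp)+)

section \<open>Function extensionality\<close>

lemma eta:
  assumes "isty \<Gamma> A" "\<Gamma> \<turnstile> f \<Colon> Prd A B"
  shows "\<Gamma> \<turnstile> f \<doteq> Lam A (App (w1 f) v0) \<Colon> Prd A B" "A # \<Gamma> \<turnstile> App (w1 f) v0 \<Colon> B"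
    "\<Gamma> \<turnstile> Lam A (App (w1 f) v0) \<Colon> Prd A B"
proof -
  show "\<Gamma> \<turnstile> f \<doteq> Lam A (App (w1 f) v0) \<Colon> Prd A B"
    by (rule prd_uniq'[OF assms(2)]) simp
  show "A # \<Gamma> \<turnstile> App (w1 f) v0 \<Colon> B"
    by (rule app_typing[where A = "w1 A" and B = "subst (v0 \<cdot> s2) B"])
      (insert assms typing_ctx[OF assms(2)], (assumption | rule tys, assumption | rule ty | simp)+)
  with assms(1) show "\<Gamma> \<turnstile> Lam A (App (w1 f) v0) \<Colon> Prd A B" by (rule lam_typing)
qed

lemma lam_cong:
  assumes "isty \<Gamma> A" "A # \<Gamma> \<turnstile> b \<doteq> b' \<Colon> B"
  shows "\<Gamma> \<turnstile> Lam A b \<doteq> Lam A b' \<Colon> Prd A B"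
  using assms by (auto simp: isty_def intro: prd_intro_eq eq_refl)

lemma id_conv:
  assumes "\<Gamma> \<Turnstile> IdT A a b" "isty \<Gamma> A" "\<Gamma> \<turnstile> a \<doteq> a' \<Colon> A" "\<Gamma> \<turnstile> b \<doteq> b' \<Colon> A"
  shows "\<Gamma> \<Turnstile> IdT A a' b'"
  using assms by (blast intro: inh_conv eqty_Id)

section \<open>The path space of a type and non-dependent function extensionality\<close>

definition Pth :: "tm \<Rightarrow> tm" where
  "Pth B = Sig B (Sig (w1 B) (IdT (w2 B) v1 v0))"

definition tgt :: "tm \<Rightarrow> tm \<Rightarrow> tm" where
  "tgt B w = Fst B (Snd B (Sig (w1 B) (IdT (w2 B) v1 v0)) w)"

lemma subst_Pth [simp]: "subst \<sigma> (Pth B) = Pth (subst \<sigma> B)"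
  by (simp add: Pth_def)

lemma subst_tgt [simp]: "subst \<sigma> (tgt B w) = tgt (subst \<sigma> B) (subst \<sigma> w)"
  by (simp add: tgt_def)

lemma Pth_form: "\<Gamma> \<turnstile> B \<Colon> Univ i \<Longrightarrow> \<Gamma> \<turnstile> Pth B \<Colon> Univ i"
  unfolding Pth_def by (frule typing_ctx) (assumption | rule tys, assumption | rule ty | simp)+

abbreviation s6 where "s6 \<equiv> S (Suc (Suc (Suc (Suc (Suc (Suc 0))))))"

lemma Pth_isty [ty]: "isty \<Gamma> B \<Longrightarrow> isty \<Gamma> (Pth B)"
  using Pth_form by (auto simp: isty_def)

context
  fixes \<Gamma> B
  assumes B: "isty \<Gamma> B"
begin

lemma Pth_fib: "isty (B # \<Gamma>) (Sig (w1 B) (IdT (w2 B) v1 v0))"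
  by (insert B isty_ctx[OF B], (assumption | rule tys, assumption | rule ty | simp)+)

lemma Pth_fib2: "\<Gamma> \<turnstile> x \<Colon> B \<Longrightarrow> isty (B # \<Gamma>) (IdT (w1 B) (w1 x) v0)"
  by (insert B isty_ctx[OF B], (assumption | rule tys, assumption | rule ty | simp)+)

lemma Pth_pair2:
  "\<Gamma> \<turnstile> x \<Colon> B \<Longrightarrow> \<Gamma> \<turnstile> y \<Colon> B \<Longrightarrow> \<Gamma> \<turnstile> q \<Colon> IdT B x y \<Longrightarrow> \<Gamma> \<turnstile> Dpair y q \<Colon> Sig B (IdT (w1 B) (w1 x) v0)"
  by (rule pair_typing[OF Pth_fib2]) simp_all

lemma Pth_pair:
  "\<Gamma> \<turnstile> x \<Colon> B \<Longrightarrow> \<Gamma> \<turnstile> y \<Colon> B \<Longrightarrow> \<Gamma> \<turnstile> q \<Colon> IdT B x y \<Longrightarrow> \<Gamma> \<turnstile> Dpair x (Dpair y q) \<Colon> Pth B"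
  unfolding Pth_def by (rule pair_typing[OF Pth_fib]) (simp_all add: Pth_pair2)

lemma src_typing: "\<Gamma> \<turnstile> w \<Colon> Pth B \<Longrightarrow> \<Gamma> \<turnstile> Fst B w \<Colon> B"
  unfolding Pth_def by (rule Fst_typing[OF B Pth_fib])

lemma tgt_typing: "\<Gamma> \<turnstile> w \<Colon> Pth B \<Longrightarrow> \<Gamma> \<turnstile> tgt B w \<Colon> B"
  unfolding tgt_def
  using Fst_typing[OF B Pth_fib2[OF src_typing]] Snd_typing[OF B Pth_fib, folded Pth_def] by simp

lemma src_pair:
  "\<Gamma> \<turnstile> x \<Colon> B \<Longrightarrow> \<Gamma> \<turnstile> y \<Colon> B \<Longrightarrow> \<Gamma> \<turnstile> q \<Colon> IdT B x y \<Longrightarrow> \<Gamma> \<turnstile> Fst B (Dpair x (Dpair y q)) \<doteq> x \<Colon> B"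
  by (rule Fst_pair[OF B Pth_fib]) (simp_all add: Pth_pair2)

lemma tgt_pair:
  assumes "\<Gamma> \<turnstile> x \<Colon> B" "\<Gamma> \<turnstile> y \<Colon> B" "\<Gamma> \<turnstile> q \<Colon> IdT B x y"
  shows "\<Gamma> \<turnstile> tgt B (Dpair x (Dpair y q)) \<doteq> y \<Colon> B"
proof -
  note ctx = isty_ctx[OF B]
  let ?T = "Sig B (IdT (w1 B) (w1 x) v0)"
  let ?s = "Snd B (Sig (w1 B) (IdT (w2 B) v1 v0)) (Dpair x (Dpair y q))"
  have p2: "\<Gamma> \<turnstile> Dpair y q \<Colon> ?T" using assms by (rule Pth_pair2)
  have T: "isty \<Gamma> ?T" by (rule isty_Sig[OF B Pth_fib2[OF assms(1)]])
  have s: "\<Gamma> \<turnstile> ?s \<doteq> Dpair y q \<Colon> ?T"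
    using Snd_pair[OF B Pth_fib assms(1), of "Dpair y q"] p2 by simp
  have "\<Gamma> \<turnstile> ?s \<Colon> subst (Fst B (Dpair x (Dpair y q)) \<cdot> s0) (Sig (w1 B) (IdT (w2 B) v1 v0))"
    by (rule Snd_typing[OF B Pth_fib]) (use Pth_pair[OF assms] in \<open>simp add: Pth_def\<close>)
  then have s': "\<Gamma> \<turnstile> ?s \<Colon> ?T"
    using functionality[OF Pth_fib src_pair[OF assms] src_typing[OF Pth_pair[OF assms]] assms(1) B]
    by (auto dest: typing_conv)
  have "?T # \<Gamma> \<turnstile> Fst (w1 B) v0 \<Colon> w1 B"
    by (rule Fst_typing[where B = "IdT (w2 B) (w2 x) v0"]) (insert B ctx T assms, (assumption | rule tys, assumption | rule ty | simp)+)
  then have "\<Gamma> \<turnstile> subst (?s \<cdot> S 0) (Fst (w1 B) v0) \<doteq> subst (Dpair y q \<cdot> S 0) (Fst (w1 B) v0) \<Colon> subst (?s \<cdot> S 0) (w1 B)"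
    by (rule functionality_tm[OF _ s s' p2 T]) (insert B ctx T, (assumption | rule tys, assumption | rule ty | simp)+)
  then have "\<Gamma> \<turnstile> tgt B (Dpair x (Dpair y q)) \<doteq> Fst B (Dpair y q) \<Colon> B" by (simp add: tgt_def)
  moreover have "\<Gamma> \<turnstile> Fst B (Dpair y q) \<doteq> y \<Colon> B"
    by (rule Fst_pair[OF B Pth_fib2[OF assms(1)] assms(2)]) (insert assms(3), simp)
  ultimately show ?thesis by (rule eq_trans)
qed

lemma diag_typing: "\<Gamma> \<turnstile> x \<Colon> B \<Longrightarrow> \<Gamma> \<turnstile> Dpair x (Dpair x (Refl x)) \<Colon> Pth B"
  by (rule Pth_pair) (rule refl_typing[OF B] refl | assumption)+

end

declare diag_typing [ty]

text \<open>Path induction proves this with \<open>x\<close> in place of \<open>f\<close>; the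
  source of the given pair is \<open>x\<close> only up to conversion, and it is in the form with
  \<open>Fst\<close> that the inverse law of \<open>diag_equiv\<close> needs it.\<close>

lemma diag_src_path:
  assumes B: "isty \<Gamma> B" and x: "\<Gamma> \<turnstile> x \<Colon> B" and y: "\<Gamma> \<turnstile> y \<Colon> B" and q: "\<Gamma> \<turnstile> q \<Colon> IdT B x y"
  defines "f \<equiv> Fst B (Dpair x (Dpair y q))"
  shows "\<Gamma> \<Turnstile> IdT (Pth B) (Dpair f (Dpair f (Refl f))) (Dpair x (Dpair y q))"
proof -
  have ctx: "ctx \<Gamma>" using x by (rule typing_ctx)
  let ?D = "\<lambda>f. Dpair f (Dpair f (Refl f))"
  have f: "\<Gamma> \<turnstile> f \<doteq> x \<Colon> B" "\<Gamma> \<turnstile> f \<Colon> B"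
    unfolding f_def using B x y q by (auto intro: src_pair src_typing Pth_pair)
  have B1: "isty (B # \<Gamma>) (w1 B)" and v0: "B # \<Gamma> \<turnstile> v0 \<Colon> w1 B" by (insert B ctx, (assumption | rule tys, assumption | rule ty | simp)+)
  have "isty (B # \<Gamma>) (IdT (Pth (w1 B)) (?D v0) (Dpair (w1 x) (Dpair (w1 y) (w1 q))))"
    by (rule isty_Id[OF Pth_isty[OF B1] diag_typing[OF B1 v0] Pth_pair[OF B1]])
      (insert B ctx x y q, (assumption | rule tys, assumption | rule ty | simp)+)
  note gen = functionality[OF this eq_sym[OF f(1)] x f(2) B, simplified]
  have "\<Gamma> \<Turnstile> IdT (Pth B) (?D x) (Dpair x (Dpair y q))"
  proof (rule based_J'[OF q, where C = "IdT (w2 (Pth B)) (?D (w2 x)) (Dpair (w2 x) (Dpair v1 v0))"])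
    have c2: "ctx (IdT (w1 B) (w1 x) v0 # B # \<Gamma>)" by (insert B ctx x, (assumption | rule tys, assumption | rule ty | simp)+)
    have B2: "isty (IdT (w1 B) (w1 x) v0 # B # \<Gamma>) (w2 B)" by (insert B ctx c2, (assumption | rule tys, assumption | rule ty | simp)+)
    show "isty (IdT (w1 B) (w1 x) v0 # B # \<Gamma>)
        (IdT (w2 (Pth B)) (?D (w2 x)) (Dpair (w2 x) (Dpair v1 v0)))"
      unfolding subst_Pth
      by (rule isty_Id[OF Pth_isty[OF B2] diag_typing[OF B2] Pth_pair[OF B2]])
        (insert B ctx c2 x, (assumption | rule tys, assumption | rule ty | simp)+)
    show "\<Gamma> \<Turnstile> subst (Refl x \<cdot> x \<cdot> s0) (IdT (w2 (Pth B)) (?D (w2 x)) (Dpair (w2 x) (Dpair v1 v0)))"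
      by (simp add: id_refl[OF Pth_isty[OF B] diag_typing[OF B x]])
  qed (insert B x y, simp_all)
  then show ?thesis using gen by (rule inh_conv)
qed

text \<open>A path can be contracted to its source, so the source map inverts the diagonal. What
  matters later is that source and target have the same composite with this equivalence.\<close>

lemma diag_equiv:
  assumes B: "\<Gamma> \<turnstile> B \<Colon> Univ i"
  shows "\<Gamma> \<Turnstile> Isequiv B (Pth B) (Lam B (Dpair v0 (Dpair v0 (Refl v0))))"
proof (rule Isequiv_Lam[OF B Pth_form[OF B], where g = "Fst (w1 B) v0" and h = "Fst (w1 B) v0"])
  have ctx: "ctx \<Gamma>" using B by (rule typing_ctx)
  note P = Pth_form[OF B]
  have B1: "isty (B # \<Gamma>) (w1 B)" and v0: "B # \<Gamma> \<turnstile> v0 \<Colon> w1 B" by (insert B ctx, (assumption | rule tys, assumption | rule ty | simp)+)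
  show "B # \<Gamma> \<turnstile> Dpair v0 (Dpair v0 (Refl v0)) \<Colon> w1 (Pth B)"
    by (simp add: diag_typing[OF B1 v0])
  have B2: "isty (Pth B # \<Gamma>) (w1 B)" and v1: "Pth B # \<Gamma> \<turnstile> v0 \<Colon> Pth (w1 B)" by (insert B P ctx, (assumption | rule tys, assumption | rule ty | simp)+)
  show g: "Pth B # \<Gamma> \<turnstile> Fst (w1 B) v0 \<Colon> w1 B" "Pth B # \<Gamma> \<turnstile> Fst (w1 B) v0 \<Colon> w1 B"
    by (rule src_typing[OF B2 v1])+
  show "B # \<Gamma> \<Turnstile> IdT (w1 B) (subst (Dpair v0 (Dpair v0 (Refl v0)) \<cdot> s1) (Fst (w1 B) v0)) v0"
    by (simp, rule id_jeq[OF B1 src_typing[OF B1 diag_typing[OF B1 v0]]])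
      (rule src_pair[OF B1 v0 v0 refl_typing[OF B1 v0 refl refl]])
  let ?D = "\<lambda>f. Dpair f (Dpair f (Refl f))"
  let ?C = "IdT (Pth (w1 B)) (?D (Fst (w1 B) v0)) v0"
  have M: "isty (Pth B # \<Gamma>) ?C"
    by (rule isty_Id[OF Pth_isty[OF B2] diag_typing[OF B2 g(1)]]) (insert B P ctx, (assumption | rule tys, assumption | rule ty | simp)+)
  have I: "isty (w1 B # B # \<Gamma>) (IdT (w2 B) v1 v0)" by (insert B ctx, (assumption | rule tys, assumption | rule ty | simp)+)
  have B3: "isty (IdT (w2 B) v1 v0 # w1 B # B # \<Gamma>) (w3 B)"
    and vs: "IdT (w2 B) v1 v0 # w1 B # B # \<Gamma> \<turnstile> v2 \<Colon> w3 B" "IdT (w2 B) v1 v0 # w1 B # B # \<Gamma> \<turnstile> v1 \<Colon> w3 B"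
      "IdT (w2 B) v1 v0 # w1 B # B # \<Gamma> \<turnstile> v0 \<Colon> IdT (w3 B) v2 v1"
    by (insert B ctx I, (assumption | rule tys, assumption | rule ty | simp)+)
  note K = diag_src_path[OF B3 vs]
  have p: "Sig (w1 B) (IdT (w2 B) v1 v0) # B # \<Gamma> \<turnstile> Dpair v1 v0 \<Colon> subst s2 (Pth B)"
    unfolding Pth_def by (insert B ctx isty_Sig[OF B1 I], (assumption | rule tys, assumption | rule ty | simp)+)
  have M1: "isty (Sig (w1 B) (IdT (w2 B) v1 v0) # B # \<Gamma>) (subst (Dpair v1 v0 \<cdot> s2) ?C)"
    by (rule isty_subst[OF M]) (insert B ctx p isty_Sig[OF B1 I], (assumption | rule tys, assumption | rule ty | simp)+)
  have "Sig (w1 B) (IdT (w2 B) v1 v0) # B # \<Gamma> \<Turnstile> subst (Dpair v1 v0 \<cdot> s2) ?C"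
    by (rule inh_sig_ctx[OF B1 I M1]) (use K in simp)
  with istyI[OF B] Pth_fib[OF istyI[OF B]] M[unfolded Pth_def[of B]] have "Pth B # \<Gamma> \<Turnstile> ?C"
    unfolding Pth_def[of B] by (rule inh_sig_ctx)
  then show "Pth B # \<Gamma> \<Turnstile> IdT (w1 (Pth B)) (subst (Fst (w1 B) v0 \<cdot> s1) (Dpair v0 (Dpair v0 (Refl v0)))) v0"
    by simp
qed

text \<open>Equivalence induction reduces this to the identity map.\<close>

lemma precomp_inj:
  assumes B: "\<Gamma> \<turnstile> B \<Colon> Univ i" and Q: "\<Gamma> \<turnstile> Q \<Colon> Univ i" and f: "\<Gamma> \<turnstile> f \<Colon> arr B Q"
    and eqv: "\<Gamma> \<Turnstile> Isequiv B Q f"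
    and u: "\<Gamma> \<turnstile> u \<Colon> arr Q B" and v: "\<Gamma> \<turnstile> v \<Colon> arr Q B"
    and uv: "\<Gamma> \<Turnstile> IdT (arr B B) (Lam B (App (w1 u) (App (w1 f) v0))) (Lam B (App (w1 v) (App (w1 f) v0)))"
  shows "\<Gamma> \<Turnstile> IdT (arr Q B) u v"
proof -
  have ctx: "ctx \<Gamma>" using B by (rule typing_ctx)
  have comp: "\<Delta> \<turnstile> Lam X (App (w1 u) (App (w1 f) v0)) \<Colon> arr X X"
    if "isty \<Delta> X" "isty \<Delta> Y" "\<Delta> \<turnstile> f \<Colon> arr X Y" "\<Delta> \<turnstile> u \<Colon> arr Y X" for \<Delta> X Y u f
    by (rule lam_typing[OF that(1)], rule arr_app[where A = "w1 Y"], (insert that isty_ctx[OF that(1)], (assumption | rule tys, assumption | rule ty | simp)+)[1],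
        rule arr_app[where A = "w1 X"]) (insert that isty_ctx[OF that(1)], (assumption | rule tys, assumption | rule ty | simp)+)
  \<comment> \<open>For the identity map, \<beta> and the judgmental \<eta>-rule turn the hypothesis
    into the conclusion.\<close>
  have step: "eqty \<Delta> (IdT (arr X X) (Lam X (App (w1 u) (App (Lam (w1 X) v0) v0)))
        (Lam X (App (w1 v) (App (Lam (w1 X) v0) v0)))) (IdT (arr X X) u v)"
    if X: "isty \<Delta> X" and uv: "\<Delta> \<turnstile> u \<Colon> arr X X" "\<Delta> \<turnstile> v \<Colon> arr X X" for \<Delta> X u v
  proof -
    have c: "ctx \<Delta>" using X by (rule isty_ctx)
    have a: "isty \<Delta> (arr X X)" by (insert X c, (assumption | rule tys, assumption | rule ty | simp)+)
    have b: "X # \<Delta> \<turnstile> App (Lam (w1 X) v0) v0 \<doteq> v0 \<Colon> w1 X"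
      by (rule beta[where B = "w2 X"]) (insert X c, (assumption | rule tys, assumption | rule ty | simp)+)
    have e: "\<Delta> \<turnstile> Lam X (App (w1 g) (App (Lam (w1 X) v0) v0)) \<doteq> g \<Colon> arr X X" if g: "\<Delta> \<turnstile> g \<Colon> arr X X" for g
    proof -
      have g1: "X # \<Delta> \<turnstile> w1 g \<Colon> arr (w1 X) (w1 X)" by (insert X c g, (assumption | rule tys, assumption | rule ty | simp)+)
      have "X # \<Delta> \<turnstile> App (w1 g) (App (Lam (w1 X) v0) v0) \<doteq> App (w1 g) v0 \<Colon> w1 X"
        by (rule prd_elim_eq'[OF eq_refl[OF g1] b]) simp
      from eq_trans[OF lam_cong[OF X this] eq_sym[OF eta(1)[OF X g]]] show ?thesis .
    qed
    show ?thesis by (rule eqty_Id[OF a e e]) (rule uv)+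
  qed
  let ?H = "IdT (arr (w4 B) (w4 B)) (Lam (w4 B) (App v2 (App v3 v0))) (Lam (w4 B) (App v1 (App v3 v0)))"
  \<comment> \<open>The types of \<open>u\<close> and \<open>v\<close> mention \<open>Q\<close>,
    which equivalence induction varies; so both maps and the hypothesis about them are quantified
    inside the motive.\<close>
  let ?C = "Prd (Prd v1 (w3 B)) (Prd (Prd v2 (w4 B)) (Prd ?H (IdT (Prd v4 (subst s6 B)) v2 v1)))"
  let ?G = "Prd (w1 B) v1 # Univ i # \<Gamma>"
  have G: "ctx ?G" by (insert B ctx, (assumption | rule tys, assumption | rule ty | simp)+)
  have G2: "ctx (Prd v2 (w4 B) # Prd v1 (w3 B) # ?G)" by (insert B ctx G, (assumption | rule tys, assumption | rule ty | simp)+)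
  have arr4: "isty (Prd v2 (w4 B) # Prd v1 (w3 B) # ?G) (arr (w4 B) (w4 B))" by (insert B ctx G2, (assumption | rule tys, assumption | rule ty | simp)+)
  have H1: "Prd v2 (w4 B) # Prd v1 (w3 B) # ?G \<turnstile> Lam (w4 B) (App (w1 v1) (App (w1 v2) v0)) \<Colon> arr (w4 B) (w4 B)"
    by (rule comp[where Y = v3]) (insert B ctx G2, (assumption | rule tys, assumption | rule ty | simp)+)
  have H2: "Prd v2 (w4 B) # Prd v1 (w3 B) # ?G \<turnstile> Lam (w4 B) (App (w1 v0) (App (w1 v2) v0)) \<Colon> arr (w4 B) (w4 B)"
    by (rule comp[where Y = v3]) (insert B ctx G2, (assumption | rule tys, assumption | rule ty | simp)+)
  have H: "isty (Prd v2 (w4 B) # Prd v1 (w3 B) # ?G) ?H"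
    using isty_Id[OF arr4 H1 H2] by simp
  have C: "isty ?G ?C"
    by (insert B ctx G G2 H, (assumption | rule tys, assumption | rule ty | simp)+)
  have arrBB: "isty \<Gamma> (arr B B)" by (insert B ctx, (assumption | rule tys, assumption | rule ty | simp)+)
  let ?H0 = "IdT (arr (w2 B) (w2 B)) (Lam (w2 B) (App v2 (App (Lam (w3 B) v0) v0))) (Lam (w2 B) (App v1 (App (Lam (w3 B) v0) v0)))"
  let ?G0 = "arr (w1 B) (w1 B) # arr B B # \<Gamma>"
  have G0: "ctx ?G0" by (insert B ctx arrBB, (assumption | rule tys, assumption | rule ty | simp)+)
  have B2: "isty ?G0 (w2 B)" and u0: "?G0 \<turnstile> v1 \<Colon> arr (w2 B) (w2 B)" and v0: "?G0 \<turnstile> v0 \<Colon> arr (w2 B) (w2 B)"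
    by (insert B ctx G0, (assumption | rule tys, assumption | rule ty | simp)+)
  have s0: "eqty ?G0 ?H0 (IdT (arr (w2 B) (w2 B)) v1 v0)"
    using step[OF B2 u0 v0] by simp
  have arr2: "isty ?G0 (arr (w2 B) (w2 B))" by (insert B ctx G0, (assumption | rule tys, assumption | rule ty | simp)+)
  have H1: "?G0 \<turnstile> Lam (w2 B) (App (w1 v1) (App (w1 (Lam (w2 B) v0)) v0)) \<Colon> arr (w2 B) (w2 B)"
    by (rule comp[where Y = "w2 B"]) (insert B ctx G0, (assumption | rule tys, assumption | rule ty | simp)+)
  have H2: "?G0 \<turnstile> Lam (w2 B) (App (w1 v0) (App (w1 (Lam (w2 B) v0)) v0)) \<Colon> arr (w2 B) (w2 B)"
    by (rule comp[where Y = "w2 B"]) (insert B ctx G0, (assumption | rule tys, assumption | rule ty | simp)+)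
  have H0: "isty ?G0 ?H0"
    using isty_Id[OF arr2 H1 H2] by simp
  have "?H0 # ?G0 \<turnstile> v0 \<Colon> w1 ?H0" by (rule var'[OF ctx_cons[OF H0]]) simp_all
  moreover have "eqty (?H0 # ?G0) (w1 ?H0) (w1 (IdT (arr (w2 B) (w2 B)) v1 v0))"
    using s0 jeq_substs[OF substs_S[OF ctx_cons[OF H0], of "Suc 0" ?G0]] by (fastforce simp: eqty_def)
  ultimately have "?H0 # ?G0 \<Turnstile> w1 (IdT (arr (w2 B) (w2 B)) v1 v0)"
    by (blast intro: inhI typing_conv)
  then have base: "\<Gamma> \<Turnstile> subst (Lam B v0 \<cdot> B \<cdot> s0) ?C"
    using H0 arrBB by (simp, intro inh_Prd) (insert B ctx arrBB, (assumption | rule tys, assumption | rule ty | simp)+)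
  have "\<Gamma> \<Turnstile> subst (f \<cdot> Q \<cdot> s0) ?C"
    by (rule equiv_induct[OF B Q f eqv C base])
  from inh_App[OF inh_App[OF this[unfolded subst.simps] _ refl, of u, unfolded subst.simps] _ refl, of v]
  have "\<Gamma> \<Turnstile> Prd (IdT (arr B B) (Lam B (App (w1 u) (App (w1 f) v0))) (Lam B (App (w1 v) (App (w1 f) v0))))
      (w1 (IdT (arr Q B) u v))"
    using u v by simp
  then show ?thesis using uv by (rule inh_mp) simp
qed

text \<open>Voevodsky's argument: source and target agree after precomposition with the diagonal,
  which is an equivalence, hence they are equal as functions on \<open>Pth B\<close>. Composing both
  with the map that sends x to the triple of \<open>b\<close>, \<open>b'\<close> and the path
  \<open>h\<close> gives the claim.\<close>

lemma nondep_funext: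
  assumes A: "\<Gamma> \<turnstile> A \<Colon> Univ i" and B: "\<Gamma> \<turnstile> B \<Colon> Univ i"
    and b: "A # \<Gamma> \<turnstile> b \<Colon> w1 B" and b': "A # \<Gamma> \<turnstile> b' \<Colon> w1 B" and p: "A # \<Gamma> \<Turnstile> IdT (w1 B) b b'"
  shows "\<Gamma> \<Turnstile> IdT (arr A B) (Lam A b) (Lam A b')"
proof -
  have ctx: "ctx \<Gamma>" using A by (rule typing_ctx)
  obtain h where h: "A # \<Gamma> \<turnstile> h \<Colon> IdT (w1 B) b b'" using p by (auto simp: inh_def)
  let ?P = "Pth B" and ?k = "Dpair b (Dpair b' h)" and ?d = "Dpair v0 (Dpair v0 (Refl v0))"
  note P = Pth_form[OF B] and B0 = istyI[OF B]
  have PB: "isty (Pth B # \<Gamma>) (w1 B)" and vP: "Pth B # \<Gamma> \<turnstile> v0 \<Colon> Pth (w1 B)"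
    and BB: "isty (B # \<Gamma>) (w1 B)" and vB: "B # \<Gamma> \<turnstile> v0 \<Colon> w1 B"
    and AB: "isty (A # \<Gamma>) (w1 B)" and arrPB: "isty \<Gamma> (arr ?P B)" and arrAB: "isty \<Gamma> (arr A B)"
    and arrBB: "isty \<Gamma> (arr B B)"
    by (insert A B P ctx, (assumption | rule tys, assumption | rule ty | simp)+)
  let ?s = "Fst (w1 B) v0" and ?t = "tgt (w1 B) v0"
  have s: "Pth B # \<Gamma> \<turnstile> ?s \<Colon> w1 B" and t: "Pth B # \<Gamma> \<turnstile> ?t \<Colon> w1 B"
    by (rule src_typing[OF PB vP], rule tgt_typing[OF PB vP])
  have d: "B # \<Gamma> \<turnstile> ?d \<Colon> Pth (w1 B)" by (rule diag_typing[OF BB vB])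
  have f: "\<Gamma> \<turnstile> Lam B ?d \<Colon> arr B ?P" by (rule lam_typing[OF B0]) (insert d, simp)
  have u: "\<Gamma> \<turnstile> Lam ?P ?s \<Colon> arr ?P B" and v: "\<Gamma> \<turnstile> Lam ?P ?t \<Colon> arr ?P B"
    by (rule lam_typing[OF istyI[OF P] s], rule lam_typing[OF istyI[OF P] t])
  have proj: "X # \<Gamma> \<turnstile> App (w1 (Lam ?P g)) k \<doteq> subst (k \<cdot> s1) g \<Colon> w1 B"
    if "Pth B # \<Gamma> \<turnstile> g \<Colon> w1 B" "isty \<Gamma> X" "X # \<Gamma> \<turnstile> k \<Colon> Pth (w1 B)" for g k X
    by (simp, rule beta[where B = "w2 B"]) (insert that B P ctx, (assumption | rule tys, assumption | rule ty | simp)+)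
  have dB: "B # \<Gamma> \<turnstile> App (w1 (Lam B ?d)) v0 \<doteq> ?d \<Colon> Pth (w1 B)"
    by (simp, rule beta[where B = "Pth (w2 B)"]) (insert B d ctx, (assumption | rule tys, assumption | rule ty | simp)+)
  have const: "\<Gamma> \<turnstile> Lam B (App (w1 (Lam ?P g)) (App (w1 (Lam B ?d)) v0)) \<doteq> Lam B v0 \<Colon> arr B B"
    if g: "Pth B # \<Gamma> \<turnstile> g \<Colon> w1 B" and e: "B # \<Gamma> \<turnstile> subst (?d \<cdot> s1) g \<doteq> v0 \<Colon> w1 B" for g
  proof (rule lam_cong[OF B0])
    have g1: "B # \<Gamma> \<turnstile> w1 (Lam ?P g) \<Colon> arr (Pth (w1 B)) (w1 B)"
      by (insert lam_typing[OF istyI[OF P] g] B ctx, (assumption | rule tys, assumption | rule ty | simp)+)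
    have "B # \<Gamma> \<turnstile> App (w1 (Lam ?P g)) (App (w1 (Lam B ?d)) v0) \<doteq> App (w1 (Lam ?P g)) ?d \<Colon> w1 B"
      by (rule prd_elim_eq'[OF eq_refl[OF g1] dB]) simp
    then show "B # \<Gamma> \<turnstile> App (w1 (Lam ?P g)) (App (w1 (Lam B ?d)) v0) \<doteq> v0 \<Colon> w1 B"
      by (rule eq_trans[OF _ eq_trans[OF proj[OF g B0 d] e]])
  qed
  note rB = refl_typing[OF BB vB refl refl]
  have c1: "\<Gamma> \<turnstile> Lam B (App (w1 (Lam ?P ?s)) (App (w1 (Lam B ?d)) v0)) \<doteq> Lam B v0 \<Colon> arr B B"
    by (rule const[OF s]) (simp add: src_pair[OF BB vB vB rB])
  have c2: "\<Gamma> \<turnstile> Lam B (App (w1 (Lam ?P ?t)) (App (w1 (Lam B ?d)) v0)) \<doteq> Lam B v0 \<Colon> arr B B"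
    by (rule const[OF t]) (simp add: tgt_pair[OF BB vB vB rB])
  have "\<Gamma> \<turnstile> Lam B v0 \<Colon> arr B B" by (rule lam_typing[OF B0 vB])
  from id_conv[OF id_refl[OF arrBB this] arrBB eq_sym[OF c1] eq_sym[OF c2]]
  have st: "\<Gamma> \<Turnstile> IdT (arr ?P B) (Lam ?P ?s) (Lam ?P ?t)"
    by (rule precomp_inj[OF B P f diag_equiv[OF B] u v])
  have k: "A # \<Gamma> \<turnstile> ?k \<Colon> Pth (w1 B)" by (rule Pth_pair[OF AB b b' h])
  have "w1 A # arr ?P B # \<Gamma> \<turnstile> App v1 (subst (v0 \<cdot> s2) ?k) \<Colon> w2 B"
    by (rule arr_app[where A = "Pth (w2 B)"], (insert A B arrPB ctx, (assumption | rule tys, assumption | rule ty | simp)+)[1], rule typing_subst[OF k])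
      (insert A B arrPB ctx, (assumption | rule tys, assumption | rule ty | simp)+)
  then have "arr ?P B # \<Gamma> \<turnstile> Lam (w1 A) (App v1 (subst (v0 \<cdot> s2) ?k)) \<Colon> w1 (arr A B)"
    by (simp, intro lam_typing) (insert A B arrPB ctx, (assumption | rule tys, assumption | rule ty | simp)+)
  from id_ap[OF st arrPB u v arrAB this]
  have "\<Gamma> \<Turnstile> IdT (arr A B) (Lam A (App (w1 (Lam ?P ?s)) ?k)) (Lam A (App (w1 (Lam ?P ?t)) ?k))"
    by simp
  moreover have "\<Gamma> \<turnstile> Lam A (App (w1 (Lam ?P ?s)) ?k) \<doteq> Lam A b \<Colon> arr A B"
    using proj[OF s istyI[OF A] k] src_pair[OF AB b b' h] by (intro lam_cong[OF istyI[OF A]]) (simp add: eq_trans)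
  moreover have "\<Gamma> \<turnstile> Lam A (App (w1 (Lam ?P ?t)) ?k) \<doteq> Lam A b' \<Colon> arr A B"
    using proj[OF t istyI[OF A] k] tgt_pair[OF AB b b' h] by (intro lam_cong[OF istyI[OF A]]) (simp add: eq_trans)
  ultimately show ?thesis using id_conv[OF _ arrAB] by blast
qed

section \<open>Contractible types and weak function extensionality\<close>

lemma trunc_0: "is_trunc 0 A = Sig A (Prd (w1 A) (IdT (w2 A) v1 v0))"
  unfolding is_trunc.simps wk_subst by simp

lemma trunc_Suc: "is_trunc (Suc m) A = Prd A (Prd (w1 A) (is_trunc m (IdT (w2 A) v1 v0)))"
  unfolding is_trunc.simps wk_subst by simp

declare is_trunc.simps [simp del]

lemma trunc_form [ty]: "\<Gamma> \<turnstile> A \<Colon> Univ i \<Longrightarrow> \<Gamma> \<turnstile> is_trunc m A \<Colon> Univ i"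
proof (induction m arbitrary: \<Gamma> A)
  case 0
  show ?case unfolding trunc_0 by (insert 0 typing_ctx[OF 0], (assumption | rule tys, assumption | rule ty | simp)+)
next
  case (Suc m)
  show ?case unfolding trunc_Suc
    by (insert Suc.prems typing_ctx[OF Suc.prems], (assumption | rule Suc.IH | assumption | rule tys, assumption | rule ty | simp)+)
qed

lemma trunc_isty [ty]: "isty \<Gamma> A \<Longrightarrow> isty \<Gamma> (is_trunc m A)"
  unfolding isty_def by (blast intro: trunc_form)

lemma trunc_SucD:
  assumes "\<Gamma> \<Turnstile> is_trunc (Suc m) A" "\<Gamma> \<turnstile> a \<Colon> A" "\<Gamma> \<turnstile> b \<Colon> A"
  shows "\<Gamma> \<Turnstile> is_trunc m (IdT A a b)"
  using inh_App[OF inh_App[OF assms(1)[unfolded trunc_Suc] assms(2) refl, unfolded subst.simps] _ refl, of b] assms(3)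
  by simp

lemma trunc_SucI:
  assumes "isty \<Gamma> A" "w1 A # A # \<Gamma> \<Turnstile> is_trunc m (IdT (w2 A) v1 v0)"
  shows "\<Gamma> \<Turnstile> is_trunc (Suc m) A"
  unfolding trunc_Suc by (insert assms isty_ctx[OF assms(1)], rule inh_Prd, assumption, rule inh_Prd, (assumption | rule tys, assumption | rule ty | simp)+)

declare unit_intro [ty] unit_form [ty]

lemma contr_centre:
  assumes "isty \<Gamma> A"
  shows "isty (A # \<Gamma>) (Prd (w1 A) (IdT (w2 A) v1 v0))"
  by (insert assms isty_ctx[OF assms], (assumption | rule tys, assumption | rule ty | simp)+)

lemma contrE:
  assumes "\<Gamma> \<Turnstile> is_trunc 0 A" "isty \<Gamma> A"
  obtains c where "\<Gamma> \<turnstile> c \<Colon> A" "\<Gamma> \<Turnstile> Prd A (IdT (w1 A) (w1 c) v0)"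
  by (rule inh_sigE[OF assms(1)[unfolded trunc_0] assms(2) contr_centre[OF assms(2)]]) (auto intro: that)

lemma contrI:
  assumes "isty \<Gamma> A" "\<Gamma> \<turnstile> c \<Colon> A" "A # \<Gamma> \<Turnstile> IdT (w1 A) (w1 c) v0"
  shows "\<Gamma> \<Turnstile> is_trunc 0 A"
  unfolding trunc_0
  by (rule inh_pair[OF contr_centre[OF assms(1)] assms(2)]) (simp add: inh_Prd assms)

lemma contr_eq:
  assumes "\<Gamma> \<Turnstile> is_trunc 0 A" "isty \<Gamma> A" "\<Gamma> \<turnstile> a \<Colon> A" "\<Gamma> \<turnstile> b \<Colon> A"
  shows "\<Gamma> \<Turnstile> IdT A a b"
proof -
  obtain c where c: "\<Gamma> \<turnstile> c \<Colon> A" "\<Gamma> \<Turnstile> Prd A (IdT (w1 A) (w1 c) v0)"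
    using contrE assms(1,2) by blast
  have "\<Gamma> \<Turnstile> IdT A c x" if "\<Gamma> \<turnstile> x \<Colon> A" for x
    by (rule inh_App[OF c(2) that]) simp
  then show ?thesis using id_trans[OF id_sym] assms c by blast
qed

lemma prop_eq:
  assumes "\<Gamma> \<Turnstile> is_trunc (Suc 0) A" "isty \<Gamma> A" "\<Gamma> \<turnstile> a \<Colon> A" "\<Gamma> \<turnstile> b \<Colon> A"
  shows "\<Gamma> \<Turnstile> IdT A a b"
  using contrE[OF trunc_SucD[OF assms(1,3,4)] isty_Id[OF assms(2-4)]] by (blast intro: inhI)

lemma trunc_jeq:
  assumes "\<Gamma> \<Turnstile> is_trunc m A" "\<Gamma> \<turnstile> A \<doteq> B \<Colon> Univ i" "\<Gamma> \<turnstile> A \<Colon> Univ i" "\<Gamma> \<turnstile> B \<Colon> Univ i"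
  shows "\<Gamma> \<Turnstile> is_trunc m B"
proof -
  have "isty (Univ i # \<Gamma>) (is_trunc m v0)" by (insert assms typing_ctx[OF assms(3)], (assumption | rule tys, assumption | rule ty | simp)+)
  from functionality[OF this assms(2-4) isty_base(1)[OF typing_ctx[OF assms(3)]]] assms(1)
  show ?thesis by (auto intro: inh_conv)
qed

lemma trunc_path:
  assumes "\<Gamma> \<Turnstile> is_trunc m A" "\<Gamma> \<Turnstile> IdT (Univ i) A B" "\<Gamma> \<turnstile> A \<Colon> Univ i" "\<Gamma> \<turnstile> B \<Colon> Univ i"
  shows "\<Gamma> \<Turnstile> is_trunc m B"
  by (rule transport'[OF assms(2), where C = "is_trunc m v0"]) (insert assms typing_ctx[OF assms(3)], (assumption | rule tys, assumption | rule ty | simp)+)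

lemma star_eq:
  assumes "\<Gamma> \<turnstile> u \<Colon> Unit"
  shows "\<Gamma> \<Turnstile> IdT Unit Star u"
proof -
  have ctx: "ctx \<Gamma>" using assms by (rule typing_ctx)
  have "Unit # \<Gamma> \<turnstile> IdT Unit Star v0 \<Colon> Univ 0"
    by (rule id_form; (rule unit_form unit_intro var')?) (insert ctx isty_base(3)[OF ctx], (assumption | rule tys, assumption | rule ty | simp)+)
  from unit_elim'[OF this _ assms, of "Refl Star"] show ?thesis
    by (rule inhI) (insert ctx, auto intro: refl_typing isty_base unit_intro)
qed

lemma contr_Unit:
  assumes P: "\<Gamma> \<turnstile> P \<Colon> Univ i" and contr: "\<Gamma> \<Turnstile> is_trunc 0 P"
  shows "\<Gamma> \<Turnstile> IdT (Univ i) P Unit"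
proof -
  have ctx: "ctx \<Gamma>" using P by (rule typing_ctx)
  obtain c where c: "\<Gamma> \<turnstile> c \<Colon> P" "\<Gamma> \<Turnstile> Prd P (IdT (w1 P) (w1 c) v0)"
    using contrE[OF contr istyI[OF P]] by blast
  have U: "\<Gamma> \<turnstile> Unit \<Colon> Univ i" using ctx by (rule unit_form)
  have f: "P # \<Gamma> \<turnstile> Star \<Colon> w1 Unit" by (simp add: unit_intro ctx_ext[OF P])
  have g: "Unit # \<Gamma> \<turnstile> w1 c \<Colon> w1 P" by (insert ctx c isty_base(3)[OF ctx], (assumption | rule tys, assumption | rule ty | simp)+)
  show ?thesis
  proof (rule ua_path[OF P U lam_typing[OF istyI[OF P] f] Isequiv_Lam[OF P U f g g]])
    have "Unit # \<Gamma> \<turnstile> v0 \<Colon> Unit" by (insert ctx isty_base(3)[OF ctx], (assumption | rule tys, assumption | rule ty | simp)+)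
    from star_eq[OF this]
    show "Unit # \<Gamma> \<Turnstile> IdT (w1 Unit) (subst (w1 c \<cdot> s1) Star) v0" by simp
    show "P # \<Gamma> \<Turnstile> IdT (w1 P) (subst (Star \<cdot> s1) (w1 c)) v0"
      using inh_unPrd[OF c(2) istyI[OF P]] by simp
  qed
qed

lemma contr_Prd_Unit:
  assumes A: "\<Gamma> \<turnstile> A \<Colon> Univ i"
  shows "\<Gamma> \<Turnstile> is_trunc 0 (Prd A Unit)"
proof (rule contrI)
  have ctx: "ctx \<Gamma>" using A by (rule typing_ctx)
  show T: "isty \<Gamma> (Prd A Unit)" by (insert A ctx, (assumption | rule tys, assumption | rule ty | simp)+)
  show "\<Gamma> \<turnstile> Lam A Star \<Colon> Prd A Unit"
    by (rule lam_typing[OF istyI[OF A] unit_intro[OF ctx_ext[OF A]]])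
  let ?G = "Prd A Unit # \<Gamma>"
  have G: "ctx ?G" using T by (rule ctx_cons)
  have A1: "?G \<turnstile> w1 A \<Colon> Univ i" and g: "?G \<turnstile> v0 \<Colon> Prd (w1 A) Unit"
    and T1: "isty ?G (Prd (w1 A) Unit)" and S: "w1 A # ?G \<turnstile> Star \<Colon> Unit"
    by (insert A G ctx unit_intro, (assumption | rule tys, assumption | rule ty | simp)+)
  note e = eta[OF istyI[OF A1] g, simplified]
  have "?G \<Turnstile> IdT (arr (w1 A) Unit) (Lam (w1 A) Star) (Lam (w1 A) (App v1 v0))"
    by (rule nondep_funext[OF A1 unit_form[OF G]]) (simp_all add: S e star_eq)
  then show "?G \<Turnstile> IdT (w1 (Prd A Unit)) (w1 (Lam A Star)) v0"
    using id_conv[OF _ T1 eq_refl eq_sym[OF e(1)]] lam_typing[OF istyI[OF A1] S] by simp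
qed

text \<open>By univalence the family is pointwise equal to the constant family \<open>Unit\<close>,
  hence equal to it as a function into the universe by the non-dependent case. The product of the
  constant family is contractible, and contractibility is transported back.\<close>

lemma weak_funext:
  assumes A: "\<Gamma> \<turnstile> A \<Colon> Univ i" and P: "A # \<Gamma> \<turnstile> P \<Colon> Univ i" and contr: "A # \<Gamma> \<Turnstile> is_trunc 0 P"
  shows "\<Gamma> \<Turnstile> is_trunc 0 (Prd A P)"
proof -
  have ctx: "ctx \<Gamma>" using A by (rule typing_ctx)
  let ?U = "arr A (Univ i)"
  have U: "A # \<Gamma> \<turnstile> Unit \<Colon> Univ i" using ctx_ext[OF A] by (rule unit_form)
  \<comment> \<open>The codomain is \<open>Univ i\<close> itself, so the instance of extensionality
    is one level up and \<open>A\<close> is lifted to that level.\<close>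
  have "\<Gamma> \<Turnstile> IdT ?U (Lam A P) (Lam A Unit)"
    by (rule nondep_funext[OF univ_cumul[OF A] univ_intro[OF ctx]]) (insert P U contr_Unit[OF P contr], simp_all)
  note path = this
  have tU: "isty \<Gamma> ?U" by (insert A ctx, (assumption | rule tys, assumption | rule ty | simp)+)
  have lP: "\<Gamma> \<turnstile> Lam A Q \<Colon> ?U" if "A # \<Gamma> \<turnstile> Q \<Colon> Univ i" for Q
    by (rule lam_typing[OF istyI[OF A]]) (simp add: that)
  have a: "w1 A # ?U # \<Gamma> \<turnstile> App v1 v0 \<Colon> Univ i"
    by (rule app_typing[where A = "w2 A" and B = "Univ i"]) (insert A ctx tU, (assumption | rule tys, assumption | rule ty | simp)+)
  have M: "isty (?U # \<Gamma>) (is_trunc 0 (Prd (w1 A) (App v1 v0)))"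
    by (insert A a ctx tU, (assumption | rule tys, assumption | rule ty | simp)+)
  have b: "A # \<Gamma> \<turnstile> App (w1 (Lam A Q)) v0 \<doteq> Q \<Colon> Univ i" if "A # \<Gamma> \<turnstile> Q \<Colon> Univ i" for Q
    by (simp, rule beta[where B = "Univ i"]) (insert A that ctx, (assumption | rule tys, assumption | rule ty | simp)+)
  have e: "\<Gamma> \<turnstile> Prd A (App (w1 (Lam A Q)) v0) \<doteq> Prd A Q \<Colon> Univ i"
    "\<Gamma> \<turnstile> Prd A (App (w1 (Lam A Q)) v0) \<Colon> Univ i" "\<Gamma> \<turnstile> Prd A Q \<Colon> Univ i" if Q: "A # \<Gamma> \<turnstile> Q \<Colon> Univ i" for Q
  proof -
    have "A # \<Gamma> \<turnstile> App (w1 (Lam A Q)) v0 \<Colon> Univ i"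
      using eta(2)[OF istyI[OF A] lP[OF Q]] by simp
    then show "\<Gamma> \<turnstile> Prd A (App (w1 (Lam A Q)) v0) \<Colon> Univ i" by (rule prd_form[OF A])
  qed (rule prd_form_eq[OF A eq_refl[OF A] b[OF Q]] prd_form[OF A Q])+
  have 1: "\<Gamma> \<Turnstile> is_trunc 0 (Prd A (App (w1 (Lam A Unit)) v0))"
    by (rule trunc_jeq[OF contr_Prd_Unit[OF A] eq_sym[OF e(1)[OF U]] e(3,2)[OF U]])
  have "\<Gamma> \<Turnstile> is_trunc 0 (Prd A (App (w1 (Lam A P)) v0))"
    by (rule transport'[OF id_sym[OF path tU lP[OF P] lP[OF U]] _ _ 1 tU lP[OF U] lP[OF P] M]) simp_all
  then show ?thesis by (rule trunc_jeq[OF _ e[OF P]])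
qed

lemma singleton_contr:
  assumes A: "isty \<Gamma> A" and a: "\<Gamma> \<turnstile> a \<Colon> A"
  shows "\<Gamma> \<Turnstile> is_trunc 0 (Sig A (IdT (w1 A) (w1 a) v0))"
proof -
  \<comment> \<open>Stated over any context, so that it can be used at the two variables into which
    an element of the sum is split.\<close>
  have gen: "\<Delta> \<Turnstile> IdT (Sig A (IdT (w1 A) (w1 a) v0)) (Dpair a (Refl a)) (Dpair y q)"
    if A: "isty \<Delta> A" and a: "\<Delta> \<turnstile> a \<Colon> A" and y: "\<Delta> \<turnstile> y \<Colon> A" and q: "\<Delta> \<turnstile> q \<Colon> IdT A a y" for \<Delta> A a y q
  proof -
    have ctx: "ctx \<Delta>" using a by (rule typing_ctx)
    let ?S = "Sig A (IdT (w1 A) (w1 a) v0)"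
    have S: "isty \<Delta> ?S" "\<Delta> \<turnstile> Dpair a (Refl a) \<Colon> ?S" by (insert A a ctx, (assumption | rule tys, assumption | rule ty | simp)+)
    show ?thesis
      by (rule based_J'[OF q, where C = "IdT (w2 ?S) (w2 (Dpair a (Refl a))) (Dpair v1 v0)"])
        (insert A a y ctx id_refl[OF S], (assumption | rule tys, assumption | rule ty | simp)+)
  qed
  have ctx: "ctx \<Gamma>" using a by (rule typing_ctx)
  let ?I = "IdT (w1 A) (w1 a) v0"
  let ?G = "?I # A # \<Gamma>"
  have I: "isty (A # \<Gamma>) ?I" by (insert A a ctx, (assumption | rule tys, assumption | rule ty | simp)+)
  have S: "isty \<Gamma> (Sig A ?I)" "\<Gamma> \<turnstile> Dpair a (Refl a) \<Colon> Sig A ?I" by (insert A a ctx, (assumption | rule tys, assumption | rule ty | simp)+)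
  have "isty ?G (w2 A)" "?G \<turnstile> w2 a \<Colon> w2 A" "?G \<turnstile> v1 \<Colon> w2 A" "?G \<turnstile> v0 \<Colon> IdT (w2 A) (w2 a) v1"
    by (insert A a ctx I, (assumption | rule tys, assumption | rule ty | simp)+)
  note g = gen[OF this]
  have M: "isty (Sig A ?I # \<Gamma>) (IdT (w1 (Sig A ?I)) (w1 (Dpair a (Refl a))) v0)"
    by (rule isty_Id[OF isty_subst[OF S(1)] typing_subst[OF S(2) _ refl]])
      (rule substs_S ctx_cons[OF S(1)] var' | simp)+
  show ?thesis
    by (rule contrI[OF S], rule inh_sig_ctx[OF A I M]) (insert g, simp)
qed

text \<open>
  An identity system at \<open>a\<close>, described by its elimination principle on the meta level.
\<close>

definition idsys :: "tm list \<Rightarrow> tm \<Rightarrow> tm \<Rightarrow> tm \<Rightarrow> tm \<Rightarrow> bool" where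
  "idsys \<Gamma> A a R r \<longleftrightarrow>
     (\<forall>C. isty (R # A # \<Gamma>) C \<longrightarrow> \<Gamma> \<Turnstile> subst (r \<cdot> a \<cdot> S 0) C \<longrightarrow> R # A # \<Gamma> \<Turnstile> C)"

lemma beta_v0:
  assumes A: "isty \<Gamma> A" and t: "A # \<Gamma> \<turnstile> t \<Colon> T"
  shows "A # \<Gamma> \<turnstile> App (w1 (Lam A t)) v0 \<doteq> t \<Colon> T"
proof -
  have c: "ctx \<Gamma>" using A by (rule isty_ctx)
  have 1: "w1 A # A # \<Gamma> \<turnstile> subst (v0 \<cdot> s2) t \<Colon> subst (v0 \<cdot> s2) T"
    by (rule typing_subst[OF t _ refl]) (insert A c, (assumption | rule tys, assumption | rule ty | simp)+)
  have "A # \<Gamma> \<turnstile> App (Lam (w1 A) (subst (v0 \<cdot> s2) t)) v0 \<doteq> t \<Colon> T"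
    by (rule beta[OF _ 1]) (insert A c, (assumption | rule tys, assumption | rule ty | simp)+)
  then show ?thesis by simp
qed

section \<open>Functions into sums, choice and homotopies\<close>

abbreviation fibT :: "tm \<Rightarrow> tm \<Rightarrow> tm" where
  "fibT F b \<equiv> IdT (w1 F) (w1 b) v0"
abbreviation lfst :: "tm \<Rightarrow> tm \<Rightarrow> tm \<Rightarrow> tm" where
  "lfst A F k \<equiv> Lam A (Fst F (App (w1 k) v0))"
abbreviation lsnd :: "tm \<Rightarrow> tm \<Rightarrow> tm \<Rightarrow> tm \<Rightarrow> tm" where
  "lsnd A F T k \<equiv> Lam A (Snd F T (App (w1 k) v0))"
text \<open>Over a variable function g: the sections of \<open>T\<close> along the graph of
  g.\<close>

abbreviation pointwise :: "tm \<Rightarrow> tm \<Rightarrow> tm" where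
  "pointwise A T \<equiv> Prd (w1 A) (subst (App v1 v0 \<cdot> v0 \<cdot> s2) T)"
text \<open>The normal form of \<open>pointwise A (fibT F b)\<close>: homotopies from
  \<open>b\<close> to a variable function.\<close>

abbreviation htpy :: "tm \<Rightarrow> tm \<Rightarrow> tm \<Rightarrow> tm" where
  "htpy A F b \<equiv> Prd (w1 A) (IdT (subst (v0 \<cdot> s2) F) (subst (v0 \<cdot> s2) b) (App v1 v0))"

context
  fixes \<Gamma> A i F T
  assumes A: "\<Gamma> \<turnstile> A \<Colon> Univ i" and F: "A # \<Gamma> \<turnstile> F \<Colon> Univ i" and T: "F # A # \<Gamma> \<turnstile> T \<Colon> Univ i"
begin

lemma lfst_typing: "\<Gamma> \<turnstile> k \<Colon> Prd A (Sig F T) \<Longrightarrow> \<Gamma> \<turnstile> lfst A F k \<Colon> Prd A F"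
  by (rule lam_typing[OF istyI[OF A] Fst_typing[OF istyI[OF F] istyI[OF T] eta(2)[OF istyI[OF A]]]])

lemma lsnd_typing:
  assumes k: "\<Gamma> \<turnstile> k \<Colon> Prd A (Sig F T)"
  shows "\<Gamma> \<turnstile> lsnd A F T k \<Colon> Prd A (subst (App (w1 (lfst A F k)) v0 \<cdot> S 0) T)"
proof (rule lam_typing[OF istyI[OF A] typing_conv])
  note k' = eta(2)[OF istyI[OF A] k]
  show "A # \<Gamma> \<turnstile> Snd F T (App (w1 k) v0) \<Colon> subst (Fst F (App (w1 k) v0) \<cdot> S 0) T"
    by (rule Snd_typing[OF istyI[OF F] istyI[OF T] k'])
  have f: "A # \<Gamma> \<turnstile> Fst F (App (w1 k) v0) \<Colon> F" by (rule Fst_typing[OF istyI[OF F] istyI[OF T] k'])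
  have "A # \<Gamma> \<turnstile> App (w1 (lfst A F k)) v0 \<doteq> Fst F (App (w1 k) v0) \<Colon> F"
    by (rule beta_v0[OF istyI[OF A] f])
  from functionality[OF istyI[OF T] eq_sym[OF this] f eta(2)[OF istyI[OF A] lfst_typing[OF k]] istyI[OF F]]
  show "eqty (A # \<Gamma>) (subst (Fst F (App (w1 k) v0) \<cdot> S 0) T) (subst (App (w1 (lfst A F k)) v0 \<cdot> S 0) T)" .
qed

lemma pointwise_form: "Prd A F # \<Gamma> \<turnstile> pointwise A T \<Colon> Univ i"
proof -
  have c: "ctx \<Gamma>" using A by (rule typing_ctx)
  have P: "\<Gamma> \<turnstile> Prd A F \<Colon> Univ i" by (insert A F c, (assumption | rule tys, assumption | rule ty | simp)+)
  have "w1 A # Prd A F # \<Gamma> \<turnstile> App v1 v0 \<Colon> subst (v0 \<cdot> s2) F"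
    by (rule app_typing[where A = "w2 A" and B = "subst (v0 \<cdot> s3) F"]) (insert A P c, (assumption | rule tys, assumption | rule ty | simp)+)
  note v = this
  show ?thesis by (insert A F T c P v, (assumption | rule tys, assumption | rule ty | simp)+)
qed

context
  fixes x y
  assumes x: "A # \<Gamma> \<turnstile> x \<Colon> F" and y: "A # \<Gamma> \<turnstile> y \<Colon> subst (x \<cdot> S 0) T"
begin

lemma pair_fun: "\<Gamma> \<turnstile> Lam A (Dpair x y) \<Colon> Prd A (Sig F T)"
  by (rule lam_typing[OF istyI[OF A] pair_typing[OF istyI[OF T] x y]])

lemma pair_fun_app:
  "A # \<Gamma> \<turnstile> App (w1 (Lam A (Dpair x y))) v0 \<doteq> Dpair x y \<Colon> Sig F T"
  "A # \<Gamma> \<turnstile> App (w1 (Lam A (Dpair x y))) v0 \<Colon> Sig F T"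
  "A # \<Gamma> \<turnstile> Dpair x y \<Colon> Sig F T"
proof -
  show p: "A # \<Gamma> \<turnstile> Dpair x y \<Colon> Sig F T"
    by (rule pair_typing[OF istyI[OF T] x y])
  show "A # \<Gamma> \<turnstile> App (w1 (Lam A (Dpair x y))) v0 \<doteq> Dpair x y \<Colon> Sig F T"
    by (rule beta_v0[OF istyI[OF A] p])
  show "A # \<Gamma> \<turnstile> App (w1 (Lam A (Dpair x y))) v0 \<Colon> Sig F T"
    by (rule eta(2)[OF istyI[OF A] pair_fun])
qed

text \<open>Congruence of both projections is read off from \<open>functionality_tm\<close> at a
  variable of the sum type. The second projection changes its type on the way, since that type
  contains the first one.\<close>

lemma lsnd_pair_aux:
  defines "k \<equiv> App (w1 (Lam A (Dpair x y))) v0"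
  shows "A # \<Gamma> \<turnstile> Fst F k \<doteq> x \<Colon> F" "A # \<Gamma> \<turnstile> Snd F T k \<doteq> y \<Colon> subst (Fst F k \<cdot> S 0) T"
proof -
  let ?G = "Sig F T # A # \<Gamma>" and ?T = "subst (v0 \<cdot> s2) T"
  have S: "isty (A # \<Gamma>) (Sig F T)" by (rule isty_Sig[OF istyI[OF F] istyI[OF T]])
  have c: "ctx ?G" using S by (rule ctx_cons)
  have F1: "isty ?G (w1 F)" by (rule isty_subst[OF istyI[OF F] substs_S[OF c]]) simp_all
  have T1: "isty (w1 F # ?G) ?T" by (rule isty_subst[OF istyI[OF T]]) (insert F1 c, (assumption | rule tys, assumption | rule ty | simp)+)
  have v: "?G \<turnstile> v0 \<Colon> Sig (w1 F) ?T" by (rule var'[OF c]) simp_all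
  have s: "?G \<turnstile> Snd (w1 F) ?T v0 \<Colon> subst (Fst (w1 F) v0 \<cdot> s1) T"
    using Snd_typing[OF F1 T1 v] by simp
  have Tf: "isty ?G (subst (Fst (w1 F) v0 \<cdot> s1) T)"
    by (rule isty_subst[OF istyI[OF T]]) (insert c Fst_typing[OF F1 T1 v], (assumption | rule tys, assumption | rule ty | simp)+)
  note p = pair_fun_app[folded k_def]
  have fk: "A # \<Gamma> \<turnstile> Fst F k \<Colon> F" by (rule Fst_typing[OF istyI[OF F] istyI[OF T] p(2)])
  have "A # \<Gamma> \<turnstile> Fst F k \<doteq> Fst F (Dpair x y) \<Colon> F"
    using functionality_tm[OF Fst_typing[OF F1 T1 v] p S F1] by simp
  from eq_trans[OF this Fst_pair[OF istyI[OF F] istyI[OF T] x y]]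
  show e: "A # \<Gamma> \<turnstile> Fst F k \<doteq> x \<Colon> F" .
  have "A # \<Gamma> \<turnstile> Snd F T k \<doteq> Snd F T (Dpair x y) \<Colon> subst (Fst F k \<cdot> S 0) T"
    using functionality_tm[OF s p S Tf] by simp
  then show "A # \<Gamma> \<turnstile> Snd F T k \<doteq> y \<Colon> subst (Fst F k \<cdot> S 0) T"
    by (rule eq_trans[OF _ jeq_conv[OF Snd_pair[OF istyI[OF F] istyI[OF T] x y]
          functionality[OF istyI[OF T] eq_sym[OF e] x fk istyI[OF F]]]])
qed

lemma lfst_pair: "\<Gamma> \<turnstile> lfst A F (Lam A (Dpair x y)) \<doteq> Lam A x \<Colon> Prd A F"
  by (rule lam_cong[OF istyI[OF A] lsnd_pair_aux(1)])

lemma lsnd_pair: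
  "\<Gamma> \<turnstile> lsnd A F T (Lam A (Dpair x y)) \<doteq> Lam A y \<Colon> Prd A (subst (App (w1 (lfst A F (Lam A (Dpair x y)))) v0 \<cdot> S 0) T)"
proof (rule lam_cong[OF istyI[OF A] jeq_conv[OF lsnd_pair_aux(2)]])
  let ?k = "App (w1 (Lam A (Dpair x y))) v0"
  have fk: "A # \<Gamma> \<turnstile> Fst F ?k \<Colon> F" by (rule Fst_typing[OF istyI[OF F] istyI[OF T] pair_fun_app(2)])
  show "eqty (A # \<Gamma>) (subst (Fst F ?k \<cdot> S 0) T) (subst (App (w1 (lfst A F (Lam A (Dpair x y)))) v0 \<cdot> S 0) T)"
    by (rule functionality[OF istyI[OF T] eq_sym[OF beta_v0[OF istyI[OF A] fk]] fk
          eta(2)[OF istyI[OF A] lfst_typing[OF pair_fun]] istyI[OF F]])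
qed

end

end

text \<open>
  If each \<open>Sig F T\<close> is contractible, then so is the type of functions \<open>g\<close> equipped with a
  section of \<open>T (g x)\<close>; this is stated as an elimination principle.
\<close>

lemma choice_elim:
  assumes A: "\<Gamma> \<turnstile> A \<Colon> Univ i" and F: "A # \<Gamma> \<turnstile> F \<Colon> Univ i" and T: "F # A # \<Gamma> \<turnstile> T \<Colon> Univ i"
    and contr: "A # \<Gamma> \<Turnstile> is_trunc 0 (Sig F T)"
    and b: "A # \<Gamma> \<turnstile> b \<Colon> F" and t: "A # \<Gamma> \<turnstile> t \<Colon> subst (b \<cdot> S 0) T"
    and C: "isty (pointwise A T # Prd A F # \<Gamma>) C"
    and base: "\<Gamma> \<Turnstile> subst (Lam A t \<cdot> Lam A b \<cdot> S 0) C"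
    and g: "\<Gamma> \<turnstile> g \<Colon> Prd A F" and r: "\<Gamma> \<turnstile> r \<Colon> Prd A (subst (App (w1 g) v0 \<cdot> S 0) T)"
  shows "\<Gamma> \<Turnstile> subst (r \<cdot> g \<cdot> S 0) C"
proof -
  have c: "ctx \<Gamma>" using A by (rule typing_ctx)
  let ?T = "Prd A (Sig F T)"
  have ST: "A # \<Gamma> \<turnstile> Sig F T \<Colon> Univ i" by (rule sig_form[OF F T])
  have TT: "\<Gamma> \<turnstile> ?T \<Colon> Univ i" by (rule prd_form[OF A ST])
  have P: "\<Gamma> \<turnstile> Prd A F \<Colon> Univ i" by (insert A F c, (assumption | rule tys, assumption | rule ty | simp)+)
  note g' = eta[OF istyI[OF A] g] and r' = eta[OF istyI[OF A] r]
  let ?k0 = "Lam A (Dpair b t)" and ?l = "Lam A (Dpair (App (w1 g) v0) (App (w1 r) v0))"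
  have k0: "\<Gamma> \<turnstile> ?k0 \<Colon> ?T" and k1: "\<Gamma> \<turnstile> ?l \<Colon> ?T"
    by (rule pair_fun[OF A F T b t], rule pair_fun[OF A F T g'(2) r'(2)])
  \<comment> \<open>By weak function extensionality any two functions into the contractible sums are
    equal: here the one paired from \<open>b\<close> and \<open>t\<close>, and the one paired from
    \<open>g\<close> and \<open>r\<close>.\<close>
  have path: "\<Gamma> \<Turnstile> IdT ?T ?k0 ?l"
    by (rule contr_eq[OF weak_funext[OF A ST contr] istyI[OF TT] k0 k1])
  \<comment> \<open>\<open>C\<close> is transported in the form of a family over single functions
    into the sum, through the two componentwise projections. On a paired function these return the
    components judgmentally, which is needed at both ends.\<close>
  have el: "eqty \<Gamma> (subst (lsnd A F T (Lam A (Dpair x y)) \<cdot> lfst A F (Lam A (Dpair x y)) \<cdot> S 0) C) (subst (r \<cdot> g \<cdot> S 0) C)"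
    if x: "A # \<Gamma> \<turnstile> x \<Colon> F" and y: "A # \<Gamma> \<turnstile> y \<Colon> subst (x \<cdot> S 0) T" and g: "\<Gamma> \<turnstile> g \<Colon> Prd A F"
      and r: "\<Gamma> \<turnstile> r \<Colon> Prd A (subst (App (w1 g) v0 \<cdot> S 0) T)"
      and xg: "\<Gamma> \<turnstile> Lam A x \<doteq> g \<Colon> Prd A F" and yr: "\<Gamma> \<turnstile> Lam A y \<doteq> r \<Colon> Prd A (subst (App (w1 g) v0 \<cdot> S 0) T)"
    for x y g r
  proof (rule functionality2[OF C])
    note k = pair_fun[OF A F T x y]
    show e: "\<Gamma> \<turnstile> lfst A F (Lam A (Dpair x y)) \<doteq> g \<Colon> Prd A F" by (rule eq_trans[OF lfst_pair[OF A F T x y] xg])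
    show 1: "\<Gamma> \<turnstile> lfst A F (Lam A (Dpair x y)) \<Colon> Prd A F" by (rule lfst_typing[OF A F T k])
    show "\<Gamma> \<turnstile> g \<Colon> Prd A F" by (rule g)
    show "isty \<Gamma> (Prd A F)" "isty (Prd A F # \<Gamma>) (pointwise A T)" by (rule istyI P pointwise_form[OF A F T])+
    show "\<Gamma> \<turnstile> r \<Colon> subst (g \<cdot> s0) (pointwise A T)" using r by simp
    show "\<Gamma> \<turnstile> lsnd A F T (Lam A (Dpair x y)) \<Colon> subst (lfst A F (Lam A (Dpair x y)) \<cdot> s0) (pointwise A T)"
      using lsnd_typing[OF A F T k] by simp
    have "eqty \<Gamma> (Prd A (subst (App (w1 g) v0 \<cdot> S 0) T)) (Prd A (subst (App (w1 (lfst A F (Lam A (Dpair x y)))) v0 \<cdot> S 0) T))"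
      using functionality[OF istyI[OF pointwise_form[OF A F T]] eq_sym[OF e] g 1 istyI[OF P]] by simp
    from eq_trans[OF lsnd_pair[OF A F T x y] jeq_conv[OF yr this]]
    show "\<Gamma> \<turnstile> lsnd A F T (Lam A (Dpair x y)) \<doteq> r \<Colon> subst (lfst A F (Lam A (Dpair x y)) \<cdot> s0) (pointwise A T)" by simp
  qed
  have 0: "\<Gamma> \<Turnstile> subst (lsnd A F T ?k0 \<cdot> lfst A F ?k0 \<cdot> S 0) C"
  proof (rule inh_conv[OF base eqty_sym[OF el[OF b t]]])
    show lb: "\<Gamma> \<turnstile> Lam A b \<Colon> Prd A F" by (rule lam_typing[OF istyI[OF A] b])
    then show "\<Gamma> \<turnstile> Lam A b \<doteq> Lam A b \<Colon> Prd A F" by (rule eq_refl)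
    have "A # \<Gamma> \<turnstile> t \<Colon> subst (App (w1 (Lam A b)) v0 \<cdot> S 0) T"
      by (rule typing_conv[OF t functionality[OF istyI[OF T] eq_sym[OF beta_v0[OF istyI[OF A] b]] b
            eta(2)[OF istyI[OF A] lb] istyI[OF F]]])
    then show "\<Gamma> \<turnstile> Lam A t \<Colon> Prd A (subst (App (w1 (Lam A b)) v0 \<cdot> S 0) T)"
      by (rule lam_typing[OF istyI[OF A]])
    then show "\<Gamma> \<turnstile> Lam A t \<doteq> Lam A t \<Colon> Prd A (subst (App (w1 (Lam A b)) v0 \<cdot> S 0) T)"
      by (rule eq_refl)
  qed
  let ?F = "subst (v0 \<cdot> s2) F" and ?U = "subst (v0 \<cdot> v1 \<cdot> s3) T"
  let ?f = "Lam (w1 A) (Fst ?F (App v1 v0))" and ?s = "Lam (w1 A) (Snd ?F ?U (App v1 v0))"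
  have "\<Gamma> \<Turnstile> subst (lsnd A F T ?l \<cdot> lfst A F ?l \<cdot> S 0) C"
  proof (rule transport'[OF path, where C = "subst (?s \<cdot> ?f \<cdot> s1) C"])
    let ?G = "?T # \<Gamma>"
    have A1: "?G \<turnstile> w1 A \<Colon> Univ i" and F1: "w1 A # ?G \<turnstile> ?F \<Colon> Univ i"
      and T1: "?F # w1 A # ?G \<turnstile> ?U \<Colon> Univ i"
      and k: "?G \<turnstile> v0 \<Colon> Prd (w1 A) (Sig ?F ?U)"
      by (insert A F T c TT, (assumption | rule tys, assumption | rule ty | simp)+)
    show "isty (?T # \<Gamma>) (subst (?s \<cdot> ?f \<cdot> s1) C)"
      by (rule isty_subst[OF C], intro substs_cons' substs_S)
        (insert lfst_typing[OF A1 F1 T1 k] lsnd_typing[OF A1 F1 T1 k] ctx_ext[OF TT], simp_all)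
  qed (use 0 istyI[OF TT] k0 k1 in simp_all)
  then show ?thesis
    by (rule inh_conv[OF _ el[OF g'(2) r'(2) g r eq_sym[OF g'(1)] eq_sym[OF r'(1)]]])
qed

context
  fixes \<Gamma> A i F b
  assumes A: "\<Gamma> \<turnstile> A \<Colon> Univ i" and F: "A # \<Gamma> \<turnstile> F \<Colon> Univ i" and b: "A # \<Gamma> \<turnstile> b \<Colon> F"
begin

lemma fibT_form: "F # A # \<Gamma> \<turnstile> fibT F b \<Colon> Univ i"
  by (insert A F b typing_ctx[OF A], (assumption | rule tys, assumption | rule ty | simp)+)

lemma htpy_form: "Prd A F # \<Gamma> \<turnstile> (htpy A F b) \<Colon> Univ i"
  using pointwise_form[OF A F fibT_form] by simp

text \<open>The choice principle for the family of paths out of \<open>b\<close>, whose total space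
  is contractible as a singleton.\<close>

lemma funext_elim:
  assumes "isty (htpy A F b # Prd A F # \<Gamma>) C"
    and "\<Gamma> \<Turnstile> subst (Lam A (Refl b) \<cdot> Lam A b \<cdot> S 0) C"
    and "\<Gamma> \<turnstile> g \<Colon> Prd A F" and "\<Gamma> \<turnstile> r \<Colon> Prd A (IdT F b (App (w1 g) v0))"
  shows "\<Gamma> \<Turnstile> subst (r \<cdot> g \<cdot> S 0) C"
  by (rule choice_elim[OF A F fibT_form singleton_contr[OF istyI[OF F] b] b, of "Refl b"])
    (use assms refl_typing[OF istyI[OF F] b refl refl] in simp_all)

end

text \<open>An elimination over the variables g and r follows from the pointwise form: take it in
  the context extended by g and r, at these very variables.\<close>

lemma idsys_funext:
  assumes A: "\<Gamma> \<turnstile> A \<Colon> Univ i" and F: "A # \<Gamma> \<turnstile> F \<Colon> Univ i" and b: "A # \<Gamma> \<turnstile> b \<Colon> F"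
  shows "idsys \<Gamma> (Prd A F) (Lam A b) (htpy A F b) (Lam A (Refl b))"
  unfolding idsys_def
proof (intro allI impI)
  fix C assume C: "isty (htpy A F b # Prd A F # \<Gamma>) C"
    and base: "\<Gamma> \<Turnstile> subst (Lam A (Refl b) \<cdot> Lam A b \<cdot> S 0) C"
  have c: "ctx \<Gamma>" using A by (rule typing_ctx)
  let ?G = "htpy A F b # Prd A F # \<Gamma>"
  have H: "isty (Prd A F # \<Gamma>) (htpy A F b)" by (rule istyI[OF htpy_form[OF A F b]])
  have G: "ctx ?G" using H by (rule ctx_cons)
  let ?F = "subst (v0 \<cdot> s3) F" and ?b = "subst (v0 \<cdot> s3) b"
  have A2: "?G \<turnstile> w2 A \<Colon> Univ i" and F2: "w2 A # ?G \<turnstile> ?F \<Colon> Univ i" and b2: "w2 A # ?G \<turnstile> ?b \<Colon> ?F"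
    and g: "?G \<turnstile> v1 \<Colon> Prd (w2 A) ?F"
    and r: "?G \<turnstile> v0 \<Colon> Prd (w2 A) (IdT ?F ?b (App (w1 v1) v0))"
    by (insert A F b c G, (assumption | rule tys, assumption | rule ty | simp)+)
  let ?C = "subst (v0 \<cdot> v1 \<cdot> s4) C"
  have C2: "isty (htpy (w2 A) ?F ?b # Prd (w2 A) ?F # ?G) ?C"
  proof (rule isty_subst[OF C], intro substs_cons' substs_S)
    have c2: "ctx (htpy (w2 A) ?F ?b # Prd (w2 A) ?F # ?G)"
      by (rule ctx_ext[OF htpy_form[OF A2 F2 b2]])
    then show "ctx (htpy (w2 A) ?F ?b # Prd (w2 A) ?F # ?G)" .
    show "htpy (w2 A) ?F ?b # Prd (w2 A) ?F # ?G \<turnstile> v1 \<Colon> subst s4 (Prd A F)"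
      "htpy (w2 A) ?F ?b # Prd (w2 A) ?F # ?G \<turnstile> v0 \<Colon> subst (v1 \<cdot> s4) (htpy A F b)"
      by (rule var'[OF c2]; simp)+
  qed simp_all
  have "?G \<Turnstile> subst (Lam (w2 A) (Refl ?b) \<cdot> Lam (w2 A) ?b \<cdot> s0) ?C"
    by (rule inh_subst[OF base substs_S[OF G, of 2]]) simp_all
  from funext_elim[OF A2 F2 b2 C2 this g r] show "?G \<Turnstile> C" by simp
qed

text \<open>In the family of paths into \<open>y\<close>, transport along q is composition with the
  inverse of q; applied to q itself it cancels.\<close>

lemma Tr_loop_cancel:
  assumes A: "isty \<Gamma> A" and a: "\<Gamma> \<turnstile> a \<Colon> A" and y: "\<Gamma> \<turnstile> y \<Colon> A" and q: "\<Gamma> \<turnstile> q \<Colon> IdT A a y"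
  shows "\<Gamma> \<Turnstile> IdT (IdT A y y) (Tr (IdT (w1 A) v0 (w1 y)) a y q q) (Refl y)"
proof -
  have ctx: "ctx \<Gamma>" using a by (rule typing_ctx)
  let ?G = "IdT (w1 A) (w1 a) v0 # A # \<Gamma>"
  have I: "isty (A # \<Gamma>) (IdT (w1 A) (w1 a) v0)" by (insert A a ctx, (assumption | rule tys, assumption | rule ty | simp)+)
  have A2: "isty ?G (w2 A)" "?G \<turnstile> w2 a \<Colon> w2 A" "?G \<turnstile> v1 \<Colon> w2 A" "?G \<turnstile> v0 \<Colon> IdT (w2 A) (w2 a) v1"
      "isty (w2 A # ?G) (IdT (w3 A) v0 v2)" "?G \<turnstile> Refl v1 \<Colon> IdT (w2 A) v1 v1"
    by (insert A a I ctx, (assumption | rule tys, assumption | rule ty | simp)+)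
  have t: "?G \<turnstile> Tr (IdT (w3 A) v0 v2) (w2 a) v1 v0 v0 \<Colon> IdT (w2 A) v1 v1"
    using Tr_typing[OF A2(1,5,2-4), of v0] A2(4) by simp
  have M: "isty ?G (IdT (IdT (w2 A) v1 v1) (Tr (IdT (w3 A) v0 v2) (w2 a) v1 v0 v0) (Refl v1))"
    by (rule isty_Id[OF isty_Id[OF A2(1,3,3)] t A2(6)])
  have r: "\<Gamma> \<turnstile> Refl a \<Colon> IdT A a a" by (rule refl_typing[OF A a refl refl])
  have A1: "isty (A # \<Gamma>) (IdT (w1 A) v0 (w1 a))" by (insert A a ctx, (assumption | rule tys, assumption | rule ty | simp)+)
  have t0: "\<Gamma> \<turnstile> Tr (IdT (w1 A) v0 (w1 a)) a a (Refl a) (Refl a) \<Colon> IdT A a a"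
    using Tr_typing[OF A A1 a a r, of "Refl a"] r by simp
  have e: "\<Gamma> \<turnstile> Tr (IdT (w1 A) v0 (w1 a)) a a (Refl a) (Refl a) \<doteq> Refl a \<Colon> IdT A a a"
    using Tr_refl[OF A A1 a, of "Refl a"] r by simp
  have base: "\<Gamma> \<Turnstile> IdT (IdT A a a) (Tr (IdT (w1 A) v0 (w1 a)) a a (Refl a) (Refl a)) (Refl a)"
    by (rule id_jeq[OF isty_Id[OF A a a] t0 e])
  show ?thesis
    by (rule based_J'[OF q _ A a y M]) (use base in simp_all)
qed

section \<open>The fundamental theorem of identity types\<close>

context
  fixes \<Gamma> A a R r0
  assumes A: "isty \<Gamma> A" and a: "\<Gamma> \<turnstile> a \<Colon> A" and R: "isty (A # \<Gamma>) R" and r0: "\<Gamma> \<turnstile> r0 \<Colon> subst (a \<cdot> S 0) R"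
begin

lemma encode_typing:
  assumes "\<Gamma> \<turnstile> y \<Colon> A" "\<Gamma> \<turnstile> p \<Colon> IdT A a y"
  shows "\<Gamma> \<turnstile> Tr R a y p r0 \<Colon> subst (y \<cdot> S 0) R"
  by (rule Tr_typing[OF A R a assms r0])

lemma decode_typing:
  assumes q: "R # A # \<Gamma> \<turnstile> q \<Colon> IdT (w2 A) (w2 a) v1" and y: "\<Gamma> \<turnstile> y \<Colon> A" and r: "\<Gamma> \<turnstile> r \<Colon> subst (y \<cdot> S 0) R"
  shows "\<Gamma> \<turnstile> subst (r \<cdot> y \<cdot> S 0) q \<Colon> IdT A a y"
  by (rule typing_subst[OF q]) (insert y r typing_ctx[OF y], (assumption | rule tys, assumption | rule ty | simp)+)

lemma cancel_typing:
  assumes y: "\<Gamma> \<turnstile> y \<Colon> A" and q0: "\<Gamma> \<turnstile> q0 \<Colon> IdT A a a" and q1: "\<Gamma> \<turnstile> q1 \<Colon> IdT A a y"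
  shows "\<Gamma> \<turnstile> Tr (IdT (w1 A) v0 (w1 y)) a a q0 q1 \<Colon> IdT A a y"
proof -
  have "isty (A # \<Gamma>) (IdT (w1 A) v0 (w1 y))" by (insert A y typing_ctx[OF y], (assumption | rule tys, assumption | rule ty | simp)+)
  from Tr_typing[OF A this a a q0, of q1] q1 show ?thesis by simp
qed

end

text \<open>A decoding \<open>q\<close> need not send \<open>r0\<close> to reflexivity, but only to
  some loop. Composition with the inverse of that loop, expressed as a transport, normalises it;
  then path induction on \<open>p\<close> succeeds.\<close>

lemma decode_encode:
  assumes A: "isty \<Gamma> A" and a: "\<Gamma> \<turnstile> a \<Colon> A" and R: "isty (A # \<Gamma>) R" and r0: "\<Gamma> \<turnstile> r0 \<Colon> subst (a \<cdot> S 0) R"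
    and q: "R # A # \<Gamma> \<turnstile> q \<Colon> IdT (w2 A) (w2 a) v1" and y: "\<Gamma> \<turnstile> y \<Colon> A" and p: "\<Gamma> \<turnstile> p \<Colon> IdT A a y"
  shows "\<Gamma> \<Turnstile> IdT (IdT A a y)
    (Tr (IdT (w1 A) v0 (w1 y)) a a (subst (r0 \<cdot> a \<cdot> S 0) q) (subst (Tr R a y p r0 \<cdot> y \<cdot> S 0) q)) p"
proof -
  have ctx: "ctx \<Gamma>" using a by (rule typing_ctx)
  let ?loop = "subst (r0 \<cdot> a \<cdot> S 0) q"
  have q0: "\<Gamma> \<turnstile> ?loop \<Colon> IdT A a a" by (rule decode_typing[OF A a R r0 q a r0])
  have ra: "\<Gamma> \<turnstile> Refl a \<Colon> IdT A a a" by (rule refl_typing[OF A a refl refl])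
  let ?G = "IdT (w1 A) (w1 a) v0 # A # \<Gamma>"
  have I: "isty (A # \<Gamma>) (IdT (w1 A) (w1 a) v0)" by (insert A a ctx, (assumption | rule tys, assumption | rule ty | simp)+)
  let ?R = "subst (v0 \<cdot> s3) R" and ?q = "subst (v0 \<cdot> v1 \<cdot> s4) q"
  have 2: "isty ?G (w2 A)" "?G \<turnstile> w2 a \<Colon> w2 A" "isty (w2 A # ?G) ?R"
    "?G \<turnstile> w2 r0 \<Colon> subst (w2 a \<cdot> S 0) ?R" "?R # w2 A # ?G \<turnstile> ?q \<Colon> IdT (w2 (w2 A)) (w2 (w2 a)) v1"
    "?G \<turnstile> v1 \<Colon> w2 A" "?G \<turnstile> v0 \<Colon> IdT (w2 A) (w2 a) v1" "?G \<turnstile> w2 ?loop \<Colon> IdT (w2 A) (w2 a) (w2 a)"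
    by (insert A a R r0 q I ctx q0, (assumption | rule tys, assumption | rule ty | simp)+)
  let ?C = "IdT (IdT (w2 A) (w2 a) v1)
    (Tr (IdT (w3 A) v0 v2) (w2 a) (w2 a) (w2 ?loop) (subst (Tr ?R (w2 a) v1 v0 (w2 r0) \<cdot> v1 \<cdot> S 0) ?q)) v0"
  have M: "isty ?G ?C"
    using isty_Id[OF isty_Id[OF 2(1,2,6)] cancel_typing[OF 2(1-4,6,8) decode_typing[OF 2(1-6)
      encode_typing[OF 2(1-4,6,7)]]] 2(7)] by simp
  have e: "\<Gamma> \<turnstile> Tr R a a (Refl a) r0 \<doteq> r0 \<Colon> subst (a \<cdot> S 0) R"
    by (rule Tr_refl[OF A R a r0])
  note er = encode_typing[OF A a R r0 a ra]
  \<comment> \<open>At reflexivity the encoding reduces to \<open>r0\<close>, so what remains is the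
    cancellation of the loop against itself.\<close>
  let ?K = "IdT (IdT A a a) (Tr (IdT (w1 A) v0 (w1 a)) a a ?loop ?loop) (Refl a)"
  let ?Ra = "subst (a \<cdot> S 0) R"
  have Ra: "isty \<Gamma> ?Ra" by (rule isty_subst[OF R]) (insert A a ctx, (assumption | rule tys, assumption | rule ty | simp)+)
  have q': "?Ra # \<Gamma> \<turnstile> subst (v0 \<cdot> w1 a \<cdot> s1) q \<Colon> IdT (w1 A) (w1 a) (w1 a)"
    by (rule typing_subst[OF q]) (insert A a Ra ctx, (assumption | rule tys, assumption | rule ty | simp)+)
  have Aa: "isty (?Ra # \<Gamma>) (w1 A)" "?Ra # \<Gamma> \<turnstile> w1 a \<Colon> w1 A" "isty (w1 A # ?Ra # \<Gamma>) (subst (v0 \<cdot> s2) R)"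
    "?Ra # \<Gamma> \<turnstile> w1 r0 \<Colon> subst (w1 a \<cdot> S 0) (subst (v0 \<cdot> s2) R)"
    "?Ra # \<Gamma> \<turnstile> w1 ?loop \<Colon> IdT (w1 A) (w1 a) (w1 a)" "?Ra # \<Gamma> \<turnstile> Refl (w1 a) \<Colon> IdT (w1 A) (w1 a) (w1 a)"
    by (insert A a R r0 Ra ctx q0, (assumption | rule tys, assumption | rule ty | simp)+)
  let ?C2 = "IdT (IdT (w1 A) (w1 a) (w1 a)) (Tr (IdT (w2 A) v0 (w2 a)) (w1 a) (w1 a) (w1 ?loop) (subst (v0 \<cdot> w1 a \<cdot> s1) q)) (Refl (w1 a))"
  have C2: "isty (?Ra # \<Gamma>) ?C2"
    using isty_Id[OF isty_Id[OF Aa(1,2,2)] cancel_typing[OF Aa(1-4,2,5) q'] Aa(6)] by simp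
  have "\<Gamma> \<Turnstile> ?K" using Tr_loop_cancel[OF A a a q0] .
  moreover have "eqty \<Gamma> ?K (IdT (IdT A a a) (Tr (IdT (w1 A) v0 (w1 a)) a a ?loop (subst (Tr R a a (Refl a) r0 \<cdot> a \<cdot> S 0) q)) (Refl a))"
    using functionality[OF C2 eq_sym[OF e] r0 er Ra] by simp
  ultimately have base: "\<Gamma> \<Turnstile> IdT (IdT A a a) (Tr (IdT (w1 A) v0 (w1 a)) a a ?loop (subst (Tr R a a (Refl a) r0 \<cdot> a \<cdot> S 0) q)) (Refl a)"
    by (rule inh_conv)
  show ?thesis
    by (rule based_J'[OF p _ A a y M]) (use base in simp_all)
qed

text \<open>For variables x and y, the paths from (a, b) to (x, y): a path in the base and one in
  the fibre over its endpoint. It serves both for sums and, with an identity system as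
  \<open>B\<close>, for the comparison of that system with the identity type.\<close>

abbreviation dpath :: "tm \<Rightarrow> tm \<Rightarrow> tm \<Rightarrow> tm \<Rightarrow> tm" where
  "dpath A B a b \<equiv> Sig (IdT (w2 A) (w2 a) v1)
     (IdT (subst (v2 \<cdot> s3) B) (Tr (subst (v0 \<cdot> s4) B) (w3 a) v2 v0 (w3 b)) v1)"

context
  fixes \<Gamma> A B a b i
  assumes A: "\<Gamma> \<turnstile> A \<Colon> Univ i" and B: "A # \<Gamma> \<turnstile> B \<Colon> Univ i"
    and a: "\<Gamma> \<turnstile> a \<Colon> A" and b: "\<Gamma> \<turnstile> b \<Colon> subst (a \<cdot> S 0) B"
begin

lemma dpath_Tr:
  assumes "\<Gamma> \<turnstile> x \<Colon> A" "\<Gamma> \<turnstile> q \<Colon> IdT A a x"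
  shows "\<Gamma> \<turnstile> Tr B a x q b \<Colon> subst (x \<cdot> S 0) B"
  by (rule Tr_typing[OF istyI[OF A] istyI[OF B] a assms b])

lemma fib_form: "\<Gamma> \<turnstile> x \<Colon> A \<Longrightarrow> \<Gamma> \<turnstile> subst (x \<cdot> S 0) B \<Colon> Univ i"
  by (frule typing_ctx, rule typing_subst[OF B]) (insert A, (assumption | rule tys, assumption | rule ty | simp)+)

end

lemma dpath_fib:
  assumes A: "\<Gamma> \<turnstile> A \<Colon> Univ i" and B: "A # \<Gamma> \<turnstile> B \<Colon> Univ i"
    and a: "\<Gamma> \<turnstile> a \<Colon> A" and b: "\<Gamma> \<turnstile> b \<Colon> subst (a \<cdot> S 0) B"
  shows "IdT (w2 A) (w2 a) v1 # B # A # \<Gamma> \<turnstile>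
    IdT (subst (v2 \<cdot> s3) B) (Tr (subst (v0 \<cdot> s4) B) (w3 a) v2 v0 (w3 b)) v1 \<Colon> Univ i"
proof -
  let ?G = "IdT (w2 A) (w2 a) v1 # B # A # \<Gamma>"
  have c: "ctx \<Gamma>" using A by (rule typing_ctx)
  have I: "isty (B # A # \<Gamma>) (IdT (w2 A) (w2 a) v1)" by (insert A B a c, (assumption | rule tys, assumption | rule ty | simp)+)
  have 3: "?G \<turnstile> w3 A \<Colon> Univ i" "w3 A # ?G \<turnstile> subst (v0 \<cdot> s4) B \<Colon> Univ i" "?G \<turnstile> w3 a \<Colon> w3 A"
    "?G \<turnstile> w3 b \<Colon> subst (w3 a \<cdot> S 0) (subst (v0 \<cdot> s4) B)" "?G \<turnstile> v2 \<Colon> w3 A" "?G \<turnstile> v0 \<Colon> IdT (w3 A) (w3 a) v2"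
    "?G \<turnstile> v1 \<Colon> subst (v2 \<cdot> s3) B"
    by (insert A B a b I c, (assumption | rule tys, assumption | rule ty | simp)+)
  show ?thesis
    using id_form[OF fib_form[OF 3(1-5)] dpath_Tr[OF 3(1-6)], of v1] 3(7) by simp
qed

lemma dpath_form:
  assumes A: "\<Gamma> \<turnstile> A \<Colon> Univ i" and B: "A # \<Gamma> \<turnstile> B \<Colon> Univ i"
    and a: "\<Gamma> \<turnstile> a \<Colon> A" and b: "\<Gamma> \<turnstile> b \<Colon> subst (a \<cdot> S 0) B"
  shows "B # A # \<Gamma> \<turnstile> dpath A B a b \<Colon> Univ i"
  by (rule sig_form[OF _ dpath_fib[OF assms]]) (insert A B a typing_ctx[OF A], (assumption | rule tys, assumption | rule ty | simp)+)

lemma dpath_pair: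
  assumes A: "\<Gamma> \<turnstile> A \<Colon> Univ i" and B: "A # \<Gamma> \<turnstile> B \<Colon> Univ i"
    and a: "\<Gamma> \<turnstile> a \<Colon> A" and b: "\<Gamma> \<turnstile> b \<Colon> subst (a \<cdot> S 0) B"
    and x: "\<Gamma> \<turnstile> x \<Colon> A" and y: "\<Gamma> \<turnstile> y \<Colon> subst (x \<cdot> S 0) B" and q: "\<Gamma> \<turnstile> q \<Colon> IdT A a x"
    and s: "\<Gamma> \<turnstile> s \<Colon> IdT (subst (x \<cdot> S 0) B) (Tr B a x q b) y"
  shows "\<Gamma> \<turnstile> Dpair q s \<Colon> subst (y \<cdot> x \<cdot> S 0) (dpath A B a b)"
proof -
  note c = typing_ctx[OF A]
  have I: "isty \<Gamma> (IdT A a x)" by (insert A a x c, (assumption | rule tys, assumption | rule ty | simp)+)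
  let ?I = "IdT (subst (w1 x \<cdot> s1) B) (Tr (subst (v0 \<cdot> s2) B) (w1 a) (w1 x) v0 (w1 b)) (w1 y)"
  have "isty (IdT A a x # \<Gamma>) (subst (v0 \<cdot> w1 y \<cdot> w1 x \<cdot> s1)
      (IdT (subst (v2 \<cdot> s3) B) (Tr (subst (v0 \<cdot> s4) B) (w3 a) v2 v0 (w3 b)) v1))"
    by (rule isty_subst[OF istyI[OF dpath_fib[OF A B a b]]]) (insert A B a x y I c, (assumption | rule tys, assumption | rule ty | simp)+)
  then have "isty (IdT A a x # \<Gamma>) ?I" by simp
  then show ?thesis
    using pair_typing[OF _ q, of ?I s] s by simp
qed

text \<open>Transport along reflexivity is judgmentally trivial, so the second component is \<open>Refl b\<close>.\<close>

lemma
  assumes A: "\<Gamma> \<turnstile> A \<Colon> Univ i" and B: "A # \<Gamma> \<turnstile> B \<Colon> Univ i"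
    and a: "\<Gamma> \<turnstile> a \<Colon> A" and b: "\<Gamma> \<turnstile> b \<Colon> subst (a \<cdot> S 0) B"
  shows dpath_refl_fib: "\<And>y. \<Gamma> \<turnstile> y \<Colon> subst (a \<cdot> S 0) B \<Longrightarrow>
      eqty \<Gamma> (IdT (subst (a \<cdot> S 0) B) (Tr B a a (Refl a) b) y) (IdT (subst (a \<cdot> S 0) B) b y)"
    and dpath_refl: "\<Gamma> \<turnstile> Dpair (Refl a) (Refl b) \<Colon> subst (b \<cdot> a \<cdot> S 0) (dpath A B a b)"
proof -
  have Ba: "isty \<Gamma> (subst (a \<cdot> S 0) B)" by (rule istyI[OF fib_form[OF A B a b a]])
  show e: "eqty \<Gamma> (IdT (subst (a \<cdot> S 0) B) (Tr B a a (Refl a) b) y) (IdT (subst (a \<cdot> S 0) B) b y)"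
    if "\<Gamma> \<turnstile> y \<Colon> subst (a \<cdot> S 0) B" for y
    by (rule eqty_Id[OF Ba Tr_refl[OF istyI[OF A] istyI[OF B] a b] eq_refl[OF that]])
  show "\<Gamma> \<turnstile> Dpair (Refl a) (Refl b) \<Colon> subst (b \<cdot> a \<cdot> S 0) (dpath A B a b)"
    by (rule dpath_pair[OF A B a b a b refl_typing[OF istyI[OF A] a refl refl]
          typing_conv[OF refl_typing[OF Ba b refl refl] eqty_sym[OF e[OF b]]]])
qed

section \<open>Pointed equivalences\<close>

text \<open>Eliminating into \<open>dpath A R a r0\<close> yields at once a decoding and the proof
  that encoding inverts it on one side. On the other side the decoding has to be corrected by the
  loop at \<open>r0\<close>; bi-invertible maps may have two different inverses, so the correction
  need not be compared with the original.\<close>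

lemma idsys_isequiv:
  assumes A: "\<Gamma> \<turnstile> A \<Colon> Univ i" and R: "A # \<Gamma> \<turnstile> R \<Colon> Univ i"
    and a: "\<Gamma> \<turnstile> a \<Colon> A" and r0: "\<Gamma> \<turnstile> r0 \<Colon> subst (a \<cdot> S 0) R"
    and ids: "idsys \<Gamma> A a R r0" and y: "\<Gamma> \<turnstile> y \<Colon> A"
  defines "f \<equiv> Tr (subst (v0 \<cdot> s2) R) (w1 a) (w1 y) v0 (w1 r0)"
  shows "IdT A a y # \<Gamma> \<turnstile> f \<Colon> w1 (subst (y \<cdot> S 0) R)"
    and "\<Gamma> \<Turnstile> Isequiv (IdT A a y) (subst (y \<cdot> S 0) R) (Lam (IdT A a y) f)"
proof -
  note c = typing_ctx[OF A] and A0 = istyI[OF A] and R0 = istyI[OF R]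
  let ?G = "R # A # \<Gamma>"
  have "?G \<Turnstile> dpath A R a r0"
    using ids istyI[OF dpath_form[OF A R a r0]] inhI[OF dpath_refl[OF A R a r0]]
    unfolding idsys_def by blast
  moreover have "isty ?G (IdT (w2 A) (w2 a) v1)" by (insert A R a c, (assumption | rule tys, assumption | rule ty | simp)+)
  ultimately
  obtain q where q: "?G \<turnstile> q \<Colon> IdT (w2 A) (w2 a) v1"
    and p: "?G \<Turnstile> subst (q \<cdot> S 0) (IdT (subst (v2 \<cdot> s3) R) (Tr (subst (v0 \<cdot> s4) R) (w3 a) v2 v0 (w3 r0)) v1)"
    by (rule inh_sigE[OF _ _ istyI[OF dpath_fib[OF A R a r0]]])
  let ?Ry = "subst (y \<cdot> S 0) R" and ?I = "IdT A a y"
  have Ry: "\<Gamma> \<turnstile> ?Ry \<Colon> Univ i" by (rule fib_form[OF A R a r0 y])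
  have I: "\<Gamma> \<turnstile> ?I \<Colon> Univ i" by (rule id_form[OF A a y])
  let ?g = "subst (v0 \<cdot> w1 y \<cdot> s1) q" and ?l = "subst (r0 \<cdot> a \<cdot> S 0) q"
  let ?h = "Tr (IdT (w2 A) v0 (w2 y)) (w1 a) (w1 a) (w1 ?l) ?g"
  have l: "\<Gamma> \<turnstile> ?l \<Colon> IdT A a a" by (rule decode_typing[OF A0 a R0 r0 q a r0])
  have gen: "isty (X # \<Gamma>) (w1 A)" "X # \<Gamma> \<turnstile> w1 a \<Colon> w1 A" "isty (w1 A # X # \<Gamma>) (subst (v0 \<cdot> s2) R)"
    "X # \<Gamma> \<turnstile> w1 r0 \<Colon> subst (w1 a \<cdot> S 0) (subst (v0 \<cdot> s2) R)"
    "subst (v0 \<cdot> s2) R # w1 A # X # \<Gamma> \<turnstile> subst (v0 \<cdot> v1 \<cdot> s3) q \<Colon> IdT (w2 (w1 A)) (w2 (w1 a)) v1"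
    "X # \<Gamma> \<turnstile> w1 y \<Colon> w1 A" "X # \<Gamma> \<turnstile> w1 ?l \<Colon> IdT (w1 A) (w1 a) (w1 a)" if X: "isty \<Gamma> X" for X
    by (insert A R a r0 q y l X c, (assumption | rule tys, assumption | rule ty | simp)+)
  note gI = gen[OF istyI[OF I]] and gR = gen[OF istyI[OF Ry]]
  have vI: "?I # \<Gamma> \<turnstile> v0 \<Colon> IdT (w1 A) (w1 a) (w1 y)" and vR: "?Ry # \<Gamma> \<turnstile> v0 \<Colon> subst (w1 y \<cdot> S 0) (subst (v0 \<cdot> s2) R)"
    by (insert A R a y istyI[OF I] istyI[OF Ry] c, (assumption | rule tys, assumption | rule ty | simp)+)
  show f: "?I # \<Gamma> \<turnstile> f \<Colon> w1 ?Ry"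
    using encode_typing[OF gI(1-4) gI(6) vI] unfolding f_def by simp
  have g: "?Ry # \<Gamma> \<turnstile> ?g \<Colon> w1 ?I"
    using decode_typing[OF gR(1-6) vR] by simp
  have h: "?Ry # \<Gamma> \<turnstile> ?h \<Colon> w1 ?I"
    using cancel_typing[OF gR(1-4) gR(6,7), of ?g] g by simp
  show "\<Gamma> \<Turnstile> Isequiv ?I ?Ry (Lam ?I f)"
  proof (rule Isequiv_Lam[OF I Ry f g h])
    have "?Ry # \<Gamma> \<Turnstile> subst (v0 \<cdot> w1 y \<cdot> s1)
        (subst (q \<cdot> S 0) (IdT (subst (v2 \<cdot> s3) R) (Tr (subst (v0 \<cdot> s4) R) (w3 a) v2 v0 (w3 r0)) v1))"
      by (rule inh_subst[OF p _ refl]) (insert A R y istyI[OF Ry] c, (assumption | rule tys, assumption | rule ty | simp)+)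
    then show "?Ry # \<Gamma> \<Turnstile> IdT (w1 ?Ry) (subst (?g \<cdot> s1) f) v0"
      by (simp add: f_def)
    show "?I # \<Gamma> \<Turnstile> IdT (w1 ?I) (subst (f \<cdot> s1) ?h) v0"
      using decode_encode[OF gI(1-6) vI] by (simp add: f_def)
  qed
qed

text \<open>
  Equality of pointed types in Leibniz form, quantifying over families on the meta level; this makes
  it a congruence for every construction on pointed types without an identity type of pairs.
\<close>

definition peq :: "tm list \<Rightarrow> nat \<Rightarrow> tm \<Rightarrow> tm \<Rightarrow> tm \<Rightarrow> tm \<Rightarrow> bool" where
  "peq \<Gamma> i A a B b \<longleftrightarrow>
     \<Gamma> \<turnstile> A \<Colon> Univ i \<and> \<Gamma> \<turnstile> B \<Colon> Univ i \<and> \<Gamma> \<turnstile> a \<Colon> A \<and> \<Gamma> \<turnstile> b \<Colon> B \<and>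
     (\<forall>C. isty (v0 # Univ i # \<Gamma>) C \<longrightarrow> \<Gamma> \<Turnstile> subst (a \<cdot> A \<cdot> S 0) C \<longrightarrow> \<Gamma> \<Turnstile> subst (b \<cdot> B \<cdot> S 0) C)"

lemma pt_ctx: "ctx \<Gamma> \<Longrightarrow> ctx (v0 # Univ i # \<Gamma>)"
  by (rule ctx_cons isty_var | simp | assumption | rule isty_base)+

lemma peq_sym:
  assumes "peq \<Gamma> i A a B b"
  shows "peq \<Gamma> i B b A a"
proof -
  have *: "\<Gamma> \<turnstile> A \<Colon> Univ i" "\<Gamma> \<turnstile> B \<Colon> Univ i" "\<Gamma> \<turnstile> a \<Colon> A" "\<Gamma> \<turnstile> b \<Colon> B" using assms by (auto simp: peq_def)
  note c = typing_ctx[OF *(1)]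
  have "\<Gamma> \<Turnstile> subst (a \<cdot> A \<cdot> S 0) C" if C: "isty (v0 # Univ i # \<Gamma>) C" and inh: "\<Gamma> \<Turnstile> subst (b \<cdot> B \<cdot> S 0) C" for C
  proof -
    let ?T = "subst (a \<cdot> A \<cdot> S 0) C"
    \<comment> \<open>Symmetry of Leibniz equality: the family of implications back to the statement
      at (A, a) holds trivially there, hence also at (B, b).\<close>
    let ?C = "Prd C (w3 ?T)"
    have T: "isty \<Gamma> ?T" by (insert C * c, (assumption | rule tys, assumption | rule ty | simp)+)
    have M: "isty (v0 # Univ i # \<Gamma>) ?C"
      by (rule isty_Prd[OF C isty_subst[OF T substs_S[OF ctx_cons[OF C]]]]) simp_all
    have "?T # \<Gamma> \<turnstile> v0 \<Colon> w1 ?T" by (rule var'[OF ctx_cons[OF T]]) simp_all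
    from inh_Prd[OF T inhI[OF this]] have "\<Gamma> \<Turnstile> subst (a \<cdot> A \<cdot> S 0) ?C" by simp
    with assms M have "\<Gamma> \<Turnstile> subst (b \<cdot> B \<cdot> S 0) ?C" unfolding peq_def by blast
    from this[unfolded subst.simps] inh show ?thesis by (rule inh_mp) simp
  qed
  then show ?thesis using * unfolding peq_def by blast
qed

lemma peq_trans: "peq \<Gamma> i A a B b \<Longrightarrow> peq \<Gamma> i B b D d \<Longrightarrow> peq \<Gamma> i A a D d"
  unfolding peq_def by blast

lemma peq_cong:
  assumes "\<Gamma> \<turnstile> A \<doteq> B \<Colon> Univ i" "\<Gamma> \<turnstile> a \<doteq> b \<Colon> A" "\<Gamma> \<turnstile> A \<Colon> Univ i" "\<Gamma> \<turnstile> B \<Colon> Univ i" "\<Gamma> \<turnstile> a \<Colon> A" "\<Gamma> \<turnstile> b \<Colon> B"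
  shows "peq \<Gamma> i A a B b"
proof -
  note c = typing_ctx[OF assms(3)]
  have v: "isty (Univ i # \<Gamma>) v0" by (rule isty_var) (simp_all add: ctx_cons isty_base c)
  have "eqty \<Gamma> (subst (a \<cdot> A \<cdot> S 0) C) (subst (b \<cdot> B \<cdot> S 0) C)" if "isty (v0 # Univ i # \<Gamma>) C" for C
    by (rule functionality2[OF that assms(1,3,4)]) (simp_all add: assms v isty_base c)
  then show ?thesis using assms inh_conv unfolding peq_def by blast
qed

text \<open>Equivalence induction with the family \<open>C\<close> taken at the image of
  \<open>a\<close>; in the base case that image is the identity applied to \<open>a\<close>, one
  \<beta>-step away from it.\<close>

lemma equiv_peq:
  assumes A: "\<Gamma> \<turnstile> A \<Colon> Univ i" and B: "\<Gamma> \<turnstile> B \<Colon> Univ i" and f: "\<Gamma> \<turnstile> f \<Colon> arr A B" and eqv: "\<Gamma> \<Turnstile> Isequiv A B f"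
    and a: "\<Gamma> \<turnstile> a \<Colon> A" and b: "\<Gamma> \<turnstile> b \<Colon> B" and fa: "\<Gamma> \<turnstile> App f a \<doteq> b \<Colon> B"
  shows "peq \<Gamma> i A a B b"
proof -
  note c = typing_ctx[OF A]
  have fa': "\<Gamma> \<turnstile> App f a \<Colon> B" by (rule arr_app[OF f a])
  have "\<Gamma> \<Turnstile> subst (App f a \<cdot> B \<cdot> S 0) C"
    if C: "isty (v0 # Univ i # \<Gamma>) C" and inh: "\<Gamma> \<Turnstile> subst (a \<cdot> A \<cdot> S 0) C" for C
  proof -
    have h: "isty (Univ i # \<Gamma>) (Prd (w1 A) v1)" by (insert A c, (assumption | rule tys, assumption | rule ty | simp)+)
    have ap: "Prd (w1 A) v1 # Univ i # \<Gamma> \<turnstile> App v0 (w2 a) \<Colon> v1"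
      by (rule app_typing[where A = "w2 A" and B = v2]) (insert A a h c, (assumption | rule tys, assumption | rule ty | simp)+)
    have M: "isty (Prd (w1 A) v1 # Univ i # \<Gamma>) (subst (App v0 (w2 a) \<cdot> v1 \<cdot> s2) C)"
      by (rule isty_subst[OF C]) (insert ap h c, (assumption | rule tys, assumption | rule ty | simp)+)
    have id: "\<Gamma> \<turnstile> Lam A v0 \<Colon> arr A A" by (insert A c, (assumption | rule tys, assumption | rule ty | simp)+)
    have e: "\<Gamma> \<turnstile> App (Lam A v0) a \<doteq> a \<Colon> A"
      by (rule beta[where B = "w1 A"]) (insert A a c, (assumption | rule tys, assumption | rule ty | simp)+)
    have "peq \<Gamma> i A a A (App (Lam A v0) a)"
      by (rule peq_cong[OF eq_refl[OF A] eq_sym[OF e] A A a arr_app[OF id a]])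
    with C inh have "\<Gamma> \<Turnstile> subst (App (Lam A v0) a \<cdot> A \<cdot> S 0) C" unfolding peq_def by blast
    then show ?thesis
      using equiv_induct[OF A B f eqv M] by simp
  qed
  then have "peq \<Gamma> i A a B (App f a)" using A B a fa' unfolding peq_def by blast
  then show ?thesis by (rule peq_trans[OF _ peq_cong[OF eq_refl[OF B] fa B B fa' b]])
qed

lemma idsys_path:
  assumes A: "\<Gamma> \<turnstile> A \<Colon> Univ i" and R: "A # \<Gamma> \<turnstile> R \<Colon> Univ i"
    and a: "\<Gamma> \<turnstile> a \<Colon> A" and r0: "\<Gamma> \<turnstile> r0 \<Colon> subst (a \<cdot> S 0) R"
    and ids: "idsys \<Gamma> A a R r0" and y: "\<Gamma> \<turnstile> y \<Colon> A"
  shows "\<Gamma> \<Turnstile> IdT (Univ i) (IdT A a y) (subst (y \<cdot> S 0) R)"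
  using ua_path[OF id_form[OF A a y] fib_form[OF A R a r0 y]
      lam_typing[OF istyI[OF id_form[OF A a y]] idsys_isequiv(1)[OF assms]] idsys_isequiv(2)[OF assms]] .

text \<open>The equivalence is transport of \<open>r0\<close>, which computes on reflexivity, so it
  preserves the base points.\<close>

lemma idsys_peq:
  assumes A: "\<Gamma> \<turnstile> A \<Colon> Univ i" and R: "A # \<Gamma> \<turnstile> R \<Colon> Univ i"
    and a: "\<Gamma> \<turnstile> a \<Colon> A" and r0: "\<Gamma> \<turnstile> r0 \<Colon> subst (a \<cdot> S 0) R" and ids: "idsys \<Gamma> A a R r0"
  shows "peq \<Gamma> i (IdT A a a) (Refl a) (subst (a \<cdot> S 0) R) r0"
proof (rule equiv_peq[OF id_form[OF A a a] fib_form[OF A R a r0 a] _ idsys_isequiv(2)[OF assms a] _ r0])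
  note I = istyI[OF id_form[OF A a a]] and f = idsys_isequiv(1)[OF assms a]
  show "\<Gamma> \<turnstile> Lam (IdT A a a) (Tr (subst (v0 \<cdot> s2) R) (w1 a) (w1 a) v0 (w1 r0)) \<Colon> arr (IdT A a a) (subst (a \<cdot> S 0) R)"
    by (rule lam_typing[OF I f])
  show r: "\<Gamma> \<turnstile> Refl a \<Colon> IdT A a a" by (rule refl_typing[OF istyI[OF A] a refl refl])
  show "\<Gamma> \<turnstile> App (Lam (IdT A a a) (Tr (subst (v0 \<cdot> s2) R) (w1 a) (w1 a) v0 (w1 r0))) (Refl a) \<doteq> r0 \<Colon> subst (a \<cdot> S 0) R"
    by (rule eq_trans[OF beta[OF I f r] Tr_refl[OF istyI[OF A] istyI[OF R] a r0]]) simp_all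
qed

lemma univalence_peq:
  assumes A: "\<Gamma> \<turnstile> A \<Colon> Univ i"
  shows "peq \<Gamma> (Suc i) (IdT (Univ i) A A) (Refl A) (Equiv A A) (id_equiv A)"
proof (rule equiv_peq[OF _ _ idtoeqv_typing[OF A A] _ _ id_equiv_typing(2)[OF A] idtoeqv_Refl[OF A]])
  note c = typing_ctx[OF A]
  show "\<Gamma> \<turnstile> IdT (Univ i) A A \<Colon> Univ (Suc i)" "\<Gamma> \<turnstile> Refl A \<Colon> IdT (Univ i) A A" by (insert A c, (assumption | rule tys, assumption | rule ty | simp)+)
  show "\<Gamma> \<turnstile> Equiv A A \<Colon> Univ (Suc i)" by (rule univ_cumul[OF Equiv_form[OF A A]])
  show "\<Gamma> \<Turnstile> Isequiv (IdT (Univ i) A A) (Equiv A A) (idtoeqv i A A)"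
    by (rule inhI, rule app_typing[OF app_typing[OF univ_ua[OF c, unfolded univalence_def] A refl, simplified] A]) simp
qed

section \<open>Identity types of dependent sums\<close>

text \<open>
  A family over \<open>x : A, y : B x\<close> is turned into one over \<open>Sig A B\<close> by large elimination, which
  computes judgmentally on pairs.
\<close>

abbreviation uncurried :: "nat \<Rightarrow> tm \<Rightarrow> tm" where
  "uncurried i R \<equiv> SigInd (Univ i) (subst (v0 \<cdot> v1 \<cdot> s3) R) v0"

context
  fixes \<Gamma> A B i R
  assumes A: "\<Gamma> \<turnstile> A \<Colon> Univ i" and B: "A # \<Gamma> \<turnstile> B \<Colon> Univ i" and R: "B # A # \<Gamma> \<turnstile> R \<Colon> Univ i"
begin

lemma uncurried_inst:
  assumes p: "\<Gamma> \<turnstile> p \<Colon> Sig A B"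
  shows "\<Gamma> \<turnstile> SigInd (Univ i) R p \<Colon> Univ i"
  by (rule sig_elim'[OF univ_intro R p]) (simp_all add: ctx_ext[OF sig_form[OF A B]])

lemma uncurried_pair:
  assumes x: "\<Gamma> \<turnstile> x \<Colon> A" and y: "\<Gamma> \<turnstile> y \<Colon> subst (x \<cdot> S 0) B"
  shows "\<Gamma> \<turnstile> SigInd (Univ i) R (Dpair x y) \<doteq> subst (y \<cdot> x \<cdot> S 0) R \<Colon> Univ i"
  by (rule sig_comp'[OF univ_intro R x y]) (simp_all add: ctx_ext[OF sig_form[OF A B]])

end

lemma uncurried_form:
  assumes A: "\<Gamma> \<turnstile> A \<Colon> Univ i" and B: "A # \<Gamma> \<turnstile> B \<Colon> Univ i" and R: "B # A # \<Gamma> \<turnstile> R \<Colon> Univ i"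
  shows "Sig A B # \<Gamma> \<turnstile> uncurried i R \<Colon> Univ i"
proof -
  note c = typing_ctx[OF A] and S = istyI[OF sig_form[OF A B]]
  show ?thesis
    by (rule uncurried_inst[where A = "w1 A" and B = "subst (v0 \<cdot> s2) B"]) (insert A B R S c, (assumption | rule tys, assumption | rule ty | simp)+)
qed

lemma idsys_Sig:
  assumes A: "\<Gamma> \<turnstile> A \<Colon> Univ i" and B: "A # \<Gamma> \<turnstile> B \<Colon> Univ i" and R: "B # A # \<Gamma> \<turnstile> R \<Colon> Univ i"
    and elim: "\<And>C. isty (R # B # A # \<Gamma>) C \<Longrightarrow> \<Gamma> \<Turnstile> subst (r \<cdot> b \<cdot> a \<cdot> S 0) C \<Longrightarrow> R # B # A # \<Gamma> \<Turnstile> C"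
  shows "idsys \<Gamma> (Sig A B) (Dpair a b) (uncurried i R) r"
  unfolding idsys_def
proof (intro allI impI)
  note c = typing_ctx[OF A] and S = istyI[OF sig_form[OF A B]]
  fix C assume C: "isty (uncurried i R # Sig A B # \<Gamma>) C"
    and base: "\<Gamma> \<Turnstile> subst (r \<cdot> Dpair a b \<cdot> S 0) C"
  have U: "isty (Sig A B # \<Gamma>) (uncurried i R)" by (rule istyI[OF uncurried_form[OF A B R]])
  have C': "isty (Sig A B # \<Gamma>) (Prd (uncurried i R) C)" by (rule isty_Prd[OF U C])
  let ?G = "B # A # \<Gamma>"
  \<comment> \<open>The uncurried family at a pair reduces to \<open>R\<close> but is a different
    raw term. A variable of the one type therefore has to be converted to the other, in both
    directions.\<close>
  let ?Rp = "SigInd (Univ i) (subst (v0 \<cdot> v1 \<cdot> s4) R) (Dpair v1 v0)"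
  have G: "?G \<turnstile> w2 A \<Colon> Univ i" "w2 A # ?G \<turnstile> subst (v0 \<cdot> s3) B \<Colon> Univ i"
    "subst (v0 \<cdot> s3) B # w2 A # ?G \<turnstile> subst (v0 \<cdot> v1 \<cdot> s4) R \<Colon> Univ i"
    "?G \<turnstile> v1 \<Colon> w2 A" "?G \<turnstile> v0 \<Colon> subst (v1 \<cdot> S 0) (subst (v0 \<cdot> s3) B)"
    by (insert A B R c, (assumption | rule tys, assumption | rule ty | simp)+)
  have p: "?G \<turnstile> Dpair v1 v0 \<Colon> Sig (w2 A) (subst (v0 \<cdot> s3) B)"
    by (rule pair_typing[OF istyI[OF G(2)] G(4,5)])
  have Rp: "?G \<turnstile> ?Rp \<Colon> Univ i" by (rule uncurried_inst[OF G(1-3) p])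
  have e: "?G \<turnstile> ?Rp \<doteq> R \<Colon> Univ i" using uncurried_pair[OF G] by simp
  let ?C = "subst (v0 \<cdot> Dpair v2 v1 \<cdot> s3) C"
  have cR: "ctx (R # ?G)" by (rule ctx_ext[OF R])
  have sub: "substs (R # ?G) (v0 \<cdot> Dpair v2 v1 \<cdot> s3) (uncurried i R # Sig A B # \<Gamma>)"
  proof (intro substs_cons' substs_S)
    have "R # ?G \<turnstile> w1 (Dpair v1 v0) \<Colon> w1 (Sig (w2 A) (subst (v0 \<cdot> s3) B))"
      by (rule typing_subst[OF p substs_S[OF cR] refl]) simp_all
    then show "R # ?G \<turnstile> Dpair v2 v1 \<Colon> subst s3 (Sig A B)" by simp
    have "R # ?G \<turnstile> w1 ?Rp \<doteq> w1 R \<Colon> w1 (Univ i)"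
      by (rule jeq_substs[OF substs_S[OF cR] e]) simp_all
    then have "eqty (R # ?G) (w1 R) (w1 ?Rp)" by (auto intro: eqtyI eq_sym)
    moreover have "R # ?G \<turnstile> v0 \<Colon> w1 R" by (rule var'[OF cR]) simp_all
    ultimately have "R # ?G \<turnstile> v0 \<Colon> w1 ?Rp" by (blast intro: typing_conv)
    then show "R # ?G \<turnstile> v0 \<Colon> subst (Dpair v2 v1 \<cdot> s3) (uncurried i R)" by simp
  qed (simp_all add: cR)
  have "isty (R # ?G) ?C" by (rule isty_subst[OF C sub])
  moreover have "\<Gamma> \<Turnstile> subst (r \<cdot> b \<cdot> a \<cdot> S 0) ?C" using base by simp
  ultimately have "R # ?G \<Turnstile> ?C" by (rule elim)
  then have "?G \<Turnstile> Prd R ?C" by (rule inh_Prd[OF istyI[OF R]])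
  note 1 = this
  have cp: "ctx (?Rp # ?G)" by (rule ctx_ext[OF Rp])
  have "?Rp # ?G \<Turnstile> w1 (Prd R ?C)"
    by (rule inh_wk[OF 1 istyI[OF Rp]])
  moreover have "?Rp # ?G \<turnstile> v0 \<Colon> w1 R"
  proof -
    have "?Rp # ?G \<turnstile> w1 ?Rp \<doteq> w1 R \<Colon> w1 (Univ i)"
      by (rule jeq_substs[OF substs_S[OF cp] e]) simp_all
    then have "eqty (?Rp # ?G) (w1 ?Rp) (w1 R)" by (auto intro: eqtyI)
    moreover have "?Rp # ?G \<turnstile> v0 \<Colon> w1 ?Rp" by (rule var'[OF cp]) simp_all
    ultimately show ?thesis by (blast intro: typing_conv)
  qed
  ultimately have "?Rp # ?G \<Turnstile> ?C"
    unfolding subst.simps by (rule inh_App) simp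
  from inh_Prd[OF istyI[OF Rp] this]
  have "?G \<Turnstile> subst (Dpair v1 v0 \<cdot> s2) (Prd (uncurried i R) C)" by simp
  from inh_sig_ctx[OF istyI[OF A] istyI[OF B] C' this]
  show "uncurried i R # Sig A B # \<Gamma> \<Turnstile> C" by (rule inh_unPrd[OF _ U])
qed

context
  fixes \<Gamma> A B i R a b r
  assumes A: "\<Gamma> \<turnstile> A \<Colon> Univ i" and B: "A # \<Gamma> \<turnstile> B \<Colon> Univ i" and R: "B # A # \<Gamma> \<turnstile> R \<Colon> Univ i"
    and a: "\<Gamma> \<turnstile> a \<Colon> A" and b: "\<Gamma> \<turnstile> b \<Colon> subst (a \<cdot> S 0) B" and r: "\<Gamma> \<turnstile> r \<Colon> subst (b \<cdot> a \<cdot> S 0) R"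
    and elim: "\<And>C. isty (R # B # A # \<Gamma>) C \<Longrightarrow> \<Gamma> \<Turnstile> subst (r \<cdot> b \<cdot> a \<cdot> S 0) C \<Longrightarrow> R # B # A # \<Gamma> \<Turnstile> C"
begin

lemma Sig_inst: "\<Gamma> \<turnstile> x \<Colon> A \<Longrightarrow> \<Gamma> \<turnstile> y \<Colon> subst (x \<cdot> S 0) B \<Longrightarrow> \<Gamma> \<turnstile> subst (y \<cdot> x \<cdot> S 0) R \<Colon> Univ i"
  by (frule typing_ctx, rule typing_subst[OF R]) (insert A B, (assumption | rule tys, assumption | rule ty | simp)+)

lemma Sig_pair: "\<Gamma> \<turnstile> x \<Colon> A \<Longrightarrow> \<Gamma> \<turnstile> y \<Colon> subst (x \<cdot> S 0) B \<Longrightarrow> \<Gamma> \<turnstile> Dpair x y \<Colon> Sig A B"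
  by (rule pair_typing[OF istyI[OF B]])

lemma Sig_refl: "\<Gamma> \<turnstile> r \<Colon> subst (Dpair a b \<cdot> S 0) (uncurried i R)"
  using typing_conv[OF r eqtyI[OF eq_sym[OF uncurried_pair[OF A B R a b]]]] by simp

lemmas Sig_idsys = sig_form[OF A B] uncurried_form[OF A B R] Sig_pair[OF a b] Sig_refl idsys_Sig[OF A B R elim]

lemma Sig_path:
  assumes x: "\<Gamma> \<turnstile> x \<Colon> A" and y: "\<Gamma> \<turnstile> y \<Colon> subst (x \<cdot> S 0) B"
  shows "\<Gamma> \<Turnstile> IdT (Univ i) (IdT (Sig A B) (Dpair a b) (Dpair x y)) (subst (y \<cdot> x \<cdot> S 0) R)"
proof -
  have "\<Gamma> \<Turnstile> IdT (Univ i) (IdT (Sig A B) (Dpair a b) (Dpair x y)) (SigInd (Univ i) R (Dpair x y))"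
    using idsys_path[OF Sig_idsys Sig_pair[OF x y]] by simp
  then show ?thesis
    by (rule id_conv[OF _ isty_base(1)[OF typing_ctx[OF A]] eq_refl[OF id_form[OF sig_form[OF A B] Sig_pair[OF a b] Sig_pair[OF x y]]]
          uncurried_pair[OF A B R x y]])
qed

lemma Sig_peq:
  "peq \<Gamma> i (IdT (Sig A B) (Dpair a b) (Dpair a b)) (Refl (Dpair a b)) (subst (b \<cdot> a \<cdot> S 0) R) r"
proof (rule peq_trans)
  show "peq \<Gamma> i (IdT (Sig A B) (Dpair a b) (Dpair a b)) (Refl (Dpair a b)) (SigInd (Univ i) R (Dpair a b)) r"
    using idsys_peq[OF Sig_idsys] by simp
  show "peq \<Gamma> i (SigInd (Univ i) R (Dpair a b)) r (subst (b \<cdot> a \<cdot> S 0) R) r"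
  proof (rule peq_cong[OF uncurried_pair[OF A B R a b]])
    show "\<Gamma> \<turnstile> r \<Colon> SigInd (Univ i) R (Dpair a b)" using Sig_refl by simp
    then show "\<Gamma> \<turnstile> r \<doteq> r \<Colon> SigInd (Univ i) R (Dpair a b)" by (rule eq_refl)
    show "\<Gamma> \<turnstile> SigInd (Univ i) R (Dpair a b) \<Colon> Univ i" by (rule uncurried_inst[OF A B R Sig_pair[OF a b]])
  qed (rule r Sig_inst[OF a b])+
qed

end

text \<open>Induction on \<open>q\<close>, with \<open>y\<close> generalised, leads to the fibre
  over \<open>a\<close>, where \<open>y\<close> is equal to \<open>b\<close>. Hence this one fibre
  is all that must be a proposition.\<close>

lemma prop_fibre_elim:
  assumes A: "isty \<Gamma> A" and B: "isty (A # \<Gamma>) B"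
    and a: "\<Gamma> \<turnstile> a \<Colon> A" and b: "\<Gamma> \<turnstile> b \<Colon> subst (a \<cdot> S 0) B"
    and prp: "\<Gamma> \<Turnstile> is_trunc (Suc 0) (subst (a \<cdot> S 0) B)"
    and C: "isty (IdT (w2 A) (w2 a) v1 # B # A # \<Gamma>) C"
    and base: "\<Gamma> \<Turnstile> subst (Refl a \<cdot> b \<cdot> a \<cdot> S 0) C"
    and x: "\<Gamma> \<turnstile> x \<Colon> A" and y: "\<Gamma> \<turnstile> y \<Colon> subst (x \<cdot> S 0) B" and q: "\<Gamma> \<turnstile> q \<Colon> IdT A a x"
  shows "\<Gamma> \<Turnstile> subst (q \<cdot> y \<cdot> x \<cdot> S 0) C"
proof -
  note c = typing_ctx[OF a]
  let ?Ba = "subst (a \<cdot> S 0) B"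
  have Ba: "isty \<Gamma> ?Ba" by (insert A B a c, (assumption | rule tys, assumption | rule ty | simp)+)
  have I: "isty (A # \<Gamma>) (IdT (w1 A) (w1 a) v0)" by (insert A a c, (assumption | rule tys, assumption | rule ty | simp)+)
  have B1: "isty (IdT (w1 A) (w1 a) v0 # A # \<Gamma>) (w1 B)" by (insert I B A a c, (assumption | rule tys, assumption | rule ty | simp)+)
  have M: "isty (IdT (w1 A) (w1 a) v0 # A # \<Gamma>) (Prd (w1 B) (subst (v1 \<cdot> v0 \<cdot> v2 \<cdot> s3) C))"
    by (rule isty_Prd[OF B1 isty_subst[OF C]]) (insert I B A a B1 c, (assumption | rule tys, assumption | rule ty | simp)+)
  let ?G = "?Ba # \<Gamma>"
  have a1: "?G \<turnstile> w1 a \<Colon> w1 A" and Ba1: "isty ?G (w1 ?Ba)" and b1: "?G \<turnstile> w1 b \<Colon> w1 ?Ba" and v: "?G \<turnstile> v0 \<Colon> w1 ?Ba"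
    by (insert A B Ba a b c, (assumption | rule tys, assumption | rule ty | simp)+)
  have A1: "isty ?G (w1 A)" by (insert A Ba c, (assumption | rule tys, assumption | rule ty | simp)+)
  have Cy: "isty (w1 ?Ba # ?G) (subst (Refl (w2 a) \<cdot> v0 \<cdot> w2 a \<cdot> s2) C)"
    by (rule isty_subst[OF C]) (insert A B Ba Ba1 a c, (assumption | rule tys, assumption | rule ty | simp)+)
  have p: "?G \<Turnstile> IdT (w1 ?Ba) (w1 b) v0"
    by (rule prop_eq[OF _ Ba1 b1 v]) (use inh_wk[OF prp Ba] in simp)
  have base1: "?G \<Turnstile> w1 (subst (Refl a \<cdot> b \<cdot> a \<cdot> S 0) C)" by (rule inh_wk[OF base Ba])
  have "?G \<Turnstile> subst (Refl (w1 a) \<cdot> v0 \<cdot> w1 a \<cdot> s1) C"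
    by (rule transport'[OF p _ _ base1 Ba1 b1 v Cy]) simp_all
  from inh_Prd[OF Ba this]
  have "\<Gamma> \<Turnstile> subst (Refl a \<cdot> a \<cdot> S 0) (Prd (w1 B) (subst (v1 \<cdot> v0 \<cdot> v2 \<cdot> s3) C))" by simp
  from based_J[OF A a x q M this]
  have "\<Gamma> \<Turnstile> Prd (subst (x \<cdot> S 0) B) (subst (w1 q \<cdot> v0 \<cdot> w1 x \<cdot> s1) C)" by simp
  from inh_App[OF this y refl] show ?thesis by simp
qed

text \<open>The same passage as for function types: the pointwise principle, in the context extended
  by the generic point, at its own variables.\<close>

lemma prop_fibre_elim_ctx:
  assumes A: "isty \<Gamma> A" and B: "isty (A # \<Gamma>) B"
    and a: "\<Gamma> \<turnstile> a \<Colon> A" and b: "\<Gamma> \<turnstile> b \<Colon> subst (a \<cdot> S 0) B"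
    and prp: "\<Gamma> \<Turnstile> is_trunc (Suc 0) (subst (a \<cdot> S 0) B)"
    and C: "isty (IdT (w2 A) (w2 a) v1 # B # A # \<Gamma>) C"
    and base: "\<Gamma> \<Turnstile> subst (Refl a \<cdot> b \<cdot> a \<cdot> S 0) C"
  shows "IdT (w2 A) (w2 a) v1 # B # A # \<Gamma> \<Turnstile> C"
proof -
  note c = typing_ctx[OF a]
  let ?G = "IdT (w2 A) (w2 a) v1 # B # A # \<Gamma>"
  have I: "isty (B # A # \<Gamma>) (IdT (w2 A) (w2 a) v1)" by (insert A B a c, (assumption | rule tys, assumption | rule ty | simp)+)
  have s: "substs ?G s3 \<Gamma>" by (rule substs_S[OF ctx_cons[OF I]]) simp_all
  let ?B = "subst (v0 \<cdot> s4) B"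
  have 3: "isty ?G (w3 A)" "isty (w3 A # ?G) ?B" "?G \<turnstile> w3 a \<Colon> w3 A" "?G \<turnstile> w3 b \<Colon> subst (w3 a \<cdot> S 0) ?B"
    "?G \<turnstile> v2 \<Colon> w3 A" "?G \<turnstile> v1 \<Colon> subst (v2 \<cdot> S 0) ?B" "?G \<turnstile> v0 \<Colon> IdT (w3 A) (w3 a) v2"
    by (insert A B a b I c, (assumption | rule tys, assumption | rule ty | simp)+)
  have prop3: "?G \<Turnstile> is_trunc (Suc 0) (subst (w3 a \<cdot> S 0) ?B)"
    by (rule inh_subst[OF prp s]) simp
  have I3: "isty (?B # w3 A # ?G) (IdT (w2 (w3 A)) (w2 (w3 a)) v1)" by (insert 3 typing_ctx[OF 3(3)], (assumption | rule tys, assumption | rule ty | simp)+)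
  have C3: "isty (IdT (w2 (w3 A)) (w2 (w3 a)) v1 # ?B # w3 A # ?G) (subst (v0 \<cdot> v1 \<cdot> v2 \<cdot> s6) C)"
    by (rule isty_subst[OF C]) (insert 3 I3 typing_ctx[OF 3(3)], (assumption | rule tys, assumption | rule ty | simp)+)
  have "?G \<Turnstile> subst (Refl (w3 a) \<cdot> w3 b \<cdot> w3 a \<cdot> S 0) (subst (v0 \<cdot> v1 \<cdot> v2 \<cdot> s6) C)"
    by (rule inh_subst[OF base s]) simp
  from prop_fibre_elim[OF 3(1-4) prop3 C3 this 3(5-7)] show ?thesis by simp
qed

context
  fixes \<Gamma> A B i a b C
  assumes A: "\<Gamma> \<turnstile> A \<Colon> Univ i" and B: "A # \<Gamma> \<turnstile> B \<Colon> Univ i"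
    and a: "\<Gamma> \<turnstile> a \<Colon> A" and b: "\<Gamma> \<turnstile> b \<Colon> subst (a \<cdot> S 0) B"
    and C: "isty (dpath A B a b # B # A # \<Gamma>) C"
    and base: "\<Gamma> \<Turnstile> subst (Dpair (Refl a) (Refl b) \<cdot> b \<cdot> a \<cdot> S 0) C"
begin

text \<open>Over reflexivity the fibre path starts at \<open>b\<close> up to conversion, so it is a
  based path and can be eliminated.\<close>

lemma dpath_elim_refl:
  assumes y: "\<Gamma> \<turnstile> y \<Colon> subst (a \<cdot> S 0) B" and s: "\<Gamma> \<turnstile> s \<Colon> IdT (subst (a \<cdot> S 0) B) b y"
  shows "\<Gamma> \<Turnstile> subst (Dpair (Refl a) s \<cdot> y \<cdot> a \<cdot> S 0) C"
proof -
  note c = typing_ctx[OF a]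
  let ?Ba = "subst (a \<cdot> S 0) B"
  have Ba: "\<Gamma> \<turnstile> ?Ba \<Colon> Univ i" by (rule fib_form[OF A B a b a])
  let ?G = "IdT (w1 ?Ba) (w1 b) v0 # ?Ba # \<Gamma>" and ?B = "subst (v0 \<cdot> s3) B"
  have I: "isty (?Ba # \<Gamma>) (IdT (w1 ?Ba) (w1 b) v0)" by (insert Ba b c, (assumption | rule tys, assumption | rule ty | simp)+)
  have 2: "?G \<turnstile> w2 A \<Colon> Univ i" "w2 A # ?G \<turnstile> ?B \<Colon> Univ i" "?G \<turnstile> w2 a \<Colon> w2 A"
    "?G \<turnstile> w2 b \<Colon> subst (w2 a \<cdot> S 0) ?B" "?G \<turnstile> v1 \<Colon> subst (w2 a \<cdot> S 0) ?B"
    "?G \<turnstile> v0 \<Colon> IdT (subst (w2 a \<cdot> S 0) ?B) (w2 b) v1"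
    by (insert A B a b Ba I c, (assumption | rule tys, assumption | rule ty | simp)+)
  have p: "?G \<turnstile> Dpair (Refl (w2 a)) v0 \<Colon> subst (v1 \<cdot> w2 a \<cdot> S 0) (dpath (w2 A) ?B (w2 a) (w2 b))"
    by (rule dpath_pair[OF 2(1-4) 2(3,5) refl_typing[OF istyI[OF 2(1)] 2(3) refl refl]
        typing_conv[OF 2(6) eqty_sym[OF dpath_refl_fib[OF 2(1-5)]]]])
  have M: "isty ?G (subst (Dpair (Refl (w2 a)) v0 \<cdot> v1 \<cdot> w2 a \<cdot> s2) C)"
    by (rule isty_subst[OF C], intro substs_cons' substs_S)
      (insert 2 p typing_ctx[OF 2(1)], simp_all)
  show ?thesis
    by (rule based_J'[OF s _ istyI[OF Ba] b y M]) (use base in simp_all)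
qed

end

text \<open>Induction on \<open>q\<close> with \<open>y\<close> and \<open>s\<close> quantified in
  the motive, since their types depend on the endpoint; the case of reflexivity is an induction on
  \<open>s\<close>.\<close>

lemma dpath_elim:
  assumes A: "\<Gamma> \<turnstile> A \<Colon> Univ i" and B: "A # \<Gamma> \<turnstile> B \<Colon> Univ i"
    and a: "\<Gamma> \<turnstile> a \<Colon> A" and b: "\<Gamma> \<turnstile> b \<Colon> subst (a \<cdot> S 0) B"
    and C: "isty (dpath A B a b # B # A # \<Gamma>) C"
    and base: "\<Gamma> \<Turnstile> subst (Dpair (Refl a) (Refl b) \<cdot> b \<cdot> a \<cdot> S 0) C"
    and x: "\<Gamma> \<turnstile> x \<Colon> A" and y: "\<Gamma> \<turnstile> y \<Colon> subst (x \<cdot> S 0) B" and q: "\<Gamma> \<turnstile> q \<Colon> IdT A a x"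
    and s: "\<Gamma> \<turnstile> s \<Colon> IdT (subst (x \<cdot> S 0) B) (Tr B a x q b) y"
  shows "\<Gamma> \<Turnstile> subst (Dpair q s \<cdot> y \<cdot> x \<cdot> S 0) C"
proof -
  note c = typing_ctx[OF a]
  let ?G = "IdT (w1 A) (w1 a) v0 # A # \<Gamma>"
  have I: "isty (A # \<Gamma>) (IdT (w1 A) (w1 a) v0)" by (insert A a c, (assumption | rule tys, assumption | rule ty | simp)+)
  have B1: "?G \<turnstile> w1 B \<Colon> Univ i" by (insert I B A a c, (assumption | rule tys, assumption | rule ty | simp)+)
  let ?G1 = "w1 B # ?G" and ?B3 = "subst (v0 \<cdot> s4) B"
  have 3: "?G1 \<turnstile> w3 A \<Colon> Univ i" "w3 A # ?G1 \<turnstile> ?B3 \<Colon> Univ i" "?G1 \<turnstile> w3 a \<Colon> w3 A"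
    "?G1 \<turnstile> w3 b \<Colon> subst (w3 a \<cdot> S 0) ?B3" "?G1 \<turnstile> v2 \<Colon> w3 A" "?G1 \<turnstile> v1 \<Colon> IdT (w3 A) (w3 a) v2"
    "?G1 \<turnstile> v0 \<Colon> subst (v2 \<cdot> S 0) ?B3"
    by (insert A B a b I B1 c, (assumption | rule tys, assumption | rule ty | simp)+)
  let ?P = "IdT (w2 B) (Tr ?B3 (w3 a) v2 v1 (w3 b)) v0"
  have P: "isty ?G1 ?P"
    using istyI[OF id_form[OF fib_form[OF 3(1-5)] dpath_Tr[OF 3(1-6)] 3(7)]] by simp
  let ?G2 = "?P # ?G1" and ?B4 = "subst (v0 \<cdot> s5) B"
  have 4: "?G2 \<turnstile> w4 A \<Colon> Univ i" "w4 A # ?G2 \<turnstile> ?B4 \<Colon> Univ i" "?G2 \<turnstile> w4 a \<Colon> w4 A"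
    "?G2 \<turnstile> w4 b \<Colon> subst (w4 a \<cdot> S 0) ?B4" "?G2 \<turnstile> v3 \<Colon> w4 A" "?G2 \<turnstile> v1 \<Colon> subst (v3 \<cdot> S 0) ?B4"
    "?G2 \<turnstile> v2 \<Colon> IdT (w4 A) (w4 a) v3" "?G2 \<turnstile> v0 \<Colon> IdT (subst (v3 \<cdot> S 0) ?B4) (Tr ?B4 (w4 a) v3 v2 (w4 b)) v1"
    by (insert A B a b I B1 P c, (assumption | rule tys, assumption | rule ty | simp)+)
  have C4: "isty ?G2 (subst (Dpair v2 v0 \<cdot> v1 \<cdot> v3 \<cdot> s4) C)"
    by (rule isty_subst[OF C], intro substs_cons' substs_S)
      (insert 4 dpath_pair[OF 4] typing_ctx[OF 4(1)], simp_all)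
  let ?M = "Prd (w1 B) (Prd ?P (subst (Dpair v2 v0 \<cdot> v1 \<cdot> v3 \<cdot> s4) C))"
  have M: "isty ?G ?M" by (rule isty_Prd[OF istyI[OF B1] isty_Prd[OF P C4]])
  let ?Ba = "subst (a \<cdot> S 0) B"
  have Ba: "\<Gamma> \<turnstile> ?Ba \<Colon> Univ i" by (rule fib_form[OF A B a b a])
  let ?D = "?Ba # \<Gamma>" and ?B1 = "subst (v0 \<cdot> s2) B"
  have 1: "?D \<turnstile> w1 A \<Colon> Univ i" "w1 A # ?D \<turnstile> ?B1 \<Colon> Univ i" "?D \<turnstile> w1 a \<Colon> w1 A"
    "?D \<turnstile> w1 b \<Colon> subst (w1 a \<cdot> S 0) ?B1" "?D \<turnstile> v0 \<Colon> subst (w1 a \<cdot> S 0) ?B1"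
    by (insert A B a b Ba c, (assumption | rule tys, assumption | rule ty | simp)+)
  note r1 = refl_typing[OF istyI[OF 1(1)] 1(3) refl refl]
  let ?P1 = "IdT (w1 ?Ba) (Tr ?B1 (w1 a) (w1 a) (Refl (w1 a)) (w1 b)) v0"
  have P1: "isty ?D ?P1"
    using istyI[OF id_form[OF fib_form[OF 1(1-4) 1(3)] dpath_Tr[OF 1(1-4) 1(3) r1] 1(5)]] by simp
  let ?D2 = "?P1 # ?D" and ?B2 = "subst (v0 \<cdot> s3) B"
  have 2: "?D2 \<turnstile> w2 A \<Colon> Univ i" "w2 A # ?D2 \<turnstile> ?B2 \<Colon> Univ i" "?D2 \<turnstile> w2 a \<Colon> w2 A"
    "?D2 \<turnstile> w2 b \<Colon> subst (w2 a \<cdot> S 0) ?B2" "?D2 \<turnstile> v1 \<Colon> subst (w2 a \<cdot> S 0) ?B2"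
    by (insert A B a b Ba P1 c, (assumption | rule tys, assumption | rule ty | simp)+)
  have v: "?D2 \<turnstile> v0 \<Colon> IdT (subst (w2 a \<cdot> S 0) ?B2) (Tr ?B2 (w2 a) (w2 a) (Refl (w2 a)) (w2 b)) v1"
    by (rule var'[OF typing_ctx[OF 2(1)]]) simp_all
  have s2: "?D2 \<turnstile> v0 \<Colon> IdT (subst (w2 a \<cdot> S 0) ?B2) (w2 b) v1"
    by (rule typing_conv[OF v dpath_refl_fib[OF 2]])
  have sub: "substs ?D2 s2 \<Gamma>" by (rule substs_S[OF typing_ctx[OF v]]) simp_all
  have D: "isty (dpath (w2 A) ?B2 (w2 a) (w2 b) # ?B2 # w2 A # ?D2) (subst (v0 \<cdot> v1 \<cdot> v2 \<cdot> s5) C)"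
    by (rule isty_subst[OF C], intro substs_cons' substs_S)
      (insert ctx_ext[OF dpath_form[OF 2(1-4)]], simp_all add: var')
  have b2: "?D2 \<Turnstile> subst (Dpair (Refl (w2 a)) (Refl (w2 b)) \<cdot> w2 b \<cdot> w2 a \<cdot> S 0) (subst (v0 \<cdot> v1 \<cdot> v2 \<cdot> s5) C)"
    by (rule inh_subst[OF base sub]) simp
  have "?D2 \<Turnstile> subst (Dpair (Refl (w2 a)) v0 \<cdot> v1 \<cdot> w2 a \<cdot> s2) C"
    using dpath_elim_refl[OF 2(1-4) D b2 2(5) s2] by simp
  from inh_Prd[OF istyI[OF Ba] inh_Prd[OF P1 this]]
  have "\<Gamma> \<Turnstile> subst (Refl a \<cdot> a \<cdot> S 0) ?M" by simp
  from based_J[OF istyI[OF A] a x q M this]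
  have "\<Gamma> \<Turnstile> Prd (subst (x \<cdot> S 0) B) (Prd (IdT (subst (w1 x \<cdot> s1) B) (Tr ?B1 (w1 a) (w1 x) (w1 q) (w1 b)) v0)
      (subst (Dpair (w2 q) v0 \<cdot> v1 \<cdot> w2 x \<cdot> s2) C))" by simp
  from inh_App[OF this y refl]
  have "\<Gamma> \<Turnstile> Prd (IdT (subst (x \<cdot> S 0) B) (Tr B a x q b) y) (subst (Dpair (w1 q) v0 \<cdot> w1 y \<cdot> w1 x \<cdot> s1) C)"
    by simp
  from inh_App[OF this s refl] show ?thesis by simp
qed

lemma dpath_elim_ctx:
  assumes A: "\<Gamma> \<turnstile> A \<Colon> Univ i" and B: "A # \<Gamma> \<turnstile> B \<Colon> Univ i"
    and a: "\<Gamma> \<turnstile> a \<Colon> A" and b: "\<Gamma> \<turnstile> b \<Colon> subst (a \<cdot> S 0) B"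
    and C: "isty (dpath A B a b # B # A # \<Gamma>) C"
    and base: "\<Gamma> \<Turnstile> subst (Dpair (Refl a) (Refl b) \<cdot> b \<cdot> a \<cdot> S 0) C"
  shows "dpath A B a b # B # A # \<Gamma> \<Turnstile> C"
proof (rule inh_sig_ctx[OF _ istyI[OF dpath_fib[OF A B a b]] C])
  note c = typing_ctx[OF a]
  show I: "isty (B # A # \<Gamma>) (IdT (w2 A) (w2 a) v1)" by (insert A B a c, (assumption | rule tys, assumption | rule ty | simp)+)
  let ?F = "IdT (subst (v2 \<cdot> s3) B) (Tr (subst (v0 \<cdot> s4) B) (w3 a) v2 v0 (w3 b)) v1"
  let ?G = "?F # IdT (w2 A) (w2 a) v1 # B # A # \<Gamma>" and ?B = "subst (v0 \<cdot> s5) B"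
  have G: "ctx ?G" by (rule ctx_ext[OF dpath_fib[OF A B a b]])
  have 4: "?G \<turnstile> w4 A \<Colon> Univ i" "w4 A # ?G \<turnstile> ?B \<Colon> Univ i" "?G \<turnstile> w4 a \<Colon> w4 A"
    "?G \<turnstile> w4 b \<Colon> subst (w4 a \<cdot> S 0) ?B" "?G \<turnstile> v3 \<Colon> w4 A" "?G \<turnstile> v2 \<Colon> subst (v3 \<cdot> S 0) ?B"
    "?G \<turnstile> v1 \<Colon> IdT (w4 A) (w4 a) v3" "?G \<turnstile> v0 \<Colon> IdT (subst (v3 \<cdot> S 0) ?B) (Tr ?B (w4 a) v3 v1 (w4 b)) v2"
    by (insert A B a b G c, (assumption | rule tys, assumption | rule ty | simp)+)
  have sub: "substs ?G s4 \<Gamma>" by (rule substs_S[OF G]) simp_all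
  let ?C = "subst (v0 \<cdot> v1 \<cdot> v2 \<cdot> S (Suc (Suc (Suc (Suc (Suc (Suc (Suc 0))))))) ) C"
  have D: "isty (dpath (w4 A) ?B (w4 a) (w4 b) # ?B # w4 A # ?G) ?C"
    by (rule isty_subst[OF C], intro substs_cons' substs_S)
      (insert ctx_ext[OF dpath_form[OF 4(1-4)]], simp_all add: var')
  have "?G \<Turnstile> subst (Dpair (Refl (w4 a)) (Refl (w4 b)) \<cdot> w4 b \<cdot> w4 a \<cdot> S 0) ?C"
    by (rule inh_subst[OF base sub]) simp
  from dpath_elim[OF 4(1-4) D this 4(5-8)]
  show "?G \<Turnstile> subst (Dpair v1 v0 \<cdot> s2) C" by simp
qed

context
  fixes \<Gamma> A B i a b
  assumes A: "\<Gamma> \<turnstile> A \<Colon> Univ i" and B: "A # \<Gamma> \<turnstile> B \<Colon> Univ i"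
    and a: "\<Gamma> \<turnstile> a \<Colon> A" and b: "\<Gamma> \<turnstile> b \<Colon> subst (a \<cdot> S 0) B"
begin

lemma dpath_Sig_path:
  "\<Gamma> \<turnstile> x \<Colon> A \<Longrightarrow> \<Gamma> \<turnstile> y \<Colon> subst (x \<cdot> S 0) B \<Longrightarrow>
   \<Gamma> \<Turnstile> IdT (Univ i) (IdT (Sig A B) (Dpair a b) (Dpair x y)) (subst (y \<cdot> x \<cdot> S 0) (dpath A B a b))"
  by (rule Sig_path[OF A B dpath_form[OF A B a b] a b dpath_refl[OF A B a b] dpath_elim_ctx[OF A B a b]])

lemma dpath_Sig_peq:
  "peq \<Gamma> i (IdT (Sig A B) (Dpair a b) (Dpair a b)) (Refl (Dpair a b))
     (subst (b \<cdot> a \<cdot> S 0) (dpath A B a b)) (Dpair (Refl a) (Refl b))"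
  by (rule Sig_peq[OF A B dpath_form[OF A B a b] a b dpath_refl[OF A B a b] dpath_elim_ctx[OF A B a b]])

text \<open>The identity system on the sum consists of the paths in the base alone and forgets the
  second component.\<close>

lemma prop_Sig_peq:
  assumes "\<Gamma> \<Turnstile> is_trunc (Suc 0) (subst (a \<cdot> S 0) B)"
  shows "peq \<Gamma> i (IdT (Sig A B) (Dpair a b) (Dpair a b)) (Refl (Dpair a b)) (IdT A a a) (Refl a)"
proof -
  have R: "B # A # \<Gamma> \<turnstile> IdT (w2 A) (w2 a) v1 \<Colon> Univ i" by (insert A B a typing_ctx[OF a], (assumption | rule tys, assumption | rule ty | simp)+)
  have r: "\<Gamma> \<turnstile> Refl a \<Colon> subst (b \<cdot> a \<cdot> S 0) (IdT (w2 A) (w2 a) v1)"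
    by (simp add: refl_typing[OF istyI[OF A] a refl refl])
  from Sig_peq[OF A B R a b r prop_fibre_elim_ctx[OF istyI[OF A] istyI[OF B] a b assms]]
  show ?thesis by simp
qed

end

section \<open>Truncation levels\<close>

lemma two_vars:
  assumes A: "isty \<Gamma> A"
  shows "w1 A # A # \<Gamma> \<turnstile> v1 \<Colon> w2 A" "w1 A # A # \<Gamma> \<turnstile> v0 \<Colon> w2 A" "substs (w1 A # A # \<Gamma>) s2 \<Gamma>"
  by (insert A isty_ctx[OF A], (assumption | rule tys, assumption | rule ty | simp)+)

text \<open>Two fresh variables are traded for arbitrary substitution instances, so that inductions
  over the level can work with arbitrary endpoints in one context.\<close>

lemma trunc_Suc_intro:
  assumes A: "isty \<Gamma> A"
    and "\<And>\<Delta> \<sigma> a b. substs \<Delta> \<sigma> \<Gamma> \<Longrightarrow> \<Delta> \<turnstile> a \<Colon> subst \<sigma> A \<Longrightarrow> \<Delta> \<turnstile> b \<Colon> subst \<sigma> A \<Longrightarrow>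
      \<Delta> \<Turnstile> is_trunc m (IdT (subst \<sigma> A) a b)"
  shows "\<Gamma> \<Turnstile> is_trunc (Suc m) A"
  by (rule trunc_SucI[OF A]) (rule assms(2)[OF two_vars(3,1,2)[OF A]])

text \<open>\<open>t\<close> goes from \<open>a\<close> back to the centre and from there to
  \<open>b\<close>. It does not mention \<open>p\<close>, and when \<open>p\<close> is reflexivity
  its two halves cancel.\<close>

lemma contr_path_eq:
  assumes A: "isty \<Gamma> A" and c: "\<Gamma> \<turnstile> c \<Colon> A" and k: "A # \<Gamma> \<turnstile> k \<Colon> IdT (w1 A) (w1 c) v0"
    and a: "\<Gamma> \<turnstile> a \<Colon> A" and b: "\<Gamma> \<turnstile> b \<Colon> A" and p: "\<Gamma> \<turnstile> p \<Colon> IdT A a b"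
  defines "t \<equiv> Tr (IdT (w1 A) v0 (w1 b)) c a (subst (a \<cdot> S 0) k) (subst (b \<cdot> S 0) k)"
  shows "\<Gamma> \<turnstile> t \<Colon> IdT A a b" and "\<Gamma> \<Turnstile> IdT (IdT A a b) t p"
proof -
  have gen: "\<Delta> \<turnstile> Tr (IdT (w1 A) v0 (w1 b)) c a (subst (a \<cdot> S 0) k) (subst (b \<cdot> S 0) k) \<Colon> IdT A a b"
    if A: "isty \<Delta> A" and c: "\<Delta> \<turnstile> c \<Colon> A" and k: "A # \<Delta> \<turnstile> k \<Colon> IdT (w1 A) (w1 c) v0"
      and a: "\<Delta> \<turnstile> a \<Colon> A" and b: "\<Delta> \<turnstile> b \<Colon> A" for \<Delta> A c k a b
  proof -
    note ctx = typing_ctx[OF a]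
    have P: "isty (A # \<Delta>) (IdT (w1 A) v0 (w1 b))" by (insert A b ctx, (assumption | rule tys, assumption | rule ty | simp)+)
    have kx: "\<Delta> \<turnstile> subst (x \<cdot> S 0) k \<Colon> IdT A c x" if "\<Delta> \<turnstile> x \<Colon> A" for x
      by (rule typing_subst[OF k]) (insert A that ctx, (assumption | rule tys, assumption | rule ty | simp)+)
    show ?thesis using Tr_typing[OF A P c a kx[OF a], of "subst (b \<cdot> S 0) k"] kx[OF b] by simp
  qed
  show t: "\<Gamma> \<turnstile> t \<Colon> IdT A a b" unfolding t_def by (rule gen[OF A c k a b])
  note ctx = typing_ctx[OF a]
  let ?G = "IdT (w1 A) (w1 a) v0 # A # \<Gamma>" and ?k = "subst (v0 \<cdot> s3) k"
  have I: "isty (A # \<Gamma>) (IdT (w1 A) (w1 a) v0)" by (insert A a ctx, (assumption | rule tys, assumption | rule ty | simp)+)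
  have 2: "isty ?G (w2 A)" "?G \<turnstile> w2 c \<Colon> w2 A" "w2 A # ?G \<turnstile> ?k \<Colon> IdT (w1 (w2 A)) (w1 (w2 c)) v0"
    "?G \<turnstile> w2 a \<Colon> w2 A" "?G \<turnstile> v1 \<Colon> w2 A" "?G \<turnstile> v0 \<Colon> IdT (w2 A) (w2 a) v1"
    by (insert A c k a I ctx, (assumption | rule tys, assumption | rule ty | simp)+)
  let ?C = "IdT (IdT (w2 A) (w2 a) v1)
    (Tr (IdT (w1 (w2 A)) v0 (w1 v1)) (w2 c) (w2 a) (subst (w2 a \<cdot> S 0) ?k) (subst (v1 \<cdot> S 0) ?k)) v0"
  have M: "isty ?G ?C"
    by (rule isty_Id[OF isty_Id[OF 2(1,4,5)] gen[OF 2(1-5)] 2(6)])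
  have ka: "\<Gamma> \<turnstile> subst (a \<cdot> S 0) k \<Colon> IdT A c a"
    by (rule typing_subst[OF k]) (insert A a ctx, (assumption | rule tys, assumption | rule ty | simp)+)
  show "\<Gamma> \<Turnstile> IdT (IdT A a b) t p"
    by (rule based_J'[OF p _ A a b M]) (use Tr_loop_cancel[OF A c a ka] in \<open>simp_all add: t_def\<close>)
qed

lemma contr_path:
  assumes contr: "\<Gamma> \<Turnstile> is_trunc 0 A" and A: "isty \<Gamma> A" and a: "\<Gamma> \<turnstile> a \<Colon> A" and b: "\<Gamma> \<turnstile> b \<Colon> A"
  shows "\<Gamma> \<Turnstile> is_trunc 0 (IdT A a b)"
proof -
  note ctx = typing_ctx[OF a]
  obtain c where c: "\<Gamma> \<turnstile> c \<Colon> A" and "\<Gamma> \<Turnstile> Prd A (IdT (w1 A) (w1 c) v0)"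
    using contrE[OF contr A] .
  from inh_unPrd[OF this(2) A] obtain k where k: "A # \<Gamma> \<turnstile> k \<Colon> IdT (w1 A) (w1 c) v0"
    by (auto simp: inh_def)
  have I: "isty \<Gamma> (IdT A a b)" by (rule isty_Id[OF A a b])
  let ?G = "IdT A a b # \<Gamma>" and ?k = "subst (v0 \<cdot> s2) k"
  have 1: "isty ?G (w1 A)" "?G \<turnstile> w1 c \<Colon> w1 A" "w1 A # ?G \<turnstile> ?k \<Colon> IdT (w1 (w1 A)) (w1 (w1 c)) v0"
    "?G \<turnstile> w1 a \<Colon> w1 A" "?G \<turnstile> w1 b \<Colon> w1 A" "?G \<turnstile> v0 \<Colon> IdT (w1 A) (w1 a) (w1 b)"
    by (insert A c k a b I ctx, (assumption | rule tys, assumption | rule ty | simp)+)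
  have "\<Gamma> \<turnstile> Tr (IdT (w1 A) v0 (w1 b)) c a (subst (a \<cdot> S 0) k) (subst (b \<cdot> S 0) k) \<Colon> IdT A a b"
  proof -
    obtain p where "\<Gamma> \<turnstile> p \<Colon> IdT A a b" using contr_eq[OF contr A a b] by (auto simp: inh_def)
    then show ?thesis by (rule contr_path_eq(1)[OF A c k a b])
  qed
  then show ?thesis
    by (rule contrI[OF I]) (use contr_path_eq(2)[OF 1] in simp)
qed

lemma trunc_mono_Suc:
  assumes "\<Gamma> \<Turnstile> is_trunc m A" "isty \<Gamma> A"
  shows "\<Gamma> \<Turnstile> is_trunc (Suc m) A"
  using assms
proof (induction m arbitrary: \<Gamma> A)
  case 0
  show ?case
  proof (rule trunc_Suc_intro[OF 0(2)])
    fix \<Delta> \<sigma> a b assume s: "substs \<Delta> \<sigma> \<Gamma>" and ab: "\<Delta> \<turnstile> a \<Colon> subst \<sigma> A" "\<Delta> \<turnstile> b \<Colon> subst \<sigma> A"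
    show "\<Delta> \<Turnstile> is_trunc 0 (IdT (subst \<sigma> A) a b)"
      using contr_path[OF inh_subst[OF 0(1) s] isty_subst[OF 0(2) s] ab] by simp
  qed
next
  case (Suc m)
  show ?case
  proof (rule trunc_Suc_intro[OF Suc.prems(2)])
    fix \<Delta> \<sigma> a b assume s: "substs \<Delta> \<sigma> \<Gamma>" and ab: "\<Delta> \<turnstile> a \<Colon> subst \<sigma> A" "\<Delta> \<turnstile> b \<Colon> subst \<sigma> A"
    show "\<Delta> \<Turnstile> is_trunc (Suc m) (IdT (subst \<sigma> A) a b)"
      using Suc.IH[OF trunc_SucD[OF inh_subst[OF Suc.prems(1) s] ab] isty_Id[OF isty_subst[OF Suc.prems(2) s] ab]]
      by simp
  qed
qed

lemma trunc_Prd: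
  assumes "\<Gamma> \<turnstile> A \<Colon> Univ i" "A # \<Gamma> \<turnstile> F \<Colon> Univ i" "A # \<Gamma> \<Turnstile> is_trunc m F"
  shows "\<Gamma> \<Turnstile> is_trunc m (Prd A F)"
  using assms
proof (induction m arbitrary: \<Gamma> A F)
  case 0
  then show ?case by (rule weak_funext)
next
  case (Suc m)
  show ?case
  proof (rule trunc_Suc_intro[OF istyI[OF prd_form[OF Suc.prems(1,2)]]])
    fix \<Delta> \<sigma> f g assume s: "substs \<Delta> \<sigma> \<Gamma>" and f0: "\<Delta> \<turnstile> f \<Colon> subst \<sigma> (Prd A F)" and g0: "\<Delta> \<turnstile> g \<Colon> subst \<sigma> (Prd A F)"
    let ?A = "subst \<sigma> A" and ?F = "subst (v0 \<cdot> (\<sigma> \<Zsemi> s1)) F"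
    have A: "\<Delta> \<turnstile> ?A \<Colon> Univ i" using typing_substs[OF s Suc.prems(1)] by simp
    note s1 = substs_up[OF s A]
    have F: "?A # \<Delta> \<turnstile> ?F \<Colon> Univ i" using typing_substs[OF s1 Suc.prems(2)] by simp
    have t: "?A # \<Delta> \<Turnstile> is_trunc (Suc m) ?F" by (rule inh_subst[OF Suc.prems(3) s1]) simp
    have f: "\<Delta> \<turnstile> f \<Colon> Prd ?A ?F" and g: "\<Delta> \<turnstile> g \<Colon> Prd ?A ?F" using f0 g0 by simp_all
    note f1 = eta[OF istyI[OF A] f] and g1 = eta[OF istyI[OF A] g]
    let ?f = "App (w1 f) v0" and ?g = "App (w1 g) v0"
    have P: "\<Delta> \<turnstile> Prd ?A ?F \<Colon> Univ i" by (rule prd_form[OF A F])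
    have I: "?A # \<Delta> \<turnstile> IdT ?F ?f ?g \<Colon> Univ i" by (rule id_form[OF F f1(2) g1(2)])
    have IH: "\<Delta> \<Turnstile> is_trunc m (Prd ?A (IdT ?F ?f ?g))"
      by (rule Suc.IH[OF A I trunc_SucD[OF t f1(2) g1(2)]])
    \<comment> \<open>\<open>idsys_funext\<close> is about an abstraction as left endpoint, so
      \<open>f\<close> is \<eta>-expanded here and contracted again at the end.\<close>
    have I': "\<Delta> \<turnstile> IdT (Prd ?A ?F) (Lam ?A ?f) g \<Colon> Univ i" by (rule id_form[OF P f1(3) g])
    have r: "\<Delta> \<turnstile> Lam ?A (Refl ?f) \<Colon> subst (Lam ?A ?f \<cdot> S 0) (htpy ?A ?F ?f)"
    proof -
      have "?A # \<Delta> \<turnstile> Refl ?f \<Colon> IdT ?F ?f (App (w1 (Lam ?A ?f)) v0)"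
        by (rule typing_conv[OF refl_typing[OF istyI[OF F] f1(2) refl refl]
            eqty_Id[OF istyI[OF F] eq_refl[OF f1(2)] eq_sym[OF beta_v0[OF istyI[OF A] f1(2)]]]])
      from lam_typing[OF istyI[OF A] this] show ?thesis by simp
    qed
    have "\<Delta> \<Turnstile> IdT (Univ i) (IdT (Prd ?A ?F) (Lam ?A ?f) g) (Prd ?A (IdT ?F ?f ?g))"
      using idsys_path[OF P htpy_form[OF A F f1(2)] f1(3) r idsys_funext[OF A F f1(2)] g] by simp
    from id_sym[OF this isty_base(1)[OF typing_ctx[OF A]] I' prd_form[OF A I]]
    have "\<Delta> \<Turnstile> is_trunc m (IdT (Prd ?A ?F) (Lam ?A ?f) g)"
      by (rule trunc_path[OF IH _ prd_form[OF A I] I'])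
    then have "\<Delta> \<Turnstile> is_trunc m (IdT (Prd ?A ?F) f g)"
      by (rule trunc_jeq[OF _ id_form_eq[OF eq_refl[OF P] eq_sym[OF f1(1)] eq_refl[OF g]] I' id_form[OF P f g]])
    then show "\<Delta> \<Turnstile> is_trunc m (IdT (subst \<sigma> (Prd A F)) f g)" by simp
  qed
qed

lemma Sig_eq:
  assumes A: "\<Gamma> \<turnstile> A \<Colon> Univ i" and B: "A # \<Gamma> \<turnstile> B \<Colon> Univ i"
    and a: "\<Gamma> \<turnstile> a \<Colon> A" and b: "\<Gamma> \<turnstile> b \<Colon> subst (a \<cdot> S 0) B"
    and x: "\<Gamma> \<turnstile> x \<Colon> A" and y: "\<Gamma> \<turnstile> y \<Colon> subst (x \<cdot> S 0) B"
    and q: "\<Gamma> \<turnstile> q \<Colon> IdT A a x" and s: "\<Gamma> \<Turnstile> IdT (subst (x \<cdot> S 0) B) (Tr B a x q b) y"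
  shows "\<Gamma> \<Turnstile> IdT (Sig A B) (Dpair a b) (Dpair x y)"
proof -
  note c = typing_ctx[OF a]
  obtain t where "\<Gamma> \<turnstile> t \<Colon> IdT (subst (x \<cdot> S 0) B) (Tr B a x q b) y" using s by (auto simp: inh_def)
  from dpath_pair[OF A B a b x y q this] have D: "\<Gamma> \<Turnstile> subst (y \<cdot> x \<cdot> S 0) (dpath A B a b)" by (rule inhI)
  have I: "\<Gamma> \<turnstile> IdT (Sig A B) (Dpair a b) (Dpair x y) \<Colon> Univ i"
    by (rule id_form[OF sig_form[OF A B] pair_typing[OF istyI[OF B] a b] pair_typing[OF istyI[OF B] x y]])
  have J: "\<Gamma> \<turnstile> subst (y \<cdot> x \<cdot> S 0) (dpath A B a b) \<Colon> Univ i"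
    by (rule typing_subst[OF dpath_form[OF A B a b]], intro substs_cons' substs_S) (insert x y c, simp_all)
  show ?thesis
    by (rule transport'[OF id_sym[OF dpath_Sig_path[OF A B a b x y] isty_base(1)[OF c] I J], where C = v0])
      (use D I J c isty_base(1)[OF c] in \<open>simp_all add: isty_var ctx_cons\<close>)
qed

lemma trunc_Sig:
  assumes "\<Gamma> \<turnstile> A \<Colon> Univ i" "A # \<Gamma> \<turnstile> B \<Colon> Univ i" "\<Gamma> \<Turnstile> is_trunc m A" "A # \<Gamma> \<Turnstile> is_trunc m B"
  shows "\<Gamma> \<Turnstile> is_trunc m (Sig A B)"
  using assms
proof (induction m arbitrary: \<Gamma> A B)
  case 0
  note A = 0(1) and B = 0(2) and c = typing_ctx[OF 0(1)]
  obtain a where a: "\<Gamma> \<turnstile> a \<Colon> A" using contrE[OF 0(3) istyI[OF A]] by blast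
  have Ba: "isty \<Gamma> (subst (a \<cdot> S 0) B)" by (insert A B a c, (assumption | rule tys, assumption | rule ty | simp)+)
  have "\<Gamma> \<Turnstile> is_trunc 0 (subst (a \<cdot> S 0) B)"
    by (rule inh_subst[OF 0(4), of _ "a \<cdot> S 0"]) (insert A a c, (assumption | rule tys, assumption | rule ty | simp)+)
  then obtain b where b: "\<Gamma> \<turnstile> b \<Colon> subst (a \<cdot> S 0) B" using contrE[OF _ Ba] by blast
  have S: "\<Gamma> \<turnstile> Sig A B \<Colon> Univ i" by (rule sig_form[OF A B])
  have ab: "\<Gamma> \<turnstile> Dpair a b \<Colon> Sig A B" by (rule pair_typing[OF istyI[OF B] a b])
  show ?case
  proof (rule contrI[OF istyI[OF S] ab], rule inh_sig_ctx[OF istyI[OF A] istyI[OF B]])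
    show "isty (Sig A B # \<Gamma>) (IdT (w1 (Sig A B)) (w1 (Dpair a b)) v0)"
      by (rule isty_Id[OF isty_subst[OF istyI[OF S]] typing_subst[OF ab _ refl]])
        (rule substs_S ctx_cons[OF istyI[OF S]] var' | simp)+
    let ?G = "B # A # \<Gamma>" and ?B = "subst (v0 \<cdot> s3) B"
    have G: "ctx ?G" by (rule ctx_ext[OF B])
    have s: "substs ?G s2 \<Gamma>" by (rule substs_S[OF G]) simp_all
    have 2: "?G \<turnstile> w2 A \<Colon> Univ i" "w2 A # ?G \<turnstile> ?B \<Colon> Univ i" "?G \<turnstile> w2 a \<Colon> w2 A" "?G \<turnstile> w2 b \<Colon> subst (w2 a \<cdot> S 0) ?B"
      "?G \<turnstile> v1 \<Colon> w2 A" "?G \<turnstile> v0 \<Colon> subst (v1 \<cdot> S 0) ?B"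
      by (insert A B a b G c, (assumption | rule tys, assumption | rule ty | simp)+)
    have tA: "?G \<Turnstile> is_trunc 0 (w2 A)" by (rule inh_subst[OF 0(3) s]) simp
    have tB: "?G \<Turnstile> is_trunc 0 (subst (v1 \<cdot> S 0) ?B)"
      by (rule inh_subst[OF 0(4), of _ "s1"]) (insert G, simp_all add: substs_S)
    obtain q where q: "?G \<turnstile> q \<Colon> IdT (w2 A) (w2 a) v1"
      using contr_eq[OF tA istyI[OF 2(1)] 2(3,5)] by (auto simp: inh_def)
    show "?G \<Turnstile> subst (Dpair v1 v0 \<cdot> s2) (IdT (w1 (Sig A B)) (w1 (Dpair a b)) v0)"
      using Sig_eq[OF 2 q contr_eq[OF tB istyI[OF fib_form[OF 2(1-5)]] dpath_Tr[OF 2(1-5) q] 2(6)]] by simp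
  qed
next
  case (Suc m)
  have S: "\<Gamma> \<turnstile> Sig A B \<Colon> Univ i" by (rule sig_form[OF Suc.prems(1,2)])
  \<comment> \<open>Between pairs, the paths form a sum of identity types, to which the induction
    hypothesis applies. Arbitrary endpoints are split into pairs afterwards, one after the
    other.\<close>
  have pairs: "\<Delta> \<Turnstile> is_trunc m (IdT (Sig A B) (Dpair a b) (Dpair x y))"
    if A: "\<Delta> \<turnstile> A \<Colon> Univ i" and B: "A # \<Delta> \<turnstile> B \<Colon> Univ i" and tA: "\<Delta> \<Turnstile> is_trunc (Suc m) A" and tB: "A # \<Delta> \<Turnstile> is_trunc (Suc m) B"
      and a: "\<Delta> \<turnstile> a \<Colon> A" and b: "\<Delta> \<turnstile> b \<Colon> subst (a \<cdot> S 0) B" and x: "\<Delta> \<turnstile> x \<Colon> A" and y: "\<Delta> \<turnstile> y \<Colon> subst (x \<cdot> S 0) B"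
    for \<Delta> A B a b x y
  proof -
    note c = typing_ctx[OF a]
    let ?I = "IdT A a x" and ?B1 = "subst (v0 \<cdot> s2) B"
    have I: "\<Delta> \<turnstile> ?I \<Colon> Univ i" by (rule id_form[OF A a x])
    have 1: "?I # \<Delta> \<turnstile> w1 A \<Colon> Univ i" "w1 A # ?I # \<Delta> \<turnstile> ?B1 \<Colon> Univ i" "?I # \<Delta> \<turnstile> w1 a \<Colon> w1 A"
      "?I # \<Delta> \<turnstile> w1 b \<Colon> subst (w1 a \<cdot> S 0) ?B1" "?I # \<Delta> \<turnstile> w1 x \<Colon> w1 A" "?I # \<Delta> \<turnstile> v0 \<Colon> IdT (w1 A) (w1 a) (w1 x)"
      "?I # \<Delta> \<turnstile> w1 y \<Colon> subst (w1 x \<cdot> S 0) ?B1"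
      by (insert A B a b x y istyI[OF I] c, (assumption | rule tys, assumption | rule ty | simp)+)
    let ?J = "IdT (subst (w1 x \<cdot> S 0) ?B1) (Tr ?B1 (w1 a) (w1 x) v0 (w1 b)) (w1 y)"
    note t = dpath_Tr[OF 1(1-6)]
    have J: "?I # \<Delta> \<turnstile> ?J \<Colon> Univ i" by (rule id_form[OF fib_form[OF 1(1-5)] t 1(7)])
    have tB1: "?I # \<Delta> \<Turnstile> is_trunc (Suc m) (subst (w1 x \<cdot> S 0) ?B1)"
      by (rule inh_subst[OF tB, of _ "w1 x \<cdot> s1"]) (insert A x istyI[OF I] 1 c, (assumption | rule tys, assumption | rule ty | simp)+)
    have "\<Delta> \<Turnstile> is_trunc m (Sig ?I ?J)"
      by (rule Suc.IH[OF I J trunc_SucD[OF tA a x] trunc_SucD[OF tB1 t 1(7)]])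
    then have D: "\<Delta> \<Turnstile> is_trunc m (subst (y \<cdot> x \<cdot> S 0) (dpath A B a b))" by simp
    have DU: "\<Delta> \<turnstile> subst (y \<cdot> x \<cdot> S 0) (dpath A B a b) \<Colon> Univ i"
      using sig_form[OF I J] by simp
    have IS: "\<Delta> \<turnstile> IdT (Sig A B) (Dpair a b) (Dpair x y) \<Colon> Univ i"
      by (rule id_form[OF sig_form[OF A B] pair_typing[OF istyI[OF B] a b] pair_typing[OF istyI[OF B] x y]])
    show ?thesis
      by (rule trunc_path[OF D id_sym[OF dpath_Sig_path[OF A B a b x y] isty_base(1)[OF c] IS DU] DU IS])
  qed
  show ?case
  proof (rule trunc_Suc_intro[OF istyI[OF S]])
    fix \<Delta> \<sigma> u v assume s: "substs \<Delta> \<sigma> \<Gamma>" and u0: "\<Delta> \<turnstile> u \<Colon> subst \<sigma> (Sig A B)" and v0: "\<Delta> \<turnstile> v \<Colon> subst \<sigma> (Sig A B)"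
    let ?A = "subst \<sigma> A" and ?B = "subst (v0 \<cdot> (\<sigma> \<Zsemi> s1)) B"
    have A: "\<Delta> \<turnstile> ?A \<Colon> Univ i" using typing_substs[OF s Suc.prems(1)] by simp
    note sup = substs_up[OF s A]
    have B: "?A # \<Delta> \<turnstile> ?B \<Colon> Univ i" using typing_substs[OF sup Suc.prems(2)] by simp
    have tA: "\<Delta> \<Turnstile> is_trunc (Suc m) ?A" by (rule inh_subst[OF Suc.prems(3) s]) simp
    have tB: "?A # \<Delta> \<Turnstile> is_trunc (Suc m) ?B" by (rule inh_subst[OF Suc.prems(4) sup]) simp
    have u: "\<Delta> \<turnstile> u \<Colon> Sig ?A ?B" and v: "\<Delta> \<turnstile> v \<Colon> Sig ?A ?B" using u0 v0 by simp_all
    note c = typing_ctx[OF A]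
    have S': "isty \<Delta> (Sig ?A ?B)" by (rule istyI[OF sig_form[OF A B]])
    let ?A2 = "w2 ?A" and ?B2 = "subst (v0 \<cdot> s3) ?B"
    let ?G = "?B # ?A # \<Delta>"
    have G: "ctx ?G" by (rule ctx_ext[OF B])
    have 2: "?G \<turnstile> ?A2 \<Colon> Univ i" "?A2 # ?G \<turnstile> ?B2 \<Colon> Univ i" "?G \<turnstile> w2 v \<Colon> Sig ?A2 ?B2"
      "?G \<turnstile> v1 \<Colon> ?A2" "?G \<turnstile> v0 \<Colon> subst (v1 \<cdot> S 0) ?B2"
      by (insert A B v G c, (assumption | rule tys, assumption | rule ty | simp)+)
    have sG: "substs ?G s2 \<Delta>" by (rule substs_S[OF G]) simp_all
    have tA2: "?G \<Turnstile> is_trunc (Suc m) ?A2" by (rule inh_subst[OF tA sG]) simp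
    have tB2: "?A2 # ?G \<Turnstile> is_trunc (Suc m) ?B2" by (rule inh_subst[OF tB substs_up[OF sG 2(1)]]) simp
    let ?G4 = "?B2 # ?A2 # ?G" and ?A4 = "w2 ?A2" and ?B4 = "subst (v0 \<cdot> s3) ?B2"
    have G4: "ctx ?G4" by (rule ctx_ext[OF 2(2)])
    have 4: "?G4 \<turnstile> ?A4 \<Colon> Univ i" "?A4 # ?G4 \<turnstile> ?B4 \<Colon> Univ i"
      "?G4 \<turnstile> v3 \<Colon> ?A4" "?G4 \<turnstile> v2 \<Colon> subst (v3 \<cdot> S 0) ?B4"
      "?G4 \<turnstile> v1 \<Colon> ?A4" "?G4 \<turnstile> v0 \<Colon> subst (v1 \<cdot> S 0) ?B4"
      by (insert 2 A B G4 c, (assumption | rule tys, assumption | rule ty | simp)+)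
    have sG4: "substs ?G4 s2 ?G" by (rule substs_S[OF G4]) simp_all
    have tA4: "?G4 \<Turnstile> is_trunc (Suc m) ?A4" by (rule inh_subst[OF tA2 sG4]) simp
    have tB4: "?A4 # ?G4 \<Turnstile> is_trunc (Suc m) ?B4" by (rule inh_subst[OF tB2 substs_up[OF sG4 4(1)]]) simp
    have S2: "isty ?G (Sig ?A2 ?B2)" by (rule istyI[OF sig_form[OF 2(1,2)]])
    have p2: "?G \<turnstile> Dpair v1 v0 \<Colon> Sig ?A2 ?B2" by (rule pair_typing[OF istyI[OF 2(2)] 2(4,5)])
    have M2: "isty (Sig ?A2 ?B2 # ?G) (is_trunc m (IdT (w1 (Sig ?A2 ?B2)) (w1 (Dpair v1 v0)) v0))"
      by (rule trunc_isty[OF isty_Id[OF isty_subst[OF S2] typing_subst[OF p2 _ refl]]])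
        (rule substs_S ctx_cons[OF S2] var' | simp)+
    have M: "isty (Sig ?A ?B # \<Delta>) (is_trunc m (IdT (w1 (Sig ?A ?B)) v0 (w1 v)))"
      by (rule trunc_isty[OF isty_Id[OF isty_subst[OF S'] _ typing_subst[OF v _ refl]]])
        (rule substs_S ctx_cons[OF S'] var' | simp)+
    have "?G \<Turnstile> is_trunc m (IdT (Sig ?A2 ?B2) (Dpair v1 v0) (w2 v))"
      by (rule inh_sig_ind[OF 2(3) _ M2]) (use pairs[OF 4(1,2) tA4 tB4 4(3-6)] in simp_all)
    then have "\<Delta> \<Turnstile> is_trunc m (IdT (Sig ?A ?B) u v)"
      by (intro inh_sig_ind[OF u _ M]) simp_all
    then show "\<Delta> \<Turnstile> is_trunc m (IdT (subst \<sigma> (Sig A B)) u v)" by simp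
  qed
qed

text \<open>Given an inhabitant, the type is assembled from contractible families by products and
  sums, so it is contractible. Propositionality follows, because two elements to be compared provide
  the inhabitant.\<close>

lemma trunc_contr:
  assumes "\<Gamma> \<Turnstile> is_trunc m A" "\<Gamma> \<turnstile> A \<Colon> Univ i"
  shows "\<Gamma> \<Turnstile> is_trunc 0 (is_trunc m A)"
  using assms
proof (induction m arbitrary: \<Gamma> A)
  case 0
  note A = 0(2)
  note two = two_vars[OF istyI[OF A]]
  have I: "w1 A # A # \<Gamma> \<turnstile> IdT (w2 A) v1 v0 \<Colon> Univ i"
    by (rule id_form[OF typing_subst[OF A two(3)] two(1,2)]) simp
  have A1: "A # \<Gamma> \<turnstile> w1 A \<Colon> Univ i" by (rule typing_subst[OF A substs_S[OF ctx_ext[OF A]]]) simp_all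
  have "w1 A # A # \<Gamma> \<Turnstile> is_trunc 0 (IdT (w2 A) v1 v0)"
    by (rule contr_path[OF _ isty_subst[OF istyI[OF A] two(3)] two(1,2)]) (rule inh_subst[OF 0(1) two(3)], simp)
  then have "A # \<Gamma> \<Turnstile> is_trunc 0 (Prd (w1 A) (IdT (w2 A) v1 v0))"
    by (rule trunc_Prd[OF A1 I])
  then show ?case unfolding trunc_0[of A] by (rule trunc_Sig[OF A prd_form[OF A1 I] 0(1)])
next
  case (Suc m)
  note A = Suc.prems(2)
  note two = two_vars[OF istyI[OF A]]
  have A1: "A # \<Gamma> \<turnstile> w1 A \<Colon> Univ i" by (rule typing_subst[OF A substs_S[OF ctx_ext[OF A]]]) simp_all
  have I: "w1 A # A # \<Gamma> \<turnstile> IdT (w2 A) v1 v0 \<Colon> Univ i"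
    by (rule id_form[OF typing_subst[OF A two(3)] two(1,2)]) simp
  have "w1 A # A # \<Gamma> \<Turnstile> is_trunc (Suc m) (w2 A)" by (rule inh_subst[OF Suc.prems(1) two(3)]) simp
  from Suc.IH[OF trunc_SucD[OF this two(1,2)] I]
  have 1: "w1 A # A # \<Gamma> \<Turnstile> is_trunc 0 (is_trunc m (IdT (w2 A) v1 v0))" .
  show ?case unfolding trunc_Suc
    by (rule trunc_Prd[OF A prd_form[OF A1 trunc_form[OF I]] trunc_Prd[OF A1 trunc_form[OF I] 1]])
qed

lemma trunc_prop:
  assumes A: "\<Gamma> \<turnstile> A \<Colon> Univ i"
  shows "\<Gamma> \<Turnstile> is_trunc (Suc 0) (is_trunc m A)"
proof (rule trunc_Suc_intro[OF istyI[OF trunc_form[OF A]]])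
  fix \<Delta> \<sigma> t u assume s: "substs \<Delta> \<sigma> \<Gamma>" and t: "\<Delta> \<turnstile> t \<Colon> subst \<sigma> (is_trunc m A)" and u: "\<Delta> \<turnstile> u \<Colon> subst \<sigma> (is_trunc m A)"
  have A': "\<Delta> \<turnstile> subst \<sigma> A \<Colon> Univ i" using typing_substs[OF s A] by simp
  from t u have tu: "\<Delta> \<turnstile> t \<Colon> is_trunc m (subst \<sigma> A)" "\<Delta> \<turnstile> u \<Colon> is_trunc m (subst \<sigma> A)" by simp_all
  from contr_path[OF trunc_contr[OF inhI[OF tu(1)] A'] istyI[OF trunc_form[OF A']] tu]
  show "\<Delta> \<Turnstile> is_trunc 0 (IdT (subst \<sigma> (is_trunc m A)) t u)" by simp
qed

section \<open>Loop spaces\<close>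

text \<open>The recursion replaces the innermost pointed type by its loop space, so that a
  description of a single loop space carries over to the higher ones by
  \<open>peq_loops\<close>.\<close>

primrec LoopT :: "nat \<Rightarrow> tm \<Rightarrow> tm \<Rightarrow> tm" where
  "LoopT 0 A a = A"
| "LoopT (Suc m) A a = LoopT m (IdT A a a) (Refl a)"

primrec LoopP :: "nat \<Rightarrow> tm \<Rightarrow> tm \<Rightarrow> tm" where
  "LoopP 0 A a = a"
| "LoopP (Suc m) A a = LoopP m (IdT A a a) (Refl a)"

declare LoopT.simps(2) [simp del] LoopP.simps(2) [simp del]

lemma subst_LoopT [simp]: "subst \<sigma> (LoopT m A a) = LoopT m (subst \<sigma> A) (subst \<sigma> a)"
  by (induction m arbitrary: A a) (simp_all add: LoopT.simps(2))

lemma subst_LoopP [simp]: "subst \<sigma> (LoopP m A a) = LoopP m (subst \<sigma> A) (subst \<sigma> a)"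
  by (induction m arbitrary: A a) (simp_all add: LoopP.simps(2))

lemma Loop_form:
  "\<Gamma> \<turnstile> A \<Colon> Univ i \<Longrightarrow> \<Gamma> \<turnstile> a \<Colon> A \<Longrightarrow> \<Gamma> \<turnstile> LoopT m A a \<Colon> Univ i \<and> \<Gamma> \<turnstile> LoopP m A a \<Colon> LoopT m A a"
proof (induction m arbitrary: A a)
  case (Suc m)
  show ?case unfolding LoopT.simps LoopP.simps
    by (rule Suc.IH[OF id_form[OF Suc.prems Suc.prems(2)] refl_typing[OF istyI[OF Suc.prems(1)] Suc.prems(2) refl refl]])
qed simp

lemmas LoopT_form = Loop_form[THEN conjunct1] and LoopP_typing = Loop_form[THEN conjunct2]

text \<open>Levels are shifted by two: the premise says that \<open>A\<close> is an (m-1)-type. Each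
  loop lowers the level by one, and the m-fold loops form a proposition.\<close>

lemma trunc_loops:
  "\<Gamma> \<Turnstile> is_trunc (Suc m) A \<Longrightarrow> isty \<Gamma> A \<Longrightarrow> \<Gamma> \<turnstile> a \<Colon> A \<Longrightarrow> \<Gamma> \<turnstile> p \<Colon> LoopT m A a \<Longrightarrow>
   \<Gamma> \<Turnstile> IdT (LoopT m A a) p (LoopP m A a)"
proof (induction m arbitrary: A a)
  case 0
  then show ?case using prop_eq by simp
next
  case (Suc m)
  show ?case unfolding LoopT.simps LoopP.simps
    by (rule Suc.IH[OF trunc_SucD[OF Suc.prems(1,3,3)] isty_Id[OF Suc.prems(2,3,3)]
        refl_typing[OF Suc.prems(2,3) refl refl] Suc.prems(4)[unfolded LoopT.simps]])
qed

lemma LoopT_add: "LoopT m (LoopT k A a) (LoopP k A a) = LoopT (k + m) A a"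
  and LoopP_add: "LoopP m (LoopT k A a) (LoopP k A a) = LoopP (k + m) A a"
  by (induction k arbitrary: A a) (simp_all add: LoopT.simps(2) LoopP.simps(2))

lemma pt_vars: "ctx \<Gamma> \<Longrightarrow> v0 # Univ i # \<Gamma> \<turnstile> v1 \<Colon> Univ i" "ctx \<Gamma> \<Longrightarrow> v0 # Univ i # \<Gamma> \<turnstile> v0 \<Colon> v1"
    "ctx \<Gamma> \<Longrightarrow> substs (v0 # Univ i # \<Gamma>) s2 \<Gamma>"
  using pt_ctx by (auto intro: var' substs_S)

text \<open>In Leibniz form, congruence is the composition of a family with the construction at two
  variables.\<close>

lemma peq_loops:
  assumes "peq \<Gamma> i A a B b"
  shows "peq \<Gamma> i (LoopT m A a) (LoopP m A a) (LoopT m B b) (LoopP m B b)"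
proof -
  have *: "\<Gamma> \<turnstile> A \<Colon> Univ i" "\<Gamma> \<turnstile> B \<Colon> Univ i" "\<Gamma> \<turnstile> a \<Colon> A" "\<Gamma> \<turnstile> b \<Colon> B" using assms by (auto simp: peq_def)
  note c = typing_ctx[OF *(1)]
  have "\<Gamma> \<Turnstile> subst (LoopP m B b \<cdot> LoopT m B b \<cdot> S 0) C"
    if C: "isty (v0 # Univ i # \<Gamma>) C" and inh: "\<Gamma> \<Turnstile> subst (LoopP m A a \<cdot> LoopT m A a \<cdot> S 0) C" for C
  proof -
    have "isty (v0 # Univ i # \<Gamma>) (subst (LoopP m v1 v0 \<cdot> LoopT m v1 v0 \<cdot> s2) C)"
      by (rule isty_subst[OF C], intro substs_cons' pt_vars(3)[OF c])
        (insert Loop_form[OF pt_vars(1)[OF c] pt_vars(2)[OF c]], simp_all)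
    with assms inh have "\<Gamma> \<Turnstile> subst (b \<cdot> B \<cdot> S 0) (subst (LoopP m v1 v0 \<cdot> LoopT m v1 v0 \<cdot> s2) C)"
      unfolding peq_def by auto
    then show ?thesis by simp
  qed
  then show ?thesis using Loop_form * unfolding peq_def by blast
qed

lemma peq_trunc:
  assumes "peq \<Gamma> i A a B b" "\<Gamma> \<Turnstile> is_trunc k A"
  shows "\<Gamma> \<Turnstile> is_trunc k B"
proof -
  have c: "ctx \<Gamma>" using assms by (auto simp: peq_def dest: typing_ctx)
  have "isty (v0 # Univ i # \<Gamma>) (is_trunc k v1)" by (rule trunc_isty[OF istyI[OF pt_vars(1)[OF c]]])
  with assms have "\<Gamma> \<Turnstile> subst (b \<cdot> B \<cdot> S 0) (is_trunc k v1)"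
    unfolding peq_def by auto
  then show ?thesis by simp
qed

definition trivial :: "tm \<Rightarrow> tm \<Rightarrow> tm" where
  "trivial A a = Prd A (IdT (w1 A) v0 (w1 a))"

lemma subst_trivial [simp]: "subst \<sigma> (trivial A a) = trivial (subst \<sigma> A) (subst \<sigma> a)"
  by (simp add: trivial_def)

lemma trivial_isty: "isty \<Gamma> A \<Longrightarrow> \<Gamma> \<turnstile> a \<Colon> A \<Longrightarrow> isty \<Gamma> (trivial A a)"
  unfolding trivial_def by (frule isty_ctx) (assumption | rule tys, assumption | rule ty | simp)+

lemma trivialD: "\<Gamma> \<Turnstile> trivial A a \<Longrightarrow> \<Gamma> \<turnstile> x \<Colon> A \<Longrightarrow> \<Gamma> \<Turnstile> IdT A x a"
  unfolding trivial_def by (erule inh_App) simp_all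

lemma peq_trivial:
  assumes "peq \<Gamma> i A a B b" "\<Gamma> \<Turnstile> trivial A a"
  shows "\<Gamma> \<Turnstile> trivial B b"
proof -
  have c: "ctx \<Gamma>" using assms by (auto simp: peq_def dest: typing_ctx)
  have "isty (v0 # Univ i # \<Gamma>) (trivial v1 v0)" by (rule trivial_isty[OF istyI[OF pt_vars(1)[OF c]] pt_vars(2)[OF c]])
  with assms have "\<Gamma> \<Turnstile> subst (b \<cdot> B \<cdot> S 0) (trivial v1 v0)"
    unfolding peq_def by auto
  then show ?thesis by simp
qed

text \<open>
  \<open>lift B b Q\<close> is inhabited by an element of \<open>B\<close> which can be equal to \<open>b\<close> only if \<open>Q\<close> holds.
\<close>

definition lift :: "tm \<Rightarrow> tm \<Rightarrow> tm \<Rightarrow> tm" where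
  "lift B b Q = Sig B (Prd (IdT (w1 B) v0 (w1 b)) (w2 Q))"

lemma subst_lift [simp]: "subst \<sigma> (lift B b Q) = lift (subst \<sigma> B) (subst \<sigma> b) (subst \<sigma> Q)"
  by (simp add: lift_def)

lemma lift_fib:
  assumes "isty \<Gamma> A" "\<Gamma> \<turnstile> a \<Colon> A" "isty \<Gamma> Q"
  shows "isty (A # \<Gamma>) (Prd (IdT (w1 A) v0 (w1 a)) (w2 Q))"
  by (insert assms isty_ctx[OF assms(1)], (assumption | rule tys, assumption | rule ty | simp)+)

lemma lift_isty: "isty \<Gamma> A \<Longrightarrow> \<Gamma> \<turnstile> a \<Colon> A \<Longrightarrow> isty \<Gamma> Q \<Longrightarrow> isty \<Gamma> (lift A a Q)"
  unfolding lift_def by (rule isty_Sig[OF _ lift_fib])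

lemma liftI:
  assumes "isty \<Gamma> A" "\<Gamma> \<turnstile> a \<Colon> A" "isty \<Gamma> Q" "\<Gamma> \<turnstile> p \<Colon> A" "IdT A p a # \<Gamma> \<Turnstile> w1 Q"
  shows "\<Gamma> \<Turnstile> lift A a Q"
  unfolding lift_def
  by (rule inh_pair[OF lift_fib[OF assms(1-3)] assms(4)])
    (use inh_Prd[OF isty_Id[OF assms(1,4,2)] assms(5)] in simp)

text \<open>\<open>Q\<close> does not mention the pointed type. Thus an element whose triviality
  forces \<open>Q\<close> can be moved along an equality of pointed types without tracking its
  image.\<close>

lemma peq_lift:
  assumes "peq \<Gamma> i A a B b" "isty \<Gamma> Q" "\<Gamma> \<Turnstile> lift A a Q"
  shows "\<Gamma> \<Turnstile> lift B b Q"
proof -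
  have c: "ctx \<Gamma>" using assms by (auto simp: peq_def dest: typing_ctx)
  have "isty (v0 # Univ i # \<Gamma>) (lift v1 v0 (w2 Q))"
    by (rule lift_isty[OF istyI[OF pt_vars(1)[OF c]] pt_vars(2)[OF c] isty_subst[OF assms(2) pt_vars(3)[OF c]]])
  with assms have "\<Gamma> \<Turnstile> subst (b \<cdot> B \<cdot> S 0) (lift v1 v0 (w2 Q))"
    unfolding peq_def by auto
  then show ?thesis by simp
qed

section \<open>Loops in function types and in the universe\<close>

text \<open>A loop at a function is a homotopy from it to itself. The identity system for functions
  has an applied abstraction at the right end, which a \<beta>-conversion removes.\<close>

lemma pi_peq:
  assumes A: "\<Gamma> \<turnstile> A \<Colon> Univ i" and F: "A # \<Gamma> \<turnstile> F \<Colon> Univ i" and b: "A # \<Gamma> \<turnstile> b \<Colon> F"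
  shows "peq \<Gamma> i (IdT (Prd A F) (Lam A b) (Lam A b)) (Refl (Lam A b)) (Prd A (IdT F b b)) (Lam A (Refl b))"
proof -
  have P: "\<Gamma> \<turnstile> Prd A F \<Colon> Univ i" by (rule prd_form[OF A F])
  have l: "\<Gamma> \<turnstile> Lam A b \<Colon> Prd A F" by (rule lam_typing[OF istyI[OF A] b])
  note beta = beta_v0[OF istyI[OF A] b] and l1 = eta(2)[OF istyI[OF A] l]
  have I: "A # \<Gamma> \<turnstile> IdT F b (App (w1 (Lam A b)) v0) \<doteq> IdT F b b \<Colon> Univ i"
    by (rule id_form_eq[OF eq_refl[OF F] eq_refl[OF b] beta])
  have IU: "A # \<Gamma> \<turnstile> IdT F b (App (w1 (Lam A b)) v0) \<Colon> Univ i" "A # \<Gamma> \<turnstile> IdT F b b \<Colon> Univ i"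
    by (rule id_form[OF F b l1] id_form[OF F b b])+
  have r: "A # \<Gamma> \<turnstile> Refl b \<Colon> IdT F b b" by (rule refl_typing[OF istyI[OF F] b refl refl])
  have r0: "\<Gamma> \<turnstile> Lam A (Refl b) \<Colon> Prd A (IdT F b (App (w1 (Lam A b)) v0))"
    by (rule lam_typing[OF istyI[OF A] typing_conv[OF r eqtyI[OF eq_sym[OF I]]]])
  have "peq \<Gamma> i (IdT (Prd A F) (Lam A b) (Lam A b)) (Refl (Lam A b))
      (Prd A (IdT F b (App (w1 (Lam A b)) v0))) (Lam A (Refl b))"
    using idsys_peq[OF P htpy_form[OF A F b] l _ idsys_funext[OF A F b]] r0 by simp
  moreover have "peq \<Gamma> i (Prd A (IdT F b (App (w1 (Lam A b)) v0))) (Lam A (Refl b)) (Prd A (IdT F b b)) (Lam A (Refl b))"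
    by (rule peq_cong[OF prd_form_eq[OF A eq_refl[OF A] I] eq_refl[OF r0] prd_form[OF A IU(1)] prd_form[OF A IU(2)] r0
          lam_typing[OF istyI[OF A] r]])
  ultimately show ?thesis by (rule peq_trans)
qed

text \<open>The right-hand side of \<open>pi_peq\<close> is again a product with an abstraction as
  base point, so that step can be iterated.\<close>

lemma pi_loops_peq:
  assumes "\<Gamma> \<turnstile> A \<Colon> Univ i" "A # \<Gamma> \<turnstile> F \<Colon> Univ i" "A # \<Gamma> \<turnstile> b \<Colon> F"
  shows "peq \<Gamma> i (LoopT m (Prd A F) (Lam A b)) (LoopP m (Prd A F) (Lam A b)) (Prd A (LoopT m F b)) (Lam A (LoopP m F b))"
  using assms
proof (induction m arbitrary: F b)
  case 0
  have P: "\<Gamma> \<turnstile> Prd A F \<Colon> Univ i" by (rule prd_form[OF 0(1,2)])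
  have l: "\<Gamma> \<turnstile> Lam A b \<Colon> Prd A F" by (rule lam_typing[OF istyI[OF 0(1)] 0(3)])
  show ?case using peq_cong[OF eq_refl[OF P] eq_refl[OF l] P P l l] by simp
next
  case (Suc m)
  note A = Suc.prems(1) and F = Suc.prems(2) and b = Suc.prems(3)
  show ?case
    unfolding LoopT.simps LoopP.simps
    by (rule peq_trans[OF peq_loops[OF pi_peq[OF A F b]] Suc.IH[OF A id_form[OF F b b]
          refl_typing[OF istyI[OF F] b refl refl]]])
qed

text \<open>Here the right endpoint is the fixed one, so the elimination rule with two free
  endpoints is used in place of \<open>based_J\<close>.\<close>

lemma singleton_contr':
  assumes A: "isty \<Gamma> A" and a: "\<Gamma> \<turnstile> a \<Colon> A"
  shows "\<Gamma> \<Turnstile> is_trunc 0 (Sig A (IdT (w1 A) v0 (w1 a)))"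
proof -
  note c = typing_ctx[OF a]
  let ?S = "\<lambda>A x. Sig A (IdT (w1 A) v0 (w1 x))"
  have S: "isty \<Delta> (?S A x)" "\<Delta> \<turnstile> Dpair x (Refl x) \<Colon> ?S A x" if "isty \<Delta> A" "\<Delta> \<turnstile> x \<Colon> A" for \<Delta> A x
    by (insert that typing_ctx[OF that(2)], (assumption | rule tys, assumption | rule ty | simp)+)
  have gen: "\<Gamma>' \<Turnstile> IdT (?S A' b) (Dpair b (Refl b)) (Dpair x q)"
    if A': "isty \<Gamma>' A'" and x: "\<Gamma>' \<turnstile> x \<Colon> A'" and b: "\<Gamma>' \<turnstile> b \<Colon> A'" and q: "\<Gamma>' \<turnstile> q \<Colon> IdT A' x b" for \<Gamma>' A' x b q
  proof -
    note c = typing_ctx[OF x]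
    let ?G = "IdT (w2 A') v1 v0 # w1 A' # A' # \<Gamma>'"
    have G: "ctx ?G" by (insert A' c, (assumption | rule tys, assumption | rule ty | simp)+)
    have 3: "isty ?G (w3 A')" "?G \<turnstile> v1 \<Colon> w3 A'" "?G \<turnstile> v2 \<Colon> w3 A'" "?G \<turnstile> v0 \<Colon> IdT (w3 A') v2 v1" by (insert A' G c, (assumption | rule tys, assumption | rule ty | simp)+)
    have p: "?G \<turnstile> Dpair v2 v0 \<Colon> ?S (w3 A') v1" by (insert A' G 3 c, (assumption | rule tys, assumption | rule ty | simp)+)
    obtain j where j: "?G \<turnstile> IdT (?S (w3 A') v1) (Dpair v1 (Refl v1)) (Dpair v2 v0) \<Colon> Univ j"
      using isty_Id[OF S[OF 3(1,2)] p] by (auto simp: isty_def)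
    have A1: "isty (A' # \<Gamma>') (w1 A')" "A' # \<Gamma>' \<turnstile> v0 \<Colon> w1 A'" by (insert A' c, (assumption | rule tys, assumption | rule ty | simp)+)
    have r: "A' # \<Gamma>' \<turnstile> Refl (Dpair v0 (Refl v0)) \<Colon> IdT (?S (w1 A') v0) (Dpair v0 (Refl v0)) (Dpair v0 (Refl v0))"
      by (rule refl_typing[OF S[OF A1] refl refl])
    show ?thesis
      by (rule inhI, rule id_elim'[OF q x b j r]) simp_all
  qed
  let ?I = "IdT (w1 A) v0 (w1 a)"
  have I: "isty (A # \<Gamma>) ?I" by (insert A a c, (assumption | rule tys, assumption | rule ty | simp)+)
  have "isty (?I # A # \<Gamma>) (w2 A)" "?I # A # \<Gamma> \<turnstile> v1 \<Colon> w2 A" "?I # A # \<Gamma> \<turnstile> w2 a \<Colon> w2 A" "?I # A # \<Gamma> \<turnstile> v0 \<Colon> IdT (w2 A) v1 (w2 a)"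
    by (insert A a I c, (assumption | rule tys, assumption | rule ty | simp)+)
  note g = gen[OF this]
  note SA = S[OF A a]
  have M: "isty (?S A a # \<Gamma>) (IdT (w1 (?S A a)) (w1 (Dpair a (Refl a))) v0)"
    by (rule isty_Id[OF isty_subst[OF SA(1)] typing_subst[OF SA(2) _ refl]])
      (rule substs_S ctx_cons[OF SA(1)] var' | simp)+
  show ?thesis
    by (rule contrI[OF SA], rule inh_sig_ctx[OF A I M]) (insert g, simp)
qed

text \<open>Choice for the singletons of points equal to x: the sections of the identity map are
  contractible to the identity with reflexivity as homotopy.\<close>

lemma contr_sections:
  assumes A: "\<Gamma> \<turnstile> A \<Colon> Univ i"
  shows "\<Gamma> \<Turnstile> is_trunc 0 (Sig (arr A A) (Prd (w1 A) (IdT (w2 A) (App v1 v0) v0)))"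
proof -
  note c = typing_ctx[OF A]
  let ?T = "\<lambda>A. IdT (w2 A) v0 v1" and ?H = "\<lambda>A. Prd (w1 A) (IdT (w2 A) (App v1 v0) v0)"
  let ?b = "Lam A v0" and ?t = "Lam A (Refl v0)"
  have 1: "A # \<Gamma> \<turnstile> w1 A \<Colon> Univ i" "w1 A # A # \<Gamma> \<turnstile> ?T A \<Colon> Univ i" "A # \<Gamma> \<turnstile> v0 \<Colon> w1 A"
    by (insert A c, (assumption | rule tys, assumption | rule ty | simp)+)
  have H: "arr A A # \<Gamma> \<turnstile> ?H A \<Colon> Univ i" using pointwise_form[OF A 1(1,2)] by simp
  have AA: "\<Gamma> \<turnstile> arr A A \<Colon> Univ i" by (rule prd_form[OF A 1(1)])
  have ct: "A # \<Gamma> \<Turnstile> is_trunc 0 (Sig (w1 A) (?T A))"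
    using singleton_contr'[OF istyI[OF 1(1)] 1(3)] by simp
  have b: "\<Gamma> \<turnstile> ?b \<Colon> arr A A" by (rule lam_typing[OF istyI[OF A] 1(3)])
  have rt: "A # \<Gamma> \<turnstile> Refl v0 \<Colon> IdT (w1 A) v0 v0" by (rule refl_typing[OF istyI[OF 1(1)] 1(3) refl refl])
  have e: "A # \<Gamma> \<turnstile> App (w1 ?b) v0 \<doteq> v0 \<Colon> w1 A" by (rule beta_v0[OF istyI[OF A] 1(3)])
  have t: "\<Gamma> \<turnstile> ?t \<Colon> subst (?b \<cdot> S 0) (?H A)"
    using lam_typing[OF istyI[OF A] typing_conv[OF rt eqty_Id[OF istyI[OF 1(1)] eq_sym[OF e] eq_refl[OF 1(3)]]]] by simp
  let ?S = "Sig (arr A A) (?H A)"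
  have S: "isty \<Gamma> ?S" by (rule istyI[OF sig_form[OF AA H]])
  have ctr: "\<Gamma> \<turnstile> Dpair ?b ?t \<Colon> ?S" by (rule pair_typing[OF istyI[OF H] b t])
  have M: "isty (?S # \<Gamma>) (IdT (w1 ?S) (w1 (Dpair ?b ?t)) v0)"
    by (rule isty_Id[OF isty_subst[OF S] typing_subst[OF ctr _ refl]])
      (rule substs_S ctx_cons[OF S] var' | simp)+
  let ?G = "?H A # arr A A # \<Gamma>"
  have G: "ctx ?G" by (rule ctx_ext[OF H])
  have sG: "substs ?G s2 \<Gamma>" by (rule substs_S[OF G]) simp_all
  have 2: "?G \<turnstile> w2 A \<Colon> Univ i" "?G \<turnstile> v1 \<Colon> arr (w2 A) (w2 A)" "?G \<turnstile> v0 \<Colon> Prd (w2 A) (subst (App (w1 v1) v0 \<cdot> S 0) (?T (w2 A)))"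
    by (insert A G c, (assumption | rule tys, assumption | rule ty | simp)+)
  have 3: "w2 A # ?G \<turnstile> w1 (w2 A) \<Colon> Univ i" "w1 (w2 A) # w2 A # ?G \<turnstile> ?T (w2 A) \<Colon> Univ i" "w2 A # ?G \<turnstile> v0 \<Colon> w1 (w2 A)"
      "w2 A # ?G \<turnstile> Refl v0 \<Colon> subst (v0 \<cdot> S 0) (?T (w2 A))"
    by (insert A G c, (assumption | rule tys, assumption | rule ty | simp)+)
  have ct2: "w2 A # ?G \<Turnstile> is_trunc 0 (Sig (w1 (w2 A)) (?T (w2 A)))"
    by (rule inh_subst[OF ct substs_up[OF sG 2(1)]]) simp
  have H2: "arr (w2 A) (w2 A) # ?G \<turnstile> pointwise (w2 A) (?T (w2 A)) \<Colon> Univ i" by (rule pointwise_form[OF 2(1) 3(1,2)])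
  let ?P = "pointwise (w2 A) (?T (w2 A)) # arr (w2 A) (w2 A) # ?G"
  let ?C = "IdT (w4 ?S) (w4 (Dpair ?b ?t)) (Dpair v1 v0)"
  have cP: "ctx ?P" by (rule ctx_ext[OF H2])
  have s4: "substs ?P s4 \<Gamma>" by (rule substs_S[OF cP]) simp_all
  have p4: "?P \<turnstile> Dpair v1 v0 \<Colon> w4 ?S"
    using pair_typing[OF isty_subst[OF istyI[OF H] substs_up[OF s4 typing_subst[OF AA s4]]], where a = v1 and b = v0] cP
    by (simp add: var')
  have C: "isty ?P ?C"
    by (rule isty_Id[OF isty_subst[OF S s4] typing_subst[OF ctr s4 refl] p4])
  have base: "?G \<Turnstile> subst (Lam (w2 A) (Refl v0) \<cdot> Lam (w2 A) v0 \<cdot> S 0) ?C"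
    using inh_subst[OF id_refl[OF S ctr] sG] by simp
  show ?thesis
    by (rule contrI[OF S ctr], rule inh_sig_ctx[OF istyI[OF AA] istyI[OF H] M])
      (use choice_elim[OF 2(1) 3(1,2) ct2 3(3,4) C base 2(2,3)] in simp)
qed

text \<open>At the identity map both halves of \<open>Isequiv\<close> are, up to \<beta>, the type
  of \<open>contr_sections\<close>. The identity map is enough, for it is the base point at which
  \<open>prop_Sig_peq\<close> is applied.\<close>

lemma Isequiv_id_contr:
  assumes A: "\<Gamma> \<turnstile> A \<Colon> Univ i"
  shows "\<Gamma> \<Turnstile> is_trunc 0 (Isequiv A A (Lam A v0))"
proof -
  note c = typing_ctx[OF A]
  have v: "A # \<Gamma> \<turnstile> v0 \<Colon> w1 A" by (insert A c, (assumption | rule tys, assumption | rule ty | simp)+)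
  have i: "\<Gamma> \<turnstile> Lam A v0 \<Colon> arr A A" by (rule lam_typing[OF istyI[OF A] v])
  note P = Isequiv_parts[OF A A i]
  let ?H = "\<lambda>u. Prd (w1 A) (IdT (w2 A) u v0)"
  let ?G = "w1 A # arr A A # \<Gamma>"
  have AA: "\<Gamma> \<turnstile> arr A A \<Colon> Univ i" by (insert A c, (assumption | rule tys, assumption | rule ty | simp)+)
  have A1: "arr A A # \<Gamma> \<turnstile> w1 A \<Colon> Univ i" by (insert A AA c, (assumption | rule tys, assumption | rule ty | simp)+)
  have A2: "?G \<turnstile> w2 A \<Colon> Univ i" and v2: "?G \<turnstile> v0 \<Colon> w2 A" by (insert A AA c, (assumption | rule tys, assumption | rule ty | simp)+)
  have g: "?G \<turnstile> v1 \<Colon> arr (w2 A) (w2 A)" by (insert A AA c, (assumption | rule tys, assumption | rule ty | simp)+)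
  note gv = arr_app[OF g v2]
  have id: "?G \<turnstile> App (Lam (w2 A) v0) u \<doteq> u \<Colon> w2 A" if "?G \<turnstile> u \<Colon> w2 A" for u
    by (rule beta[where B = "w3 A"]) (insert A2 that typing_ctx[OF A2], (assumption | rule tys, assumption | rule ty | simp)+)
  have e2: "?G \<turnstile> App v1 (App (Lam (w2 A) v0) v0) \<doteq> App v1 v0 \<Colon> w2 A"
    by (rule prd_elim_eq'[OF eq_refl[OF g] id[OF v2]]) simp
  have HH: "arr A A # \<Gamma> \<turnstile> ?H (App v1 v0) \<Colon> Univ i"
    by (rule prd_form[OF A1 id_form[OF A2 gv v2]])
  have contr: "\<Gamma> \<Turnstile> is_trunc 0 (Sig (arr A A) (?H u))"
    if e: "?G \<turnstile> u \<doteq> App v1 v0 \<Colon> w2 A" and u: "arr A A # \<Gamma> \<turnstile> ?H u \<Colon> Univ i" for u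
    by (rule trunc_jeq[OF contr_sections[OF A] sig_form_eq[OF AA eq_refl[OF AA] prd_form_eq[OF A1 eq_refl[OF A1]
          id_form_eq[OF eq_refl[OF A2] eq_sym[OF e] eq_refl[OF v2]]]] sig_form[OF AA HH] sig_form[OF AA u]])
  let ?S = "Sig (arr A A) (Prd (w1 A) (IdT (w2 A) (App (w2 (Lam A v0)) (App v1 v0)) v0))"
  let ?T = "Sig (arr A A) (Prd (w1 A) (IdT (w2 A) (App v1 (App (w2 (Lam A v0)) v0)) v0))"
  have S: "\<Gamma> \<turnstile> ?S \<Colon> Univ i" and T: "\<Gamma> \<turnstile> ?T \<Colon> Univ i"
    by (rule sig_form[OF AA P(1)], rule sig_form[OF AA P(2)])
  have cS: "\<Gamma> \<Turnstile> is_trunc 0 ?S" by (rule contr[OF _ P(1)]) (simp add: id[OF gv])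
  have cT: "\<Gamma> \<Turnstile> is_trunc 0 ?T" by (rule contr[OF _ P(2)]) (simp add: e2)
  have sub: "substs (?S # \<Gamma>) s1 \<Gamma>" by (rule substs_S[OF ctx_ext[OF S]]) simp_all
  have "?S # \<Gamma> \<turnstile> w1 ?T \<Colon> Univ i" by (rule typing_subst[OF T sub]) simp
  moreover have "?S # \<Gamma> \<Turnstile> is_trunc 0 (w1 ?T)" by (rule inh_subst[OF cT sub]) simp
  ultimately show ?thesis unfolding Isequiv_eq using trunc_Sig[OF S _ cS] by blast
qed

text \<open>The local-global looping principle: \<open>\<Omega>\<^sup>2(\<U>, L) \<simeq> \<Prod>(l : L). \<Omega>(L, l)\<close> as pointed types.\<close>

lemma local_global:
  assumes L: "\<Gamma> \<turnstile> L \<Colon> Univ i"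
  shows "peq \<Gamma> (Suc i) (LoopT (Suc (Suc 0)) (Univ i) L) (LoopP (Suc (Suc 0)) (Univ i) L)
    (Prd L (IdT (w1 L) v0 v0)) (Lam L (Refl v0))"
proof -
  note c = typing_ctx[OF L]
  have L': "\<Gamma> \<turnstile> L \<Colon> Univ (Suc i)" by (rule univ_cumul[OF L])
  have L1: "L # \<Gamma> \<turnstile> w1 L \<Colon> Univ (Suc i)" and v: "L # \<Gamma> \<turnstile> v0 \<Colon> w1 L" by (insert L' c, (assumption | rule tys, assumption | rule ty | simp)+)
  let ?s = "Dpair (Dpair (Lam L v0) (Lam L (Refl v0))) (Dpair (Lam L v0) (Lam L (Refl v0)))"
  have id: "id_equiv L = Dpair (Lam L v0) ?s" by (rule id_equiv_eq)
  have arrU: "\<Gamma> \<turnstile> arr L L \<Colon> Univ (Suc i)" by (rule prd_form[OF L' L1])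
  have l: "\<Gamma> \<turnstile> Lam L v0 \<Colon> arr L L" by (rule lam_typing[OF istyI[OF L] v])
  have fib: "arr L L # \<Gamma> \<turnstile> Isequiv (w1 L) (w1 L) v0 \<Colon> Univ (Suc i)"
    by (rule Isequiv_form) (insert L' c arrU, (assumption | rule tys, assumption | rule ty | simp)+)
  have s: "\<Gamma> \<turnstile> ?s \<Colon> subst (Lam L v0 \<cdot> S 0) (Isequiv (w1 L) (w1 L) v0)"
    using id_equiv_typing(1)[OF L] by simp
  have "\<Gamma> \<Turnstile> is_trunc (Suc 0) (Isequiv L L (Lam L v0))"
    by (rule trunc_mono_Suc[OF Isequiv_id_contr[OF L] istyI[OF Isequiv_form[OF L L l]]])
  then have p: "\<Gamma> \<Turnstile> is_trunc (Suc 0) (subst (Lam L v0 \<cdot> S 0) (Isequiv (w1 L) (w1 L) v0))" by simp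
  \<comment> \<open>Univalence turns the first loop into a self-equivalence. In the second one the
    proof of being an equivalence drops out, which leaves loops at the identity function.\<close>
  have 1: "peq \<Gamma> (Suc i) (LoopT (Suc (Suc 0)) (Univ i) L) (LoopP (Suc (Suc 0)) (Univ i) L)
      (IdT (Equiv L L) (id_equiv L) (id_equiv L)) (Refl (id_equiv L))"
    using peq_loops[OF univalence_peq[OF L], of "Suc 0"] by (simp add: LoopT.simps LoopP.simps)
  have 2: "peq \<Gamma> (Suc i) (IdT (Equiv L L) (id_equiv L) (id_equiv L)) (Refl (id_equiv L))
      (IdT (arr L L) (Lam L v0) (Lam L v0)) (Refl (Lam L v0))"
    unfolding id Equiv_eq by (rule prop_Sig_peq[OF arrU fib l s p])
  show ?thesis
    by (rule peq_trans[OF 1 peq_trans[OF 2 pi_peq[OF L' L1 v]]])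
qed

text \<open>The first two loops are consumed by \<open>local_global\<close>; the other
  \<open>m\<close> are taken inside the product.\<close>

lemma local_global_loops:
  assumes L: "\<Gamma> \<turnstile> L \<Colon> Univ i"
  shows "peq \<Gamma> (Suc i) (LoopT (Suc (Suc m)) (Univ i) L) (LoopP (Suc (Suc m)) (Univ i) L)
    (Prd L (LoopT (Suc m) (w1 L) v0)) (Lam L (LoopP (Suc m) (w1 L) v0))"
proof -
  note c = typing_ctx[OF L]
  have L': "\<Gamma> \<turnstile> L \<Colon> Univ (Suc i)" by (rule univ_cumul[OF L])
  have L1: "L # \<Gamma> \<turnstile> w1 L \<Colon> Univ (Suc i)" and v: "L # \<Gamma> \<turnstile> v0 \<Colon> w1 L" by (insert L' c, (assumption | rule tys, assumption | rule ty | simp)+)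
  have "peq \<Gamma> (Suc i) (LoopT (Suc (Suc m)) (Univ i) L) (LoopP (Suc (Suc m)) (Univ i) L)
      (LoopT m (Prd L (IdT (w1 L) v0 v0)) (Lam L (Refl v0))) (LoopP m (Prd L (IdT (w1 L) v0 v0)) (Lam L (Refl v0)))"
    using peq_loops[OF local_global[OF L], of m] by (simp add: LoopT_add LoopP_add)
  from peq_trans[OF this pi_loops_peq[OF L' id_form[OF L1 v v] refl_typing[OF istyI[OF L1] v refl refl]]]
  show ?thesis by (simp add: LoopT.simps(2) LoopP.simps(2))
qed

section \<open>The total space of set-like loops\<close>

abbreviation isset :: "tm \<Rightarrow> tm" where
  "isset \<equiv> is_trunc (Suc (Suc 0))"

definition fibre :: "nat \<Rightarrow> tm \<Rightarrow> tm \<Rightarrow> tm" where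
  "fibre m A a = Sig (LoopT m A a) (isset (LoopT m (w1 A) (w1 a)))"

lemma subst_fibre [simp]: "subst \<sigma> (fibre m A a) = fibre m (subst \<sigma> A) (subst \<sigma> a)"
  by (simp add: fibre_def)

lemma fibre_snd:
  assumes "\<Gamma> \<turnstile> A \<Colon> Univ i" "\<Gamma> \<turnstile> a \<Colon> A"
  shows "LoopT m A a # \<Gamma> \<turnstile> isset (LoopT m (w1 A) (w1 a)) \<Colon> Univ i"
proof (rule trunc_form[OF LoopT_form])
  have "substs (LoopT m A a # \<Gamma>) s1 \<Gamma>" by (rule substs_S[OF ctx_ext[OF LoopT_form[OF assms]]]) simp_all
  from typing_substs[OF this assms(1)] typing_substs[OF this assms(2)]
  show "LoopT m A a # \<Gamma> \<turnstile> w1 A \<Colon> Univ i" "LoopT m A a # \<Gamma> \<turnstile> w1 a \<Colon> w1 A" by simp_all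
qed

lemma fibre_form: "\<Gamma> \<turnstile> A \<Colon> Univ i \<Longrightarrow> \<Gamma> \<turnstile> a \<Colon> A \<Longrightarrow> \<Gamma> \<turnstile> fibre m A a \<Colon> Univ i"
  unfolding fibre_def by (rule sig_form[OF LoopT_form fibre_snd])

lemma fibre_pair:
  assumes "\<Gamma> \<turnstile> A \<Colon> Univ i" "\<Gamma> \<turnstile> a \<Colon> A" "\<Gamma> \<turnstile> p \<Colon> LoopT m A a" "\<Gamma> \<turnstile> t \<Colon> isset (LoopT m A a)"
  shows "\<Gamma> \<turnstile> Dpair p t \<Colon> fibre m A a"
  unfolding fibre_def by (rule pair_typing[OF istyI[OF fibre_snd[OF assms(1,2)]] assms(3)]) (simp add: assms(4))

lemma fibre_set:
  assumes A: "\<Gamma> \<turnstile> A \<Colon> Univ i" and a: "\<Gamma> \<turnstile> a \<Colon> A" and t: "\<Gamma> \<Turnstile> isset (LoopT m A a)"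
  shows "\<Gamma> \<Turnstile> isset (fibre m A a)"
proof -
  note L = LoopT_form[OF A a, of m]
  have sub: "substs (LoopT m A a # \<Gamma>) s1 \<Gamma>" by (rule substs_S[OF ctx_ext[OF L]]) simp_all
  have "LoopT m A a # \<Gamma> \<turnstile> LoopT m (w1 A) (w1 a) \<Colon> Univ i" using typing_substs[OF sub L] by simp
  from trunc_mono_Suc[OF trunc_prop[OF this] istyI[OF trunc_form[OF this]]]
  have "LoopT m A a # \<Gamma> \<Turnstile> isset (isset (LoopT m (w1 A) (w1 a)))" .
  then show ?thesis unfolding fibre_def by (rule trunc_Sig[OF L fibre_snd[OF A a] t])
qed

text \<open>A single loop of the sum still contains a path in the fibre, but the type of such paths
  over the base point is a proposition as the fibre is a set. A second loop no longer sees it, so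
  the sum and its base agree from dimension two on.\<close>

lemma set_fibre_peq:
  assumes A: "\<Gamma> \<turnstile> A \<Colon> Univ i" and B: "A # \<Gamma> \<turnstile> B \<Colon> Univ i"
    and a: "\<Gamma> \<turnstile> a \<Colon> A" and b: "\<Gamma> \<turnstile> b \<Colon> subst (a \<cdot> S 0) B" and set: "\<Gamma> \<Turnstile> isset (subst (a \<cdot> S 0) B)"
  shows "peq \<Gamma> i (LoopT (Suc (Suc m)) (Sig A B) (Dpair a b)) (LoopP (Suc (Suc m)) (Sig A B) (Dpair a b))
    (LoopT (Suc (Suc m)) A a) (LoopP (Suc (Suc m)) A a)"
proof -
  note c = typing_ctx[OF a]
  note ra = refl_typing[OF istyI[OF A] a refl refl]
  let ?I = "IdT A a a" and ?B1 = "subst (v0 \<cdot> s2) B"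
  have I: "\<Gamma> \<turnstile> ?I \<Colon> Univ i" by (rule id_form[OF A a a])
  have 1: "?I # \<Gamma> \<turnstile> w1 A \<Colon> Univ i" "w1 A # ?I # \<Gamma> \<turnstile> ?B1 \<Colon> Univ i" "?I # \<Gamma> \<turnstile> w1 a \<Colon> w1 A"
    "?I # \<Gamma> \<turnstile> w1 b \<Colon> subst (w1 a \<cdot> S 0) ?B1" "?I # \<Gamma> \<turnstile> v0 \<Colon> IdT (w1 A) (w1 a) (w1 a)"
    by (insert A B a b istyI[OF I] c, (assumption | rule tys, assumption | rule ty | simp)+)
  let ?J = "IdT (subst (w1 a \<cdot> S 0) ?B1) (Tr ?B1 (w1 a) (w1 a) v0 (w1 b)) (w1 b)"
  have J: "?I # \<Gamma> \<turnstile> ?J \<Colon> Univ i"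
    by (rule id_form[OF fib_form[OF 1(1-4) 1(3)] dpath_Tr[OF 1(1-4) 1(3,5)] 1(4)])
  have D: "subst (b \<cdot> a \<cdot> S 0) (dpath A B a b) = Sig ?I ?J" by simp
  have tr: "\<Gamma> \<turnstile> Tr B a a (Refl a) b \<Colon> subst (a \<cdot> S 0) B" by (rule dpath_Tr[OF A B a b a ra])
  have rb: "\<Gamma> \<turnstile> Refl b \<Colon> IdT (subst (a \<cdot> S 0) B) (Tr B a a (Refl a) b) b"
    by (rule typing_conv[OF refl_typing[OF istyI[OF fib_form[OF A B a b a]] b refl refl] eqty_sym[OF dpath_refl_fib[OF A B a b b]]])
  have p: "\<Gamma> \<Turnstile> is_trunc (Suc 0) (subst (Refl a \<cdot> S 0) ?J)"
    using trunc_SucD[OF set tr b] by simp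
  have "peq \<Gamma> i (IdT (Sig ?I ?J) (Dpair (Refl a) (Refl b)) (Dpair (Refl a) (Refl b))) (Refl (Dpair (Refl a) (Refl b)))
      (IdT ?I (Refl a) (Refl a)) (Refl (Refl a))"
    by (rule prop_Sig_peq[OF I J ra _ p]) (simp add: rb)
  then have 2: "peq \<Gamma> i (LoopT (Suc 0) (Sig ?I ?J) (Dpair (Refl a) (Refl b))) (LoopP (Suc 0) (Sig ?I ?J) (Dpair (Refl a) (Refl b)))
      (LoopT (Suc (Suc 0)) A a) (LoopP (Suc (Suc 0)) A a)"
    by (simp add: LoopT.simps(2) LoopP.simps(2))
  have "peq \<Gamma> i (LoopT (Suc (Suc 0)) (Sig A B) (Dpair a b)) (LoopP (Suc (Suc 0)) (Sig A B) (Dpair a b))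
      (LoopT (Suc 0) (Sig ?I ?J) (Dpair (Refl a) (Refl b))) (LoopP (Suc 0) (Sig ?I ?J) (Dpair (Refl a) (Refl b)))"
    using peq_loops[OF dpath_Sig_peq[OF A B a b], of "Suc 0"] unfolding D
    by (simp add: LoopT.simps(2) LoopP.simps(2))
  from peq_loops[OF peq_trans[OF this 2], of m] show ?thesis by (simp add: LoopT_add LoopP_add)
qed

lemma Loop_one [simp]: "LoopT (Suc 0) A a = IdT A a a" "LoopP (Suc 0) A a = Refl a"
  by (simp_all add: LoopT.simps(2) LoopP.simps(2))

lemma inh_of_path:
  assumes "\<Gamma> \<Turnstile> IdT (Univ i) A B" "\<Gamma> \<Turnstile> B" "\<Gamma> \<turnstile> A \<Colon> Univ i" "\<Gamma> \<turnstile> B \<Colon> Univ i"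
  shows "\<Gamma> \<Turnstile> A"
proof -
  note c = typing_ctx[OF assms(3)]
  show ?thesis
    by (rule transport'[OF id_sym[OF assms(1) isty_base(1)[OF c] assms(3,4)] _ _ assms(2), where C = v0])
      (use assms c isty_base(1)[OF c] in \<open>simp_all add: isty_var ctx_cons\<close>)
qed

lemma prop_Sig_eq:
  assumes A: "\<Gamma> \<turnstile> A \<Colon> Univ i" and B: "A # \<Gamma> \<turnstile> B \<Colon> Univ i"
    and a: "\<Gamma> \<turnstile> a \<Colon> A" and b: "\<Gamma> \<turnstile> b \<Colon> subst (a \<cdot> S 0) B"
    and x: "\<Gamma> \<turnstile> x \<Colon> A" and y: "\<Gamma> \<turnstile> y \<Colon> subst (x \<cdot> S 0) B"
    and p: "\<Gamma> \<Turnstile> is_trunc (Suc 0) (subst (a \<cdot> S 0) B)" and q: "\<Gamma> \<Turnstile> IdT A a x"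
  shows "\<Gamma> \<Turnstile> IdT (Sig A B) (Dpair a b) (Dpair x y)"
proof -
  have R: "B # A # \<Gamma> \<turnstile> IdT (w2 A) (w2 a) v1 \<Colon> Univ i" by (insert A B a typing_ctx[OF a], (assumption | rule tys, assumption | rule ty | simp)+)
  have r: "\<Gamma> \<turnstile> Refl a \<Colon> subst (b \<cdot> a \<cdot> S 0) (IdT (w2 A) (w2 a) v1)"
    by (simp add: refl_typing[OF istyI[OF A] a refl refl])
  from Sig_path[OF A B R a b r prop_fibre_elim_ctx[OF istyI[OF A] istyI[OF B] a b p] x y]
  have path: "\<Gamma> \<Turnstile> IdT (Univ i) (IdT (Sig A B) (Dpair a b) (Dpair x y)) (IdT A a x)" by simp
  show ?thesis
    by (rule inh_of_path[OF path q id_form[OF sig_form[OF A B] pair_typing[OF istyI[OF B] a b] pair_typing[OF istyI[OF B] x y]]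
          id_form[OF A a x]])
qed

lemma fibre_eq:
  assumes A: "\<Gamma> \<turnstile> A \<Colon> Univ i" and x: "\<Gamma> \<turnstile> x \<Colon> A"
    and q: "\<Gamma> \<turnstile> q \<Colon> LoopT m A x" and t: "\<Gamma> \<turnstile> t \<Colon> isset (LoopT m A x)"
    and r: "\<Gamma> \<turnstile> r \<Colon> LoopT m A x" and t': "\<Gamma> \<turnstile> t' \<Colon> isset (LoopT m A x)" and qr: "\<Gamma> \<Turnstile> IdT (LoopT m A x) q r"
  shows "\<Gamma> \<Turnstile> IdT (fibre m A x) (Dpair q t) (Dpair r t')"
  unfolding fibre_def
  by (rule prop_Sig_eq[OF LoopT_form[OF A x] fibre_snd[OF A x] q _ r _ _ qr])
    (simp_all add: t t' trunc_prop[OF LoopT_form[OF A x]])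

section \<open>Transport of a loop along itself\<close>

abbreviation tail :: "tm \<Rightarrow> tm \<Rightarrow> tm" where
  "tail A x \<equiv> IdT (w1 A) (w1 x) v0"

text \<open>Transport in \<open>tail A x\<close> is composition on the right, so the two sides are q
  followed by p, and p followed by r.\<close>

abbreviation commute :: "tm \<Rightarrow> tm \<Rightarrow> tm \<Rightarrow> tm \<Rightarrow> tm \<Rightarrow> tm \<Rightarrow> tm" where
  "commute A x y p q r \<equiv> IdT (IdT A x y) (Tr (tail A x) x y p q) (Tr (tail A x) y y r p)"

lemma tail_isty: "isty \<Gamma> A \<Longrightarrow> \<Gamma> \<turnstile> x \<Colon> A \<Longrightarrow> isty (A # \<Gamma>) (tail A x)"
  by (frule isty_ctx) (assumption | rule tys, assumption | rule ty | simp)+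

lemma tail_Tr:
  assumes "isty \<Gamma> A" "\<Gamma> \<turnstile> x \<Colon> A" "\<Gamma> \<turnstile> y \<Colon> A" "\<Gamma> \<turnstile> z \<Colon> A" "\<Gamma> \<turnstile> p \<Colon> IdT A y z" "\<Gamma> \<turnstile> q \<Colon> IdT A x y"
  shows "\<Gamma> \<turnstile> Tr (tail A x) y z p q \<Colon> IdT A x z"
  using Tr_typing[OF assms(1) tail_isty[OF assms(1,2)] assms(3-5), of q] assms(6) by simp

lemma commute_isty:
  assumes "isty \<Gamma> A" "\<Gamma> \<turnstile> x \<Colon> A" "\<Gamma> \<turnstile> y \<Colon> A" "\<Gamma> \<turnstile> p \<Colon> IdT A x y" "\<Gamma> \<turnstile> q \<Colon> IdT A x x" "\<Gamma> \<turnstile> r \<Colon> IdT A y y"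
  shows "isty \<Gamma> (commute A x y p q r)"
  by (rule isty_Id[OF isty_Id[OF assms(1-3)] tail_Tr[OF assms(1,2,2,3,4,5)] tail_Tr[OF assms(1,2,3,3,6,4)]])

text \<open>Composition by transport computes when the path on the right is reflexivity; the other
  unit law needs an induction.\<close>

lemma left_unit:
  assumes A: "isty \<Gamma> A" and x: "\<Gamma> \<turnstile> x \<Colon> A" and y: "\<Gamma> \<turnstile> y \<Colon> A" and r: "\<Gamma> \<turnstile> r \<Colon> IdT A x y"
  shows "\<Gamma> \<Turnstile> IdT (IdT A x y) (Tr (tail A x) x y r (Refl x)) r"
proof -
  note c = typing_ctx[OF x]
  let ?G = "tail A x # A # \<Gamma>"
  have G: "ctx ?G" by (rule ctx_cons[OF tail_isty[OF A x]])
  have 2: "isty ?G (w2 A)" "?G \<turnstile> w2 x \<Colon> w2 A" "?G \<turnstile> v1 \<Colon> w2 A" "?G \<turnstile> v0 \<Colon> IdT (w2 A) (w2 x) v1"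
    by (insert A x G c, (assumption | rule tys, assumption | rule ty | simp)+)
  let ?C = "IdT (IdT (w2 A) (w2 x) v1) (Tr (tail (w2 A) (w2 x)) (w2 x) v1 v0 (Refl (w2 x))) v0"
  have M: "isty ?G ?C"
    by (rule isty_Id[OF isty_Id[OF 2(1-3)] tail_Tr[OF 2(1,2,2,3,4) refl_typing[OF 2(1,2) refl refl]] 2(4)])
  note rx = refl_typing[OF A x refl refl]
  have e: "\<Gamma> \<turnstile> Tr (tail A x) x x (Refl x) (Refl x) \<doteq> Refl x \<Colon> IdT A x x"
    using Tr_refl[OF A tail_isty[OF A x] x, of "Refl x"] rx by simp
  have "\<Gamma> \<Turnstile> IdT (IdT A x x) (Tr (tail A x) x x (Refl x) (Refl x)) (Refl x)"
    by (rule id_jeq[OF isty_Id[OF A x x] tail_Tr[OF A x x x rx rx] e])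
  then show ?thesis
    using based_J'[OF r _ A x y M] by simp
qed

abbreviation fam :: "tm \<Rightarrow> tm" where
  "fam A \<equiv> fibre (Suc 0) (w1 A) v0"

lemma fam_form: "\<Gamma> \<turnstile> A \<Colon> Univ i \<Longrightarrow> A # \<Gamma> \<turnstile> fam A \<Colon> Univ i"
  by (rule fibre_form, frule typing_ctx, (assumption | rule tys, assumption | rule ty | simp)+)

lemma fam_Tr:
  assumes "\<Gamma> \<turnstile> A \<Colon> Univ i" "\<Gamma> \<turnstile> x \<Colon> A" "\<Gamma> \<turnstile> y \<Colon> A" "\<Gamma> \<turnstile> p \<Colon> IdT A x y" "\<Gamma> \<turnstile> u \<Colon> fibre (Suc 0) A x"
  shows "\<Gamma> \<turnstile> Tr (fam A) x y p u \<Colon> fibre (Suc 0) A y"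
  using Tr_typing[OF istyI[OF assms(1)] istyI[OF fam_form[OF assms(1)]] assms(2-4), of u] assms(5) by simp

text \<open>For reflexivity in place of p the square says that q equals r, by the unit laws; the
  accompanying set proofs agree because being a set is a proposition.\<close>

lemma commute_base:
  assumes A: "\<Gamma> \<turnstile> A \<Colon> Univ i" and x: "\<Gamma> \<turnstile> x \<Colon> A"
    and q: "\<Gamma> \<turnstile> q \<Colon> IdT A x x" and t: "\<Gamma> \<turnstile> t \<Colon> isset (IdT A x x)"
    and r: "\<Gamma> \<turnstile> r \<Colon> IdT A x x" and t': "\<Gamma> \<turnstile> t' \<Colon> isset (IdT A x x)"
    and h: "\<Gamma> \<Turnstile> commute A x x (Refl x) q r"
  shows "\<Gamma> \<Turnstile> IdT (fibre (Suc 0) A x) (Tr (fam A) x x (Refl x) (Dpair q t)) (Dpair r t')"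
proof -
  note A0 = istyI[OF A]
  note I = isty_Id[OF A0 x x] and rx = refl_typing[OF A0 x refl refl]
  have e: "\<Gamma> \<turnstile> Tr (tail A x) x x (Refl x) q \<doteq> q \<Colon> IdT A x x"
    using Tr_refl[OF A0 tail_isty[OF A0 x] x, of q] q by simp
  have t1: "\<Gamma> \<turnstile> Tr (tail A x) x x (Refl x) q \<Colon> IdT A x x" "\<Gamma> \<turnstile> Tr (tail A x) x x r (Refl x) \<Colon> IdT A x x"
    by (rule tail_Tr[OF A0 x x x rx q], rule tail_Tr[OF A0 x x x r rx])
  have qr: "\<Gamma> \<Turnstile> IdT (IdT A x x) q r"
    by (rule id_trans[OF id_conv[OF h I e eq_refl[OF t1(2)]] left_unit[OF A0 x x r] I q t1(2) r])
  have p: "\<Gamma> \<turnstile> Dpair q t \<Colon> fibre (Suc 0) A x" "\<Gamma> \<turnstile> Dpair r t' \<Colon> fibre (Suc 0) A x"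
    using fibre_pair[OF A x] q t r t' by simp_all
  have "\<Gamma> \<turnstile> Tr (fam A) x x (Refl x) (Dpair q t) \<doteq> Dpair q t \<Colon> fibre (Suc 0) A x"
    using Tr_refl[OF A0 istyI[OF fam_form[OF A]] x, of "Dpair q t"] p by simp
  moreover have "\<Gamma> \<Turnstile> IdT (fibre (Suc 0) A x) (Dpair q t) (Dpair r t')"
    using fibre_eq[OF A x, of q "Suc 0"] q t r t' qr by simp
  ultimately show ?thesis
    using id_conv[OF _ istyI[OF fibre_form[OF A x]] eq_sym eq_refl[OF p(2)]] by blast
qed

text \<open>
  Transport of a loop \<open>q\<close> at \<open>x\<close> along \<open>p\<close> is \<open>r\<close> as soon as \<open>q \<cdot> p = p \<cdot> r\<close>; below only the
  case \<open>p = q = r\<close> matters, which has to be generalised for path induction.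
\<close>

lemma commute_transport:
  assumes A: "\<Gamma> \<turnstile> A \<Colon> Univ i" and x: "\<Gamma> \<turnstile> x \<Colon> A" and y: "\<Gamma> \<turnstile> y \<Colon> A" and p: "\<Gamma> \<turnstile> p \<Colon> IdT A x y"
    and q: "\<Gamma> \<turnstile> q \<Colon> IdT A x x" and t: "\<Gamma> \<turnstile> t \<Colon> isset (IdT A x x)"
    and r: "\<Gamma> \<turnstile> r \<Colon> IdT A y y" and t': "\<Gamma> \<turnstile> t' \<Colon> isset (IdT A y y)"
    and h: "\<Gamma> \<Turnstile> commute A x y p q r"
  shows "\<Gamma> \<Turnstile> IdT (fibre (Suc 0) A y) (Tr (fam A) x y p (Dpair q t)) (Dpair r t')"
proof -
  note c = typing_ctx[OF x] and A0 = istyI[OF A]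
  have qt: "\<Gamma> \<turnstile> Dpair q t \<Colon> fibre (Suc 0) A x" using fibre_pair[OF A x] q t by simp
  let ?G2 = "tail A x # A # \<Gamma>"
  have G2: "ctx ?G2" by (rule ctx_cons[OF tail_isty[OF A0 x]])
  let ?R = "IdT (w2 A) v1 v1" 
  have R: "isty ?G2 ?R" by (insert A G2 c, (assumption | rule tys, assumption | rule ty | simp)+)
  let ?G3 = "?R # ?G2" and ?T = "isset (IdT (w3 A) v2 v2)"
  have T: "isty ?G3 ?T" by (insert A ctx_cons[OF R] c, (assumption | rule tys, assumption | rule ty | simp)+)
  let ?G4 = "?T # ?G3" and ?H = "commute (w4 A) (w4 x) v3 v2 (w4 q) v1"
  have 4: "isty ?G4 (w4 A)" "?G4 \<turnstile> w4 x \<Colon> w4 A" "?G4 \<turnstile> v3 \<Colon> w4 A" "?G4 \<turnstile> v2 \<Colon> IdT (w4 A) (w4 x) v3"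
    "?G4 \<turnstile> w4 q \<Colon> IdT (w4 A) (w4 x) (w4 x)" "?G4 \<turnstile> v1 \<Colon> IdT (w4 A) v3 v3"
    by (insert A x q ctx_cons[OF T] c, (assumption | rule tys, assumption | rule ty | simp)+)
  note H = commute_isty[OF 4]
  let ?G5 = "?H # ?G4" and ?K = "IdT (fibre (Suc 0) (w5 A) v4) (Tr (fam (w5 A)) (w5 x) v4 v3 (w5 (Dpair q t))) (Dpair v2 v1)"
  have 5: "?G5 \<turnstile> w5 A \<Colon> Univ i" "?G5 \<turnstile> w5 x \<Colon> w5 A" "?G5 \<turnstile> v4 \<Colon> w5 A" "?G5 \<turnstile> v3 \<Colon> IdT (w5 A) (w5 x) v4"
    "?G5 \<turnstile> v2 \<Colon> LoopT (Suc 0) (w5 A) v4" "?G5 \<turnstile> v1 \<Colon> isset (LoopT (Suc 0) (w5 A) v4)"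
    by (insert A x ctx_cons[OF H] c, (assumption | rule tys, assumption | rule ty | simp)+)
  have u: "?G5 \<turnstile> w5 (Dpair q t) \<Colon> fibre (Suc 0) (w5 A) (w5 x)"
    using typing_substs[OF substs_S[OF ctx_cons[OF H], of "Suc (Suc (Suc (Suc (Suc 0))))"] qt] by simp
  have K: "isty ?G5 ?K"
    by (rule isty_Id[OF istyI[OF fibre_form[OF 5(1,3)]] fam_Tr[OF 5(1-4) u] fibre_pair[OF 5(1,3,5,6)]])
  \<comment> \<open>The data \<open>q\<close> and \<open>t\<close> at \<open>x\<close> stay fixed
    while the endpoint varies; everything over the endpoint, including the square, is
    quantified.\<close>
  let ?M = "Prd ?R (Prd ?T (Prd ?H ?K))"
  have M: "isty ?G2 ?M" by (rule isty_Prd[OF R isty_Prd[OF T isty_Prd[OF H K]]])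
  let ?R0 = "IdT A x x" and ?T0 = "isset (IdT (w1 A) (w1 x) (w1 x))"
    and ?H0 = "commute (w2 A) (w2 x) (w2 x) (Refl (w2 x)) (w2 q) v1"
  have R0: "isty \<Gamma> ?R0" by (rule isty_Id[OF A0 x x])
  have T0: "isty (?R0 # \<Gamma>) ?T0" by (insert A x R0 c, (assumption | rule tys, assumption | rule ty | simp)+)
  let ?D2 = "?T0 # ?R0 # \<Gamma>"
  have 2: "isty ?D2 (w2 A)" "?D2 \<turnstile> w2 x \<Colon> w2 A" "?D2 \<turnstile> w2 q \<Colon> IdT (w2 A) (w2 x) (w2 x)" "?D2 \<turnstile> v1 \<Colon> IdT (w2 A) (w2 x) (w2 x)"
    by (insert A x q ctx_cons[OF T0] c, (assumption | rule tys, assumption | rule ty | simp)+)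
  have H0: "isty ?D2 ?H0"
    by (rule commute_isty[OF 2(1,2,2) refl_typing[OF 2(1,2) refl refl] 2(3,4)])
  let ?D = "?H0 # ?D2"
  have 3: "?D \<turnstile> w3 A \<Colon> Univ i" "?D \<turnstile> w3 x \<Colon> w3 A" "?D \<turnstile> w3 q \<Colon> IdT (w3 A) (w3 x) (w3 x)" "?D \<turnstile> w3 t \<Colon> isset (IdT (w3 A) (w3 x) (w3 x))"
    "?D \<turnstile> v2 \<Colon> IdT (w3 A) (w3 x) (w3 x)" "?D \<turnstile> v1 \<Colon> isset (IdT (w3 A) (w3 x) (w3 x))"
    by (insert A x q t ctx_cons[OF H0] c, (assumption | rule tys, assumption | rule ty | simp)+)
  have "?D \<turnstile> v0 \<Colon> commute (w3 A) (w3 x) (w3 x) (Refl (w3 x)) (w3 q) v2"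
    by (rule var'[OF ctx_cons[OF H0]]) simp_all
  from commute_base[OF 3 inhI[OF this]]
  have "\<Gamma> \<Turnstile> Prd ?R0 (Prd ?T0 (Prd ?H0 (IdT (fibre (Suc 0) (w3 A) (w3 x))
      (Tr (fam (w3 A)) (w3 x) (w3 x) (Refl (w3 x)) (w3 (Dpair q t))) (Dpair v2 v1))))"
    by (intro inh_Prd[OF R0] inh_Prd[OF T0] inh_Prd[OF H0]) simp
  then have "\<Gamma> \<Turnstile> subst (Refl x \<cdot> x \<cdot> S 0) ?M" by simp
  from based_J[OF A0 x y p M this, unfolded subst.simps]
  have 6: "\<Gamma> \<Turnstile> Prd (IdT A y y) (Prd (isset (IdT (w1 A) (w1 y) (w1 y))) (Prd (commute (w2 A) (w2 x) (w2 y) (w2 p) (w2 q) v1)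
      (IdT (fibre (Suc 0) (w3 A) (w3 y)) (Tr (fam (w3 A)) (w3 x) (w3 y) (w3 p) (w3 (Dpair q t))) (Dpair v2 v1))))"
    by simp
  from inh_App[OF 6 r refl]
  have 7: "\<Gamma> \<Turnstile> Prd (isset (IdT A y y)) (Prd (commute (w1 A) (w1 x) (w1 y) (w1 p) (w1 q) (w1 r))
      (IdT (fibre (Suc 0) (w2 A) (w2 y)) (Tr (fam (w2 A)) (w2 x) (w2 y) (w2 p) (w2 (Dpair q t))) (Dpair (w2 r) v1)))"
    by simp
  from inh_App[OF 7 t' refl]
  have "\<Gamma> \<Turnstile> Prd (commute A x y p q r)
      (IdT (fibre (Suc 0) (w1 A) (w1 y)) (Tr (fam (w1 A)) (w1 x) (w1 y) (w1 p) (w1 (Dpair q t))) (Dpair (w1 r) (w1 t')))"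
    by simp
  then show ?thesis using h by (rule inh_mp) simp
qed

text \<open>With q and r equal to p both sides of the square are the same term.\<close>

lemma loop_fixes_itself:
  assumes A: "\<Gamma> \<turnstile> A \<Colon> Univ i" and x: "\<Gamma> \<turnstile> x \<Colon> A" and p: "\<Gamma> \<turnstile> p \<Colon> IdT A x x" and t: "\<Gamma> \<turnstile> t \<Colon> isset (IdT A x x)"
  shows "\<Gamma> \<Turnstile> IdT (fibre (Suc 0) A x) (Tr (fam A) x x p (Dpair p t)) (Dpair p t)"
  by (rule commute_transport[OF A x x p p t p t id_refl[OF isty_Id[OF istyI[OF A] x x] tail_Tr[OF istyI[OF A] x x x p p]]])

lemma Sig_eq_fst:
  assumes "isty \<Gamma> A" "isty (A # \<Gamma>) B" "\<Gamma> \<turnstile> a \<Colon> A" "\<Gamma> \<turnstile> b \<Colon> subst (a \<cdot> S 0) B" "\<Gamma> \<turnstile> x \<Colon> A" "\<Gamma> \<turnstile> y \<Colon> subst (x \<cdot> S 0) B"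
    and e: "\<Gamma> \<Turnstile> IdT (Sig A B) (Dpair a b) (Dpair x y)"
  shows "\<Gamma> \<Turnstile> IdT A a x"
proof -
  note c = typing_ctx[OF assms(3)]
  have S: "isty \<Gamma> (Sig A B)" by (rule isty_Sig[OF assms(1,2)])
  have f: "Sig A B # \<Gamma> \<turnstile> Fst (w1 A) v0 \<Colon> w1 A"
    by (rule Fst_typing[where B = "subst (v0 \<cdot> s2) B"]) (insert assms(1,2) S c, (assumption | rule tys, assumption | rule ty | simp)+)
  have "\<Gamma> \<Turnstile> IdT A (Fst A (Dpair a b)) (Fst A (Dpair x y))"
    using id_ap[OF e S pair_typing[OF assms(2-4)] pair_typing[OF assms(2,5,6)] assms(1) f] by simp
  then show ?thesis
    by (rule id_conv[OF _ assms(1) Fst_pair[OF assms(1-4)] Fst_pair[OF assms(1,2,5,6)]])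
qed

section \<open>Loops in the total space\<close>

abbreviation total :: "nat \<Rightarrow> tm \<Rightarrow> tm" where
  "total m A \<equiv> Sig A (fibre m (w1 A) v0)"

lemma fibre_v0_form: "\<Gamma> \<turnstile> A \<Colon> Univ i \<Longrightarrow> A # \<Gamma> \<turnstile> fibre m (w1 A) v0 \<Colon> Univ i"
  by (rule fibre_form, frule typing_ctx, (assumption | rule tys, assumption | rule ty | simp)+)

lemma lift_self:
  assumes A: "isty \<Gamma> A" and a: "\<Gamma> \<turnstile> a \<Colon> A" and p: "\<Gamma> \<turnstile> p \<Colon> A"
  shows "\<Gamma> \<Turnstile> lift A a (IdT A p a)"
proof (rule liftI[OF A a isty_Id[OF A p a] p])
  show "IdT A p a # \<Gamma> \<Turnstile> w1 (IdT A p a)"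
    by (rule inhI[where t = v0], rule var'[OF ctx_cons[OF isty_Id[OF A p a]], where k = 0]) simp_all
qed

context
  fixes \<Gamma> A i x p t and m :: nat
  assumes A: "\<Gamma> \<turnstile> A \<Colon> Univ i" and x: "\<Gamma> \<turnstile> x \<Colon> A"
    and p: "\<Gamma> \<turnstile> p \<Colon> LoopT (Suc m) A x" and t: "\<Gamma> \<turnstile> t \<Colon> isset (LoopT (Suc m) A x)"
begin

lemma total_pair: "\<Gamma> \<turnstile> Dpair x (Dpair p t) \<Colon> total (Suc m) A"
  by (rule pair_typing[OF istyI[OF fibre_v0_form[OF A]] x]) (simp add: fibre_pair[OF A x p t])

text \<open>Both statements are moved along a pointed equality from a known type. In dimension at
  least two this is the loop space of \<open>A\<close>, and \<open>p\<close> is its own lift. In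
  dimension one it is a sum, in which \<open>p\<close> has to be paired with a path in the
  fibre.\<close>

lemma total_loops:
  "\<Gamma> \<Turnstile> isset (LoopT (Suc m) (total (Suc m) A) (Dpair x (Dpair p t))) \<and>
   \<Gamma> \<Turnstile> lift (LoopT (Suc m) (total (Suc m) A) (Dpair x (Dpair p t)))
      (LoopP (Suc m) (total (Suc m) A) (Dpair x (Dpair p t)))
      (IdT (LoopT (Suc m) A x) p (LoopP (Suc m) A x))"
proof (cases m)
  case (Suc k)
  note L = istyI[OF LoopT_form[OF A x, of "Suc m"]] and P = LoopP_typing[OF A x, of "Suc m"]
  have b: "\<Gamma> \<turnstile> Dpair p t \<Colon> subst (x \<cdot> S 0) (fibre (Suc m) (w1 A) v0)" using fibre_pair[OF A x p t] by simp
  have s: "\<Gamma> \<Turnstile> isset (subst (x \<cdot> S 0) (fibre (Suc m) (w1 A) v0))" using fibre_set[OF A x inhI[OF t]] by simp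
  note peq = peq_sym[OF set_fibre_peq[OF A fibre_v0_form[OF A] x b s, of k, folded Suc]]
  show ?thesis
    using peq_trunc[OF peq inhI[OF t]] peq_lift[OF peq isty_Id[OF L p P] lift_self[OF L P p]] by blast
next
  case 0
  let ?B = "fam A" and ?b = "Dpair p t"
  have p0: "\<Gamma> \<turnstile> p \<Colon> IdT A x x" and t0: "\<Gamma> \<turnstile> t \<Colon> isset (IdT A x x)" using p t 0 by simp_all
  note c = typing_ctx[OF x] and A0 = istyI[OF A] and B = fam_form[OF A]
  have b: "\<Gamma> \<turnstile> ?b \<Colon> subst (x \<cdot> S 0) ?B" using fibre_pair[OF A x p t] 0 by simp
  let ?I = "IdT A x x" and ?B1 = "fam (w1 A)"
  have I: "\<Gamma> \<turnstile> ?I \<Colon> Univ i" by (rule id_form[OF A x x])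
  have 1: "?I # \<Gamma> \<turnstile> w1 A \<Colon> Univ i" "?I # \<Gamma> \<turnstile> w1 x \<Colon> w1 A" "?I # \<Gamma> \<turnstile> v0 \<Colon> IdT (w1 A) (w1 x) (w1 x)"
    "?I # \<Gamma> \<turnstile> w1 t \<Colon> isset (IdT (w1 A) (w1 x) (w1 x))" "?I # \<Gamma> \<turnstile> w1 p \<Colon> IdT (w1 A) (w1 x) (w1 x)"
    by (insert A x p0 t0 istyI[OF I] c, (assumption | rule tys, assumption | rule ty | simp)+)
  have b1: "?I # \<Gamma> \<turnstile> Dpair (w1 p) (w1 t) \<Colon> fibre (Suc 0) (w1 A) (w1 x)"
    using fibre_pair[OF 1(1,2), of "w1 p" "Suc 0" "w1 t"] 1(4,5) by simp
  let ?J = "IdT (fibre (Suc 0) (w1 A) (w1 x)) (Tr ?B1 (w1 x) (w1 x) v0 (Dpair (w1 p) (w1 t))) (Dpair (w1 p) (w1 t))"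
  note F = fibre_form[OF 1(1,2), of "Suc 0"] and tr = fam_Tr[OF 1(1,2,2,3) b1]
  have J: "?I # \<Gamma> \<turnstile> ?J \<Colon> Univ i" by (rule id_form[OF F tr b1])
  have D: "subst (?b \<cdot> x \<cdot> S 0) (dpath A ?B x ?b) = Sig ?I ?J" by simp
  have setF: "?I # \<Gamma> \<Turnstile> isset (fibre (Suc 0) (w1 A) (w1 x))"
    by (rule fibre_set[OF 1(1,2)]) (use inhI[OF 1(4)] in simp)
  have "\<Gamma> \<Turnstile> isset (Sig ?I ?J)"
    by (rule trunc_Sig[OF I J inhI[OF t0] trunc_mono_Suc[OF trunc_SucD[OF setF tr b1] istyI[OF J]]])
  note set = this
  note peq = peq_sym[OF dpath_Sig_peq[OF A B x b], unfolded D]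
  \<comment> \<open>The fibre component of the lift of \<open>p\<close>: transport along
    \<open>p\<close> carries \<open>(p, t)\<close> to itself.\<close>
  obtain k where k: "\<Gamma> \<turnstile> k \<Colon> IdT (subst (x \<cdot> S 0) ?B) (Tr ?B x x p ?b) ?b"
    using loop_fixes_itself[OF A x p0 t0] by (auto simp: inh_def)
  have el: "\<Gamma> \<turnstile> Dpair p k \<Colon> Sig ?I ?J" using dpath_pair[OF A B x b x b p0 k] unfolding D .
  let ?r = "Dpair (Refl x) (Refl ?b)"
  have rr: "\<Gamma> \<turnstile> ?r \<Colon> Sig ?I ?J" using dpath_refl[OF A B x b] unfolding D .
  note rx = refl_typing[OF A0 x refl refl]
  have rb: "\<Gamma> \<turnstile> Refl ?b \<Colon> subst (Refl x \<cdot> S 0) ?J"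
    using typing_conv[OF refl_typing[OF istyI[OF fib_form[OF A B x b x]] b refl refl] eqty_sym[OF dpath_refl_fib[OF A B x b b]]]
    by simp
  have kJ: "\<Gamma> \<turnstile> k \<Colon> subst (p \<cdot> S 0) ?J" using k by simp
  have DT: "\<Gamma> \<turnstile> Sig ?I ?J \<Colon> Univ i" by (rule sig_form[OF I J])
  let ?Q = "IdT ?I p (Refl x)" and ?E = "IdT (Sig ?I ?J) (Dpair p k) ?r"
  have Q: "isty \<Gamma> ?Q" by (rule isty_Id[OF istyI[OF I] p0 rx])
  have E: "isty \<Gamma> ?E" by (rule isty_Id[OF istyI[OF DT] el rr])
  have sub: "substs (?E # \<Gamma>) s1 \<Gamma>" by (rule substs_S[OF ctx_cons[OF E]]) simp_all
  note up = substs_up[OF sub typing_substs[OF sub I, unfolded subst.simps(2)]]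
  note W = typing_substs[OF sub]
  have "?E # \<Gamma> \<turnstile> v0 \<Colon> w1 ?E" by (rule var'[OF ctx_cons[OF E]]) simp_all
  then have v: "?E # \<Gamma> \<Turnstile> IdT (Sig (w1 ?I) (subst (v0 \<cdot> (s1 \<Zsemi> s1)) ?J)) (Dpair (w1 p) (w1 k)) (Dpair (w1 (Refl x)) (w1 (Refl ?b)))"
    by (auto intro: inhI)
  have kJ1: "?E # \<Gamma> \<turnstile> w1 k \<Colon> subst (w1 p \<cdot> S 0) (subst (v0 \<cdot> (s1 \<Zsemi> s1)) ?J)"
    and rb1: "?E # \<Gamma> \<turnstile> w1 (Refl ?b) \<Colon> subst (w1 (Refl x) \<cdot> S 0) (subst (v0 \<cdot> (s1 \<Zsemi> s1)) ?J)"
    using W[OF kJ] W[OF rb] by simp_all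
  \<comment> \<open>If the lifted loop is trivial, then so is its first component, which is
    \<open>p\<close>.\<close>
  have "?E # \<Gamma> \<Turnstile> IdT (w1 ?I) (w1 p) (w1 (Refl x))"
    by (rule Sig_eq_fst[OF isty_subst[OF istyI[OF I] sub] isty_subst[OF istyI[OF J] up] W[OF p0] kJ1 W[OF rx] rb1 v])
  then have "?E # \<Gamma> \<Turnstile> w1 ?Q" by simp
  from liftI[OF istyI[OF DT] rr Q el this] have lift: "\<Gamma> \<Turnstile> lift (Sig ?I ?J) ?r ?Q" .
  show ?thesis
    using peq_trunc[OF peq set] peq_lift[OF peq Q lift] 0 by simp
qed

end

lemma lift_conv:
  assumes A: "isty \<Gamma> A" and a: "\<Gamma> \<turnstile> a \<Colon> A" and e: "\<Gamma> \<turnstile> Q \<doteq> Q' \<Colon> Univ i"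
    and Q: "\<Gamma> \<turnstile> Q \<Colon> Univ i" and Q': "\<Gamma> \<turnstile> Q' \<Colon> Univ i" and l: "\<Gamma> \<Turnstile> lift A a Q"
  shows "\<Gamma> \<Turnstile> lift A a Q'"
proof -
  note c = typing_ctx[OF a]
  have "isty (Univ i # \<Gamma>) (lift (w1 A) (w1 a) v0)"
    by (rule lift_isty) (insert A a c, (assumption | rule tys, assumption | rule ty | simp)+)
  from functionality[OF this e Q Q' isty_base(1)[OF c]] l show ?thesis
    by (auto intro: inh_conv)
qed

text \<open>
  The statement \<open>p = refl\<close> as a family over \<open>(x, (p, t)) : total m A\<close>, by large elimination.
\<close>

definition triv_base :: "nat \<Rightarrow> tm \<Rightarrow> tm" where
  "triv_base m A = IdT (LoopT m (w3 A) v2) v1 (LoopP m (w3 A) v2)"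

definition triv_fam :: "nat \<Rightarrow> nat \<Rightarrow> tm \<Rightarrow> tm" where
  "triv_fam i m A = uncurried i (uncurried i (triv_base m A))"

context
  fixes \<Gamma> A i and m :: nat
  assumes A: "\<Gamma> \<turnstile> A \<Colon> Univ i"
begin

lemma triv_parts:
  "A # \<Gamma> \<turnstile> w1 A \<Colon> Univ i" "A # \<Gamma> \<turnstile> v0 \<Colon> w1 A" "A # \<Gamma> \<turnstile> LoopT m (w1 A) v0 \<Colon> Univ i"
  "LoopT m (w1 A) v0 # A # \<Gamma> \<turnstile> isset (LoopT m (w2 A) v1) \<Colon> Univ i"
  "isset (LoopT m (w2 A) v1) # LoopT m (w1 A) v0 # A # \<Gamma> \<turnstile> triv_base m A \<Colon> Univ i"
proof -
  note c = typing_ctx[OF A]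
  show 1: "A # \<Gamma> \<turnstile> w1 A \<Colon> Univ i" "A # \<Gamma> \<turnstile> v0 \<Colon> w1 A" by (insert A c, (assumption | rule tys, assumption | rule ty | simp)+)
  show L: "A # \<Gamma> \<turnstile> LoopT m (w1 A) v0 \<Colon> Univ i" by (rule LoopT_form[OF 1])
  show T: "LoopT m (w1 A) v0 # A # \<Gamma> \<turnstile> isset (LoopT m (w2 A) v1) \<Colon> Univ i"
    using fibre_snd[OF 1, of m] by simp
  let ?G = "isset (LoopT m (w2 A) v1) # LoopT m (w1 A) v0 # A # \<Gamma>"
  have 3: "?G \<turnstile> w3 A \<Colon> Univ i" "?G \<turnstile> v2 \<Colon> w3 A" "?G \<turnstile> v1 \<Colon> LoopT m (w3 A) v2"
    by (insert A ctx_ext[OF T] c, (assumption | rule tys, assumption | rule ty | simp)+)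
  show "?G \<turnstile> triv_base m A \<Colon> Univ i"
    unfolding triv_base_def by (rule id_form[OF LoopT_form[OF 3(1,2)] 3(3) LoopP_typing[OF 3(1,2)]])
qed

lemma triv_fam_form: "total m A # \<Gamma> \<turnstile> triv_fam i m A \<Colon> Univ i"
proof -
  have "fibre m (w1 A) v0 # A # \<Gamma> \<turnstile> uncurried i (triv_base m A) \<Colon> Univ i"
    using uncurried_form[OF triv_parts(3-5)] by (simp add: fibre_def)
  then show ?thesis unfolding triv_fam_def by (rule uncurried_form[OF A fibre_v0_form[OF A]])
qed

lemma triv_fam_pair:
  assumes x: "\<Gamma> \<turnstile> x \<Colon> A" and p: "\<Gamma> \<turnstile> p \<Colon> LoopT m A x" and t: "\<Gamma> \<turnstile> t \<Colon> isset (LoopT m A x)"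
  shows "\<Gamma> \<turnstile> subst (Dpair x (Dpair p t) \<cdot> S 0) (triv_fam i m A) \<doteq> IdT (LoopT m A x) p (LoopP m A x) \<Colon> Univ i"
    "\<Gamma> \<turnstile> subst (Dpair x (Dpair p t) \<cdot> S 0) (triv_fam i m A) \<Colon> Univ i"
proof -
  note c = typing_ctx[OF A]
  have U: "fibre m (w1 A) v0 # A # \<Gamma> \<turnstile> uncurried i (triv_base m A) \<Colon> Univ i"
    using uncurried_form[OF triv_parts(3-5)] by (simp add: fibre_def)
  note f = fibre_pair[OF A x p t]
  have pt: "\<Gamma> \<turnstile> Dpair p t \<Colon> subst (x \<cdot> S 0) (fibre m (w1 A) v0)" using f by simp
  note e1 = uncurried_pair[OF A fibre_v0_form[OF A] U x pt]
  let ?R = "IdT (LoopT m (w2 A) (w2 x)) v1 (LoopP m (w2 A) (w2 x))"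
  note L = LoopT_form[OF A x, of m] and T = fibre_snd[OF A x, of m]
  let ?G = "isset (LoopT m (w1 A) (w1 x)) # LoopT m A x # \<Gamma>"
  have 2: "?G \<turnstile> w2 A \<Colon> Univ i" "?G \<turnstile> w2 x \<Colon> w2 A" "?G \<turnstile> v1 \<Colon> LoopT m (w2 A) (w2 x)"
    by (insert A x ctx_ext[OF T] c, (assumption | rule tys, assumption | rule ty | simp)+)
  have R: "?G \<turnstile> ?R \<Colon> Univ i" by (rule id_form[OF LoopT_form[OF 2(1,2)] 2(3) LoopP_typing[OF 2(1,2)]])
  have e2: "\<Gamma> \<turnstile> SigInd (Univ i) ?R (Dpair p t) \<doteq> IdT (LoopT m A x) p (LoopP m A x) \<Colon> Univ i"
    using uncurried_pair[OF L T R p, of t] t by simp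
  from eq_trans[OF e1, unfolded triv_base_def, simplified, OF e2]
  show "\<Gamma> \<turnstile> subst (Dpair x (Dpair p t) \<cdot> S 0) (triv_fam i m A) \<doteq> IdT (LoopT m A x) p (LoopP m A x) \<Colon> Univ i"
    by (simp add: triv_fam_def triv_base_def)
  have "\<Gamma> \<turnstile> Dpair x (Dpair p t) \<Colon> total m A"
    by (rule pair_typing[OF istyI[OF fibre_v0_form[OF A]] x pt])
  then have "substs \<Gamma> (Dpair x (Dpair p t) \<cdot> S 0) (total m A # \<Gamma>)"
    by (intro substs_cons' substs_S[OF c]) simp_all
  from typing_subst[OF triv_fam_form this, of "Univ i"]
  show "\<Gamma> \<turnstile> subst (Dpair x (Dpair p t) \<cdot> S 0) (triv_fam i m A) \<Colon> Univ i"
    by simp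
qed

end

lemma total_ctx_ind:
  assumes A: "\<Gamma> \<turnstile> A \<Colon> Univ i" and C: "isty (total m A # \<Gamma>) C"
    and base: "isset (LoopT m (w2 A) v1) # LoopT m (w1 A) v0 # A # \<Gamma> \<Turnstile> subst (Dpair v2 (Dpair v1 v0) \<cdot> s3) C"
  shows "total m A # \<Gamma> \<Turnstile> C"
proof (rule inh_sig_ctx[OF istyI[OF A] istyI[OF fibre_v0_form[OF A]] C])
  note c = typing_ctx[OF A] and P = triv_parts(3,4)[OF A, of m]
  have fib: "fibre m (w1 A) v0 = Sig (LoopT m (w1 A) v0) (isset (LoopT m (w2 A) v1))"
    by (simp add: fibre_def)
  let ?G = "fibre m (w1 A) v0 # A # \<Gamma>"
  have G: "ctx ?G" by (rule ctx_ext[OF fibre_v0_form[OF A]])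
  have 2: "?G \<turnstile> w2 A \<Colon> Univ i" "?G \<turnstile> v1 \<Colon> w2 A" "?G \<turnstile> v0 \<Colon> fibre m (w2 A) v1"
    by (insert A G c, (assumption | rule tys, assumption | rule ty | simp)+)
  have "?G \<turnstile> Dpair v1 v0 \<Colon> total m (w2 A)"
    by (rule pair_typing[OF istyI[OF fibre_v0_form[OF 2(1)]] 2(2)]) (simp add: 2(3))
  then have "isty ?G (subst (Dpair v1 v0 \<cdot> s2) C)"
    by (intro isty_subst[OF C] substs_cons' substs_S[OF G]) simp_all
  then show "?G \<Turnstile> subst (Dpair v1 v0 \<cdot> s2) C"
    unfolding fib by (rule inh_sig_ctx[OF istyI[OF P(1)] istyI[OF P(2)]]) (use base in simp)
qed

text \<open>\<open>total_loops\<close> treats explicit triples, whereas a section over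
  \<open>L\<close> needs the statement at a variable of \<open>L\<close>. Splitting that variable
  requires the triviality of its loop to be a family over \<open>L\<close>, which is the purpose of
  \<open>triv_fam\<close>.\<close>

lemma total_loops_ctx:
  fixes m :: nat
  assumes A: "\<Gamma> \<turnstile> A \<Colon> Univ i"
  defines "L \<equiv> total (Suc m) A"
  shows "L # \<Gamma> \<Turnstile> isset (LoopT (Suc m) (w1 L) v0)"
    and "L # \<Gamma> \<Turnstile> lift (LoopT (Suc m) (w1 L) v0) (LoopP (Suc m) (w1 L) v0) (triv_fam i (Suc m) A)"
proof -
  note c = typing_ctx[OF A] and P = triv_parts(4)[OF A, of "Suc m"]
  let ?G = "isset (LoopT (Suc m) (w2 A) v1) # LoopT (Suc m) (w1 A) v0 # A # \<Gamma>"
  have G: "ctx ?G" by (rule ctx_ext[OF P])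
  have 3: "?G \<turnstile> w3 A \<Colon> Univ i" "?G \<turnstile> v2 \<Colon> w3 A" "?G \<turnstile> v1 \<Colon> LoopT (Suc m) (w3 A) v2" "?G \<turnstile> v0 \<Colon> isset (LoopT (Suc m) (w3 A) v2)"
    by (insert A G c, (assumption | rule tys, assumption | rule ty | simp)+)
  note T = total_loops[OF 3] and tp = total_pair[OF 3]
  have L: "\<Gamma> \<turnstile> L \<Colon> Univ i" unfolding L_def by (rule sig_form[OF A fibre_v0_form[OF A]])
  have L1: "L # \<Gamma> \<turnstile> w1 L \<Colon> Univ i" and v: "L # \<Gamma> \<turnstile> v0 \<Colon> w1 L" by (insert L c, (assumption | rule tys, assumption | rule ty | simp)+)
  note LT = LoopT_form[OF L1 v, of "Suc m"] and LP = LoopP_typing[OF L1 v, of "Suc m"]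
  have M1: "isty (L # \<Gamma>) (isset (LoopT (Suc m) (w1 L) v0))" by (rule istyI[OF trunc_form[OF LT]])
  have F: "L # \<Gamma> \<turnstile> triv_fam i (Suc m) A \<Colon> Univ i" unfolding L_def by (rule triv_fam_form[OF A])
  have M2: "isty (L # \<Gamma>) (lift (LoopT (Suc m) (w1 L) v0) (LoopP (Suc m) (w1 L) v0) (triv_fam i (Suc m) A))"
    by (rule lift_isty[OF istyI[OF LT] LP istyI[OF F]])
  show "L # \<Gamma> \<Turnstile> isset (LoopT (Suc m) (w1 L) v0)"
    unfolding L_def
    by (rule total_ctx_ind[OF A M1[unfolded L_def]]) (use T in simp)
  let ?l = "Dpair v2 (Dpair v1 v0)"
  have LL: "?G \<turnstile> total (Suc m) (w3 A) \<Colon> Univ i" by (rule sig_form[OF 3(1) fibre_v0_form[OF 3(1)]])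
  note e = triv_fam_pair[OF 3]
  have I: "?G \<turnstile> IdT (LoopT (Suc m) (w3 A) v2) v1 (LoopP (Suc m) (w3 A) v2) \<Colon> Univ i"
    by (rule id_form[OF LoopT_form[OF 3(1,2)] 3(3) LoopP_typing[OF 3(1,2)]])
  have "?G \<Turnstile> lift (LoopT (Suc m) (total (Suc m) (w3 A)) ?l) (LoopP (Suc m) (total (Suc m) (w3 A)) ?l)
      (subst (?l \<cdot> S 0) (triv_fam i (Suc m) (w3 A)))"
    by (rule lift_conv[OF istyI[OF LoopT_form[OF LL tp]] LoopP_typing[OF LL tp] eq_sym[OF e(1)] I e(2)]) (use T in blast)
  moreover have "subst (?l \<cdot> S 0) (triv_fam i (Suc m) (w3 A)) = subst (?l \<cdot> s3) (triv_fam i (Suc m) A)"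
    by (simp add: triv_fam_def triv_base_def)
  ultimately show "L # \<Gamma> \<Turnstile> lift (LoopT (Suc m) (w1 L) v0) (LoopP (Suc m) (w1 L) v0) (triv_fam i (Suc m) A)"
    unfolding L_def
    by (intro total_ctx_ind[OF A M2[unfolded L_def]]) simp
qed

lemma universe_step:
  assumes hyp: "\<And>X. \<Gamma> \<turnstile> X \<Colon> Univ (Suc n) \<Longrightarrow> \<Gamma> \<Turnstile> isset (LoopT (Suc (Suc n)) (Univ (Suc n)) X) \<Longrightarrow>
      \<Gamma> \<Turnstile> trivial (LoopT (Suc (Suc n)) (Univ (Suc n)) X) (LoopP (Suc (Suc n)) (Univ (Suc n)) X)"
    and X: "\<Gamma> \<turnstile> X \<Colon> Univ n" and set: "\<Gamma> \<Turnstile> isset (LoopT (Suc n) (Univ n) X)"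
  shows "\<Gamma> \<Turnstile> trivial (LoopT (Suc n) (Univ n) X) (LoopP (Suc n) (Univ n) X)"
proof -
  note c = typing_ctx[OF X]
  have A: "\<Gamma> \<turnstile> Univ n \<Colon> Univ (Suc n)" by (rule univ_intro[OF c])
  define L where "L = total (Suc n) (Univ n)"
  have L: "\<Gamma> \<turnstile> L \<Colon> Univ (Suc n)" unfolding L_def by (rule sig_form[OF A fibre_v0_form[OF A]])
  \<comment> \<open>\<open>L\<close> is built from a universe alone and is therefore closed.\<close>
  have wL: "subst \<sigma> L = L" for \<sigma> by (simp add: L_def)
  note t = total_loops_ctx[OF A, of n, folded L_def]
  have L1: "L # \<Gamma> \<turnstile> w1 L \<Colon> Univ (Suc n)" and v: "L # \<Gamma> \<turnstile> v0 \<Colon> w1 L" by (insert L c, (assumption | rule tys, assumption | rule ty | simp)+)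
  note LT = LoopT_form[OF L1 v, of "Suc n"] and LP = LoopP_typing[OF L1 v, of "Suc n"]
  note lg = local_global_loops[OF L, of n]
  \<comment> \<open>A product of sets is a set; along \<open>lg\<close> this is exactly the
    condition under which \<open>hyp\<close> may be applied to \<open>L\<close>.\<close>
  have "\<Gamma> \<Turnstile> isset (Prd L (LoopT (Suc n) (w1 L) v0))" by (rule trunc_Prd[OF L LT t(1)])
  from hyp[OF L peq_trunc[OF peq_sym[OF lg] this]]
  have triv: "\<Gamma> \<Turnstile> trivial (Prd L (LoopT (Suc n) (w1 L) v0)) (Lam L (LoopP (Suc n) (w1 L) v0))"
    by (rule peq_trivial[OF lg])
  have F: "L # \<Gamma> \<turnstile> triv_fam (Suc n) (Suc n) (Univ n) \<Colon> Univ (Suc n)" unfolding L_def by (rule triv_fam_form[OF A])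
  \<comment> \<open>The tautological section as an open term over the variable of \<open>L\<close>,
    together with the implication from its triviality to that of the loop contained in the
    variable.\<close>
  obtain w where w: "L # \<Gamma> \<turnstile> w \<Colon> LoopT (Suc n) (w1 L) v0"
    and w': "L # \<Gamma> \<Turnstile> subst (w \<cdot> S 0) (Prd (IdT (w1 (LoopT (Suc n) (w1 L) v0)) v0 (w1 (LoopP (Suc n) (w1 L) v0))) (w2 (triv_fam (Suc n) (Suc n) (Univ n))))"
    by (rule inh_sigE[OF t(2)[unfolded lift_def] istyI[OF LT] lift_fib[OF istyI[OF LT] LP istyI[OF F]]])
  let ?P = "Prd L (LoopT (Suc n) (w1 L) v0)"
  have P: "\<Gamma> \<turnstile> ?P \<Colon> Univ (Suc n)" by (rule prd_form[OF L LT])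
  note lw = lam_typing[OF istyI[OF L] w] and lp = lam_typing[OF istyI[OF L] LP]
  have path: "\<Gamma> \<Turnstile> IdT ?P (Lam L w) (Lam L (LoopP (Suc n) (w1 L) v0))" by (rule trivialD[OF triv lw])
  have sL: "substs (L # \<Gamma>) s1 \<Gamma>" by (rule substs_S[OF ctx_ext[OF L]]) simp_all
  have P1: "isty (L # \<Gamma>) (w1 ?P)" by (rule isty_subst[OF istyI[OF P] sL])
  have f: "w1 ?P # L # \<Gamma> \<turnstile> App v0 v1 \<Colon> w1 (LoopT (Suc n) (w1 L) v0)"
    by (rule app_typing[where A = "w2 L" and B = "LoopT (Suc n) (w3 L) v0"])
      (insert L ctx_cons[OF P1] c, (assumption | rule tys, assumption | rule ty | simp)+)
  have "L # \<Gamma> \<Turnstile> IdT (LoopT (Suc n) (w1 L) v0) (App (w1 (Lam L w)) v0) (App (w1 (Lam L (LoopP (Suc n) (w1 L) v0))) v0)"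
    using id_ap[OF inh_wk[OF path istyI[OF L], unfolded subst.simps(22)] P1 _ _ istyI[OF LT] f]
      typing_substs[OF sL lw] typing_substs[OF sL lp] by simp
  from id_conv[OF this istyI[OF LT] beta_v0[OF istyI[OF L] w] beta_v0[OF istyI[OF L] LP]]
  have "L # \<Gamma> \<Turnstile> IdT (LoopT (Suc n) (w1 L) v0) w (LoopP (Suc n) (w1 L) v0)" .
  with w' have 1: "L # \<Gamma> \<Turnstile> triv_fam (Suc n) (Suc n) (Univ n)"
    by (simp, elim inh_mp) simp_all
  obtain s where s: "\<Gamma> \<turnstile> s \<Colon> isset (LoopT (Suc n) (Univ n) X)" using set by (auto simp: inh_def)
  \<comment> \<open>The generic element of \<open>L\<close> is now specialised to \<open>X\<close>,
    a variable loop at \<open>X\<close>, and the given set proof \<open>s\<close>.\<close>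
  let ?S = "LoopT (Suc n) (Univ n) X"
  have S: "\<Gamma> \<turnstile> ?S \<Colon> Univ (Suc n)" by (rule LoopT_form[OF A X])
  have cS: "ctx (?S # \<Gamma>)" by (rule ctx_ext[OF S])
  have X1: "?S # \<Gamma> \<turnstile> Univ n \<Colon> Univ (Suc n)" "?S # \<Gamma> \<turnstile> w1 X \<Colon> Univ n" "?S # \<Gamma> \<turnstile> v0 \<Colon> LoopT (Suc n) (Univ n) (w1 X)"
    "?S # \<Gamma> \<turnstile> w1 s \<Colon> isset (LoopT (Suc n) (Univ n) (w1 X))"
    by (insert X s cS c, (assumption | rule tys, assumption | rule ty | simp)+)
  note tp = total_pair[OF X1, folded L_def]
  have "?S # \<Gamma> \<Turnstile> subst (Dpair (w1 X) (Dpair v0 (w1 s)) \<cdot> s1) (triv_fam (Suc n) (Suc n) (Univ n))"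
    by (rule inh_subst[OF 1 _ refl], intro substs_cons' substs_S[OF cS]) (use tp in \<open>simp_all add: wL\<close>)
  moreover have "subst (Dpair (w1 X) (Dpair v0 (w1 s)) \<cdot> s1) (triv_fam (Suc n) (Suc n) (Univ n)) =
      subst (Dpair (w1 X) (Dpair v0 (w1 s)) \<cdot> S 0) (triv_fam (Suc n) (Suc n) (Univ n))"
    by (simp add: triv_fam_def triv_base_def)
  ultimately have "?S # \<Gamma> \<Turnstile> IdT (LoopT (Suc n) (Univ n) (w1 X)) v0 (LoopP (Suc n) (Univ n) (w1 X))"
    using inh_conv[OF _ eqtyI[OF triv_fam_pair(1)[OF X1]]] by simp
  then have "?S # \<Gamma> \<Turnstile> IdT (w1 ?S) v0 (w1 (LoopP (Suc n) (Univ n) X))" by simp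
  then show ?thesis unfolding trivial_def by (rule inh_Prd[OF istyI[OF S]])
qed

section \<open>The universes are not truncated\<close>

abbreviation two :: tm where
  "two \<equiv> Coprod Unit Unit"

definition nt :: "bool \<Rightarrow> tm" where
  "nt b = (if b then CInl Star else CInr Star)"

definition pt :: "bool \<Rightarrow> tm" where
  "pt b = (if b then Unit else Empty)"

text \<open>Observational equality with \<open>nt b\<close>, by large elimination.\<close>

definition code :: "bool \<Rightarrow> tm \<Rightarrow> tm" where
  "code b e = CoprodInd (Univ 0) (pt b) (pt (\<not> b)) e"

definition flip :: "tm \<Rightarrow> tm" where
  "flip e = CoprodInd two (nt False) (nt True) e"

lemma subst_nt [simp]: "subst \<sigma> (nt b) = nt b"
  by (simp add: nt_def)

lemma subst_pt [simp]: "subst \<sigma> (pt b) = pt b"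
  by (simp add: pt_def)

lemma subst_code [simp]: "subst \<sigma> (code b e) = code b (subst \<sigma> e)"
  by (simp add: code_def)

lemma subst_flip [simp]: "subst \<sigma> (flip e) = flip (subst \<sigma> e)"
  by (simp add: flip_def)

lemma pt_form: "ctx \<Gamma> \<Longrightarrow> \<Gamma> \<turnstile> pt b \<Colon> Univ 0"
  by (simp add: pt_def unit_form empty_form)

lemma two_form: "ctx \<Gamma> \<Longrightarrow> \<Gamma> \<turnstile> two \<Colon> Univ 0"
  by (intro coprod_form unit_form)

lemma nt_typing: "ctx \<Gamma> \<Longrightarrow> \<Gamma> \<turnstile> nt b \<Colon> two"
  by (auto simp: nt_def intro: coprod_intro1 coprod_intro2 unit_form unit_intro)

lemma two_ctx: "ctx \<Gamma> \<Longrightarrow> ctx (two # \<Gamma>)" "ctx \<Gamma> \<Longrightarrow> ctx (Unit # \<Gamma>)"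
  by (auto intro: ctx_ext two_form unit_form)

lemma code_form: "\<Gamma> \<turnstile> e \<Colon> two \<Longrightarrow> \<Gamma> \<turnstile> code b e \<Colon> Univ 0"
  unfolding code_def
  by (frule typing_ctx, rule coprod_elim'[OF univ_intro pt_form pt_form]) (simp_all add: two_ctx)

lemma flip_typing: "\<Gamma> \<turnstile> e \<Colon> two \<Longrightarrow> \<Gamma> \<turnstile> flip e \<Colon> two"
  unfolding flip_def
  by (frule typing_ctx, rule coprod_elim'[OF two_form nt_typing nt_typing]) (simp_all add: two_ctx)

lemma code_nt: "ctx \<Gamma> \<Longrightarrow> \<Gamma> \<turnstile> code b (nt c) \<doteq> pt (b = c) \<Colon> Univ 0"
  unfolding code_def nt_def
  by (cases c)
    (simp, rule coprod_comp1'[OF univ_intro pt_form pt_form, where A = Unit and B = Unit] coprod_comp2'[OF univ_intro pt_form pt_form, where A = Unit and B = Unit];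
      simp add: two_ctx unit_intro)+

lemma flip_nt: "ctx \<Gamma> \<Longrightarrow> \<Gamma> \<turnstile> flip (nt c) \<doteq> nt (\<not> c) \<Colon> two"
  unfolding flip_def nt_def[of c]
  by (cases c)
    (simp, rule coprod_comp1'[OF two_form nt_typing nt_typing, where A = Unit and B = Unit] coprod_comp2'[OF two_form nt_typing nt_typing, where A = Unit and B = Unit];
      simp add: two_ctx unit_intro)+

lemma flip_cong: "\<Gamma> \<turnstile> e \<doteq> e' \<Colon> two \<Longrightarrow> \<Gamma> \<turnstile> e \<Colon> two \<Longrightarrow> \<Gamma> \<turnstile> flip e \<doteq> flip e' \<Colon> two"
  unfolding flip_def
  by (frule typing_ctx, rule coprod_elim_eq'[OF eq_refl[OF two_form] eq_refl[OF nt_typing] eq_refl[OF nt_typing]])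
    (simp_all add: two_ctx)

lemma unit_ctx_ind:
  assumes "isty (Unit # \<Gamma>) C" "\<Gamma> \<Turnstile> subst (Star \<cdot> S 0) C"
  shows "Unit # \<Gamma> \<Turnstile> C"
proof -
  obtain c where c: "\<Gamma> \<turnstile> c \<Colon> subst (Star \<cdot> S 0) C" using assms(2) by (auto simp: inh_def)
  obtain i where C: "Unit # \<Gamma> \<turnstile> C \<Colon> Univ i" using assms(1) by (auto simp: isty_def)
  have G: "ctx \<Gamma>" using c by (rule typing_ctx)
  have v: "Unit # \<Gamma> \<turnstile> v0 \<Colon> Unit" by (rule var'[OF two_ctx(2)[OF G]]) simp_all
  have "Unit # Unit # \<Gamma> \<turnstile> subst (v0 \<cdot> s2) C \<Colon> Univ i" "Unit # \<Gamma> \<turnstile> w1 c \<Colon> subst (Star \<cdot> s1) C"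
    by (insert C c G two_ctx[OF G], (assumption | rule tys, assumption | rule ty | simp)+)
  from unit_elim'[OF this(1,2) v] show ?thesis by (rule inhI) simp_all
qed

lemma empty_ctx_ind:
  assumes "isty (Empty # \<Gamma>) C"
  shows "Empty # \<Gamma> \<Turnstile> C"
proof -
  obtain i where C: "Empty # \<Gamma> \<turnstile> C \<Colon> Univ i" using assms by (auto simp: isty_def)
  have G: "ctx \<Gamma>" "ctx (Empty # \<Gamma>)" using isty_ctx[OF assms] by (auto elim: ctx.cases dest: typing_ctx)
  have v: "Empty # \<Gamma> \<turnstile> v0 \<Colon> Empty" by (rule var'[OF G(2)]) simp_all
  have "Empty # Empty # \<Gamma> \<turnstile> subst (v0 \<cdot> s2) C \<Colon> Univ i"
    by (insert C G, (assumption | rule tys, assumption | rule ty | simp)+)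
  from empty_elim'[OF this v] show ?thesis by (rule inhI) simp_all
qed

text \<open>A case distinction of the object theory becomes a quantification over meta-level
  booleans.\<close>

lemma two_ctx_ind:
  assumes "isty (two # \<Gamma>) C" "\<And>b. \<Gamma> \<Turnstile> subst (nt b \<cdot> S 0) C"
  shows "two # \<Gamma> \<Turnstile> C"
proof -
  obtain i where C: "two # \<Gamma> \<turnstile> C \<Colon> Univ i" using assms(1) by (auto simp: isty_def)
  have G: "ctx \<Gamma>" using assms(2)[of True] by (auto simp: inh_def intro: typing_ctx)
  note G1 = two_ctx[OF G]
  have v: "two # \<Gamma> \<turnstile> v0 \<Colon> two" by (rule var'[OF G1(1)]) simp_all
  have V: "Unit # \<Gamma> \<turnstile> v0 \<Colon> Unit" by (rule var'[OF G1(2)]) simp_all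
  have i: "Unit # \<Gamma> \<turnstile> CInl v0 \<Colon> two" "Unit # \<Gamma> \<turnstile> CInr v0 \<Colon> two"
    by (rule coprod_intro1 coprod_intro2; use G1 V in \<open>simp add: unit_form\<close>)+
  have t: "isty (Unit # \<Gamma>) (subst (CInl v0 \<cdot> s1) C)" "isty (Unit # \<Gamma>) (subst (CInr v0 \<cdot> s1) C)"
    by (insert assms(1) i G1, (assumption | rule tys, assumption | rule ty | simp)+)
  have "Unit # \<Gamma> \<Turnstile> subst (CInl v0 \<cdot> s1) C" "Unit # \<Gamma> \<Turnstile> subst (CInr v0 \<cdot> s1) C"
    by (rule unit_ctx_ind[OF t(1)], use assms(2)[of True] in \<open>simp add: nt_def\<close>)
      (rule unit_ctx_ind[OF t(2)], use assms(2)[of False] in \<open>simp add: nt_def\<close>)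
  then obtain c d where c: "Unit # \<Gamma> \<turnstile> c \<Colon> subst (CInl v0 \<cdot> s1) C"
    and d: "Unit # \<Gamma> \<turnstile> d \<Colon> subst (CInr v0 \<cdot> s1) C" by (auto simp: inh_def)
  have "two # two # \<Gamma> \<turnstile> subst (v0 \<cdot> s2) C \<Colon> Univ i"
    by (insert C G1, (assumption | rule tys, assumption | rule ty | simp)+)
  moreover have "Unit # two # \<Gamma> \<turnstile> subst (v0 \<cdot> s2) c \<Colon> subst (CInl v0 \<cdot> s2) C"
    "Unit # two # \<Gamma> \<turnstile> subst (v0 \<cdot> s2) d \<Colon> subst (CInr v0 \<cdot> s2) C"
    by (insert c d G1, (assumption | rule tys, assumption | rule ty | simp)+)
  ultimately show ?thesis by (rule inhI[OF coprod_elim'[OF _ _ _ v]]) simp_all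
qed

text \<open>Once the element of \<open>two\<close> is split into cases, its code is
  \<open>Unit\<close> or \<open>Empty\<close> up to conversion. The induction for that type then
  finishes each case, with \<open>Star\<close> as the base point.\<close>

lemma idsys_code:
  assumes G: "ctx \<Gamma>"
  obtains r where "\<Gamma> \<turnstile> r \<Colon> code b (nt b)" "idsys \<Gamma> two (nt b) (code b v0) r"
proof
  have e: "eqty \<Gamma> (code b (nt c)) (pt (b = c))" for c using code_nt[OF G] by (rule eqtyI)
  show r: "\<Gamma> \<turnstile> Star \<Colon> code b (nt b)"
    by (rule typing_conv[OF unit_intro[OF G] eqty_sym]) (use e[of b] in \<open>simp add: pt_def\<close>)
  show "idsys \<Gamma> two (nt b) (code b v0) Star"
    unfolding idsys_def
  proof (intro allI impI)
    fix C assume C: "isty (code b v0 # two # \<Gamma>) C" and base: "\<Gamma> \<Turnstile> subst (Star \<cdot> nt b \<cdot> S 0) C"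
    have v: "two # \<Gamma> \<turnstile> v0 \<Colon> two" by (rule var'[OF two_ctx(1)[OF G]]) simp_all
    note R = istyI[OF code_form[OF v, of b]]
    note P = isty_Prd[OF R C]
    have "\<Gamma> \<Turnstile> Prd (code b (nt c)) (subst (v0 \<cdot> nt c \<cdot> s1) C)" for c
    proof -
      let ?A = "code b (nt c)" and ?B = "pt (b = c)" and ?C = "subst (v0 \<cdot> nt c \<cdot> s1) C"
      have fm: "\<Gamma> \<turnstile> ?A \<Colon> Univ 0" "\<Gamma> \<turnstile> ?B \<Colon> Univ 0" by (rule code_form[OF nt_typing[OF G]]) (rule pt_form[OF G])
      have c: "ctx (?A # \<Gamma>)" "ctx (?B # \<Gamma>)" using fm by (auto intro: ctx_ext)
      have sub: "isty (X # \<Gamma>) ?C" if X: "ctx (X # \<Gamma>)" "eqty (X # \<Gamma>) (w1 X) ?A" for X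
      proof -
        have "X # \<Gamma> \<turnstile> v0 \<Colon> w1 X" by (rule var'[OF X(1)]) simp_all
        from typing_conv[OF this X(2)] show ?thesis
          by (intro isty_subst[OF C] substs_cons' substs_S[OF X(1)]) (simp_all add: nt_typing[OF X(1)])
      qed
      have C1: "isty (?A # \<Gamma>) ?C" by (rule sub[OF c(1)]) (use code_form[OF nt_typing[OF c(1)]] in \<open>auto intro: eqtyI eq_refl\<close>)
      have C2: "isty (?B # \<Gamma>) ?C" by (rule sub[OF c(2)]) (use eq_sym[OF code_nt[OF c(2)]] in \<open>auto intro: eqtyI\<close>)
      have "?B # \<Gamma> \<Turnstile> ?C"
      proof (cases "b = c")
        case True
        then show ?thesis using unit_ctx_ind[of \<Gamma> ?C] C2 base by (simp add: pt_def)
      next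
        case False
        then show ?thesis using empty_ctx_ind[of \<Gamma> ?C] C2 by (simp add: pt_def)
      qed
      then have "\<Gamma> \<Turnstile> Prd ?B ?C" by (rule inh_Prd[OF istyI[OF fm(2)]])
      moreover have "eqty \<Gamma> (Prd ?A ?C) (Prd ?B ?C)"
      proof -
        obtain j where j: "?A # \<Gamma> \<turnstile> ?C \<Colon> Univ j" using C1 by (auto simp: isty_def)
        \<comment> \<open>Congruence of products takes place in a single universe, so the equation
          at level 0 is raised to the level of \<open>?C\<close>.\<close>
        have "\<Gamma> \<turnstile> ?A \<doteq> ?B \<Colon> Univ j" "\<Gamma> \<turnstile> ?A \<Colon> Univ j"
          using code_nt[OF G, of b c] fm(1) by (induction j) (auto intro: univ_cumul univ_cumul_eq)
        from prd_form_eq[OF this(2,1) eq_refl[OF j]] show ?thesis by (rule eqtyI)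
      qed
      ultimately show ?thesis by (blast intro: inh_conv eqty_sym)
    qed
    then have "two # \<Gamma> \<Turnstile> Prd (code b v0) C" by (intro two_ctx_ind[OF P]) simp
    then show "code b v0 # two # \<Gamma> \<Turnstile> C" by (rule inh_unPrd[OF _ R])
  qed
qed

lemma prop_pt:
  assumes "ctx \<Gamma>"
  shows "\<Gamma> \<Turnstile> is_trunc (Suc 0) (pt b)"
proof (cases b)
  case True
  have U: "isty \<Gamma> Unit" using assms by (rule isty_base)
  have "Unit # \<Gamma> \<turnstile> v0 \<Colon> Unit" by (rule var'[OF two_ctx(2)[OF assms]]) simp_all
  then have "\<Gamma> \<Turnstile> is_trunc 0 Unit"
    by (intro contrI[OF U unit_intro[OF assms]]) (simp add: star_eq)
  from trunc_mono_Suc[OF this U] True show ?thesis by (simp add: pt_def)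
next
  case False
  have E: "isty \<Gamma> Empty" using assms by (rule isty_base)
  have c: "ctx (Empty # \<Gamma>)" using E by (rule ctx_cons)
  have T: "isty (Empty # \<Gamma>) (Prd Empty (is_trunc 0 (IdT Empty v1 v0)))"
    by (insert c, (assumption | rule tys, assumption | rule ty | simp)+)
  have "\<Gamma> \<Turnstile> is_trunc (Suc 0) Empty"
    unfolding trunc_Suc using inh_Prd[OF E empty_ctx_ind[OF T]] by simp
  with False show ?thesis by (simp add: pt_def)
qed

text \<open>Paths out of \<open>nt b\<close> are identified with the codes, which are propositions
  by cases; a second case distinction covers the left endpoint.\<close>

lemma isset_two:
  assumes G: "ctx \<Gamma>"
  shows "\<Gamma> \<Turnstile> isset two"
proof -
  let ?T = "is_trunc (Suc 0) (IdT two v1 v0)"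
  note T2 = istyI[OF two_form]
  have c: "ctx (two # \<Gamma>)" using G by (rule two_ctx)
  have v: "two # \<Gamma> \<turnstile> v0 \<Colon> two" by (rule var'[OF c]) simp_all
  have code: "two # \<Gamma> \<Turnstile> is_trunc (Suc 0) (code b v0)" for b
  proof (rule two_ctx_ind)
    show "isty (two # \<Gamma>) (is_trunc (Suc 0) (code b v0))" by (rule trunc_isty[OF istyI[OF code_form[OF v]]])
    show "\<Gamma> \<Turnstile> subst (nt d \<cdot> S 0) (is_trunc (Suc 0) (code b v0))" for d
      using trunc_jeq[OF prop_pt[OF G] eq_sym[OF code_nt[OF G]] pt_form[OF G] code_form[OF nt_typing[OF G]], of b d] by simp
  qed
  have "two # \<Gamma> \<Turnstile> is_trunc (Suc 0) (IdT two (nt b) v0)" for b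
  proof -
    note nt = nt_typing[OF c, of b]
    obtain r where r: "two # \<Gamma> \<turnstile> r \<Colon> code b (nt b)" "idsys (two # \<Gamma>) two (nt b) (code b v0) r"
      using idsys_code[OF c] by blast
    have v': "two # two # \<Gamma> \<turnstile> v0 \<Colon> two" by (rule var'[OF two_ctx(1)[OF c]]) simp_all
    have I: "two # \<Gamma> \<turnstile> IdT two (nt b) v0 \<Colon> Univ 0" by (rule id_form[OF two_form[OF c] nt v])
    have "two # \<Gamma> \<Turnstile> IdT (Univ 0) (IdT two (nt b) v0) (subst (v0 \<cdot> S 0) (code b v0))"
      by (rule idsys_path[OF two_form[OF c] code_form[OF v'] nt _ r(2) v]) (simp add: r(1))
    then have "two # \<Gamma> \<Turnstile> IdT (Univ 0) (IdT two (nt b) v0) (code b v0)" by simp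
    from id_sym[OF this isty_base(1)[OF c] I code_form[OF v]]
    show ?thesis by (rule trunc_path[OF code _ code_form[OF v] I])
  qed
  from inh_Prd[OF T2[OF G] this]
  have nts: "\<Gamma> \<Turnstile> Prd two (is_trunc (Suc 0) (IdT two (nt b) v0))" for b .
  have "two # \<Gamma> \<Turnstile> Prd two ?T"
  proof (rule two_ctx_ind)
    show "isty (two # \<Gamma>) (Prd two ?T)"
      by (insert c T2[OF c], (assumption | rule tys, assumption | rule ty | simp)+)
  qed (use nts in simp)
  from inh_Prd[OF T2[OF G] this] show ?thesis unfolding trunc_Suc[of "Suc 0"] by simp
qed

lemma isset_Id:
  "\<Gamma> \<Turnstile> isset A \<Longrightarrow> isty \<Gamma> A \<Longrightarrow> \<Gamma> \<turnstile> a \<Colon> A \<Longrightarrow> \<Gamma> \<turnstile> b \<Colon> A \<Longrightarrow> \<Gamma> \<Turnstile> isset (IdT A a b)"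
  by (rule trunc_mono_Suc[OF trunc_SucD isty_Id])

text \<open>Fully unfolded, the type is an iterated sum of functions into \<open>two\<close> and
  homotopies between such functions, and all of these form sets.\<close>

lemma isset_Equiv_two:
  assumes G: "ctx \<Gamma>"
  shows "\<Gamma> \<Turnstile> isset (Equiv two two)"
proof -
  have a: "\<Delta> \<turnstile> Prd two two \<Colon> Univ 0" "\<Delta> \<Turnstile> isset (Prd two two)" if "ctx \<Delta>" for \<Delta>
    using that by (auto intro!: prd_form trunc_Prd two_form two_ctx isset_two)
  have P: "\<Delta> \<turnstile> Prd two (IdT two t v0) \<Colon> Univ 0 \<and> \<Delta> \<Turnstile> isset (Prd two (IdT two t v0))"
    if "ctx \<Delta>" "two # \<Delta> \<turnstile> t \<Colon> two" for \<Delta> t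
  proof -
    have c: "ctx (two # \<Delta>)" using that(1) by (rule two_ctx)
    have v: "two # \<Delta> \<turnstile> v0 \<Colon> two" by (rule var'[OF c]) simp_all
    note I = id_form[OF two_form[OF c] that(2) v]
    show ?thesis
      using prd_form[OF two_form[OF that(1)] I]
        trunc_Prd[OF two_form[OF that(1)] I isset_Id[OF isset_two[OF c] istyI[OF two_form[OF c]] that(2) v]] ..
  qed
  have Q: "\<Delta> \<turnstile> Sig (Prd two two) (Prd two (IdT two t v0)) \<Colon> Univ 0 \<and> \<Delta> \<Turnstile> isset (Sig (Prd two two) (Prd two (IdT two t v0)))"
    if "ctx \<Delta>" "two # Prd two two # \<Delta> \<turnstile> t \<Colon> two" for \<Delta> t
    using P[OF ctx_ext[OF a(1)[OF that(1)]] that(2)] a[OF that(1)] by (blast intro: sig_form trunc_Sig)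
  have E: "Equiv two two = Sig (Prd two two) (Sig (Sig (Prd two two) (Prd two (IdT two (App v2 (App v1 v0)) v0)))
      (Sig (Prd two two) (Prd two (IdT two (App v1 (App v3 v0)) v0))))"
    by (simp add: Equiv_eq Isequiv_eq)
  let ?G = "Prd two two # \<Gamma>"
  let ?F = "Sig (Prd two two) (Prd two (IdT two (App v2 (App v1 v0)) v0))"
  have G1: "ctx ?G" by (rule ctx_ext[OF a(1)[OF G]])
  have t1: "two # Prd two two # ?G \<turnstile> App v2 (App v1 v0) \<Colon> two"
    by (rule app_typing[where A = two and B = two], rule_tac [2] app_typing[where A = two and B = two])
      (insert G1 two_ctx a(1)[OF G1], (assumption | rule tys, assumption | rule ty | simp)+)
  note F = Q[OF G1 t1]
  have G2: "ctx (?F # ?G)" using F by (auto intro: ctx_ext)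
  have t2: "two # Prd two two # ?F # ?G \<turnstile> App v1 (App v3 v0) \<Colon> two"
    by (rule app_typing[where A = two and B = two], rule_tac [2] app_typing[where A = two and B = two])
      (insert G2 two_ctx a(1)[OF G2], (assumption | rule tys, assumption | rule ty | simp)+)
  note H = Q[OF G2 t2]
  show ?thesis unfolding E
    by (rule trunc_Sig[OF a(1)[OF G] sig_form a(2)[OF G] trunc_Sig]) (use F H in blast)+
qed

lemma flip_equiv:
  assumes G: "ctx \<Gamma>"
  shows "\<Gamma> \<Turnstile> Isequiv two two (Lam two (flip v0))"
proof -
  have c: "ctx (two # \<Gamma>)" using G by (rule two_ctx)
  have v: "two # \<Gamma> \<turnstile> v0 \<Colon> two" by (rule var'[OF c]) simp_all
  note f = flip_typing[OF v] and T = two_form[OF G]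
  have "\<Gamma> \<Turnstile> IdT two (flip (flip (nt b))) (nt b)" for b
  proof -
    note t = nt_typing[OF G]
    have "\<Gamma> \<turnstile> flip (flip (nt b)) \<doteq> nt b \<Colon> two"
      using eq_trans[OF flip_cong[OF flip_nt[OF G] flip_typing[OF t]] flip_nt[OF G], of b] by simp
    from id_conv[OF id_refl[OF istyI[OF T] t] istyI[OF T] eq_sym[OF this] eq_refl[OF t]]
    show ?thesis .
  qed
  then have "two # \<Gamma> \<Turnstile> IdT two (flip (flip v0)) v0"
    by (intro two_ctx_ind isty_Id istyI[OF two_form[OF c]] flip_typing v) simp
  then show ?thesis
    by (intro Isequiv_Lam[OF T T, where g = "flip v0" and h = "flip v0"]) (simp_all add: f)
qed

text \<open>Evaluation at \<open>nt True\<close> identifies the two elements; transport in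
  \<open>code False\<close> then leads from \<open>Unit\<close> to \<open>Empty\<close>.\<close>

lemma flip_not_id:
  assumes G: "ctx \<Gamma>" and e: "\<Gamma> \<Turnstile> IdT (Prd two two) (Lam two (flip v0)) (Lam two v0)"
  shows "\<Gamma> \<Turnstile> Empty"
proof -
  have c: "ctx (two # \<Gamma>)" using G by (rule two_ctx)
  have v: "two # \<Gamma> \<turnstile> v0 \<Colon> two" by (rule var'[OF c]) simp_all
  note T = istyI[OF two_form[OF G]] and t = nt_typing[OF G] and f = flip_typing[OF v]
  have P: "isty \<Gamma> (Prd two two)" by (rule isty_Prd[OF T istyI[OF two_form[OF c]]])
  have c': "ctx (Prd two two # \<Gamma>)" using P by (rule ctx_cons)
  have "Prd two two # \<Gamma> \<turnstile> v0 \<Colon> Prd two two" by (rule var'[OF c']) simp_all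
  then have a: "Prd two two # \<Gamma> \<turnstile> App v0 (nt True) \<Colon> two"
    by (rule app_typing[OF _ nt_typing[OF c']]) simp
  have "\<Gamma> \<Turnstile> IdT two (App (Lam two (flip v0)) (nt True)) (App (Lam two v0) (nt True))"
    using id_ap[OF e P lam_typing[OF T f] lam_typing[OF T v] T, of "App v0 (nt True)"] a by simp
  moreover have "\<Gamma> \<turnstile> App (Lam two (flip v0)) (nt True) \<doteq> nt False \<Colon> two"
    by (rule eq_trans[OF beta[OF T f t]]) (use flip_nt[OF G, of True] in simp_all)
  moreover have "\<Gamma> \<turnstile> App (Lam two v0) (nt True) \<doteq> nt True \<Colon> two"
    by (rule beta[OF T v t]) simp_all
  ultimately have p: "\<Gamma> \<Turnstile> IdT two (nt False) (nt True)"
    using id_conv[OF _ T] by blast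
  have "\<Gamma> \<Turnstile> code False (nt False)"
    using inh_conv[OF inhI[OF unit_intro[OF G]] eqty_sym[OF eqtyI[OF code_nt[OF G, of False False, unfolded pt_def, simplified]]]] .
  then have "\<Gamma> \<Turnstile> code False (nt True)"
    by (rule transport'[OF p _ _ _ T t t istyI[OF code_form[OF v]], rotated 2]) simp_all
  then show ?thesis
    using inh_conv[OF _ eqtyI[OF code_nt[OF G, of False True, unfolded pt_def, simplified]]] by blast
qed

lemma universe_base:
  assumes G: "ctx \<Gamma>"
    and hyp: "\<And>X. \<Gamma> \<turnstile> X \<Colon> Univ 0 \<Longrightarrow> \<Gamma> \<Turnstile> isset (LoopT (Suc 0) (Univ 0) X) \<Longrightarrow>
      \<Gamma> \<Turnstile> trivial (LoopT (Suc 0) (Univ 0) X) (LoopP (Suc 0) (Univ 0) X)"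
  shows "\<Gamma> \<Turnstile> Empty"
proof -
  note T = two_form[OF G]
  note peq = univalence_peq[OF T]
  have "\<Gamma> \<Turnstile> isset (IdT (Univ 0) two two)" by (rule peq_trunc[OF peq_sym[OF peq] isset_Equiv_two[OF G]])
  then have "\<Gamma> \<Turnstile> trivial (IdT (Univ 0) two two) (Refl two)" using hyp[OF T] by simp
  from peq_trivial[OF peq this] have triv: "\<Gamma> \<Turnstile> trivial (Equiv two two) (id_equiv two)" .
  have c: "ctx (two # \<Gamma>)" using G by (rule two_ctx)
  have v: "two # \<Gamma> \<turnstile> v0 \<Colon> two" by (rule var'[OF c]) simp_all
  note f = lam_typing[OF istyI[OF T] flip_typing[OF v]] and P = isty_Prd[OF istyI[OF T] istyI[OF two_form[OF c]]]
  obtain s where s: "\<Gamma> \<turnstile> s \<Colon> Isequiv two two (Lam two (flip v0))" using flip_equiv[OF G] by (auto simp: inh_def)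
  have fib: "isty (Prd two two # \<Gamma>) (Isequiv two two v0)" using Equiv_fib[OF T T] by simp
  have E: "Equiv two two = Sig (Prd two two) (Isequiv two two v0)" by (simp add: Equiv_eq)
  have F: "\<Gamma> \<turnstile> Dpair (Lam two (flip v0)) s \<Colon> Equiv two two"
    unfolding E by (rule pair_typing[OF fib f]) (simp add: s)
  \<comment> \<open>Triviality of the self-equivalences is only used after projection to the
    underlying functions, where it equates the swap with the identity.\<close>
  have "Equiv two two # \<Gamma> \<turnstile> Fst (Prd two two) v0 \<Colon> Prd two two"
  proof -
    have EF: "isty \<Gamma> (Equiv two two)" by (rule istyI[OF Equiv_form[OF T T]])
    have cE: "ctx (Equiv two two # \<Gamma>)" using EF by (rule ctx_cons)
    have "Equiv two two # \<Gamma> \<turnstile> v0 \<Colon> Equiv two two" by (rule var'[OF cE]) simp_all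
    from Fst_Equiv[OF two_form[OF cE] two_form[OF cE] this] show ?thesis by simp
  qed
  then have "\<Gamma> \<Turnstile> IdT (Prd two two) (Fst (Prd two two) (Dpair (Lam two (flip v0)) s)) (Fst (Prd two two) (id_equiv two))"
    using id_ap[OF trivialD[OF triv F] istyI[OF Equiv_form[OF T T]] F id_equiv_typing(2)[OF T] P,
      of "Fst (Prd two two) v0"] by simp
  from id_conv[OF this P Fst_pair[OF P fib f] Fst_id_equiv[OF T, simplified]]
  have "\<Gamma> \<Turnstile> IdT (Prd two two) (Lam two (flip v0)) (Lam two v0)" by (simp add: s)
  then show ?thesis by (rule flip_not_id[OF G])
qed

theorem theorem5p9:
  fixes n :: nat
  shows "\<exists>t. [] \<turnstile> t \<Colon> Neg (is_type (int n) (Univ n))"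
proof -
  let ?T = "is_trunc (Suc (Suc n)) (Univ n)"
  \<comment> \<open>The numbering of levels starts at -2, so an n-type has index n + 2.\<close>
  have "nat (int n + 2) = Suc (Suc n)" by simp
  then have T: "is_type (int n) (Univ n) = ?T" by (simp only: is_type_def)
  have "[] \<turnstile> ?T \<Colon> Univ (Suc n)" by (rule trunc_form[OF univ_intro[OF ctx_empty]])
  note T' = istyI[OF this]
  let ?G = "[?T]"
  have G: "ctx ?G" by (rule ctx_cons[OF T'])
  have v: "?G \<turnstile> v0 \<Colon> ?T" by (rule var'[OF G]) simp_all
  \<comment> \<open>Downward induction from \<open>n\<close> to 0, entirely in the context of the
    assumption that \<open>Univ n\<close> is an n-type.\<close>
  have "?G \<turnstile> X \<Colon> Univ m \<longrightarrow> ?G \<Turnstile> isset (LoopT (Suc m) (Univ m) X) \<longrightarrow>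
      ?G \<Turnstile> trivial (LoopT (Suc m) (Univ m) X) (LoopP (Suc m) (Univ m) X)" if "m \<le> n" for m X
    using that
  proof (induction arbitrary: X rule: inc_induct)
    case base
    show ?case
    proof (intro impI)
      assume X: "?G \<turnstile> X \<Colon> Univ n"
      let ?L = "LoopT (Suc n) (Univ n) X"
      have L: "?G \<turnstile> ?L \<Colon> Univ (Suc n)" by (rule LoopT_form[OF univ_intro[OF G] X])
      have c: "ctx (?L # ?G)" by (rule ctx_ext[OF L])
      have *: "?L # ?G \<turnstile> w1 X \<Colon> Univ n" "?L # ?G \<turnstile> v0 \<Colon> LoopT (Suc n) (Univ n) (w1 X)"
        by (insert X c, (assumption | rule tys, assumption | rule ty | simp)+)
      have "?L # ?G \<Turnstile> ?T" using inh_wk[OF inhI[OF v] istyI[OF L]] by simp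
      \<comment> \<open>The index \<open>Suc (Suc n)\<close> matches the (n+1)-fold loops. At the
        top level the truncation assumption makes every loop trivial, for all
        \<open>X\<close>.\<close>
      from trunc_loops[OF this isty_base(1)[OF c] *]
      show "?G \<Turnstile> trivial ?L (LoopP (Suc n) (Univ n) X)"
        unfolding trivial_def by (intro inh_Prd[OF istyI[OF L]]) simp
    qed
  next
    case (step m)
    then show ?case by (blast intro: universe_step)
  qed
  from this[of 0] have "?G \<Turnstile> Empty" by (intro universe_base[OF G]) blast+
  then have "[] \<Turnstile> Prd ?T Empty" by (rule inh_Prd[OF T'])
  then show ?thesis by (simp add: T Neg_def inh_def)
qed

end
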